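(* Let $\delta>0$ and let $\{T_\varepsilon\}_{\varepsilon\in[0,\delta)}$ be an admissible cusp family of maps of $[0,1]$ (as defined in the context), with transfer operators $L_{T_\varepsilon}$. Then there is $\delta_2>0$ such that for every $\varepsilon\in[0,\delta_2)$ the map $T_\varepsilon$ admits a unique invariant probability density $h_\varepsilon\in W^{2,1}$. Moreover, $\varepsilon\mapsto h_\varepsilon$ is differentiable in $L^1$ at $\varepsilon=0$. In particular, $$h_\varepsilon=h_0+\varepsilon\,(I-L_{T_0})^{-1}(q)+o(\varepsilon),$$ where $$q(x)=\begin{cases}L_{T_0}\big[A_0h_0'+B_0h_0\big](x) & \text{for } x\in[0,a_0),\\ 0 & \text{for } x\in[a_0,1],\end{cases}$$ with $$A_\varepsilon=-\frac{\partial_\varepsilon T_\varepsilon}{T_\varepsilon'},\qquad B_\varepsilon=\frac{\partial_\varepsilon T_\varepsilon\cdot T_\varepsilon''}{(T_\varepsilon')^2}-\frac{\partial_\varepsilon T_\varepsilon'}{T_\varepsilon'},$$ and the $o(\varepsilon)$ is understood in the $L^1$-topology.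
   Context: Notation. $m$ is Lebesgue measure on $[0,1]$; $L^p=L^p([0,1],m)$ with norm $\|\cdot\|_p$. For $i=1,2$, $W^{i,1}=W^{i,1}([0,1])$ is the Sobolev space with norm $\|f\|_{W^{i,1}}=\sum_{k=0}^{i}\|f^{(k)}\|_1$, and $W^{1,1}_0=\{f\in W^{1,1}:\int_0^1 f\,dm=0\}$. Primes denote derivatives in $x$. $A_0,B_0$ are $A_\varepsilon,B_\varepsilon$ evaluated at $\varepsilon=0$; $\partial_\varepsilon$ at $\varepsilon=0$ is the one-sided derivative in $\varepsilon\ge 0$, taken pointwise for $x\neq c$; $\partial_\varepsilon T_\varepsilon'$ means $\partial_\varepsilon(T_\varepsilon')$. $(I-L_{T_0})^{-1}$ is the inverse of $I-L_{T_0}$ on $W^{1,1}_0$. Transfer operator. For a map $T:[0,1]\to[0,1]$ nonsingular with respect to $m$, $L_T$ is defined by $\int_0^1 L_Tf\cdot g\,dm=\int_0^1 f\cdot g\circ T\,dm$ for all $f\in L^1$, $g\in L^\infty$. An invariant probability density of $T$ is a probability density $h$ with $L_Th=h$. Admissible cusp family. Fix $\delta>0$, $c\in(0,1)$, $\beta\in(-1,-\tfrac34)$. A family $T_\varepsilon:[0,1]\to[0,1]$, $\varepsilon\in[0,\delta)$, of maps nonsingular with respect to $m$ is called an admissible cusp family if all of the following hold. (A1) For every $\varepsilon$, $T_\varepsilon|_{[0,c)}$ and $T_\varepsilon|_{(c,1]}$ are one-to-one. (A2) $T_\varepsilon(0)=0$, $T_\varepsilon(1)=0$, $\lim_{x\to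 c^\pm}T_\varepsilon(x)=a_\varepsilon\in[0,1]$. (A3) $T_\varepsilon|_{[0,1]\setminus\{c\}}\in C^3$. (A4) There is $\theta>1$ with $\inf_{\varepsilon\in[0,\delta)}\inf_{x\in[0,1]\setminus\{c\}}|T_\varepsilon'(x)|\ge\theta$. (A5) $T_0$ is topologically mixing on $[0,a_0]$. (A6) For all $\varepsilon\in[0,\delta)$: $\lim_{x\to c^-}T_\varepsilon'(x)=+\infty$, $\lim_{x\to c^+}T_\varepsilon'(x)=-\infty$, and $\lim_{x\to c^\pm}\frac{|T_\varepsilon'(x)|}{|x-c|^\beta}=C_{\varepsilon,1}$ for some constant $C_{\varepsilon,1}$. (A7) For all $\varepsilon\in[0,\delta)$: $\lim_{x\to c^\pm}\frac{|T_\varepsilon''(x)|}{|x-c|^{\beta-1}}=C_{\varepsilon,2}$ and $\lim_{x\to c^\pm}\frac{|T_\varepsilon'''(x)|}{|x-c|^{\beta-2}}=C_{\varepsilon,3}$ for some constants $C_{\varepsilon,2},C_{\varepsilon,3}$. (A8) $\sup_{\varepsilon\in[0,\delta),\,i\in\{0,1,2\},\,x\in[0,1]\setminus\{c\}}\frac{|T_\varepsilon^{(i+1)}(x)|}{|x-c|^{\beta-i}}<\infty$ and $\inf_{\varepsilon\in[0,\delta),\,x\in[0,1]\setminus\{c\}}\frac{|T_\varepsilon'(x)|}{|x-c|^{\beta}}>0$. (A9) $\sup_{\|f\|_{W^{1,1}}\le1}\|(L_{T_0}-L_{T_\varepsilon})f\|_{L^2}\to0$ as $\varepsilon\to0$;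 moreover, for every $f\in W^{2,1}$ there exists an element $\partial_\varepsilon L_{T_\varepsilon}f|_{\varepsilon=0}\in W^{1,1}$ such that $\|L_{T_\varepsilon}f-L_{T_0}f-\varepsilon\,(\partial_\varepsilon L_{T_\varepsilon}f|_{\varepsilon=0})\|_{W^{1,1}}=o(\varepsilon)$ as $\varepsilon\to0$. *)

theory Defs
  imports "HOL-Analysis.Analysis" "HOL-Library.Landau_Symbols"
begin

text \<open>Elements of function spaces over \<open>[0,1]\<close> are represented by functions \<open>real \<Rightarrow> real\<close>,
  taken up to equality almost everywhere; values outside \<open>[0,1]\<close> never matter.\<close>

abbreviation leb01 :: "real measure" where
  "leb01 \<equiv> lebesgue_on {0..1}"

definition ae_eq :: "(real \<Rightarrow> real) \<Rightarrow> (real \<Rightarrow> real) \<Rightarrow> bool" where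
  "ae_eq f g \<longleftrightarrow> (AE x in leb01. f x = g x)"

definition L1 :: "(real \<Rightarrow> real) set" where
  "L1 = {f. integrable leb01 f}"

definition L1_norm :: "(real \<Rightarrow> real) \<Rightarrow> real" where
  "L1_norm f = (LINT x|leb01. \<bar>f x\<bar>)"

definition L2 :: "(real \<Rightarrow> real) set" where
  "L2 = {f. f \<in> borel_measurable leb01 \<and> integrable leb01 (\<lambda>x. (f x)\<^sup>2)}"

definition L2_norm :: "(real \<Rightarrow> real) \<Rightarrow> real" where
  "L2_norm f = sqrt (LINT x|leb01. (f x)\<^sup>2)"

definition Linf :: "(real \<Rightarrow> real) set" where
  "Linf = {g. g \<in> borel_measurable leb01 \<and> (\<exists>K. AE x in leb01. \<bar>g x\<bar> \<le> K)}"


section \<open>Sobolev spaces\<close>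

text \<open>Weak derivatives are tested against compactly supported \<open>C\<^sup>1\<close> functions on \<open>(0,1)\<close>,
  as in Brezis' definition of \<open>W\<^sup>1\<^sup>,\<^sup>p\<close> of an interval.\<close>

definition test_fun :: "(real \<Rightarrow> real) \<Rightarrow> bool" where
  "test_fun \<phi> \<longleftrightarrow> \<phi> C1_differentiable_on UNIV \<and>
     (\<exists>K. compact K \<and> K \<subseteq> {0<..<1} \<and> (\<forall>x. x \<notin> K \<longrightarrow> \<phi> x = 0))"

definition has_weak_deriv :: "(real \<Rightarrow> real) \<Rightarrow> (real \<Rightarrow> real) \<Rightarrow> bool" where
  "has_weak_deriv f g \<longleftrightarrow> f \<in> L1 \<and> g \<in> L1 \<and>
     (\<forall>\<phi>. test_fun \<phi> \<longrightarrow>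
        (LINT x|leb01. f x * deriv \<phi> x) = - (LINT x|leb01. g x * \<phi> x))"

definition wderiv :: "(real \<Rightarrow> real) \<Rightarrow> real \<Rightarrow> real" where
  "wderiv f = (SOME g. has_weak_deriv f g)"

definition W11 :: "(real \<Rightarrow> real) set" where
  "W11 = {f. \<exists>g. has_weak_deriv f g}"

definition W21 :: "(real \<Rightarrow> real) set" where
  "W21 = {f \<in> W11. wderiv f \<in> W11}"

definition W11_norm :: "(real \<Rightarrow> real) \<Rightarrow> real" where
  "W11_norm f = L1_norm f + L1_norm (wderiv f)"

definition W11_0 :: "(real \<Rightarrow> real) set" where
  "W11_0 = {f \<in> W11. (LINT x|leb01. f x) = 0}"


section \<open>Transfer operators\<close>

definition nonsingular :: "(real \<Rightarrow> real) \<Rightarrow> bool" where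
  "nonsingular T \<longleftrightarrow> T \<in> leb01 \<rightarrow>\<^sub>M leb01 \<and>
     (\<forall>N \<in> null_sets leb01. T -` N \<inter> space leb01 \<in> null_sets leb01)"

text \<open>The duality relation \<open>\<integral> u g dm = \<integral> f (g \<circ> T) dm\<close> is required for those \<open>g\<close> in \<open>L\<^sup>\<infinity>\<close> for which
  the right-hand side exists. If \<open>f\<close> is in \<open>L\<^sup>1\<close> this is every \<open>g\<close>, and one gets the usual
  definition (see the lemma below). The relation also makes sense for functions such as
  \<open>A\<^sub>0 h\<^sub>0' + B\<^sub>0 h\<^sub>0\<close>, which are bounded on the preimage of each \<open>[0,b]\<close> with \<open>b < a\<^sub>0\<close>, but whose
  integrability up to the cusp is not part of the hypotheses.\<close>

definition is_transfer :: "(real \<Rightarrow> real) \<Rightarrow> (real \<Rightarrow> real) \<Rightarrow> (real \<Rightarrow> real) \<Rightarrow> bool" where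
  "is_transfer T f u \<longleftrightarrow> f \<in> borel_measurable leb01 \<and> u \<in> borel_measurable leb01 \<and>
     (\<forall>g \<in> Linf. integrable leb01 (\<lambda>x. f x * g (T x)) \<longrightarrow>
        integrable leb01 (\<lambda>x. u x * g x) \<and>
        (LINT x|leb01. u x * g x) = (LINT x|leb01. f x * g (T x)))"

lemma integrable_mult_Linf:
  assumes "f \<in> L1" "g \<in> Linf"
  shows "integrable leb01 (\<lambda>x. f x * g x)"
proof -
  obtain K where K: "AE x in leb01. \<bar>g x\<bar> \<le> K" and g: "g \<in> borel_measurable leb01"
    using assms(2) by (auto simp: Linf_def)
  have f: "integrable leb01 f" using assms(1) by (simp add: L1_def)
  show ?thesis
  proof (rule Bochner_Integration.integrable_bound)
    show "integrable leb01 (\<lambda>x. K * f x)" using f by simp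
    show "(\<lambda>x. f x * g x) \<in> borel_measurable leb01" using f g by measurable
    show "AE x in leb01. norm (f x * g x) \<le> norm (K * f x)"
      using K
    proof eventually_elim
      case (elim x)
      then have "\<bar>f x\<bar> * \<bar>g x\<bar> \<le> \<bar>f x\<bar> * \<bar>K\<bar>" by (intro mult_left_mono) auto
      then show ?case by (simp add: abs_mult mult.commute)
    qed
  qed
qed

lemma Linf_comp:
  assumes "nonsingular T" "g \<in> Linf"
  shows "(\<lambda>x. g (T x)) \<in> Linf"
proof -
  have T: "T \<in> leb01 \<rightarrow>\<^sub>M leb01" using assms(1) by (simp add: nonsingular_def)
  obtain K where K: "AE x in leb01. \<bar>g x\<bar> \<le> K" and g: "g \<in> borel_measurable leb01"
    using assms(2) by (auto simp: Linf_def)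
  obtain N where N: "N \<in> null_sets leb01" "{x \<in> space leb01. \<not> \<bar>g x\<bar> \<le> K} \<subseteq> N"
    using K unfolding eventually_ae_filter by blast
  have "AE x in leb01. \<bar>g (T x)\<bar> \<le> K"
  proof (rule AE_I')
    show "T -` N \<inter> space leb01 \<in> null_sets leb01"
      using assms(1) N(1) by (simp add: nonsingular_def)
    show "{x \<in> space leb01. \<not> \<bar>g (T x)\<bar> \<le> K} \<subseteq> T -` N \<inter> space leb01"
      using N(2) measurable_space[OF T] by blast
  qed
  then show ?thesis using measurable_compose[OF T g] by (auto simp: Linf_def)
qed

lemma is_transfer_L1_iff:
  assumes "nonsingular T" "f \<in> L1"
  shows "is_transfer T f u \<longleftrightarrow>
    u \<in> L1 \<and> (\<forall>g \<in> Linf. (LINT x|leb01. u x * g x) = (LINT x|leb01. f x * g (T x)))"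
proof
  assume *: "is_transfer T f u"
  have D: "integrable leb01 (\<lambda>x. u x * g x) \<and>
      (LINT x|leb01. u x * g x) = (LINT x|leb01. f x * g (T x))" if "g \<in> Linf" for g
    using * that integrable_mult_Linf[OF assms(2) Linf_comp[OF assms(1) that]]
    unfolding is_transfer_def by blast
  have "(\<lambda>x. 1) \<in> Linf"
    unfolding Linf_def by (auto intro: exI[of _ 1])
  from D[OF this] have "u \<in> L1" by (simp add: L1_def)
  with D show "u \<in> L1 \<and> (\<forall>g \<in> Linf. (LINT x|leb01. u x * g x) = (LINT x|leb01. f x * g (T x)))"
    by blast
next
  assume u: "u \<in> L1 \<and> (\<forall>g \<in> Linf. (LINT x|leb01. u x * g x) = (LINT x|leb01. f x * g (T x)))"
  have "f \<in> borel_measurable leb01" "u \<in> borel_measurable leb01"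
    using assms(2) u unfolding L1_def by (blast intro: borel_measurable_integrable)+
  moreover have "integrable leb01 (\<lambda>x. u x * g x)" if "g \<in> Linf" for g
    using integrable_mult_Linf that u by blast
  ultimately show "is_transfer T f u"
    using u unfolding is_transfer_def by blast
qed

definition transfer_op :: "(real \<Rightarrow> real) \<Rightarrow> (real \<Rightarrow> real) \<Rightarrow> real \<Rightarrow> real" where
  "transfer_op T f = (SOME u. is_transfer T f u)"

definition invariant_density :: "(real \<Rightarrow> real) \<Rightarrow> (real \<Rightarrow> real) \<Rightarrow> bool" where
  "invariant_density T h \<longleftrightarrow> h \<in> L1 \<and> (AE x in leb01. 0 \<le> h x) \<and>
     (LINT x|leb01. h x) = 1 \<and> ae_eq (transfer_op T h) h"

text \<open>Invertibility of \<open>I - L\<^sub>T\<close> as a map of \<open>W\<^sup>1\<^sup>,\<^sup>1\<^sub>0\<close> to itself, and its inverse.\<close>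

definition I_minus_L_invertible :: "(real \<Rightarrow> real) \<Rightarrow> bool" where
  "I_minus_L_invertible T \<longleftrightarrow>
     (\<forall>w \<in> W11_0. transfer_op T w \<in> W11_0) \<and>
     (\<forall>r \<in> W11_0. \<exists>w \<in> W11_0. ae_eq (\<lambda>x. w x - transfer_op T w x) r \<and>
        (\<forall>v \<in> W11_0. ae_eq (\<lambda>x. v x - transfer_op T v x) r \<longrightarrow> ae_eq v w))"

definition I_minus_L_inv :: "(real \<Rightarrow> real) \<Rightarrow> (real \<Rightarrow> real) \<Rightarrow> real \<Rightarrow> real" where
  "I_minus_L_inv T r = (SOME w. w \<in> W11_0 \<and> ae_eq (\<lambda>x. w x - transfer_op T w x) r)"


section \<open>Admissible cusp families\<close>

text \<open>Derivatives in \<open>x\<close> are one-sided at the endpoints \<open>0\<close> and \<open>1\<close>.\<close>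

definition D01 :: "(real \<Rightarrow> real) \<Rightarrow> real \<Rightarrow> real" where
  "D01 f x = vector_derivative f (at x within {0..1})"

definition C_on01 :: "nat \<Rightarrow> real set \<Rightarrow> (real \<Rightarrow> real) \<Rightarrow> bool" where
  "C_on01 k S f \<longleftrightarrow>
     (\<forall>i<k. \<forall>x\<in>S. (D01 ^^ i) f differentiable (at x within {0..1})) \<and>
     continuous_on S ((D01 ^^ k) f)"

definition topologically_mixing_on :: "real set \<Rightarrow> (real \<Rightarrow> real) \<Rightarrow> bool" where
  "topologically_mixing_on X f \<longleftrightarrow>
     (\<forall>U V. openin (top_of_set X) U \<and> openin (top_of_set X) V \<and> U \<noteq> {} \<and> V \<noteq> {} \<longrightarrow>
        (\<exists>N. \<forall>n\<ge>N. (f ^^ n) ` U \<inter> V \<noteq> {}))"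

text \<open>The value of \<open>T \<epsilon>\<close> at the cusp \<open>c\<close> itself is left unconstrained.\<close>

locale admissible_cusp_family =
  fixes \<delta> c \<beta> :: real and T :: "real \<Rightarrow> real \<Rightarrow> real" and a :: "real \<Rightarrow> real"
  assumes delta_pos: "0 < \<delta>"
    and c_in: "0 < c" "c < 1"
    and beta_in: "- 1 < \<beta>" "\<beta> < - 3 / 4"
    and nonsing: "\<And>\<epsilon>. \<epsilon> \<in> {0..<\<delta>} \<Longrightarrow> nonsingular (T \<epsilon>)"
    and A1: "\<And>\<epsilon>. \<epsilon> \<in> {0..<\<delta>} \<Longrightarrow> inj_on (T \<epsilon>) {0..<c} \<and> inj_on (T \<epsilon>) {c<..1}"
    and A2: "\<And>\<epsilon>. \<epsilon> \<in> {0..<\<delta>} \<Longrightarrow> T \<epsilon> 0 = 0 \<and> T \<epsilon> 1 = 0 \<and> a \<epsilon> \<in> {0..1} \<and>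
               (T \<epsilon> \<longlongrightarrow> a \<epsilon>) (at_left c) \<and> (T \<epsilon> \<longlongrightarrow> a \<epsilon>) (at_right c)"
    and A3: "\<And>\<epsilon>. \<epsilon> \<in> {0..<\<delta>} \<Longrightarrow> C_on01 3 ({0..1} - {c}) (T \<epsilon>)"
    and A4: "\<exists>\<theta>>1. \<forall>\<epsilon>\<in>{0..<\<delta>}. \<forall>x\<in>{0..1} - {c}. \<theta> \<le> \<bar>D01 (T \<epsilon>) x\<bar>"
    and A5: "topologically_mixing_on {0..a 0} (T 0)"
    and A6: "\<And>\<epsilon>. \<epsilon> \<in> {0..<\<delta>} \<Longrightarrow>
               filterlim (D01 (T \<epsilon>)) at_top (at_left c) \<and>
               filterlim (D01 (T \<epsilon>)) at_bot (at_right c) \<and>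
               (\<exists>C1. ((\<lambda>x. \<bar>D01 (T \<epsilon>) x\<bar> / \<bar>x - c\<bar> powr \<beta>) \<longlongrightarrow> C1) (at c))"
    and A7: "\<And>\<epsilon>. \<epsilon> \<in> {0..<\<delta>} \<Longrightarrow>
               (\<exists>C2. ((\<lambda>x. \<bar>(D01 ^^ 2) (T \<epsilon>) x\<bar> / \<bar>x - c\<bar> powr (\<beta> - 1)) \<longlongrightarrow> C2) (at c)) \<and>
               (\<exists>C3. ((\<lambda>x. \<bar>(D01 ^^ 3) (T \<epsilon>) x\<bar> / \<bar>x - c\<bar> powr (\<beta> - 2)) \<longlongrightarrow> C3) (at c))"
    and A8_upper: "\<exists>K. \<forall>\<epsilon>\<in>{0..<\<delta>}. \<forall>i\<in>{0,1,2::nat}. \<forall>x\<in>{0..1} - {c}.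
               \<bar>(D01 ^^ (i + 1)) (T \<epsilon>) x\<bar> / \<bar>x - c\<bar> powr (\<beta> - real i) \<le> K"
    and A8_lower: "\<exists>\<kappa>>0. \<forall>\<epsilon>\<in>{0..<\<delta>}. \<forall>x\<in>{0..1} - {c}.
               \<kappa> \<le> \<bar>D01 (T \<epsilon>) x\<bar> / \<bar>x - c\<bar> powr \<beta>"
    and A9_L2: "\<forall>e>0. \<forall>\<^sub>F \<epsilon> in at_right 0. \<forall>f\<in>W11. W11_norm f \<le> 1 \<longrightarrow>
               (\<lambda>x. transfer_op (T 0) f x - transfer_op (T \<epsilon>) f x) \<in> L2 \<and>
               L2_norm (\<lambda>x. transfer_op (T 0) f x - transfer_op (T \<epsilon>) f x) \<le> e"
    and A9_deriv: "\<forall>f\<in>W21. \<exists>Lf'\<in>W11.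
               (\<forall>\<^sub>F \<epsilon> in at_right 0.
                  (\<lambda>x. transfer_op (T \<epsilon>) f x - transfer_op (T 0) f x - \<epsilon> * Lf' x) \<in> W11) \<and>
               (\<lambda>\<epsilon>. W11_norm (\<lambda>x. transfer_op (T \<epsilon>) f x - transfer_op (T 0) f x - \<epsilon> * Lf' x))
                  \<in> o[at_right 0](\<lambda>\<epsilon>. \<epsilon>)"


section \<open>The response formula\<close>

definition eps_deriv0 :: "(real \<Rightarrow> real \<Rightarrow> real) \<Rightarrow> real \<Rightarrow> real" where
  "eps_deriv0 F x = vector_derivative (\<lambda>\<epsilon>. F \<epsilon> x) (at_right 0)"

definition A0 :: "(real \<Rightarrow> real \<Rightarrow> real) \<Rightarrow> real \<Rightarrow> real" where
  "A0 T x = - (eps_deriv0 T x / D01 (T 0) x)"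

definition B0 :: "(real \<Rightarrow> real \<Rightarrow> real) \<Rightarrow> real \<Rightarrow> real" where
  "B0 T x = eps_deriv0 T x * (D01 ^^ 2) (T 0) x / (D01 (T 0) x)\<^sup>2
            - eps_deriv0 (\<lambda>\<epsilon>. D01 (T \<epsilon>)) x / D01 (T 0) x"

definition response_q ::
  "(real \<Rightarrow> real \<Rightarrow> real) \<Rightarrow> real \<Rightarrow> (real \<Rightarrow> real) \<Rightarrow> real \<Rightarrow> real" where
  "response_q T a0 h0 x =
     (if x < a0 then transfer_op (T 0) (\<lambda>y. A0 T y * wderiv h0 y + B0 T y * h0 y) x else 0)"

end

theory Submission
  imports Defs "HOL-Probability.Helly_Selection"
begin

text \<open>The spectral theory of the transfer operator is replaced by compactness arguments.  Duality turns
  \<open>(L f)' = L (f' / T' - f T'' / T'\<^sup>2)\<close> into an integration by parts against \<open>\<phi> \<circ> T / T'\<close>, which vanishes at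
  the cusp and at the endpoints; since \<open>T'' / T'\<^sup>2\<close> is integrable, this gives a Lasota--Yorke inequality
  with constants that are uniform in the family.

  An invariant function of mean \<open>0\<close> in \<open>W\<^sup>1\<^sup>,\<^sup>1\<close> vanishes: its positive and negative parts are invariant, and the
  support of each contains an interval.  Expansion makes the interval grow until it contains the cusp, so
  that both supports contain a left neighbourhood of \<open>a\<close>.  By Helly's theorem,
  normalised solutions of \<open>w = \<lambda> L w + r\<close> have limit points as \<open>\<lambda> \<rightarrow> 1\<close>; this yields the invariant density and
  the inverse of \<open>I - L\<close> on \<open>W\<^sup>1\<^sup>,\<^sup>1\<^sub>0\<close>, and then uniqueness in \<open>L\<^sup>1\<close>.  The same compactness argument along \<open>\<epsilon> \<rightarrow> 0\<close>
  shows that \<open>(h \<epsilon> - h 0) / \<epsilon>\<close> converges to \<open>(I - L)\<^sup>-\<^sup>1 q\<close>, where \<open>q\<close> is the derivative of \<open>L\<^sub>\<epsilon> (h 0)\<close> from (A9).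

  For the formula for \<open>q\<close>, (A9) is applied to a cutoff supported on one branch: the primitive of its image
  under \<open>L\<^sub>\<epsilon>\<close> is the inverse of that branch of \<open>T\<^sub>\<epsilon>\<close>, so \<open>T\<^sub>\<epsilon>\<close> and \<open>T\<^sub>\<epsilon>'\<close> are differentiable in \<open>\<epsilon>\<close>.\<close>

text \<open>Near the cusp the derivatives of \<open>T\<close> are known only through powers of the
  distance to \<open>c\<close>, so the proof works with quotients whose power is harmless. In terms
  of \<open>|x - c|\<close>, \<open>1 / T'\<close> has exponent \<open>- \<beta>\<close> and
  vanishes at \<open>c\<close>; \<open>(1 / T')'\<close> has \<open>- 1 - \<beta>\<close>,
  integrable but possibly unbounded; \<open>(1 / T'^2)'\<close> has \<open>- 1 - 2 \<beta>\<close>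
  and is bounded; \<open>(T'' / T'^3)'\<close> has \<open>- 2 - 2 \<beta>\<close> and is integrable.
  The last two need \<open>\<beta> < - 1/2\<close>. Since the first-order weight has no supremum
  bound, the Lasota--Yorke inequality goes through a truncation of it. \<open>A9_deriv\<close>
  speaks only of functions in \<open>W21\<close>, so the regularity of \<open>h 0\<close> has to be
  raised by one order. \<open>A9_L2\<close> compares the operators only in a norm weaker than that
  of \<open>W11\<close>, so the derivatives of the remainders are merely bounded and convergence
  must come from compactness. The formula for \<open>q\<close> is therefore proved on the sets
  \<open>T 0 z \<le> b\<close> with \<open>b < a 0\<close>, and \<open>b\<close> is then sent to
  \<open>a 0\<close>.\<close>

lemma ae_eq_refl [simp]: "ae_eq f f"
  by (simp add: ae_eq_def)

lemma ae_eq_sym: "ae_eq f g \<Longrightarrow> ae_eq g f"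
  unfolding ae_eq_def by (auto elim: eventually_mono)

lemma ae_eq_trans [trans]: "ae_eq f g \<Longrightarrow> ae_eq g h \<Longrightarrow> ae_eq f h"
  unfolding ae_eq_def by (auto elim: eventually_elim2)

lemma finite_measure_leb01: "finite_measure leb01"
  by (rule finite_measure_lebesgue_on) auto

lemma measure_leb01: "measure leb01 (space leb01) = 1"
  by (simp add: measure_restrict_space)

text \<open>Lebesgue measure is complete, so a change on a null set keeps measurability. Extension
  by zero reduces the claim to the whole line.\<close>

lemma borel_measurable_ae_eq:
  assumes "f \<in> borel_measurable leb01" "ae_eq f g"
  shows "g \<in> borel_measurable leb01"
proof -
  let ?f = "\<lambda>x. if x \<in> {0..1} then f x else 0" and ?g = "\<lambda>x. if x \<in> {0..1} then g x else 0"
  have "?f \<in> borel_measurable lebesgue" using assms(1) borel_measurable_if[of "{0..1}" f] by simp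
  moreover have "AE x in lebesgue. ?f x = ?g x"
    using assms(2) by (auto simp: ae_eq_def AE_restrict_space_iff elim: eventually_mono)
  ultimately have "?g \<in> borel_measurable lebesgue" by (rule borel_measurable_AE)
  then show ?thesis using borel_measurable_if[of "{0..1}" g] by simp
qed

lemma L1_measurable: "f \<in> L1 \<Longrightarrow> f \<in> borel_measurable leb01"
  unfolding L1_def by auto

lemma L1_cong: "f \<in> L1 \<Longrightarrow> ae_eq f g \<Longrightarrow> g \<in> L1"
  unfolding L1_def
  using integrable_cong_AE[of f leb01 g] borel_measurable_ae_eq[of f g]
  by (auto simp: ae_eq_def)

lemma integral_ae_eq:
  assumes "f \<in> borel_measurable leb01" "ae_eq f g"
  shows "(LINT x|leb01. f x) = (LINT x|leb01. g x)"
  using assms borel_measurable_ae_eq[OF assms] by (intro integral_cong_AE) (auto simp: ae_eq_def)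

lemma L1_add: "f \<in> L1 \<Longrightarrow> g \<in> L1 \<Longrightarrow> (\<lambda>x. f x + g x) \<in> L1"
  by (auto simp: L1_def)

lemma L1_diff: "f \<in> L1 \<Longrightarrow> g \<in> L1 \<Longrightarrow> (\<lambda>x. f x - g x) \<in> L1"
  by (auto simp: L1_def)

lemma L1_cmult: "f \<in> L1 \<Longrightarrow> (\<lambda>x. k * f x) \<in> L1"
  by (auto simp: L1_def)

lemma L1_uminus: "f \<in> L1 \<Longrightarrow> (\<lambda>x. - f x) \<in> L1"
  by (auto simp: L1_def)

lemma L1_abs: "f \<in> L1 \<Longrightarrow> (\<lambda>x. \<bar>f x\<bar>) \<in> L1"
  by (auto simp: L1_def)

lemma L1_const: "(\<lambda>x. k) \<in> L1"
proof -
  interpret finite_measure leb01 by (rule finite_measure_leb01)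
  show ?thesis unfolding L1_def by simp
qed

lemma L1_sum: "(\<And>i. i \<in> A \<Longrightarrow> f i \<in> L1) \<Longrightarrow> (\<lambda>x. \<Sum>i\<in>A. f i x) \<in> L1"
  by (auto simp: L1_def)

lemma LINT_const01: "(LINT x|leb01. k) = (k::real)"
  using measure_leb01 by simp

lemma L1_dominated:
  assumes "g \<in> L1" "f \<in> borel_measurable leb01" "AE x in leb01. \<bar>f x\<bar> \<le> \<bar>g x\<bar>"
  shows "f \<in> L1"
  using assms unfolding L1_def by (auto intro: Bochner_Integration.integrable_bound)

lemma L1_dominated':
  assumes "g \<in> L1" "f \<in> borel_measurable leb01" "\<And>x. x \<in> {0..1} \<Longrightarrow> \<bar>f x\<bar> \<le> \<bar>g x\<bar>"
  shows "f \<in> L1"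
  by (rule L1_dominated[OF assms(1,2)]) (use assms(3) in \<open>auto intro!: AE_I2\<close>)

lemma L1_norm_nonneg: "0 \<le> L1_norm f"
  unfolding L1_norm_def by simp

lemma L1_norm_ae_eq: "f \<in> L1 \<Longrightarrow> ae_eq f g \<Longrightarrow> L1_norm f = L1_norm g"
  unfolding L1_norm_def
  by (intro integral_ae_eq) (auto simp: ae_eq_def L1_def elim: eventually_mono)

lemma L1_norm_add: "f \<in> L1 \<Longrightarrow> g \<in> L1 \<Longrightarrow> L1_norm (\<lambda>x. f x + g x) \<le> L1_norm f + L1_norm g"
  using integral_mono[of leb01 "\<lambda>x. \<bar>f x + g x\<bar>" "\<lambda>x. \<bar>f x\<bar> + \<bar>g x\<bar>"]
  unfolding L1_norm_def L1_def by auto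

lemma L1_norm_diff: "f \<in> L1 \<Longrightarrow> g \<in> L1 \<Longrightarrow> L1_norm (\<lambda>x. f x - g x) \<le> L1_norm f + L1_norm g"
  using integral_mono[of leb01 "\<lambda>x. \<bar>f x - g x\<bar>" "\<lambda>x. \<bar>f x\<bar> + \<bar>g x\<bar>"]
  unfolding L1_norm_def L1_def by auto

lemma L1_norm_cmult: "L1_norm (\<lambda>x. k * f x) = \<bar>k\<bar> * L1_norm f"
  unfolding L1_norm_def by (simp add: abs_mult)

lemma L1_norm_minus_commute: "L1_norm (\<lambda>x. f x - g x) = L1_norm (\<lambda>x. g x - f x)"
  unfolding L1_norm_def by (simp add: abs_minus_commute)

lemma L1_norm_triangle:
  assumes "f \<in> L1" "g \<in> L1" "h \<in> L1"
  shows "L1_norm (\<lambda>x. f x - h x) \<le> L1_norm (\<lambda>x. f x - g x) + L1_norm (\<lambda>x. g x - h x)"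
  using L1_norm_add[OF L1_diff[OF assms(1,2)] L1_diff[OF assms(2,3)]] by simp

lemma L1_norm_mono:
  assumes "g \<in> L1" "f \<in> L1" "AE x in leb01. \<bar>f x\<bar> \<le> \<bar>g x\<bar>"
  shows "L1_norm f \<le> L1_norm g"
  using assms unfolding L1_norm_def L1_def by (auto intro!: integral_mono_AE)

lemma L1_norm_const: "L1_norm (\<lambda>x. k) = \<bar>k\<bar>"
  unfolding L1_norm_def by (rule LINT_const01)

lemma abs_LINT_le: "f \<in> L1 \<Longrightarrow> \<bar>LINT x|leb01. f x\<bar> \<le> L1_norm f"
  unfolding L1_norm_def by (rule integral_abs_bound)

lemma L1_norm_eq_0: "f \<in> L1 \<Longrightarrow> L1_norm f = 0 \<Longrightarrow> ae_eq f (\<lambda>x. 0)"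
  unfolding L1_norm_def ae_eq_def L1_def
  by (subst (asm) integral_nonneg_eq_0_iff_AE) auto

lemma Linf_const: "(\<lambda>x. k) \<in> Linf"
  unfolding Linf_def by (auto intro: exI[of _ "\<bar>k\<bar>"])

lemma LinfI:
  assumes "g \<in> borel_measurable leb01" "\<And>x. x \<in> {0..1} \<Longrightarrow> \<bar>g x\<bar> \<le> K"
  shows "g \<in> Linf"
  using assms unfolding Linf_def by (auto intro!: exI[of _ K] AE_I2)

lemma L1_mult_Linf: "f \<in> L1 \<Longrightarrow> g \<in> Linf \<Longrightarrow> (\<lambda>x. f x * g x) \<in> L1"
  using integrable_mult_Linf by (simp add: L1_def)

lemma Linf_L1: "g \<in> Linf \<Longrightarrow> g \<in> L1"
  using L1_mult_Linf[OF L1_const[of 1]] by simp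

lemma Linf_indicator: "E \<in> sets leb01 \<Longrightarrow> indicator E \<in> Linf"
  by (rule LinfI[of _ 1]) (auto split: split_indicator)

lemma L1_ae_zero:
  assumes "f \<in> L1" "\<And>E. E \<in> sets leb01 \<Longrightarrow> (LINT x|leb01. f x * indicator E x) = 0"
  shows "ae_eq f (\<lambda>x. 0)"
  unfolding ae_eq_def
  by (rule sigma_finite_measure.density_zero[OF finite_measure.axioms(1)[OF finite_measure_leb01]]) (use assms in \<open>auto simp: L1_def set_lebesgue_integral_def mult.commute\<close>)

lemma continuous_borel_measurable01:
  assumes "continuous_on {0..1} f" shows "f \<in> borel_measurable leb01"
  using assms continuous_imp_measurable_on_sets_lebesgue[of "{0..1}" f] by auto

lemma continuous_Linf:
  assumes "continuous_on {0..1} (f::real\<Rightarrow>real)" shows "f \<in> Linf"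
proof -
  have "bounded (f ` {0..1})" using assms by (intro compact_imp_bounded compact_continuous_image) auto
  then obtain B where "\<forall>x\<in>{0..1}. \<bar>f x\<bar> \<le> B" by (auto simp: bounded_iff)
  then show ?thesis using continuous_borel_measurable01[OF assms] by (intro LinfI) auto
qed

lemma continuous_L1: "continuous_on {0..1} f \<Longrightarrow> f \<in> L1"
  by (rule Linf_L1[OF continuous_Linf])

section \<open>The transfer operator on integrable functions\<close>

text \<open>The transfer is a Radon--Nikodym derivative: the measure with density \<open>f\<close>
  is pushed forward by \<open>T\<close>, and nonsingularity makes the image absolutely
  continuous.\<close>

lemma transfer_exists_nonneg:
  assumes "nonsingular T" "f \<in> L1" "\<And>x. 0 \<le> f x"
  shows "\<exists>u. is_transfer T f u"
proof -
  let ?M = leb01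
  have T[measurable]: "T \<in> ?M \<rightarrow>\<^sub>M ?M" using assms(1) by (simp add: nonsingular_def)
  have f[measurable]: "f \<in> borel_measurable ?M" and fi: "integrable ?M f"
    using assms(2) by (auto simp: L1_def)
  interpret M: finite_measure ?M by (rule finite_measure_leb01)
  define D where "D = density ?M (\<lambda>x. ennreal (f x))"
  define N where "N = distr D ?M T"
  have TD[measurable]: "T \<in> D \<rightarrow>\<^sub>M ?M" using T by (simp add: D_def)
  have "emeasure D (space D) = (\<integral>\<^sup>+x. ennreal (f x) \<partial>?M)"
    unfolding D_def by (auto simp: emeasure_density intro!: nn_integral_cong split: split_indicator)
  also have "\<dots> < \<infinity>" using fi assms(3) by (simp add: nn_integral_eq_integral)
  finally have fD: "finite_measure D" by (intro finite_measureI) auto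
  then have fN: "finite_measure N" unfolding N_def
    by (rule finite_measure.finite_measure_distr) (rule TD)
  have ac: "absolutely_continuous ?M N"
    unfolding absolutely_continuous_def
  proof
    fix A assume A: "A \<in> null_sets ?M"
    then have A': "T -` A \<inter> space ?M \<in> null_sets ?M" using assms(1) by (simp add: nonsingular_def)
    have "absolutely_continuous ?M D" unfolding D_def by (rule absolutely_continuousI_density) simp
    then have "T -` A \<inter> space ?M \<in> null_sets D" using A' by (auto simp: absolutely_continuous_def)
    then show "A \<in> null_sets N" using A unfolding N_def
      by (auto simp: null_sets_def emeasure_distr D_def)
  qed
  obtain w where w[measurable]: "w \<in> borel_measurable ?M" and dw: "density ?M w = N"
    using M.Radon_Nikodym_finite_measure[OF fN _ ac] by (auto simp: N_def)
  have "(\<integral>\<^sup>+x. w x \<partial>?M) = emeasure N (space N)"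
    unfolding dw[symmetric] by (auto simp: emeasure_density intro!: nn_integral_cong split: split_indicator)
  also have "\<dots> \<noteq> \<infinity>" using fN by (simp add: finite_measure.emeasure_finite)
  finally have "AE x in ?M. w x \<noteq> \<infinity>" by (intro nn_integral_PInf_AE) auto
  then have we: "AE x in ?M. w x = ennreal (enn2real (w x))" by (auto elim!: eventually_mono simp: less_top)
  \<comment> \<open>The density \<open>w\<close> may take the value infinity, but its total mass is
    finite, so it is real almost everywhere.\<close>
  define u where "u x = enn2real (w x)" for x
  have u[measurable]: "u \<in> borel_measurable ?M" unfolding u_def by measurable
  have du: "density ?M (\<lambda>x. ennreal (u x)) = N"
    unfolding dw[symmetric] u_def by (rule density_cong) (use we in \<open>auto elim: eventually_mono\<close>)
  have "integrable ?M u"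
  proof (rule integrableI_nonneg)
    have "(\<integral>\<^sup>+x. ennreal (u x) \<partial>?M) = emeasure N (space N)"
      unfolding du[symmetric] by (auto simp: emeasure_density intro!: nn_integral_cong split: split_indicator)
    then show "(\<integral>\<^sup>+x. ennreal (u x) \<partial>?M) < \<infinity>"
      using fN by (simp add: finite_measure.emeasure_finite less_top[symmetric])
  qed (auto simp: u_def)
  moreover have "(LINT x|?M. u x * g x) = (LINT x|?M. f x * g (T x))" if "g \<in> Linf" for g
  proof -
    have g[measurable]: "g \<in> borel_measurable ?M" using that by (simp add: Linf_def)
    have "(LINT x|?M. u x * g x) = (LINT x|density ?M (\<lambda>x. ennreal (u x)). g x)"
      by (subst integral_density) (auto simp: u_def)
    also have "\<dots> = (LINT x|D. g (T x))" unfolding du N_def by (subst integral_distr) auto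
    also have "\<dots> = (LINT x|?M. f x * g (T x))" unfolding D_def
      by (subst integral_density) (auto simp: assms(3))
    finally show ?thesis .
  qed
  ultimately show ?thesis
    using is_transfer_L1_iff[OF assms(1,2), of u] by (auto simp: L1_def)
qed

lemma transfer_exists:
  assumes "nonsingular T" "f \<in> L1"
  shows "\<exists>u. is_transfer T f u"
proof -
  let ?p = "\<lambda>x. max 0 (f x)" and ?n = "\<lambda>x. max 0 (- f x)"
  have p: "?p \<in> L1" and n: "?n \<in> L1" using assms(2) by (auto simp: L1_def)
  obtain u v where u: "is_transfer T ?p u" and v: "is_transfer T ?n v"
    using transfer_exists_nonneg[OF assms(1) p] transfer_exists_nonneg[OF assms(1) n] by auto
  have u': "u \<in> L1" "\<And>g. g \<in> Linf \<Longrightarrow> (LINT x|leb01. u x * g x) = (LINT x|leb01. ?p x * g (T x))"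
    and v': "v \<in> L1" "\<And>g. g \<in> Linf \<Longrightarrow> (LINT x|leb01. v x * g x) = (LINT x|leb01. ?n x * g (T x))"
    using u v is_transfer_L1_iff[OF assms(1)] p n by auto
  have "(LINT x|leb01. (u x - v x) * g x) = (LINT x|leb01. f x * g (T x))" if g: "g \<in> Linf" for g
  proof -
    have gT: "(\<lambda>x. g (T x)) \<in> Linf" by (rule Linf_comp[OF assms(1) g])
    have "(LINT x|leb01. (u x - v x) * g x) = (LINT x|leb01. u x * g x) - (LINT x|leb01. v x * g x)"
      by (subst Bochner_Integration.integral_diff[symmetric])
        (auto simp: left_diff_distrib intro: integrable_mult_Linf u'(1) v'(1) g)
    also have "\<dots> = (LINT x|leb01. ?p x * g (T x) - ?n x * g (T x))"
      using integrable_mult_Linf[OF p gT] integrable_mult_Linf[OF n gT]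
      by (simp add: u'(2)[OF g] v'(2)[OF g])
    also have "\<dots> = (LINT x|leb01. f x * g (T x))"
      by (rule Bochner_Integration.integral_cong) (auto simp: max_def)
    finally show ?thesis .
  qed
  then have "is_transfer T f (\<lambda>x. u x - v x)"
    using is_transfer_L1_iff[OF assms] L1_diff[OF u'(1) v'(1)] by blast
  then show ?thesis by blast
qed

locale nonsingular_map =
  fixes T :: "real \<Rightarrow> real"
  assumes nonsing: "nonsingular T"
begin

abbreviation L where "L \<equiv> transfer_op T"

lemma T_measurable: "T \<in> leb01 \<rightarrow>\<^sub>M leb01"
  using nonsing by (simp add: nonsingular_def)

lemma T_in: "x \<in> {0..1} \<Longrightarrow> T x \<in> {0..1}"
  using measurable_space[OF T_measurable, of x] by simp

lemma is_transfer_L: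
  assumes "f \<in> L1" shows "is_transfer T f (L f)"
  unfolding transfer_op_def by (rule someI_ex[OF transfer_exists[OF nonsing assms]])

lemma L_L1: "f \<in> L1 \<Longrightarrow> L f \<in> L1"
  and L_dual: "f \<in> L1 \<Longrightarrow> g \<in> Linf \<Longrightarrow> (LINT x|leb01. L f x * g x) = (LINT x|leb01. f x * g (T x))"
  using is_transfer_L is_transfer_L1_iff[OF nonsing] by auto

lemma L_integral: "f \<in> L1 \<Longrightarrow> (LINT x|leb01. L f x) = (LINT x|leb01. f x)"
  using L_dual[OF _ Linf_const[of 1]] by simp

lemma L_eqI:
  assumes "f \<in> L1" "u \<in> L1"
    "\<And>g. g \<in> Linf \<Longrightarrow> (LINT x|leb01. u x * g x) = (LINT x|leb01. f x * g (T x))"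
  shows "ae_eq (L f) u"
proof -
  have "ae_eq (\<lambda>x. L f x - u x) (\<lambda>x. 0)"
  proof (rule L1_ae_zero)
    show "(\<lambda>x. L f x - u x) \<in> L1" by (intro L1_diff L_L1 assms)
    fix E assume "E \<in> sets leb01"
    then have E: "indicator E \<in> Linf" by (rule Linf_indicator)
    have "(LINT x|leb01. (L f x - u x) * indicator E x)
        = (LINT x|leb01. L f x * indicator E x) - (LINT x|leb01. u x * indicator E x)"
      using integrable_mult_Linf[OF L_L1[OF assms(1)] E] integrable_mult_Linf[OF assms(2) E]
      by (simp add: left_diff_distrib)
    then show "(LINT x|leb01. (L f x - u x) * indicator E x) = 0"
      using L_dual[OF assms(1) E] assms(3)[OF E] by simp
  qed
  then show ?thesis by (simp add: ae_eq_def)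
qed

text \<open>\<open>transfer_op\<close> selects an arbitrary representative, so linearity is an
  almost-everywhere statement; it is read off from duality.\<close>

lemma L_lin:
  assumes "f \<in> L1" "g \<in> L1"
  shows "ae_eq (L (\<lambda>x. p * f x + q * g x)) (\<lambda>x. p * L f x + q * L g x)"
proof (rule L_eqI)
  show "(\<lambda>x. p * f x + q * g x) \<in> L1" "(\<lambda>x. p * L f x + q * L g x) \<in> L1"
    using assms by (auto intro!: L1_add L1_cmult L_L1)
  fix k assume k: "k \<in> Linf"
  have kT: "(\<lambda>x. k (T x)) \<in> Linf" by (rule Linf_comp[OF nonsing k])
  have "(LINT x|leb01. (p * L f x + q * L g x) * k x)
     = (LINT x|leb01. p * (L f x * k x) + q * (L g x * k x))"
    by (simp add: algebra_simps)
  also have "\<dots> = p * (LINT x|leb01. L f x * k x) + q * (LINT x|leb01. L g x * k x)"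
    using integrable_mult_Linf[OF L_L1[OF assms(1)] k] integrable_mult_Linf[OF L_L1[OF assms(2)] k]
    by simp
  also have "\<dots> = (LINT x|leb01. p * (f x * k (T x)) + q * (g x * k (T x)))"
    using integrable_mult_Linf[OF assms(1) kT] integrable_mult_Linf[OF assms(2) kT]
    by (simp add: L_dual[OF assms(1) k] L_dual[OF assms(2) k])
  also have "\<dots> = (LINT x|leb01. (p * f x + q * g x) * k (T x))"
    by (simp add: algebra_simps)
  finally show "(LINT x|leb01. (p * L f x + q * L g x) * k x)
     = (LINT x|leb01. (p * f x + q * g x) * k (T x))" .
qed

lemma L_add: "f \<in> L1 \<Longrightarrow> g \<in> L1 \<Longrightarrow> ae_eq (L (\<lambda>x. f x + g x)) (\<lambda>x. L f x + L g x)"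
  using L_lin[of f g 1 1] by simp

lemma L_diff: "f \<in> L1 \<Longrightarrow> g \<in> L1 \<Longrightarrow> ae_eq (L (\<lambda>x. f x - g x)) (\<lambda>x. L f x - L g x)"
  using L_lin[of f g 1 "-1"] by simp

lemma L_cmult: "f \<in> L1 \<Longrightarrow> ae_eq (L (\<lambda>x. k * f x)) (\<lambda>x. k * L f x)"
  using L_lin[of f f k 0] by simp

lemma L_cong:
  assumes "f \<in> L1" "ae_eq f g" shows "ae_eq (L f) (L g)"
proof (rule ae_eq_sym, rule L_eqI)
  show g: "g \<in> L1" by (rule L1_cong[OF assms])
  show "L f \<in> L1" by (rule L_L1[OF assms(1)])
  fix k assume k: "k \<in> Linf"
  have kT: "(\<lambda>x. k (T x)) \<in> Linf" by (rule Linf_comp[OF nonsing k])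
  show "(LINT x|leb01. L f x * k x) = (LINT x|leb01. g x * k (T x))"
    unfolding L_dual[OF assms(1) k]
    by (rule integral_ae_eq[OF L1_measurable[OF L1_mult_Linf[OF assms(1) kT]]])
      (use assms(2) in \<open>auto simp: ae_eq_def elim: eventually_mono\<close>)
qed

text \<open>The test function \<open>sgn (L f)\<close> turns the norm of the image into a pairing of
  \<open>f\<close> with a function bounded by 1.\<close>

lemma L_norm:
  assumes "f \<in> L1" shows "L1_norm (L f) \<le> L1_norm f"
proof -
  let ?s = "\<lambda>x. sgn (L f x)"
  have s: "?s \<in> Linf"
    by (rule LinfI[of _ 1]) (use L1_measurable[OF L_L1[OF assms]] in \<open>auto simp: sgn_if\<close>)
  have sT: "(\<lambda>x. ?s (T x)) \<in> Linf" by (rule Linf_comp[OF nonsing s])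
  have "L1_norm (L f) = (LINT x|leb01. L f x * ?s x)"
    unfolding L1_norm_def by (simp add: abs_sgn)
  also have "\<dots> = (LINT x|leb01. f x * ?s (T x))" by (rule L_dual[OF assms s])
  also have "\<dots> \<le> L1_norm f" unfolding L1_norm_def
  proof (rule integral_mono)
    show "integrable leb01 (\<lambda>x. f x * ?s (T x))" by (rule integrable_mult_Linf[OF assms sT])
    show "integrable leb01 (\<lambda>x. \<bar>f x\<bar>)" using assms by (simp add: L1_def)
    show "f x * ?s (T x) \<le> \<bar>f x\<bar>" for x by (auto simp: sgn_if)
  qed
  finally show ?thesis .
qed

lemma L_norm_diff:
  assumes "f \<in> L1" "g \<in> L1"
  shows "L1_norm (\<lambda>x. L f x - L g x) \<le> L1_norm (\<lambda>x. f x - g x)"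
  using L_norm[OF L1_diff[OF assms]]
    L1_norm_ae_eq[OF L_L1[OF L1_diff[OF assms]] L_diff[OF assms]] by simp

lemma L_pos:
  assumes "f \<in> L1" "AE x in leb01. 0 \<le> f x" shows "AE x in leb01. 0 \<le> L f x"
proof (rule sigma_finite_measure.density_nonneg[OF finite_measure.axioms(1)[OF finite_measure_leb01]])
  show "integrable leb01 (L f)" using L_L1[OF assms(1)] by (simp add: L1_def)
  fix A assume "A \<in> sets leb01"
  then have A: "indicator A \<in> Linf" by (rule Linf_indicator)
  have "set_lebesgue_integral leb01 A (L f) = (LINT x|leb01. L f x * indicator A x)"
    by (simp add: set_lebesgue_integral_def mult.commute)
  also have "\<dots> = (LINT x|leb01. f x * indicator A (T x))" by (rule L_dual[OF assms(1) A])
  also have "\<dots> \<ge> 0" by (rule integral_nonneg_AE) (use assms(2) in \<open>auto elim!: eventually_mono\<close>)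
  finally show "0 \<le> set_lebesgue_integral leb01 A (L f)" .
qed

end

section \<open>Convergence in the mean\<close>

lemma L1_dct:
  assumes "g \<in> L1" "\<And>n. f n \<in> borel_measurable leb01"
    and "AE x in leb01. (\<lambda>n. f n x) \<longlonglongrightarrow> F x" "\<And>n. AE x in leb01. \<bar>f n x\<bar> \<le> g x"
    and F: "F \<in> borel_measurable leb01"
  shows "F \<in> L1" "(\<lambda>n. L1_norm (\<lambda>x. f n x - F x)) \<longlonglongrightarrow> 0"
proof -
  have g: "integrable leb01 g" using assms(1) by (simp add: L1_def)
  show FL: "F \<in> L1" unfolding L1_def
    using integrable_dominated_convergence[OF F assms(2) g assms(3)] assms(4) by simp
  have FF: "AE x in leb01. \<bar>F x\<bar> \<le> g x"
  proof -
    have "AE x in leb01. \<forall>n. \<bar>f n x\<bar> \<le> g x" using assms(4) by (simp add: AE_all_countable)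
    with assms(3) show ?thesis
    proof eventually_elim
      case (elim x)
      have "(\<lambda>n. \<bar>f n x\<bar>) \<longlonglongrightarrow> \<bar>F x\<bar>" using elim(1) by (rule tendsto_rabs)
      then show ?case by (rule LIMSEQ_le_const2) (use elim(2) in auto)
    qed
  qed
  have "(\<lambda>n. LINT x|leb01. \<bar>f n x - F x\<bar>) \<longlonglongrightarrow> (LINT x|leb01. 0)"
  proof (rule integral_dominated_convergence)
    show "integrable leb01 (\<lambda>x. 2 * g x)" using g by simp
    show "(\<lambda>x. \<bar>f n x - F x\<bar>) \<in> borel_measurable leb01" for n using F assms(2)[of n] by measurable
    show "AE x in leb01. (\<lambda>n. \<bar>f n x - F x\<bar>) \<longlonglongrightarrow> 0"
      using assms(3) by eventually_elim (auto intro: tendsto_rabs_zero LIM_zero)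
    show "AE x in leb01. norm \<bar>f n x - F x\<bar> \<le> 2 * g x" for n
      using FF assms(4)[of n] by eventually_elim auto
  qed auto
  then show "(\<lambda>n. L1_norm (\<lambda>x. f n x - F x)) \<longlonglongrightarrow> 0" by (simp add: L1_norm_def)
qed

lemma LINT_mult_le:
  assumes "f \<in> L1" "g \<in> Linf" "AE x in leb01. \<bar>g x\<bar> \<le> K"
  shows "\<bar>LINT x|leb01. f x * g x\<bar> \<le> K * L1_norm f"
proof -
  have "\<bar>LINT x|leb01. f x * g x\<bar> \<le> (LINT x|leb01. \<bar>f x * g x\<bar>)" by (rule integral_abs_bound)
  also have "\<dots> \<le> (LINT x|leb01. K * \<bar>f x\<bar>)"
  proof (rule integral_mono_AE)
    show "integrable leb01 (\<lambda>x. \<bar>f x * g x\<bar>)" using integrable_mult_Linf[OF assms(1,2)] by simp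
    show "integrable leb01 (\<lambda>x. K * \<bar>f x\<bar>)" using assms(1) by (simp add: L1_def)
    show "AE x in leb01. \<bar>f x * g x\<bar> \<le> K * \<bar>f x\<bar>"
      using assms(3) by eventually_elim (auto simp: abs_mult mult.commute[of K] intro: mult_left_mono)
  qed
  finally show ?thesis by (simp add: L1_norm_def)
qed

lemma LINT_tendsto:
  assumes "\<And>n. f n \<in> L1" "F \<in> L1" "g \<in> Linf" "(\<lambda>n. L1_norm (\<lambda>x. f n x - F x)) \<longlonglongrightarrow> 0"
  shows "(\<lambda>n. LINT x|leb01. f n x * g x) \<longlonglongrightarrow> (LINT x|leb01. F x * g x)"
proof -
  obtain K where K: "AE x in leb01. \<bar>g x\<bar> \<le> K" using assms(3) by (auto simp: Linf_def)
  have "(\<lambda>n. (LINT x|leb01. f n x * g x) - (LINT x|leb01. F x * g x)) \<longlonglongrightarrow> 0"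
  proof (rule Lim_null_comparison[OF always_eventually])
    show "\<forall>n. norm ((LINT x|leb01. f n x * g x) - (LINT x|leb01. F x * g x))
        \<le> K * L1_norm (\<lambda>x. f n x - F x)"
    proof
      fix n
      have "(LINT x|leb01. f n x * g x) - (LINT x|leb01. F x * g x) = (LINT x|leb01. (f n x - F x) * g x)"
        using integrable_mult_Linf[OF assms(1)[of n] assms(3)] integrable_mult_Linf[OF assms(2,3)]
        by (simp add: left_diff_distrib)
      then show "norm ((LINT x|leb01. f n x * g x) - (LINT x|leb01. F x * g x))
        \<le> K * L1_norm (\<lambda>x. f n x - F x)"
        using LINT_mult_le[OF L1_diff[OF assms(1)[of n] assms(2)] assms(3) K] by simp
    qed
    show "(\<lambda>n. K * L1_norm (\<lambda>x. f n x - F x)) \<longlonglongrightarrow> 0"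
      using tendsto_mult_right_zero[OF assms(4)] by simp
  qed
  then show ?thesis by (rule LIM_zero_cancel)
qed

lemma LINT_tendsto1:
  assumes "\<And>n. f n \<in> L1" "F \<in> L1" "(\<lambda>n. L1_norm (\<lambda>x. f n x - F x)) \<longlonglongrightarrow> 0"
  shows "(\<lambda>n. LINT x|leb01. f n x) \<longlonglongrightarrow> (LINT x|leb01. F x)"
  using LINT_tendsto[OF assms(1,2) Linf_const[of 1] assms(3)] by simp

section \<open>Primitives\<close>

text \<open>Written as a pairing with the indicator of a half-line, so that duality for the transfer
  operator applies to it directly. For integrable \<open>u\<close> it is defined on the whole line,
  0 to the left of the unit interval and constant to its right.\<close>

definition prim :: "(real \<Rightarrow> real) \<Rightarrow> real \<Rightarrow> real" where
  "prim u x = (LINT t|leb01. u t * indicator {..x} t)"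

lemma ind_Linf: "indicator {..x::real} \<in> Linf"
proof (rule LinfI[of _ 1])
  show "indicator {..x} \<in> borel_measurable leb01"
    by (intro measurable_restrict_space1 borel_measurable_indicator) auto
qed (auto split: split_indicator)

lemma null_point: "AE t in leb01. t \<noteq> (x::real)"
proof -
  have "AE t in lebesgue. t \<noteq> x"
    by (rule AE_I'[of "{x}"]) (auto simp: negligible_iff_null_sets[symmetric])
  then show ?thesis by (auto simp: AE_restrict_space_iff)
qed

lemma prim_integrable: "u \<in> L1 \<Longrightarrow> integrable leb01 (\<lambda>t. u t * indicator {..x} t)"
  using integrable_mult_Linf[OF _ ind_Linf] .

lemma prim_add: "u \<in> L1 \<Longrightarrow> v \<in> L1 \<Longrightarrow> prim (\<lambda>t. u t + v t) x = prim u x + prim v x"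
  unfolding prim_def using prim_integrable by (simp add: distrib_right)

lemma prim_diff: "u \<in> L1 \<Longrightarrow> v \<in> L1 \<Longrightarrow> prim (\<lambda>t. u t - v t) x = prim u x - prim v x"
  unfolding prim_def using prim_integrable by (simp add: left_diff_distrib)

lemma prim_cmult: "prim (\<lambda>t. k * u t) x = k * prim u x"
  unfolding prim_def by (simp add: mult.assoc)

lemma prim_0: "u \<in> L1 \<Longrightarrow> x \<le> 0 \<Longrightarrow> prim u x = 0"
proof -
  assume u: "u \<in> L1" "x \<le> 0"
  have "prim u x = (LINT t|leb01. 0)" unfolding prim_def
  proof (rule integral_ae_eq)
    show "(\<lambda>t. u t * indicator {..x} t) \<in> borel_measurable leb01" using prim_integrable[OF u(1)] by auto
    show "ae_eq (\<lambda>t. u t * indicator {..x} t) (\<lambda>t. 0)" unfolding ae_eq_def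
      using null_point[of 0] AE_space by eventually_elim (use u in \<open>auto split: split_indicator\<close>)
  qed
  then show ?thesis by simp
qed

lemma prim_1: "1 \<le> x \<Longrightarrow> prim u x = (LINT t|leb01. u t)"
  unfolding prim_def by (rule Bochner_Integration.integral_cong) (auto split: split_indicator)

lemma prim_cong: "u \<in> L1 \<Longrightarrow> ae_eq u v \<Longrightarrow> prim u x = prim v x"
  unfolding prim_def
  by (rule integral_ae_eq) (use prim_integrable in \<open>auto simp: ae_eq_def elim: eventually_mono\<close>)

lemma prim_diff_le: "u \<in> L1 \<Longrightarrow> \<bar>prim u x - prim u y\<bar> \<le> L1_norm u"
proof -
  assume u: "u \<in> L1"
  have g: "(\<lambda>t. indicator {..x} t - indicator {..y} t :: real) \<in> Linf"
    by (rule LinfI[of _ 1])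
      (use ind_Linf in \<open>auto simp: Linf_def intro!: borel_measurable_diff split: split_indicator\<close>)
  have "prim u x - prim u y = (LINT t|leb01. u t * (indicator {..x} t - indicator {..y} t))"
    unfolding prim_def using prim_integrable[OF u] by (simp add: right_diff_distrib)
  also have "\<bar>\<dots>\<bar> \<le> 1 * L1_norm u"
    by (rule LINT_mult_le[OF u g]) (auto split: split_indicator)
  finally show ?thesis by simp
qed

lemma prim_le: "u \<in> L1 \<Longrightarrow> \<bar>prim u x\<bar> \<le> L1_norm u"
  using prim_diff_le[of u x 0] prim_0[of u 0] by simp

lemma prim_mono:
  assumes "u \<in> L1" "\<And>t. 0 \<le> u t" shows "mono (prim u)"
proof (rule monoI)
  fix x y :: real assume "x \<le> y"
  then show "prim u x \<le> prim u y" unfolding prim_def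
    by (intro integral_mono prim_integrable assms) (use assms(2) in \<open>auto split: split_indicator\<close>)
qed

lemma isCont_prim:
  assumes "u \<in> L1" shows "isCont (prim u) x"
  unfolding continuous_at_sequentially
proof (intro allI impI)
  fix X :: "nat \<Rightarrow> real" assume X: "X \<longlonglongrightarrow> x"
  have "(\<lambda>n. prim u (X n)) \<longlonglongrightarrow> prim u x" unfolding prim_def
  proof (rule integral_dominated_convergence)
    show "integrable leb01 (\<lambda>t. \<bar>u t\<bar>)" using assms by (simp add: L1_def)
    show "(\<lambda>t. u t * indicator {..x} t) \<in> borel_measurable leb01"
      "(\<lambda>t. u t * indicator {..X n} t) \<in> borel_measurable leb01" for n
      using prim_integrable[OF assms] by auto
    show "AE t in leb01. (\<lambda>n. u t * indicator {..X n} t) \<longlonglongrightarrow> u t * indicator {..x} t"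
      using null_point[of x]
    proof eventually_elim
      case (elim t)
      have "eventually (\<lambda>n. indicator {..X n} t = (indicator {..x} t :: real)) sequentially"
      proof (cases "t < x")
        case True
        then show ?thesis using order_tendstoD(1)[OF X True] by (auto elim!: eventually_mono split: split_indicator)
      next
        case False
        then have "x < t" using elim by simp
        then show ?thesis using order_tendstoD(2)[OF X \<open>x < t\<close>] by (auto elim!: eventually_mono split: split_indicator)
      qed
      then have "eventually (\<lambda>n. u t * indicator {..X n} t = u t * indicator {..x} t) sequentially"
        by (auto elim: eventually_mono)
      then show ?case by (rule tendsto_eventually)
    qed
    show "AE t in leb01. norm (u t * indicator {..X n} t) \<le> \<bar>u t\<bar>" for n
      by (auto split: split_indicator)
  qed
  then show "(prim u \<circ> X) \<longlonglongrightarrow> prim u x" by (simp add: comp_def)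
qed

lemma continuous_on_prim: "u \<in> L1 \<Longrightarrow> continuous_on S (prim u)"
  by (intro continuous_at_imp_continuous_on ballI isCont_prim)

lemma prim_diff_integral:
  assumes u: "u \<in> L1" and "a \<le> b"
  shows "prim u b - prim u a = integral {a..b} (\<lambda>t. if t \<in> {0..1} then u t else 0)"
    and "S \<in> sets lebesgue \<Longrightarrow> (\<lambda>t. if t \<in> {0..1} then u t else 0) absolutely_integrable_on S"
proof -
  let ?f = "\<lambda>t. if t \<in> {0..1} then u t else 0"
  have feq: "?f = (\<lambda>t. indicator {0..1} t *\<^sub>R u t)" by (auto split: split_indicator)
  have f: "integrable lebesgue ?f"
    using u integrable_restrict_space[of "{0..1}" lebesgue u] unfolding feq by (simp add: L1_def)
  have "set_integrable lebesgue UNIV ?f" using f by (simp add: set_integrable_def)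
  then have abs: "?f absolutely_integrable_on S" if "S \<in> sets lebesgue"
    for S using that by (rule set_integrable_subset) auto
  then show "S \<in> sets lebesgue \<Longrightarrow> ?f absolutely_integrable_on S" .
  have "prim u b - prim u a = (LINT t|leb01. u t * indicator {..b} t - u t * indicator {..a} t)"
    unfolding prim_def using prim_integrable[OF u] by simp
  also have "\<dots> = (LINT t|leb01. u t * indicator {a..b} t)"
  proof (rule integral_ae_eq)
    show "(\<lambda>t. u t * indicator {..b} t - u t * indicator {..a} t) \<in> borel_measurable leb01"
      using prim_integrable[OF u] by (intro borel_measurable_diff) auto
    show "ae_eq (\<lambda>t. u t * indicator {..b} t - u t * indicator {..a} t) (\<lambda>t. u t * indicator {a..b} t)"
      unfolding ae_eq_def using null_point[of a]
      by eventually_elim (use \<open>a \<le> b\<close> in \<open>auto split: split_indicator\<close>)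
  qed
  also have "\<dots> = (LINT t|lebesgue. indicator {0..1} t *\<^sub>R (u t * indicator {a..b} t))"
    by (rule integral_restrict_space) auto
  also have "\<dots> = (LINT t:{a..b}|lebesgue. ?f t)"
    unfolding set_lebesgue_integral_def
    by (rule Bochner_Integration.integral_cong) (auto split: split_indicator)
  also have "\<dots> = integral {a..b} ?f"
    by (rule set_lebesgue_integral_eq_integral) (rule abs, simp)
  finally show "prim u b - prim u a = integral {a..b} ?f" .
qed

lemma prim_eq_integral:
  assumes "u \<in> L1" "x \<in> {0..1}" shows "prim u x = integral {0..x} u"
proof -
  have "prim u x = integral {0..x} (\<lambda>t. if t \<in> {0..1} then u t else 0)"
    using prim_diff_integral(1)[OF assms(1), of 0 x] assms prim_0[of u 0] by simp
  also have "\<dots> = integral {0..x} u" by (rule integral_cong) (use assms in auto)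
  finally show ?thesis .
qed

text \<open>The finite exceptional set makes room for the cusp and for the kinks of piecewise linear
  functions.\<close>

lemma prim_FTC:
  assumes "p \<in> L1" "finite S" "continuous_on {0..1} f"
    "\<And>x. x \<in> {0<..<1} - S \<Longrightarrow> (f has_real_derivative p x) (at x)" "x \<in> {0..1}"
  shows "prim p x = f x - f 0"
proof -
  have "(p has_integral (f x - f 0)) {0..x}"
  proof (rule fundamental_theorem_of_calculus_interior_strong[OF assms(2)])
    show "0 \<le> x" using assms(5) by simp
    show "continuous_on {0..x} f" using assms(5) by (intro continuous_on_subset[OF assms(3)]) auto
    fix y assume "y \<in> {0<..<x} - S"
    then show "(f has_vector_derivative p y) (at y)"
      using assms(4)[of y] assms(5) by (auto simp: has_real_derivative_iff_has_vector_derivative)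
  qed
  then show ?thesis using prim_eq_integral[OF assms(1,5)] by (simp add: integral_unique)
qed

lemma prim_FTC_C1:
  assumes "continuous_on {0..1} p" 
    "\<And>x. x \<in> {0..1} \<Longrightarrow> (f has_real_derivative p x) (at x within {0..1})" "x \<in> {0..1}"
  shows "prim p x = f x - f 0"
proof (rule prim_FTC[where S="{}"])
  show "p \<in> L1" by (rule continuous_L1[OF assms(1)])
  show "continuous_on {0..1} f" by (rule DERIV_continuous_on[OF assms(2)])
  fix x :: real assume "x \<in> {0<..<1} - {}"
  then show "(f has_real_derivative p x) (at x)"
    using assms(2)[of x] at_within_interior[of x "{0..1}"] by (simp add: interior_atLeastAtMost_real)
qed (use assms in auto)

lemma prim_has_derivative:
  assumes u: "u \<in> L1" and c: "continuous_on {0..1} u" and x: "x \<in> {0..1}"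
  shows "(prim u has_real_derivative u x) (at x within {0..1})"
proof -
  have "((\<lambda>x. integral {0..x} u) has_real_derivative u x) (at x within {0..1})"
    using integral_has_vector_derivative[OF c x] by (simp add: has_real_derivative_iff_has_vector_derivative)
  then show ?thesis
    by (rule has_field_derivative_transform_within[OF _ zero_less_one x])
      (use prim_eq_integral[OF u] in auto)
qed

text \<open>By Lebesgue differentiation almost every value of \<open>u\<close> is the limit of its
  means over shrinking intervals, and these means are difference quotients of
  \<open>prim u\<close>.\<close>

lemma ae_zero_if_prim_zero:
  assumes u: "u \<in> L1" and z: "\<And>x. x \<in> {0..1} \<Longrightarrow> prim u x = 0"
  shows "ae_eq u (\<lambda>x. 0)"
proof -
  let ?f = "\<lambda>t. if t \<in> {0..1} then u t else 0"
  have pz: "prim u x = 0" for x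
    using z[of x] z[of 1] prim_0[OF u, of x] prim_1[of x u] prim_1[of 1 u] by (cases "x \<le> 0"; cases "x \<ge> 1") auto
  have int: "?f integrable_on cbox a b" for a b
    using prim_diff_integral(2)[OF u, of 0 0 "cbox a b"] by (simp add: set_lebesgue_integral_eq_integral)
  obtain N where N: "negligible N" and der: "\<And>x e. \<lbrakk>x \<notin> N; 0 < e\<rbrakk> \<Longrightarrow>
               \<exists>d>0. \<forall>h. 0 < h \<and> h < d \<longrightarrow>
                  norm (integral (cbox x (x + h *\<^sub>R One)) ?f /\<^sub>R h ^ DIM(real) - ?f x) < e"
    using integrable_ccontinuous_explicit[OF int] by blast
  have "?f x = 0" if xN: "x \<notin> N" for x
  proof (rule ccontr)
    assume "?f x \<noteq> 0"
    then obtain d where d: "d > 0" "\<And>h. 0 < h \<Longrightarrow> h < d \<Longrightarrow>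
        norm (integral (cbox x (x + h *\<^sub>R One)) ?f /\<^sub>R h ^ DIM(real) - ?f x) < \<bar>?f x\<bar>"
      using der[OF xN, of "\<bar>?f x\<bar>"] by auto
    have "integral {x..x + d/2} ?f = 0"
      using prim_diff_integral(1)[OF u, of x "x + d/2"] d(1) pz by simp
    then show False using d(2)[of "d/2"] d(1) by auto
  qed
  then have "x \<in> N" if "x \<in> {0..1}" "u x \<noteq> 0" for x using that by metis
  then have "AE x in lebesgue. x \<in> {0..1} \<longrightarrow> u x = 0"
    using N by (intro AE_I'[of N]) (auto simp: negligible_iff_null_sets)
  then show ?thesis by (simp add: ae_eq_def AE_restrict_space_iff)
qed

lemma continuous_ae_zero:
  assumes "continuous_on {0..1} (f::real\<Rightarrow>real)" "ae_eq f (\<lambda>x. 0)" "x \<in> {0..1}"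
  shows "f x = 0"
proof -
  have L: "(\<lambda>x. \<bar>f x\<bar>) \<in> L1" using assms(1) by (intro continuous_L1 continuous_intros)
  have "integral {0..1} (\<lambda>x. \<bar>f x\<bar>) = (LINT x|leb01. \<bar>f x\<bar>)"
    using L lebesgue_integral_eq_integral[of "{0..1}" "\<lambda>x. \<bar>f x\<bar>"] by (simp add: L1_def)
  also have "\<dots> = (LINT x|leb01. 0)"
    by (rule integral_ae_eq) (use L assms(2) in \<open>auto simp: L1_def ae_eq_def elim: eventually_mono\<close>)
  finally have "integral (cbox 0 1) (\<lambda>x. \<bar>f x\<bar>) = 0" by simp
  moreover have "continuous_on (cbox 0 1) (\<lambda>x. \<bar>f x\<bar>)" using assms(1) by (auto intro!: continuous_intros)
  ultimately have "\<forall>x\<in>cbox 0 1. \<bar>f x\<bar> = 0"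
    by (subst (asm) integral_cbox_eq_0_iff) auto
  then show ?thesis using assms(3) by auto
qed

lemma continuous_ae_eq:
  assumes "continuous_on {0..1} (f::real\<Rightarrow>real)" "continuous_on {0..1} g" "ae_eq f g" "x \<in> {0..1}"
  shows "f x = g x"
  using continuous_ae_zero[of "\<lambda>x. f x - g x" x] assms by (auto simp: ae_eq_def intro!: continuous_intros)

text \<open>The order of integration is exchanged over the triangle \<open>t \<le> x\<close>. This
  is integration by parts for absolutely continuous functions, with \<open>p\<close> merely
  integrable.\<close>

lemma prim_Fubini:
  assumes u: "u \<in> L1" and p: "p \<in> L1"
  shows "(LINT x|leb01. prim u x * p x) = (LINT t|leb01. u t * ((LINT x|leb01. p x) - prim p t))"
proof -
  interpret finite_measure leb01 by (rule finite_measure_leb01)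
  interpret pair_sigma_finite leb01 leb01 ..
  have [measurable]: "u \<in> borel_measurable leb01" "p \<in> borel_measurable leb01"
    using u p by (auto simp: L1_def)
  have id[measurable]: "(\<lambda>x. x) \<in> leb01 \<rightarrow>\<^sub>M borel"
    by (rule measurable_restrict_space1) (simp add: measurable_completion)
  define h where "h = (\<lambda>(x, t). p x * (u t * (if t \<le> x then 1 else 0 :: real)))"
  have hm: "h \<in> borel_measurable (leb01 \<Otimes>\<^sub>M leb01)" unfolding h_def by measurable
  have ind: "(if t \<le> x then 1 else 0) = (indicator {..x} t :: real)" for t x :: real by auto
  have int: "integrable (leb01 \<Otimes>\<^sub>M leb01) h"
  proof (rule Fubini_integrable[OF hm])
    have "(LINT t|leb01. norm (h (x, t))) = \<bar>p x\<bar> * prim (\<lambda>t. \<bar>u t\<bar>) x" for x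
      unfolding h_def prim_def by (simp add: ind abs_mult)
    moreover have "(\<lambda>x. \<bar>p x\<bar> * prim (\<lambda>t. \<bar>u t\<bar>) x) \<in> L1"
      by (intro L1_mult_Linf L1_abs p continuous_Linf continuous_on_prim u)
    ultimately show "integrable leb01 (\<lambda>x. LINT t|leb01. norm (h (x, t)))" by (simp add: L1_def)
    show "AE x in leb01. integrable leb01 (\<lambda>t. h (x, t))"
      unfolding h_def using prim_integrable[OF u] by (auto simp: ind)
  qed
  have "(LINT x|leb01. prim u x * p x) = (LINT x|leb01. LINT t|leb01. h (x, t))"
    unfolding h_def prim_def by (simp add: ind mult.commute)
  also have "\<dots> = (LINT t|leb01. LINT x|leb01. h (x, t))"
    using Fubini_integral[of "\<lambda>x t. h (x, t)"] int by simp
  also have "\<dots> = (LINT t|leb01. u t * ((LINT x|leb01. p x) - prim p t))"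
  proof (rule Bochner_Integration.integral_cong[OF refl])
    fix t
    have "(LINT x|leb01. h (x, t)) = (LINT x|leb01. u t * (p x * (if t \<le> x then 1 else 0)))"
      unfolding h_def by (simp add: mult_ac)
    also have "\<dots> = u t * (LINT x|leb01. p x * (if t \<le> x then 1 else 0))" by simp
    also have "(LINT x|leb01. p x * (if t \<le> x then 1 else 0)) = (LINT x|leb01. p x - p x * indicator {..t} x)"
    proof (rule integral_ae_eq)
      show "(\<lambda>x. p x * (if t \<le> x then 1 else 0)) \<in> borel_measurable leb01" by measurable
      show "ae_eq (\<lambda>x. p x * (if t \<le> x then 1 else 0)) (\<lambda>x. p x - p x * indicator {..t} x)"
        unfolding ae_eq_def using null_point[of t] by eventually_elim auto
    qed
    also have "\<dots> = (LINT x|leb01. p x) - prim p t"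
      unfolding prim_def using prim_integrable[OF p] p by (simp add: L1_def)
    finally show "(LINT x|leb01. h (x, t)) = u t * ((LINT x|leb01. p x) - prim p t)" .
  qed
  finally show ?thesis .
qed

lemma integration_by_parts:
  assumes f: "ae_eq f (\<lambda>x. k + prim u x)" and u: "u \<in> L1" and p: "p \<in> L1"
    and psi: "\<And>t. t \<in> {0..1} \<Longrightarrow> prim p t = \<psi> t" "\<psi> 1 = 0"
  shows "(LINT x|leb01. f x * p x) = - (LINT x|leb01. u x * \<psi> x)"
proof -
  have p0: "(LINT x|leb01. p x) = 0" using psi(1)[of 1] psi(2) prim_1[of 1 p] by simp
  have F: "(\<lambda>x. k + prim u x) \<in> Linf"
    by (intro continuous_Linf continuous_intros continuous_on_prim u)
  have "(LINT x|leb01. f x * p x) = (LINT x|leb01. (k + prim u x) * p x)"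
  proof (rule integral_ae_eq[symmetric])
    show "(\<lambda>x. (k + prim u x) * p x) \<in> borel_measurable leb01"
      using L1_measurable[OF L1_mult_Linf[OF p F]] by (simp add: mult.commute)
    show "ae_eq (\<lambda>x. (k + prim u x) * p x) (\<lambda>x. f x * p x)"
      using f unfolding ae_eq_def by eventually_elim simp
  qed
  also have "\<dots> = (LINT x|leb01. k * p x + prim u x * p x)" by (simp add: distrib_right)
  also have "\<dots> = k * (LINT x|leb01. p x) + (LINT x|leb01. prim u x * p x)"
  proof -
    have "(\<lambda>x. p x * prim u x) \<in> L1" by (intro L1_mult_Linf p continuous_Linf continuous_on_prim u)
    then have "integrable leb01 (\<lambda>x. prim u x * p x)" by (simp add: L1_def mult.commute)
    then show ?thesis using p by (simp add: L1_def)
  qed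
  also have "\<dots> = (LINT t|leb01. u t * (- prim p t))"
    unfolding prim_Fubini[OF u p] by (simp add: p0)
  also have "\<dots> = (LINT t|leb01. - (u t * \<psi> t))"
    by (rule Bochner_Integration.integral_cong) (auto simp: psi(1))
  finally show ?thesis by simp
qed

section \<open>Weak derivatives on the unit interval\<close>

lemma test_funD:
  assumes "test_fun \<phi>"
  shows "(\<phi> has_real_derivative deriv \<phi> x) (at x)" "continuous_on UNIV (deriv \<phi>)"
    "\<phi> 0 = 0" "\<phi> 1 = 0" "\<exists>\<eta>>0. \<forall>x. x \<le> \<eta> \<longrightarrow> \<phi> x = 0"
proof -
  obtain D where D: "\<And>x. (\<phi> has_vector_derivative D x) (at x)" "continuous_on UNIV D"
    using assms unfolding test_fun_def C1_differentiable_on_def by auto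
  have dd: "deriv \<phi> = D" using D(1)
    by (auto simp: has_real_derivative_iff_has_vector_derivative[symmetric] intro: DERIV_imp_deriv)
  show "(\<phi> has_real_derivative deriv \<phi> x) (at x)" "continuous_on UNIV (deriv \<phi>)"
    unfolding dd using D by (auto simp: has_real_derivative_iff_has_vector_derivative)
  obtain K where K: "compact K" "K \<subseteq> {0<..<1}" "\<And>x. x \<notin> K \<Longrightarrow> \<phi> x = 0"
    using assms by (auto simp: test_fun_def)
  have "0 \<notin> K" "1 \<notin> K" using K(2) by auto
  then show "\<phi> 0 = 0" "\<phi> 1 = 0" using K(3) by auto
  show "\<exists>\<eta>>0. \<forall>x. x \<le> \<eta> \<longrightarrow> \<phi> x = 0"
  proof (cases "K = {}")
    case True then show ?thesis using K(3) by (auto intro: exI[of _ 1])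
  next
    case False
    then obtain m where m: "m \<in> K" "\<And>x. x \<in> K \<Longrightarrow> m \<le> x" using compact_attains_inf[OF K(1)] by auto
    have "0 < m" using m(1) K(2) by auto
    moreover have "\<phi> x = 0" if "x \<le> m / 2" for x
      using K(3)[of x] m(2)[of x] that \<open>0 < m\<close> by fastforce
    ultimately show ?thesis by (intro exI[of _ "m/2"]) auto
  qed
qed

lemma test_fun_continuous: "test_fun \<phi> \<Longrightarrow> continuous_on S \<phi>"
  using test_funD(1) by (meson DERIV_isCont continuous_at_imp_continuous_on)

lemma test_fun_Linf: "test_fun \<phi> \<Longrightarrow> \<phi> \<in> Linf" "test_fun \<phi> \<Longrightarrow> deriv \<phi> \<in> Linf"
  using continuous_Linf[OF test_fun_continuous]
    continuous_Linf[OF continuous_on_subset[OF test_funD(2)]] by auto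

lemma prim_deriv_test:
  assumes "test_fun \<phi>" "t \<in> {0..1}" shows "prim (deriv \<phi>) t = \<phi> t"
proof -
  have "prim (deriv \<phi>) t = \<phi> t - \<phi> 0"
    by (rule prim_FTC_C1[OF continuous_on_subset[OF test_funD(2)[OF assms(1)]] _ assms(2)])
      (use test_funD(1)[OF assms(1)] in \<open>auto intro: has_field_derivative_at_within\<close>)
  then show ?thesis using test_funD(3)[OF assms(1)] by simp
qed

lemma has_weak_deriv_prim:
  assumes "u \<in> L1" "f \<in> L1" "ae_eq f (\<lambda>x. k + prim u x)" shows "has_weak_deriv f u"
  unfolding has_weak_deriv_def
proof (intro conjI allI impI assms)
  fix \<phi> assume \<phi>: "test_fun \<phi>"
  show "(LINT x|leb01. f x * deriv \<phi> x) = - (LINT x|leb01. u x * \<phi> x)"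
    by (rule integration_by_parts[OF assms(3,1)])
      (use prim_deriv_test[OF \<phi>] test_funD(4)[OF \<phi>] Linf_L1[OF test_fun_Linf(2)[OF \<phi>]] in auto)
qed

lemma has_weak_deriv_C1:
  assumes "continuous_on {0..1} p"
    "\<And>x. x \<in> {0..1} \<Longrightarrow> (f has_real_derivative p x) (at x within {0..1})"
  shows "has_weak_deriv f p"
proof (rule has_weak_deriv_prim)
  show "p \<in> L1" by (rule continuous_L1[OF assms(1)])
  show "f \<in> L1" using DERIV_continuous_on[OF assms(2)] by (rule continuous_L1)
  show "ae_eq f (\<lambda>x. f 0 + prim p x)" unfolding ae_eq_def
    by (rule AE_I2) (use prim_FTC_C1[OF assms] in simp)
qed

text \<open>To the left of the support nothing has been integrated yet; to the right the primitive
  is the whole integral, which is 0. So each continuous function of mean 0 supported inside the open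
  unit interval is the derivative of a test function.\<close>

lemma test_fun_prim:
  assumes \<rho>: "continuous_on UNIV \<rho>" "\<And>x. x \<notin> {s..t} \<Longrightarrow> \<rho> x = 0" and st: "0 < s" "t < 1"
    and z: "(LINT x|leb01. \<rho> x) = 0"
  shows "test_fun (prim \<rho>)" "deriv (prim \<rho>) x = \<rho> x"
proof -
  have L: "\<rho> \<in> L1" using \<rho>(1) by (auto intro: continuous_L1 continuous_on_subset)
  have lo: "prim \<rho> x = 0" if "x < s" for x
  proof -
    have "prim \<rho> x = (LINT t|leb01. 0)" unfolding prim_def
      by (rule Bochner_Integration.integral_cong) (use that \<rho>(2) in \<open>auto split: split_indicator\<close>)
    then show ?thesis by simp
  qed
  have hi: "prim \<rho> x = 0" if "t < x" for x
  proof -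
    have "prim \<rho> x = (LINT x|leb01. \<rho> x)" unfolding prim_def
      by (rule Bochner_Integration.integral_cong) (use that \<rho>(2) in \<open>auto split: split_indicator\<close>)
    then show ?thesis using z by simp
  qed
  have der: "(prim \<rho> has_real_derivative \<rho> x) (at x)" for x
  proof -
    consider "x \<in> {0<..<1}" | "x < s" | "t < x" using st by force
    then show ?thesis
    proof cases
      case 1
      then show ?thesis
        using prim_has_derivative[OF L continuous_on_subset[OF \<rho>(1)], of x]
          at_within_interior[of x "{0..1}"] by (simp add: interior_atLeastAtMost_real)
    next
      case 2
      have "((\<lambda>x. 0) has_real_derivative \<rho> x) (at x)" using \<rho>(2)[of x] 2 by simp
      then show ?thesis
        by (rule has_field_derivative_transform_within_open[of _ _ _ "{..<s}"]) (use 2 lo in auto)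
    next
      case 3
      have "((\<lambda>x. 0) has_real_derivative \<rho> x) (at x)" using \<rho>(2)[of x] 3 by simp
      then show ?thesis
        by (rule has_field_derivative_transform_within_open[of _ _ _ "{t<..}"]) (use 3 hi in auto)
    qed
  qed
  then show "deriv (prim \<rho>) x = \<rho> x" by (rule DERIV_imp_deriv)
  have "prim \<rho> C1_differentiable_on UNIV" unfolding C1_differentiable_on_def
    using der \<rho>(1) by (auto simp: has_real_derivative_iff_has_vector_derivative)
  then show "test_fun (prim \<rho>)" unfolding test_fun_def
    using st lo hi by (intro conjI exI[of _ "{s..t}"]) (auto simp: not_le)
qed

text \<open>Continuous functions supported in \<open>{s..t}\<close>, with flanks of slope
  \<open>n\<close>, that increase to the indicator of the open interval.\<close>

definition trapezoid :: "nat \<Rightarrow> real \<Rightarrow> real \<Rightarrow> real \<Rightarrow> real" where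
  "trapezoid n s t x = min 1 (real n * max 0 (min (x - s) (t - x)))"

lemma trapezoid_continuous: "continuous_on S (trapezoid n s t)"
  unfolding trapezoid_def by (intro continuous_intros)

lemma trapezoid_bounds: "\<bar>trapezoid n s t x\<bar> \<le> 1"
  unfolding trapezoid_def by (auto simp: min_def)

lemma trapezoid_zero: "x \<notin> {s..t} \<Longrightarrow> trapezoid n s t x = 0"
  unfolding trapezoid_def by auto

lemma trapezoid_tendsto: "(\<lambda>n. trapezoid n s t x) \<longlonglongrightarrow> indicator {s<..<t} x"
proof (cases "x \<in> {s<..<t}")
  case True
  define d where "d = min (x - s) (t - x)"
  have d: "d > 0" using True by (auto simp: d_def)
  obtain N where N: "real N * d > 1" using reals_Archimedean3[OF d] by blast
  have "eventually (\<lambda>n. trapezoid n s t x = 1) sequentially"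
  proof (rule eventually_sequentiallyI)
    fix n assume "N \<le> n"
    then have "real N * d \<le> real n * d" using d by simp
    then have "1 \<le> real n * d" using N by linarith
    then show "trapezoid n s t x = 1" using d unfolding trapezoid_def d_def[symmetric] by simp
  qed
  then show ?thesis using True by (auto intro: tendsto_eventually)
next
  case False
  then have "trapezoid n s t x = 0" for n unfolding trapezoid_def by auto
  then show ?thesis using False by simp
qed

lemma LINT_trapezoid_tendsto:
  assumes "v \<in> L1"
  shows "(\<lambda>n. LINT x|leb01. v x * trapezoid n s t x) \<longlonglongrightarrow> (LINT x|leb01. v x * indicator {s<..<t} x)"
proof (rule integral_dominated_convergence)
  show "integrable leb01 (\<lambda>x. \<bar>v x\<bar>)" using assms by (simp add: L1_def)
  have m: "v \<in> borel_measurable leb01" using assms by (simp add: L1_def)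
  have "indicator {s<..<t} \<in> borel_measurable leb01"
    by (intro measurable_restrict_space1 borel_measurable_indicator) auto
  then show "(\<lambda>x. v x * indicator {s<..<t} x) \<in> borel_measurable leb01" using m by (rule borel_measurable_times[rotated])
  show "(\<lambda>x. v x * trapezoid n s t x) \<in> borel_measurable leb01" for n
    using m continuous_borel_measurable01[OF trapezoid_continuous] by (rule borel_measurable_times)
  show "AE x in leb01. (\<lambda>n. v x * trapezoid n s t x) \<longlonglongrightarrow> v x * indicator {s<..<t} x"
    by (rule AE_I2) (intro tendsto_intros trapezoid_tendsto)
  show "AE x in leb01. norm (v x * trapezoid n s t x) \<le> \<bar>v x\<bar>" for n
    by (rule AE_I2) (use trapezoid_bounds in \<open>simp add: abs_mult mult_left_le\<close>)
qed

lemma prim_diff_Ioo: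
  assumes "v \<in> L1" "s \<le> t"
  shows "(LINT x|leb01. v x * indicator {s<..<t} x) = prim v t - prim v s"
proof -
  have "prim v t - prim v s = (LINT x|leb01. v x * indicator {..t} x - v x * indicator {..s} x)"
    unfolding prim_def using prim_integrable[OF assms(1)] by simp
  also have "\<dots> = (LINT x|leb01. v x * indicator {s<..<t} x)"
  proof (rule integral_ae_eq)
    show "(\<lambda>x. v x * indicator {..t} x - v x * indicator {..s} x) \<in> borel_measurable leb01"
      using prim_integrable[OF assms(1)] by (intro borel_measurable_diff) auto
    show "ae_eq (\<lambda>x. v x * indicator {..t} x - v x * indicator {..s} x) (\<lambda>x. v x * indicator {s<..<t} x)"
      unfolding ae_eq_def using null_point[of s] null_point[of t]
      by eventually_elim (use assms(2) in \<open>auto split: split_indicator\<close>)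
  qed
  finally show ?thesis by simp
qed

text \<open>Subtracting a multiple of a fixed bump \<open>\<rho>0\<close> gives any trapezoid mean 0
  and hence makes it the derivative of a test function. So \<open>v - k\<close> is orthogonal to all
  trapezoids inside the interval and, in the limit, to the indicators of intervals.\<close>

lemma du_Bois_Reymond:
  assumes v: "v \<in> L1" and z: "\<And>\<phi>. test_fun \<phi> \<Longrightarrow> (LINT x|leb01. v x * deriv \<phi> x) = 0"
  shows "\<exists>k. ae_eq v (\<lambda>x. k)"
proof -
  have int: "integrable leb01 (\<lambda>x. f x * trapezoid n s t x)" if "f \<in> L1" for f n s t
    by (rule integrable_mult_Linf[OF that continuous_Linf[OF trapezoid_continuous]])
  have int1: "integrable leb01 (trapezoid n s t)" for n s t
    using int[OF L1_const[of 1]] by simp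
  have "(\<lambda>n. LINT x|leb01. 1 * trapezoid n (1/4) (3/4) x) \<longlonglongrightarrow> (LINT x|leb01. 1 * indicator {1/4<..<3/4} x)"
    by (rule LINT_trapezoid_tendsto[OF L1_const])
  moreover have "(LINT x|leb01. 1 * indicator {1/4<..<3/4} x) = (1/2::real)"
    using prim_diff_Ioo[OF L1_const[of 1], of "1/4" "3/4"]
      prim_FTC_C1[of "\<lambda>_. 1" "\<lambda>x. x" "1/4"] prim_FTC_C1[of "\<lambda>_. 1" "\<lambda>x. x" "3/4"] by simp
  ultimately have "eventually (\<lambda>n. (LINT x|leb01. 1 * trapezoid n (1/4) (3/4) x) > 0) sequentially"
    by (intro order_tendstoD) auto
  then obtain n0 where n0: "(LINT x|leb01. trapezoid n0 (1/4) (3/4) x) > 0"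
    by (auto simp: eventually_sequentially)
  define \<rho>0 where "\<rho>0 = trapezoid n0 (1/4) (3/4)"
  define J where "J = (LINT x|leb01. \<rho>0 x)"
  have J: "J > 0" using n0 by (simp add: J_def \<rho>0_def)
  \<comment> \<open>The only possible constant: the mean of \<open>v\<close> weighted by the
    bump.\<close>
  define k where "k = (LINT x|leb01. v x * \<rho>0 x) / J"
  have orth: "(LINT x|leb01. (v x - k) * trapezoid n s t x) = 0" if st: "0 < s" "t < 1" for n s t
  proof -
    define I where "I = (LINT x|leb01. trapezoid n s t x)"
    define \<rho> where "\<rho> x = trapezoid n s t x - (I / J) * \<rho>0 x" for x
    have i0: "integrable leb01 \<rho>0" "integrable leb01 (\<lambda>x. v x * \<rho>0 x)"
      using int1 int[OF v] by (auto simp: \<rho>0_def)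
    have c: "continuous_on UNIV \<rho>" unfolding \<rho>_def \<rho>0_def
      by (intro continuous_intros trapezoid_continuous)
    have "(LINT x|leb01. \<rho> x) = I - (I / J) * J"
      unfolding \<rho>_def I_def J_def using int1 i0 by simp
    then have I0: "(LINT x|leb01. \<rho> x) = 0" using J by simp
    have zz: "\<rho> x = 0" if "x \<notin> {min s (1/4)..max t (3/4)}" for x
    proof -
      have "x \<notin> {s..t}" "x \<notin> {1/4..3/4}" using that by auto
      then show ?thesis unfolding \<rho>_def \<rho>0_def by (simp add: trapezoid_zero)
    qed
    have "(LINT x|leb01. v x * \<rho> x) = 0"
      using z[OF test_fun_prim(1)[OF c zz _ _ I0]] test_fun_prim(2)[OF c zz _ _ I0] st by simp
    moreover have "(LINT x|leb01. v x * \<rho> x) = (LINT x|leb01. v x * trapezoid n s t x - (I / J) * (v x * \<rho>0 x))"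
      unfolding \<rho>_def by (simp add: algebra_simps)
    moreover have "\<dots> = (LINT x|leb01. v x * trapezoid n s t x) - I * k"
      unfolding k_def using int[OF v] i0 by simp
    moreover have "(LINT x|leb01. (v x - k) * trapezoid n s t x) = (LINT x|leb01. v x * trapezoid n s t x - k * trapezoid n s t x)"
      by (simp add: algebra_simps)
    moreover have "\<dots> = (LINT x|leb01. v x * trapezoid n s t x) - k * I"
      unfolding I_def using int[OF v] int1 by simp
    ultimately show ?thesis by simp
  qed
  have vk: "(\<lambda>x. v x - k) \<in> L1" by (intro L1_diff v L1_const)
  define P where "P = prim (\<lambda>x. v x - k)"
  have Pc: "continuous_on S P" for S unfolding P_def by (rule continuous_on_prim[OF vk])
  have eq: "P t = P s" if "0 < s" "s \<le> t" "t < 1" for s t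
  proof -
    have "(\<lambda>n. LINT x|leb01. (v x - k) * trapezoid n s t x) \<longlonglongrightarrow> P t - P s"
      using LINT_trapezoid_tendsto[OF vk, of s t] prim_diff_Ioo[OF vk that(2)] by (simp add: P_def)
    then show ?thesis using orth[OF that(1,3)] LIMSEQ_unique[OF tendsto_const] by fastforce
  qed
  define m where "m = P (1/2)"
  have int: "P x = m" if "x \<in> {0<..<1}" for x
    using eq[of x "1/2"] eq[of "1/2" x] that unfolding m_def by (cases "x \<le> 1/2") auto
  have all: "P x = m" if "x \<in> {0..1}" for x
    by (rule continuous_constant_on_closure[of "{0<..<1}"]) (use Pc that int in auto)
  have "P 0 = 0" unfolding P_def by (rule prim_0[OF vk]) simp
  then have "P x = 0" if "x \<in> {0..1}" for x using that all[of 0] all[of x] by simp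
  then have "ae_eq (\<lambda>x. v x - k) (\<lambda>x. 0)" by (intro ae_zero_if_prim_zero[OF vk]) (simp add: P_def)
  then show ?thesis unfolding ae_eq_def by auto
qed

lemma has_weak_deriv_L1: "has_weak_deriv f u \<Longrightarrow> f \<in> L1" "has_weak_deriv f u \<Longrightarrow> u \<in> L1"
  by (auto simp: has_weak_deriv_def)

text \<open>The function \<open>f - prim u\<close> is orthogonal to all derivatives of test
  functions. Weak differentiability thereby becomes absolute continuity of a representative.\<close>

lemma has_weak_deriv_rep:
  assumes "has_weak_deriv f u" shows "\<exists>k. ae_eq f (\<lambda>x. k + prim u x)"
proof -
  note L = has_weak_deriv_L1[OF assms]
  have pL: "prim u \<in> L1" by (rule continuous_L1[OF continuous_on_prim[OF L(2)]])
  have w: "has_weak_deriv (prim u) u" by (rule has_weak_deriv_prim[of _ _ 0]) (use L pL in auto)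
  have "\<exists>k. ae_eq (\<lambda>x. f x - prim u x) (\<lambda>x. k)"
  proof (rule du_Bois_Reymond)
    show "(\<lambda>x. f x - prim u x) \<in> L1" by (rule L1_diff[OF L(1) pL])
    fix \<phi> assume t: "test_fun \<phi>"
    have "(LINT x|leb01. (f x - prim u x) * deriv \<phi> x)
        = (LINT x|leb01. f x * deriv \<phi> x) - (LINT x|leb01. prim u x * deriv \<phi> x)"
      using integrable_mult_Linf[OF L(1) test_fun_Linf(2)[OF t]] integrable_mult_Linf[OF pL test_fun_Linf(2)[OF t]]
      by (simp add: left_diff_distrib)
    then show "(LINT x|leb01. (f x - prim u x) * deriv \<phi> x) = 0"
      using assms w t by (simp add: has_weak_deriv_def)
  qed
  then obtain k where "ae_eq (\<lambda>x. f x - prim u x) (\<lambda>x. k)" by blast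
  then show ?thesis by (intro exI[of _ k]) (auto simp: ae_eq_def algebra_simps elim: eventually_mono)
qed

lemma has_weak_deriv_ae_unique:
  assumes "has_weak_deriv f u" "has_weak_deriv f v" shows "ae_eq u v"
proof -
  note u = has_weak_deriv_L1(2)[OF assms(1)] and v = has_weak_deriv_L1(2)[OF assms(2)]
  obtain k l where kl: "ae_eq f (\<lambda>x. k + prim u x)" "ae_eq f (\<lambda>x. l + prim v x)"
    using has_weak_deriv_rep assms by blast
  have eq: "k + prim u x = l + prim v x" if "x \<in> {0..1}" for x
    by (rule continuous_ae_eq[OF _ _ ae_eq_trans[OF ae_eq_sym[OF kl(1)] kl(2)] that])
      (intro continuous_intros continuous_on_prim u v)+
  have "k = l" using eq[of 0] prim_0[OF u, of 0] prim_0[OF v, of 0] by simp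
  then have "ae_eq (\<lambda>x. u x - v x) (\<lambda>x. 0)"
    using eq prim_diff[OF u v] by (intro ae_zero_if_prim_zero L1_diff u v) simp
  then show ?thesis by (simp add: ae_eq_def)
qed

lemma has_weak_deriv_cong:
  assumes "has_weak_deriv f u" "ae_eq f g" "ae_eq u v" shows "has_weak_deriv g v"
proof -
  obtain k where k: "ae_eq f (\<lambda>x. k + prim u x)" using has_weak_deriv_rep[OF assms(1)] by blast
  note L = has_weak_deriv_L1[OF assms(1)]
  show ?thesis
    by (rule has_weak_deriv_prim[of _ _ k])
      (use L1_cong[OF L(2) assms(3)] L1_cong[OF L(1) assms(2)] prim_cong[OF L(2) assms(3)]
        ae_eq_trans[OF ae_eq_sym[OF assms(2)] k] in auto)
qed

lemma has_weak_deriv_lin: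
  assumes "has_weak_deriv f u" "has_weak_deriv g v"
  shows "has_weak_deriv (\<lambda>x. p * f x + q * g x) (\<lambda>x. p * u x + q * v x)"
proof -
  note u = has_weak_deriv_L1[OF assms(1)] and v = has_weak_deriv_L1[OF assms(2)]
  obtain k l where kl: "ae_eq f (\<lambda>x. k + prim u x)" "ae_eq g (\<lambda>x. l + prim v x)"
    using has_weak_deriv_rep assms by blast
  show ?thesis
  proof (rule has_weak_deriv_prim)
    show "(\<lambda>x. p * u x + q * v x) \<in> L1" "(\<lambda>x. p * f x + q * g x) \<in> L1"
      by (intro L1_add L1_cmult u v)+
    have e: "prim (\<lambda>x. p * u x + q * v x) x = p * prim u x + q * prim v x" for x
      by (subst prim_add) (auto intro: L1_cmult u v simp: prim_cmult)
    show "ae_eq (\<lambda>x. p * f x + q * g x) (\<lambda>x. (p * k + q * l) + prim (\<lambda>x. p * u x + q * v x) x)"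
      unfolding ae_eq_def e using kl[unfolded ae_eq_def] by eventually_elim (simp add: algebra_simps)
  qed
qed

lemma has_weak_deriv_add: "has_weak_deriv f u \<Longrightarrow> has_weak_deriv g v \<Longrightarrow>
    has_weak_deriv (\<lambda>x. f x + g x) (\<lambda>x. u x + v x)"
  using has_weak_deriv_lin[of f u g v 1 1] by simp

lemma has_weak_deriv_diff: "has_weak_deriv f u \<Longrightarrow> has_weak_deriv g v \<Longrightarrow>
    has_weak_deriv (\<lambda>x. f x - g x) (\<lambda>x. u x - v x)"
  using has_weak_deriv_lin[of f u g v 1 "-1"] by simp

lemma has_weak_deriv_cmult: "has_weak_deriv f u \<Longrightarrow> has_weak_deriv (\<lambda>x. k * f x) (\<lambda>x. k * u x)"
  using has_weak_deriv_lin[of f u f u k 0] by simp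

lemma has_weak_deriv_const: "has_weak_deriv (\<lambda>x. k) (\<lambda>x. 0)"
  by (rule has_weak_deriv_C1) auto

lemma has_weak_deriv_limit:
  assumes w: "\<And>n. has_weak_deriv (f n) (u n)" and F: "F \<in> L1" and U: "U \<in> L1"
    and fF: "(\<lambda>n. L1_norm (\<lambda>x. f n x - F x)) \<longlonglongrightarrow> 0" and uU: "(\<lambda>n. L1_norm (\<lambda>x. u n x - U x)) \<longlonglongrightarrow> 0"
  shows "has_weak_deriv F U"
  unfolding has_weak_deriv_def
proof (intro conjI allI impI F U)
  fix \<phi> assume t: "test_fun \<phi>"
  note L = has_weak_deriv_L1[OF w]
  have 1: "(\<lambda>n. LINT x|leb01. f n x * deriv \<phi> x) \<longlonglongrightarrow> (LINT x|leb01. F x * deriv \<phi> x)"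
    by (rule LINT_tendsto[OF L(1) F test_fun_Linf(2)[OF t] fF])
  have "(\<lambda>n. LINT x|leb01. u n x * \<phi> x) \<longlonglongrightarrow> (LINT x|leb01. U x * \<phi> x)"
    by (rule LINT_tendsto[OF L(2) U test_fun_Linf(1)[OF t] uU])
  then have "(\<lambda>n. LINT x|leb01. f n x * deriv \<phi> x) \<longlonglongrightarrow> - (LINT x|leb01. U x * \<phi> x)"
    using w t by (auto simp: has_weak_deriv_def intro: tendsto_minus)
  with 1 show "(LINT x|leb01. F x * deriv \<phi> x) = - (LINT x|leb01. U x * \<phi> x)" by (rule LIMSEQ_unique)
qed

text \<open>The one-dimensional Sobolev embedding: values at two points differ by at most
  \<open>L1_norm u\<close>, and averaging over one of the points produces
  \<open>L1_norm f\<close>.\<close>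

lemma sup_bound:
  assumes u: "u \<in> L1" and f: "f \<in> L1" "ae_eq f (\<lambda>x. k + prim u x)"
  shows "\<bar>k + prim u x\<bar> \<le> L1_norm f + L1_norm u"
proof -
  have P: "(\<lambda>x. k + prim u x) \<in> L1"
    by (intro continuous_L1 continuous_intros continuous_on_prim u)
  have "\<bar>k + prim u x\<bar> = (LINT y|leb01. \<bar>k + prim u x\<bar>)" by (simp only: LINT_const01)
  also have "\<dots> \<le> (LINT y|leb01. \<bar>k + prim u y\<bar> + L1_norm u)"
  proof (rule integral_mono)
    show "integrable leb01 (\<lambda>y. \<bar>k + prim u x\<bar>)" using L1_const by (simp add: L1_def)
    show "integrable leb01 (\<lambda>y. \<bar>k + prim u y\<bar> + L1_norm u)"
      using L1_add[OF L1_abs[OF P] L1_const] by (simp add: L1_def)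
    show "\<bar>k + prim u x\<bar> \<le> \<bar>k + prim u y\<bar> + L1_norm u" for y
      using prim_diff_le[OF u, of x y] by linarith
  qed
  also have "\<dots> = L1_norm (\<lambda>x. k + prim u x) + L1_norm u"
    using L1_abs[OF P] L1_const[of "L1_norm u"] LINT_const01[of "L1_norm u"]
    unfolding L1_def L1_norm_def by simp
  finally show ?thesis using L1_norm_ae_eq[OF f] by simp
qed

lemma has_weak_deriv_bound:
  assumes "has_weak_deriv f u" shows "AE x in leb01. \<bar>f x\<bar> \<le> L1_norm f + L1_norm u"
proof -
  obtain k where k: "ae_eq f (\<lambda>x. k + prim u x)" using has_weak_deriv_rep[OF assms] by blast
  from k show ?thesis unfolding ae_eq_def
    by eventually_elim (use sup_bound[OF has_weak_deriv_L1(2)[OF assms] has_weak_deriv_L1(1)[OF assms] k] in simp)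
qed

lemma has_weak_deriv_Linf: "has_weak_deriv f u \<Longrightarrow> f \<in> Linf"
  using has_weak_deriv_bound has_weak_deriv_L1 by (auto simp: Linf_def L1_def)

lemma W11I: "has_weak_deriv f u \<Longrightarrow> f \<in> W11" by (auto simp: W11_def)

lemma wderiv: "f \<in> W11 \<Longrightarrow> has_weak_deriv f (wderiv f)"
  unfolding wderiv_def W11_def using someI_ex[of "has_weak_deriv f"] by blast

lemma wderiv_eq: "has_weak_deriv f u \<Longrightarrow> ae_eq (wderiv f) u"
  using has_weak_deriv_ae_unique wderiv W11I by blast

lemma W11_norm_eq: "has_weak_deriv f u \<Longrightarrow> W11_norm f = L1_norm f + L1_norm u"
  unfolding W11_norm_def
  using L1_norm_ae_eq[OF has_weak_deriv_L1(2)[OF wderiv[OF W11I]] wderiv_eq] by simp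

lemma W11_cong: "f \<in> W11 \<Longrightarrow> ae_eq f g \<Longrightarrow> g \<in> W11"
  using has_weak_deriv_cong[OF wderiv _ ae_eq_refl] W11I by blast

lemma W11_L1: "f \<in> W11 \<Longrightarrow> f \<in> L1"
  by (auto simp: W11_def has_weak_deriv_def)

lemma W21I: "has_weak_deriv f u \<Longrightarrow> has_weak_deriv u v \<Longrightarrow> f \<in> W21"
  unfolding W21_def using W11I W11_cong[OF _ ae_eq_sym[OF wderiv_eq]] by blast

section \<open>Compactness and density\<close>

lemma countable_null: "countable S \<Longrightarrow> AE x in leb01. x \<notin> (S::real set)"
proof -
  assume "countable S"
  then have "S \<in> null_sets lebesgue" using countable_imp_null_set_lborel null_sets_completionI by blast
  then have "AE x in lebesgue. x \<notin> S" by (rule AE_I') auto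
  then show ?thesis by (auto simp: AE_restrict_space_iff)
qed

lemma borel_measurable_leb01:
  assumes "f \<in> borel_measurable borel" shows "f \<in> borel_measurable leb01"
  using assms by (intro measurable_restrict_space1 measurable_completion) simp

text \<open>Splitting \<open>u\<close> into positive and negative parts writes each representative
  as a difference of bounded monotone functions. Helly's theorem is applied to the two parts in
  turn, and each monotone limit is discontinuous only on a countable set.\<close>

lemma rellich:
  assumes w: "\<And>n. has_weak_deriv (f n) (u n)" and b: "\<And>n. L1_norm (f n) \<le> C" "\<And>n. L1_norm (u n) \<le> C"
  shows "\<exists>s F. strict_mono (s :: nat \<Rightarrow> nat) \<and> F \<in> borel_measurable leb01 \<and>
    (AE x in leb01. (\<lambda>n. f (s n) x) \<longlonglongrightarrow> F x)"
proof -
  note L = has_weak_deriv_L1[OF w]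
  have "\<exists>k. ae_eq (f n) (\<lambda>x. k + prim (u n) x)" for n by (rule has_weak_deriv_rep[OF w])
  then obtain k where k: "\<And>n. ae_eq (f n) (\<lambda>x. k n + prim (u n) x)" by metis
  define P where "P n = prim (\<lambda>x. max 0 (u n x))" for n
  define N where "N n = prim (\<lambda>x. max 0 (- u n x))" for n
  have pL: "(\<lambda>x. max 0 (u n x)) \<in> L1" and nL: "(\<lambda>x. max 0 (- u n x)) \<in> L1" for n
    using L(2)[of n] by (auto simp: L1_def)
  have "prim (u n) x = P n x - N n x" for n x
    unfolding P_def N_def prim_diff[OF pL nL, symmetric] by (rule arg_cong[where f="\<lambda>f. prim f x"]) (auto simp: max_def)
  note PN = this
  have kb: "\<bar>k n\<bar> \<le> 2 * C" for n
    using sup_bound[OF L(2) L(1) k, of n 0] prim_0[OF L(2), of 0 n] b[of n] by simp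
  have Pb: "\<bar>P n x\<bar> \<le> C" for n x
    using prim_le[OF pL, of n x] b(2)[of n] L1_norm_mono[OF L(2) pL, of n n] unfolding P_def by (auto simp: max_def)
  have Nb: "\<bar>N n x\<bar> \<le> C" for n x
    using prim_le[OF nL, of n x] b(2)[of n] L1_norm_mono[OF L(2) nL, of n n] unfolding N_def by (auto simp: max_def)
  \<comment> \<open>The constant \<open>k n\<close> is absorbed in the increasing part, so its
    convergence needs no extraction of its own.\<close>
  define Q where "Q n x = k n + P n x" for n x
  have "\<exists>s. strict_mono (s::nat \<Rightarrow> nat) \<and> (\<exists>F. (\<forall>x. continuous (at_right x) F) \<and> mono F \<and> (\<forall>x. \<bar>F x\<bar> \<le> 3 * C) \<and>
    (\<forall>x. continuous (at x) F \<longrightarrow> (\<lambda>n. Q (s n) x) \<longlonglongrightarrow> F x))"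
  proof (rule Helly_selection)
    show "continuous (at_right x) (Q n)" for n x
      unfolding Q_def P_def
      by (rule continuous_at_imp_continuous_at_within, intro continuous_add continuous_const isCont_prim pL)
    show "mono (Q n)" for n
      using prim_mono[OF pL, of n] unfolding Q_def P_def by (auto simp: mono_def)
    show "\<bar>Q n x\<bar> \<le> 3 * C" for n x using kb[of n] Pb[of n x] unfolding Q_def by linarith
  qed
  then obtain s F where s: "strict_mono (s::nat\<Rightarrow>nat)" and F: "mono F"
      "\<And>x. isCont F x \<Longrightarrow> (\<lambda>n. Q (s n) x) \<longlonglongrightarrow> F x" by blast
  have "\<exists>r. strict_mono (r::nat \<Rightarrow> nat) \<and> (\<exists>F. (\<forall>x. continuous (at_right x) F) \<and> mono F \<and> (\<forall>x. \<bar>F x\<bar> \<le> C) \<and>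
    (\<forall>x. continuous (at x) F \<longrightarrow> (\<lambda>n. N (s (r n)) x) \<longlonglongrightarrow> F x))"
  proof (rule Helly_selection)
    show "continuous (at_right x) (N (s n))" for n x
      unfolding N_def by (rule continuous_at_imp_continuous_at_within[OF isCont_prim[OF nL]])
    show "mono (N (s n))" for n using prim_mono[OF nL] unfolding N_def by simp
    show "\<bar>N (s n) x\<bar> \<le> C" for n x by (rule Nb)
  qed
  then obtain r G where r: "strict_mono (r::nat\<Rightarrow>nat)" and G: "mono G"
      "\<And>x. isCont G x \<Longrightarrow> (\<lambda>n. N (s (r n)) x) \<longlonglongrightarrow> G x" by blast
  have ae: "AE x in leb01. \<forall>n. f n x = k n + prim (u n) x"
    using k by (simp add: ae_eq_def AE_all_countable)
  have "AE x in leb01. (\<lambda>n. f (s (r n)) x) \<longlonglongrightarrow> F x - G x"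
    using ae countable_null[OF mono_ctble_discont[OF F(1)]] countable_null[OF mono_ctble_discont[OF G(1)]]
  proof eventually_elim
    case (elim x)
    have "(\<lambda>n. Q (s (r n)) x) \<longlonglongrightarrow> F x"
      using LIMSEQ_subseq_LIMSEQ[OF F(2) r, of x] elim(2) by (simp add: comp_def)
    then have "(\<lambda>n. Q (s (r n)) x - N (s (r n)) x) \<longlonglongrightarrow> F x - G x"
      using G(2)[of x] elim(3) by (intro tendsto_diff) auto
    moreover have "f (s (r n)) x = Q (s (r n)) x - N (s (r n)) x" for n
      using spec[OF elim(1), of "s (r n)"] PN[of "s (r n)" x] unfolding Q_def by linarith
    ultimately show ?case by simp
  qed
  moreover have "(\<lambda>x. F x - G x) \<in> borel_measurable leb01"
    using borel_measurable_mono[OF F(1)] borel_measurable_mono[OF G(1)]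
    by (intro borel_measurable_leb01 borel_measurable_diff)
  moreover have "strict_mono (\<lambda>n. s (r n))" using s r by (simp add: strict_mono_def)
  ultimately show ?thesis by (intro exI[of _ "\<lambda>n. s (r n)"] exI[of _ "\<lambda>x. F x - G x"]) auto
qed

lemma real_polynomial_has_weak_deriv:
  assumes "real_polynomial_function g" shows "\<exists>p. has_weak_deriv g p"
proof -
  obtain p where p: "real_polynomial_function p" "\<And>x. (g has_real_derivative p x) (at x)"
    using has_real_derivative_polynomial_function[OF assms] by blast
  have "continuous_on {0..1} p"
    using p(1) continuous_on_polymonial_function[of p] real_polynomial_function_eq by blast
  then show ?thesis using has_weak_deriv_C1[of p g] p(2) by (auto intro: has_field_derivative_at_within)
qed

lemma L1_dense_Linf:
  assumes "f \<in> L1" "e > 0"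
  shows "\<exists>g M. g \<in> L1 \<and> (\<forall>x. \<bar>g x\<bar> \<le> M) \<and> L1_norm (\<lambda>x. f x - g x) < e"
proof -
  define g where "g n x = max (- real n) (min (real n) (f x))" for n x
  have f: "f \<in> borel_measurable leb01" using assms(1) by (rule L1_measurable)
  have conv: "(\<lambda>n. g n x) \<longlonglongrightarrow> f x" for x
  proof -
    obtain N where N: "\<bar>f x\<bar> \<le> real N" using real_arch_simple by blast
    have "eventually (\<lambda>n. g n x = f x) sequentially"
      by (rule eventually_sequentiallyI[of N]) (use N in \<open>auto simp: g_def\<close>)
    then show ?thesis by (rule tendsto_eventually)
  qed
  have m: "g n \<in> borel_measurable leb01" for n unfolding g_def using f by measurable
  have "(\<lambda>n. L1_norm (\<lambda>x. g n x - f x)) \<longlonglongrightarrow> 0"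
    by (rule L1_dct(2)[OF L1_abs[OF assms(1)] m _ _ f]) (use conv in \<open>auto simp: g_def\<close>)
  then have "eventually (\<lambda>n. L1_norm (\<lambda>x. g n x - f x) < e) sequentially"
    using assms(2) by (auto dest: order_tendstoD(2))
  then obtain n where n: "L1_norm (\<lambda>x. g n x - f x) < e" by (auto simp: eventually_sequentially)
  have "g n \<in> L1" by (rule L1_dominated'[OF L1_const[of "real n"] m]) (auto simp: g_def)
  then show ?thesis using n L1_norm_minus_commute[of f "g n"]
    by (intro exI[of _ "g n"] exI[of _ "real n"]) (auto simp: g_def)
qed

text \<open>Measurability supplies continuous functions that converge almost everywhere; clamping
  them at the bound \<open>M\<close> makes a constant dominate the sequence.\<close>

lemma L1_dense_continuous:
  assumes "f \<in> L1" "e > 0" "\<And>x. \<bar>f x\<bar> \<le> M"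
  shows "\<exists>g. continuous_on UNIV g \<and> L1_norm (\<lambda>x. f x - g x) < e"
proof -
  have f: "f \<in> borel_measurable leb01" using assms(1) by (rule L1_measurable)
  then have "f measurable_on {0..1}" by (subst measurable_on_iff_borel_measurable) auto
  then obtain N h where N: "negligible N" and h: "\<And>n. continuous_on UNIV (h n)"
      "\<And>x. x \<notin> N \<Longrightarrow> (\<lambda>n. h n x) \<longlonglongrightarrow> (if x \<in> {0..1} then f x else 0)"
    by (auto simp: measurable_on_def)
  define g where "g n x = max (- M) (min M (h n x))" for n :: nat and x
  have gc: "continuous_on S (g n)" for n S
    unfolding g_def by (intro continuous_intros continuous_on_subset[OF h(1)]) auto
  have m: "g n \<in> borel_measurable leb01" for n by (rule continuous_borel_measurable01[OF gc])
  have "AE x in lebesgue. x \<notin> N" by (rule AE_I'[of N]) (use N in \<open>auto simp: negligible_iff_null_sets\<close>)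
  then have "AE x in leb01. x \<notin> N" by (auto simp: AE_restrict_space_iff)
  then have conv: "AE x in leb01. (\<lambda>n. g n x) \<longlonglongrightarrow> f x" using AE_space
  proof eventually_elim
    case (elim x)
    have "(\<lambda>n. g n x) \<longlonglongrightarrow> max (- M) (min M (if x \<in> {0..1} then f x else 0))"
      unfolding g_def by (intro tendsto_intros h(2) elim)
    then show ?case using elim assms(3)[of x] by (simp add: abs_le_iff)
  qed
  have M: "0 \<le> M" using assms(3)[of 0] by linarith
  have "(\<lambda>n. L1_norm (\<lambda>x. g n x - f x)) \<longlonglongrightarrow> 0"
    by (rule L1_dct(2)[OF L1_const[of M] m conv _ f]) (use M in \<open>auto simp: g_def\<close>)
  then have "eventually (\<lambda>n. L1_norm (\<lambda>x. g n x - f x) < e) sequentially"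
    using assms(2) by (auto dest: order_tendstoD(2))
  then obtain n where n: "L1_norm (\<lambda>x. g n x - f x) < e" by (auto simp: eventually_sequentially)
  then show ?thesis using gc L1_norm_minus_commute[of f "g n"] by (intro exI[of _ "g n"]) auto
qed

text \<open>Truncation, continuous approximation and polynomial approximation cost
  \<open>e / 3\<close> each, and polynomials have weak derivatives.\<close>

lemma L1_dense_W11:
  assumes "f \<in> L1" "e > 0"
  shows "\<exists>g p. has_weak_deriv g p \<and> L1_norm (\<lambda>x. f x - g x) < e"
proof -
  obtain g M where g: "g \<in> L1" "\<And>x. \<bar>g x\<bar> \<le> M" "L1_norm (\<lambda>x. f x - g x) < e / 3"
    using L1_dense_Linf[OF assms(1), of "e/3"] assms(2) by auto
  obtain h where h: "continuous_on UNIV h" "L1_norm (\<lambda>x. g x - h x) < e / 3"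
    using L1_dense_continuous[OF g(1) _ g(2), of "e/3"] assms(2) by auto
  have hc: "continuous_on {0..1} h" using h(1) continuous_on_subset by blast
  obtain q where q: "real_polynomial_function q" "\<And>x. x \<in> {0..1} \<Longrightarrow> \<bar>h x - q x\<bar> < e / 3"
    using Stone_Weierstrass_real_polynomial_function[OF _ hc, of "e/3"] assms(2) by auto
  obtain p where p: "has_weak_deriv q p" using real_polynomial_has_weak_deriv[OF q(1)] by blast
  have hL: "h \<in> L1" by (rule continuous_L1[OF hc])
  note qL = has_weak_deriv_L1(1)[OF p]
  have "L1_norm (\<lambda>x. h x - q x) \<le> L1_norm (\<lambda>x. e / 3)"
    by (rule L1_norm_mono[OF L1_const L1_diff[OF hL qL]]) (use q(2) assms(2) in \<open>auto intro!: AE_I2 less_imp_le\<close>)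
  then have "L1_norm (\<lambda>x. h x - q x) \<le> e / 3" using assms(2) by (simp add: L1_norm_const)
  moreover have "L1_norm (\<lambda>x. f x - q x) \<le> L1_norm (\<lambda>x. f x - g x) + L1_norm (\<lambda>x. g x - q x)"
    by (rule L1_norm_triangle[OF assms(1) g(1) qL])
  moreover have "L1_norm (\<lambda>x. g x - q x) \<le> L1_norm (\<lambda>x. g x - h x) + L1_norm (\<lambda>x. h x - q x)"
    by (rule L1_norm_triangle[OF g(1) hL qL])
  ultimately have "L1_norm (\<lambda>x. f x - q x) < e" using g(3) h(2) by linarith
  then show ?thesis using p by blast
qed

section \<open>Absolutely convergent series\<close>

text \<open>The sum of the absolute values has a finite integral. It is therefore finite almost
  everywhere, and it dominates all partial sums.\<close>

lemma L1_series:
  assumes f: "\<And>n. f n \<in> L1" and s: "summable (\<lambda>n. L1_norm (f n))"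
  shows "\<exists>F\<in>L1. (\<lambda>N. L1_norm (\<lambda>x. (\<Sum>n<N. f n x) - F x)) \<longlonglongrightarrow> 0"
proof -
  have i: "integrable leb01 (f n)" for n using f by (simp add: L1_def)
  have nn: "(\<integral>\<^sup>+x. (\<Sum>n. ennreal \<bar>f n x\<bar>) \<partial>leb01) < \<infinity>"
  proof -
    have "(\<integral>\<^sup>+x. (\<Sum>n. ennreal \<bar>f n x\<bar>) \<partial>leb01) = (\<Sum>n. \<integral>\<^sup>+x. ennreal \<bar>f n x\<bar> \<partial>leb01)"
      by (rule nn_integral_suminf) (use i in measurable)
    also have "\<dots> = (\<Sum>n. ennreal (L1_norm (f n)))"
      unfolding L1_norm_def using i by (subst nn_integral_eq_integral) auto
    also have "\<dots> = ennreal (\<Sum>n. L1_norm (f n))"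
      by (rule suminf_ennreal2) (use s L1_norm_nonneg in auto)
    finally show ?thesis by simp
  qed
  have "AE x in leb01. (\<Sum>n. ennreal \<bar>f n x\<bar>) \<noteq> \<infinity>"
    by (rule nn_integral_PInf_AE) (use nn i in \<open>auto simp: less_top intro!: borel_measurable_suminf_order\<close>)
  then have sx: "AE x in leb01. summable (\<lambda>n. norm (f n x))"
    by eventually_elim (auto intro: summable_suminf_not_top)
  have sn: "summable (\<lambda>n. LINT x|leb01. norm (f n x))" using s by (simp add: L1_norm_def)
  define F where "F x = (\<Sum>n. f n x)" for x
  define G where "G x = (\<Sum>n. norm (f n x))" for x
  have "integrable leb01 F" unfolding F_def by (rule integrable_suminf[OF i sx sn])
  then have F: "F \<in> L1" by (simp add: L1_def)
  have "integrable leb01 G" unfolding G_def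
    by (rule integrable_suminf) (use i sx sn in auto)
  then have G: "G \<in> L1" by (simp add: L1_def)
  have "(\<lambda>N. L1_norm (\<lambda>x. (\<Sum>n<N. f n x) - F x)) \<longlonglongrightarrow> 0"
  proof (rule L1_dct(2)[OF G])
    show "(\<lambda>x. \<Sum>n<N. f n x) \<in> borel_measurable leb01" for N using i by auto
    show "AE x in leb01. (\<lambda>N. \<Sum>n<N. f n x) \<longlonglongrightarrow> F x"
      using sx by eventually_elim (simp add: F_def summable_LIMSEQ summable_norm_cancel)
    show "AE x in leb01. \<bar>\<Sum>n<N. f n x\<bar> \<le> G x" for N
      using sx
    proof eventually_elim
      case (elim x)
      have "\<bar>\<Sum>n<N. f n x\<bar> \<le> (\<Sum>n<N. norm (f n x))" using sum_abs by simp
      also have "\<dots> \<le> G x" unfolding G_def by (rule sum_le_suminf[OF elim]) auto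
      finally show ?case .
    qed
    show "F \<in> borel_measurable leb01" using F by (rule L1_measurable)
  qed
  then show ?thesis using F by blast
qed

lemma has_weak_deriv_series:
  assumes f: "\<And>n. has_weak_deriv (f n) (u n)"
    and s: "summable (\<lambda>n. L1_norm (f n))" "summable (\<lambda>n. L1_norm (u n))"
  shows "\<exists>F U. has_weak_deriv F U \<and> (\<lambda>N. L1_norm (\<lambda>x. (\<Sum>n<N. f n x) - F x)) \<longlonglongrightarrow> 0"
proof -
  obtain F where F: "F \<in> L1" "(\<lambda>N. L1_norm (\<lambda>x. (\<Sum>n<N. f n x) - F x)) \<longlonglongrightarrow> 0"
    using L1_series[OF has_weak_deriv_L1(1)[OF f] s(1)] by blast
  obtain U where U: "U \<in> L1" "(\<lambda>N. L1_norm (\<lambda>x. (\<Sum>n<N. u n x) - U x)) \<longlonglongrightarrow> 0"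
    using L1_series[OF has_weak_deriv_L1(2)[OF f] s(2)] by blast
  have "has_weak_deriv (\<lambda>x. \<Sum>n<N. f n x) (\<lambda>x. \<Sum>n<N. u n x)" for N
    by (induction N) (auto intro: has_weak_deriv_const has_weak_deriv_add[OF _ f])
  from has_weak_deriv_limit[OF this F(1) U(1) F(2) U(2)] show ?thesis using F(2) by blast
qed

text \<open>A subsequence whose steps decrease geometrically telescopes into an absolutely
  convergent series; the Cauchy property carries its limit over to the full sequence.\<close>

lemma L1_Cauchy:
  assumes f: "\<And>n. f n \<in> L1"
    and C: "\<And>e. e > 0 \<Longrightarrow> \<exists>N. \<forall>m\<ge>N. \<forall>n\<ge>N. L1_norm (\<lambda>x. f m x - f n x) < e"
  shows "\<exists>F\<in>L1. (\<lambda>n. L1_norm (\<lambda>x. f n x - F x)) \<longlonglongrightarrow> 0"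
proof -
  have "\<exists>N. \<forall>m\<ge>N. \<forall>n\<ge>N. L1_norm (\<lambda>x. f m x - f n x) < (1/2)^k" for k
    using C[of "(1/2)^k"] by simp
  then obtain N where N: "\<And>k m n. m \<ge> N k \<Longrightarrow> n \<ge> N k \<Longrightarrow> L1_norm (\<lambda>x. f m x - f n x) < (1/2)^k"
    by metis
  \<comment> \<open>The running maximum lies beyond \<open>N j\<close> for every
    \<open>j \<le> k\<close>, so consecutive indices are both admissible for the bound with exponent
    \<open>k\<close>.\<close>
  define M where "M k = Max (N ` {..k})" for k
  have M: "N j \<le> M k" if "j \<le> k" for j k unfolding M_def using that by (intro Max_ge) auto
  define d where "d k x = f (M (Suc k)) x - f (M k) x" for k x
  have dL: "d k \<in> L1" for k unfolding d_def by (intro L1_diff f)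
  have sd: "summable (\<lambda>k. L1_norm (d k))"
  proof (rule summable_comparison_test'[of "\<lambda>k. (1/2::real)^k" 0])
    show "summable (\<lambda>k. (1/2::real)^k)" by (rule summable_geometric) simp
    show "norm (L1_norm (d k)) \<le> (1/2)^k" for k
    proof -
      have eq: "d k = (\<lambda>x. f (M (Suc k)) x - f (M k) x)" by (rule ext) (rule d_def)
      have "L1_norm (d k) < (1/2)^k" unfolding eq
        by (rule N) (rule M, simp)+
      then show ?thesis by (subst real_norm_def, subst abs_of_nonneg[OF L1_norm_nonneg]) (rule less_imp_le)
    qed
  qed
  obtain D where D: "D \<in> L1" "(\<lambda>n. L1_norm (\<lambda>x. (\<Sum>k<n. d k x) - D x)) \<longlonglongrightarrow> 0"
    using L1_series[OF dL sd] by (elim bexE)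
  define F where "F x = f (M 0) x + D x" for x
  have tel: "(\<Sum>k<n. d k x) = f (M n) x - f (M 0) x" for n x
    unfolding d_def by (induction n) auto
  have FL: "F \<in> L1" unfolding F_def by (intro L1_add f D)
  have sub: "(\<lambda>n. L1_norm (\<lambda>x. f (M n) x - F x)) \<longlonglongrightarrow> 0"
    using D(2) by (simp add: tel F_def algebra_simps)
  have "(\<lambda>n. L1_norm (\<lambda>x. f n x - F x)) \<longlonglongrightarrow> 0"
  proof (rule LIMSEQ_I)
    fix e :: real assume e: "e > 0"
    obtain j where j: "(1/2::real)^j < e/2" using real_arch_pow_inv[of "e/2" "1/2"] e by auto
    have "eventually (\<lambda>n. L1_norm (\<lambda>x. f (M n) x - F x) < e/2) sequentially"
      using e by (intro order_tendstoD(2)[OF sub]) simp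
    then obtain k where k: "\<And>n. n \<ge> k \<Longrightarrow> L1_norm (\<lambda>x. f (M n) x - F x) < e/2"
      unfolding eventually_sequentially by (elim exE) blast
    define i where "i = max j k"
    have "L1_norm (\<lambda>x. f n x - F x) < e" if n: "n \<ge> N j" for n
    proof -
      have "L1_norm (\<lambda>x. f n x - f (M i) x) < (1/2)^j" by (rule N) (use n M[of j i] in \<open>auto simp: i_def\<close>)
      moreover have "L1_norm (\<lambda>x. f (M i) x - F x) < e/2" by (rule k) (simp add: i_def)
      ultimately show ?thesis using L1_norm_triangle[OF f[of n] f[of "M i"] FL] j by linarith
    qed
    then show "\<exists>no. \<forall>n\<ge>no. norm (L1_norm (\<lambda>x. f n x - F x) - 0) < e"
      by (intro exI[of _ "N j"] allI impI) (simp only: diff_0_right real_norm_def abs_of_nonneg[OF L1_norm_nonneg])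
  qed
  then show ?thesis by (rule bexI[OF _ FL])
qed

section \<open>Cusp maps\<close>

text \<open>The explicit primitive \<open>F\<close> is continuous through \<open>c\<close> because
  \<open>s + 1 > 0\<close>. The fundamental theorem with exceptional point \<open>c\<close> then
  applies, and a nonnegative function with an integral is absolutely integrable.\<close>

lemma powr_abs_L1:
  assumes "s > -1" shows "(\<lambda>x. \<bar>x - c\<bar> powr s) \<in> L1"
proof -
  define F where "F x = (x - c) * \<bar>x - c\<bar> powr s / (s + 1)" for x
  have Feq: "F x = sgn (x - c) * \<bar>x - c\<bar> powr (s + 1) / (s + 1)" for x
  proof (cases "x = c")
    case False
    then have "\<bar>x - c\<bar> powr (s + 1) = \<bar>x - c\<bar> powr s * \<bar>x - c\<bar>" by (simp add: powr_add)
    then show ?thesis unfolding F_def by (simp add: sgn_if)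
  qed (simp add: F_def)
  have cont: "continuous_on {0..1} F"
  proof -
    have "isCont F x" for x
    proof (cases "x = c")
      case True
      have "((\<lambda>x. \<bar>x - c\<bar> powr (s + 1) / (s + 1)) \<longlongrightarrow> \<bar>c - c\<bar> powr (s + 1) / (s + 1)) (at c)"
        by (intro tendsto_intros tendsto_powr') (use assms in \<open>auto intro!: tendsto_eq_intros\<close>)
      then have "((\<lambda>x. \<bar>x - c\<bar> powr (s + 1) / (s + 1)) \<longlongrightarrow> 0) (at c)" by simp
      then have "(F \<longlongrightarrow> 0) (at c)"
        by (rule Lim_null_comparison[rotated]) (use assms in \<open>auto simp: Feq abs_mult sgn_if\<close>)
      then show ?thesis using True by (simp add: isCont_def F_def)
    next
      case False
      then show ?thesis unfolding F_def using assms by (intro continuous_intros) auto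
    qed
    then show ?thesis by (intro continuous_at_imp_continuous_on) auto
  qed
  have der: "(F has_vector_derivative \<bar>x - c\<bar> powr s) (at x)" if "x \<noteq> c" for x
  proof (cases "x > c")
    case True
    have "((\<lambda>x. (x - c) powr (s + 1) / (s + 1)) has_real_derivative (x - c) powr s) (at x)"
      using True assms by (auto intro!: derivative_eq_intros)
    then have "(F has_real_derivative (x - c) powr s) (at x)"
      by (rule has_field_derivative_transform_within_open[of _ _ _ "{c<..}"]) (use True in \<open>auto simp: Feq\<close>)
    then show ?thesis using True by (simp add: has_real_derivative_iff_has_vector_derivative)
  next
    case False
    then have x: "x < c" using that by simp
    have "((\<lambda>x. - ((c - x) powr (s + 1) / (s + 1))) has_real_derivative (c - x) powr s) (at x)"
      using x assms by (auto intro!: derivative_eq_intros)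
    then have "(F has_real_derivative (c - x) powr s) (at x)"
      by (rule has_field_derivative_transform_within_open[of _ _ _ "{..<c}"]) (use x in \<open>auto simp: Feq\<close>)
    then show ?thesis using x by (simp add: has_real_derivative_iff_has_vector_derivative)
  qed
  have "((\<lambda>x. \<bar>x - c\<bar> powr s) has_integral (F 1 - F 0)) {0..1}"
    by (rule fundamental_theorem_of_calculus_interior_strong[of "{c}"]) (use cont der in auto)
  then have "(\<lambda>x. \<bar>x - c\<bar> powr s) absolutely_integrable_on {0..1}"
    by (intro nonnegative_absolutely_integrable_1) auto
  then show ?thesis using integrable_restrict_space[of "{0..1}" lebesgue "\<lambda>x. \<bar>x - c\<bar> powr s"]
    by (simp add: L1_def set_integrable_def)
qed

lemma borel_measurable_off_point:
  assumes "continuous_on ({0..1} - {c}) (f::real\<Rightarrow>real)" shows "f \<in> borel_measurable leb01"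
proof -
  have S: "{0..1} - {c} \<in> sets lebesgue" by (intro sets.Diff) auto
  have "f \<in> borel_measurable (lebesgue_on ({0..1} - {c}))"
    by (rule continuous_imp_measurable_on_sets_lebesgue[OF assms S])
  then have "(\<lambda>x. if x \<in> {0..1} - {c} then f x else 0) \<in> borel_measurable lebesgue"
    using borel_measurable_if[OF S, of f] by blast
  then have "(\<lambda>x. if x \<in> {0..1} - {c} then f x else 0) \<in> borel_measurable leb01"
    by (rule measurable_restrict_space1)
  moreover have "ae_eq (\<lambda>x. if x \<in> {0..1} - {c} then f x else 0) f"
    unfolding ae_eq_def using null_point[of c] AE_space by eventually_elim auto
  ultimately show ?thesis by (rule borel_measurable_ae_eq)
qed

lemma L1_powr_bound:
  assumes "continuous_on ({0..1} - {c}) f" "s > -1" "\<And>x. x \<in> {0..1} - {c} \<Longrightarrow> \<bar>f x\<bar> \<le> C * \<bar>x - c\<bar> powr s"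
  shows "f \<in> L1"
proof (rule L1_dominated[OF L1_cmult[OF powr_abs_L1[OF assms(2)]]])
  show "f \<in> borel_measurable leb01" by (rule borel_measurable_off_point[OF assms(1)])
  show "AE x in leb01. \<bar>f x\<bar> \<le> \<bar>C * \<bar>x - c\<bar> powr s\<bar>"
    using null_point[of c] AE_space
  proof eventually_elim
    case (elim x)
    then have "\<bar>f x\<bar> \<le> C * \<bar>x - c\<bar> powr s" by (intro assms(3)) auto
    then show ?case by linarith
  qed
qed

text \<open>A single map with its derivatives as named functions. The constants are parameters, so
  bounds expressed through them are common to all maps that share them. Expansion carries its sign
  on each branch, which yields monotonicity.\<close>

locale cusp_map = nonsingular_map T for T +
  fixes c a \<beta> \<theta> \<kappa> K :: real and T1 T2 T3 :: "real \<Rightarrow> real"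
  assumes c_in: "0 < c" "c < 1"
    and beta: "- 1 < \<beta>" "\<beta> < - 3 / 4"
    and theta: "1 < \<theta>" and kappa: "0 < \<kappa>"
    and T_ends: "T 0 = 0" "T 1 = 0"
    and a_in: "a \<in> {0..1}"
    and T_lim: "(T \<longlongrightarrow> a) (at_left c)" "(T \<longlongrightarrow> a) (at_right c)"
    and d1: "\<And>x. x \<in> {0..1} - {c} \<Longrightarrow> (T has_real_derivative T1 x) (at x within {0..1})"
    and d2: "\<And>x. x \<in> {0..1} - {c} \<Longrightarrow> (T1 has_real_derivative T2 x) (at x within {0..1})"
    and d3: "\<And>x. x \<in> {0..1} - {c} \<Longrightarrow> (T2 has_real_derivative T3 x) (at x within {0..1})"
    and cont3: "continuous_on ({0..1} - {c}) T3"
    and exp_left: "\<And>x. x \<in> {0..<c} \<Longrightarrow> \<theta> \<le> T1 x"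
    and exp_right: "\<And>x. x \<in> {c<..1} \<Longrightarrow> T1 x \<le> - \<theta>"
    and b1_lower: "\<And>x. x \<in> {0..1} - {c} \<Longrightarrow> \<kappa> * \<bar>x - c\<bar> powr \<beta> \<le> \<bar>T1 x\<bar>"
    and b1_upper: "\<And>x. x \<in> {0..1} - {c} \<Longrightarrow> \<bar>T1 x\<bar> \<le> K * \<bar>x - c\<bar> powr \<beta>"
    and b2: "\<And>x. x \<in> {0..1} - {c} \<Longrightarrow> \<bar>T2 x\<bar> \<le> K * \<bar>x - c\<bar> powr (\<beta> - 1)"
    and b3: "\<And>x. x \<in> {0..1} - {c} \<Longrightarrow> \<bar>T3 x\<bar> \<le> K * \<bar>x - c\<bar> powr (\<beta> - 2)"
begin

abbreviation X where "X \<equiv> {0..1} - {c}"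

lemma exp_abs: "x \<in> X \<Longrightarrow> \<theta> \<le> \<bar>T1 x\<bar>"
  using exp_left[of x] exp_right[of x] theta by (cases "x < c") auto

lemma T1_nz: "x \<in> X \<Longrightarrow> T1 x \<noteq> 0"
  using exp_abs[of x] theta by auto

lemma K_nonneg: "0 \<le> K"
proof -
  have "\<bar>T1 0\<bar> \<le> K * \<bar>0 - c\<bar> powr \<beta>" using b1_upper[of 0] c_in by simp
  then have "0 \<le> K * \<bar>0 - c\<bar> powr \<beta>" by linarith
  then show ?thesis using c_in by (simp add: zero_le_mult_iff)
qed

lemma AE_X: "AE x in leb01. x \<in> X"
  using null_point[of c] AE_space by eventually_elim auto

lemma ae_eq_X: "(\<And>x. x \<in> X \<Longrightarrow> f x = g x) \<Longrightarrow> ae_eq f g"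
  unfolding ae_eq_def using AE_X by (auto elim: eventually_mono)

lemma cont_X: "continuous_on X T" "continuous_on X T1" "continuous_on X T2"
proof -
  show "continuous_on X T" unfolding continuous_on_eq_continuous_within
    using d1 by (blast intro: DERIV_continuous continuous_within_subset)
  show "continuous_on X T1" unfolding continuous_on_eq_continuous_within
    using d2 by (blast intro: DERIV_continuous continuous_within_subset)
  show "continuous_on X T2" unfolding continuous_on_eq_continuous_within
    using d3 by (blast intro: DERIV_continuous continuous_within_subset)
qed

lemma inverse_T1_bound: "x \<in> X \<Longrightarrow> 1 / \<bar>T1 x\<bar> \<le> (1 / \<kappa>) * \<bar>x - c\<bar> powr (- \<beta>)"
proof -
  assume x: "x \<in> X"
  then have p: "0 < \<kappa> * \<bar>x - c\<bar> powr \<beta>" using kappa by simp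
  have "1 / \<bar>T1 x\<bar> \<le> 1 / (\<kappa> * \<bar>x - c\<bar> powr \<beta>)"
    using p b1_lower[OF x] by (intro divide_left_mono mult_pos_pos[of "\<bar>T1 x\<bar>"]) auto
  then show ?thesis by (simp add: powr_minus divide_simps)
qed

text \<open>Bookkeeping of exponents: every division by \<open>T1\<close> raises the power of the
  distance to \<open>c\<close> by the positive number \<open>- \<beta>\<close>.\<close>

lemma quotient_bound:
  assumes x: "x \<in> X" and f: "\<bar>f\<bar> \<le> C * \<bar>x - c\<bar> powr s"
  shows "\<bar>f / T1 x ^ n\<bar> \<le> C / \<kappa> ^ n * \<bar>x - c\<bar> powr (s - real n * \<beta>)"
proof -
  have "\<bar>f / T1 x ^ n\<bar> = \<bar>f\<bar> * (1 / \<bar>T1 x\<bar>) ^ n" by (simp add: power_abs[symmetric] power_divide abs_divide)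
  also have "\<dots> \<le> (C * \<bar>x - c\<bar> powr s) * ((1 / \<kappa>) * \<bar>x - c\<bar> powr (- \<beta>)) ^ n"
    by (intro mult_mono f power_mono inverse_T1_bound[OF x]) (use f in auto)
  also have "\<dots> = C / \<kappa> ^ n * (\<bar>x - c\<bar> powr s * \<bar>x - c\<bar> powr (real n * (- \<beta>)))"
    using x by (simp add: power_mult_distrib power_divide powr_power mult_ac)
  also have "\<bar>x - c\<bar> powr s * \<bar>x - c\<bar> powr (real n * (- \<beta>)) = \<bar>x - c\<bar> powr (s - real n * \<beta>)"
    by (simp add: powr_add[symmetric])
  finally show ?thesis .
qed

text \<open>A test function is pulled back to \<open>\<sigma> \<cdot> \<phi> \<circ> T\<close>, which is admissible in the integration by parts
  because \<open>\<sigma>\<close> vanishes at the cusp and \<open>T\<close> maps both endpoints to \<open>0\<close>.\<close>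

lemma transfer_weak_deriv:
  assumes f: "has_weak_deriv f u"
    and der: "\<And>x. x \<in> X \<Longrightarrow> (\<sigma> has_real_derivative \<sigma>' x) (at x within {0..1})"
    and cont': "continuous_on X \<sigma>'"
    and bd: "s > 0" "\<And>x. x \<in> X \<Longrightarrow> \<bar>\<sigma> x\<bar> \<le> C * \<bar>x - c\<bar> powr s"
    and bd': "s' > -1" "\<And>x. x \<in> X \<Longrightarrow> \<bar>\<sigma>' x\<bar> \<le> C' * \<bar>x - c\<bar> powr s'"
    and bd'': "s'' > -1" "\<And>x. x \<in> X \<Longrightarrow> \<bar>\<sigma> x * T1 x\<bar> \<le> C'' * \<bar>x - c\<bar> powr s''"
  shows "has_weak_deriv (L (\<lambda>x. \<sigma> x * T1 x * f x)) (L (\<lambda>x. \<sigma> x * u x + \<sigma>' x * f x))"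
    and "(\<lambda>x. \<sigma> x * u x) \<in> L1" and "(\<lambda>x. \<sigma>' x * f x) \<in> L1" and "(\<lambda>x. \<sigma> x * T1 x * f x) \<in> L1"
proof -
  note fL = has_weak_deriv_L1(1)[OF f] and uL = has_weak_deriv_L1(2)[OF f]
  have fi: "f \<in> Linf" by (rule has_weak_deriv_Linf[OF f])
  \<comment> \<open>Nothing is known of \<open>\<sigma>\<close> at \<open>c\<close>. With the value
    0 there, the bound with \<open>s > 0\<close> makes the function continuous.\<close>
  define \<tau> where "\<tau> x = (if x = c then 0 else \<sigma> x)" for x
  have cX: "continuous_on X \<sigma>" unfolding continuous_on_eq_continuous_within
    using der by (blast intro: DERIV_continuous continuous_within_subset)
  have derT: "(\<tau> has_real_derivative \<sigma>' x) (at x within {0..1})" if "x \<in> X" for x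
    by (rule has_field_derivative_transform_within[OF der[OF that], of "\<bar>x - c\<bar>"])
      (use that in \<open>auto simp: \<tau>_def dist_real_def\<close>)
  have \<tau>c: "(\<tau> \<longlongrightarrow> 0) (at c within {0..1})"
  proof (rule Lim_null_comparison)
    have "((\<lambda>x. C * \<bar>x - c\<bar> powr s) \<longlongrightarrow> C * \<bar>c - c\<bar> powr s) (at c within {0..1})"
      by (intro tendsto_intros tendsto_powr') (use bd(1) in auto)
    then show "((\<lambda>x. C * \<bar>x - c\<bar> powr s) \<longlongrightarrow> 0) (at c within {0..1})" by simp
    show "eventually (\<lambda>x. norm (\<tau> x) \<le> C * \<bar>x - c\<bar> powr s) (at c within {0..1})"
      unfolding eventually_at_filter using bd(2) by (auto simp: \<tau>_def)
  qed
  have \<tau>cont: "continuous_on {0..1} \<tau>"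
    unfolding continuous_on_eq_continuous_within
  proof
    fix x :: real assume "x \<in> {0..1}"
    then show "continuous (at x within {0..1}) \<tau>"
      using derT[of x] \<tau>c by (cases "x = c") (auto simp: continuous_within \<tau>_def dest: DERIV_continuous)
  qed
  have \<tau>i: "\<tau> \<in> Linf" by (rule continuous_Linf[OF \<tau>cont])
  have \<sigma>'L: "\<sigma>' \<in> L1" by (rule L1_powr_bound[OF cont' bd'])
  have \<rho>L: "(\<lambda>x. \<sigma> x * T1 x) \<in> L1"
    by (rule L1_powr_bound[OF continuous_on_mult[OF cX cont_X(2)] bd''])
  show \<sigma>uL: "(\<lambda>x. \<sigma> x * u x) \<in> L1"
    by (rule L1_cong[OF L1_mult_Linf[OF uL \<tau>i]], rule ae_eq_X) (simp add: \<tau>_def)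
  show \<sigma>fL: "(\<lambda>x. \<sigma>' x * f x) \<in> L1" by (rule L1_mult_Linf[OF \<sigma>'L fi])
  show \<rho>fL: "(\<lambda>x. \<sigma> x * T1 x * f x) \<in> L1" by (rule L1_mult_Linf[OF \<rho>L fi])
  have gL: "(\<lambda>x. \<sigma> x * u x + \<sigma>' x * f x) \<in> L1" by (rule L1_add[OF \<sigma>uL \<sigma>fL])
  show "has_weak_deriv (L (\<lambda>x. \<sigma> x * T1 x * f x)) (L (\<lambda>x. \<sigma> x * u x + \<sigma>' x * f x))"
    unfolding has_weak_deriv_def
  proof (intro conjI allI impI L_L1 \<rho>fL gL)
    fix \<phi> assume t: "test_fun \<phi>"
    define \<phi>' where "\<phi>' = deriv \<phi>"
    have Ti: "(\<lambda>x. \<phi> (T x)) \<in> Linf" "(\<lambda>x. \<phi>' (T x)) \<in> Linf"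
      unfolding \<phi>'_def by (rule Linf_comp[OF nonsing test_fun_Linf(1)[OF t]] Linf_comp[OF nonsing test_fun_Linf(2)[OF t]])+
    define p where "p x = \<sigma> x * T1 x * \<phi>' (T x) + \<sigma>' x * \<phi> (T x)" for x
    have p1: "(\<lambda>x. \<sigma> x * T1 x * \<phi>' (T x)) \<in> L1" by (rule L1_mult_Linf[OF \<rho>L Ti(2)])
    have p2: "(\<lambda>x. \<sigma>' x * \<phi> (T x)) \<in> L1" by (rule L1_mult_Linf[OF \<sigma>'L Ti(1)])
    have pL: "p \<in> L1" unfolding p_def by (rule L1_add[OF p1 p2])
    \<comment> \<open>Off the cusp \<open>p\<close> is the derivative of \<open>\<psi>\<close>; it
      need not be bounded there, but it is integrable, which is what the fundamental theorem asks
      for.\<close>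
    define \<psi> where "\<psi> x = \<tau> x * \<phi> (T x)" for x
    have derpsi: "(\<psi> has_real_derivative p x) (at x within {0..1})" if x: "x \<in> X" for x
    proof -
      have "((\<lambda>x. \<phi> (T x)) has_real_derivative \<phi>' (T x) * T1 x) (at x within {0..1})"
        unfolding \<phi>'_def by (rule DERIV_chain2[OF test_funD(1)[OF t] d1[OF x]])
      from DERIV_mult[OF derT[OF x] this]
      show ?thesis unfolding \<psi>_def[abs_def] p_def using x by (simp add: \<tau>_def algebra_simps)
    qed
    obtain B where B: "\<And>x. x \<in> {0..1} \<Longrightarrow> \<bar>\<phi> x\<bar> \<le> B"
    proof -
      have "bounded (\<phi> ` {0..1})"
        by (intro compact_imp_bounded compact_continuous_image test_fun_continuous[OF t]) auto
      then obtain m where m: "\<forall>x\<in>{0..1}. \<bar>\<phi> x\<bar> \<le> m" by (auto simp: bounded_iff)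
      show ?thesis by (rule that[of m]) (rule bspec[OF m])
    qed
    have psicont: "continuous_on {0..1} \<psi>"
      unfolding continuous_on_eq_continuous_within
    proof
      fix x :: real assume x: "x \<in> {0..1}"
      show "continuous (at x within {0..1}) \<psi>"
      proof (cases "x = c")
        case True
        have "(\<psi> \<longlongrightarrow> 0) (at c within {0..1})"
        proof (rule Lim_null_comparison)
          show "((\<lambda>x. B * \<bar>\<tau> x\<bar>) \<longlongrightarrow> 0) (at c within {0..1})"
            using tendsto_mult[OF tendsto_const[of B] tendsto_rabs_zero[OF \<tau>c]] by simp
          show "eventually (\<lambda>x. norm (\<psi> x) \<le> B * \<bar>\<tau> x\<bar>) (at c within {0..1})"
            unfolding eventually_at_filter
            by (rule always_eventually) (use B T_in in \<open>auto simp: \<psi>_def abs_mult mult.commute[of B] intro!: mult_left_mono\<close>)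
        qed
        then show ?thesis using True by (simp add: continuous_within \<psi>_def \<tau>_def)
      next
        case False
        then show ?thesis using derpsi[of x] x by (auto dest: DERIV_continuous)
      qed
    qed
    have prim: "prim p t = \<psi> t" if "t \<in> {0..1}" for t
    proof -
      have "prim p t = \<psi> t - \<psi> 0"
      proof (rule prim_FTC[OF pL _ psicont _ that, of "{c}"])
        fix x assume "x \<in> {0<..<1} - {c}"
        then show "(\<psi> has_real_derivative p x) (at x)"
          using derpsi[of x] at_within_interior[of x "{0..1}"] by (simp add: interior_atLeastAtMost_real)
      qed auto
      then show ?thesis by (simp add: \<psi>_def T_ends test_funD(3)[OF t])
    qed
    obtain k where k: "ae_eq f (\<lambda>x. k + prim u x)" using has_weak_deriv_rep[OF f] by blast
    have ibp: "(LINT x|leb01. f x * p x) = - (LINT x|leb01. u x * \<psi> x)"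
      by (rule integration_by_parts[OF k uL pL prim]) (auto simp: \<psi>_def T_ends test_funD(3)[OF t])
    have i1: "(\<lambda>x. \<sigma> x * T1 x * f x * \<phi>' (T x)) \<in> L1" by (rule L1_mult_Linf[OF \<rho>fL Ti(2)])
    have i2: "(\<lambda>x. \<sigma>' x * f x * \<phi> (T x)) \<in> L1" by (rule L1_mult_Linf[OF \<sigma>fL Ti(1)])
    have i3: "(\<lambda>x. \<sigma> x * u x * \<phi> (T x)) \<in> L1" by (rule L1_mult_Linf[OF \<sigma>uL Ti(1)])
    have "(LINT x|leb01. f x * p x) = (LINT x|leb01. \<sigma> x * T1 x * f x * \<phi>' (T x) + \<sigma>' x * f x * \<phi> (T x))"
      by (simp add: p_def algebra_simps)
    also have "\<dots> = (LINT x|leb01. \<sigma> x * T1 x * f x * \<phi>' (T x)) + (LINT x|leb01. \<sigma>' x * f x * \<phi> (T x))"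
      using i1 i2 by (simp add: L1_def)
    finally have e1: "(LINT x|leb01. \<sigma> x * T1 x * f x * \<phi>' (T x))
        = - (LINT x|leb01. u x * \<psi> x) - (LINT x|leb01. \<sigma>' x * f x * \<phi> (T x))"
      using ibp by simp
    have "(LINT x|leb01. u x * \<psi> x) = (LINT x|leb01. \<sigma> x * u x * \<phi> (T x))"
      by (rule integral_ae_eq[symmetric, OF L1_measurable[OF i3]], rule ae_eq_X) (simp add: \<psi>_def \<tau>_def)
    with e1 have "(LINT x|leb01. \<sigma> x * T1 x * f x * \<phi>' (T x))
        = - ((LINT x|leb01. \<sigma> x * u x * \<phi> (T x)) + (LINT x|leb01. \<sigma>' x * f x * \<phi> (T x)))" by simp
    also have "(LINT x|leb01. \<sigma> x * u x * \<phi> (T x)) + (LINT x|leb01. \<sigma>' x * f x * \<phi> (T x))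
        = (LINT x|leb01. (\<sigma> x * u x + \<sigma>' x * f x) * \<phi> (T x))"
      using i2 i3 by (simp add: L1_def distrib_right)
    finally show "(LINT x|leb01. L (\<lambda>x. \<sigma> x * T1 x * f x) x * deriv \<phi> x)
        = - (LINT x|leb01. L (\<lambda>x. \<sigma> x * u x + \<sigma>' x * f x) x * \<phi> x)"
      using L_dual[OF \<rho>fL test_fun_Linf(2)[OF t]] L_dual[OF gL test_fun_Linf(1)[OF t]]
      by (simp add: \<phi>'_def)
  qed
qed

text \<open>The weights of the differentiated transfer formulas: off the cusp \<open>b\<close> is
  the derivative of \<open>1 / T1\<close>, \<open>d\<close> that of \<open>1 / T1 ^ 2\<close>, and
  \<open>e\<close> that of \<open>b / T1\<close>.\<close>

definition b :: "real \<Rightarrow> real" where "b x = - (T2 x / T1 x ^ 2)"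
definition d :: "real \<Rightarrow> real" where "d x = - (2 * T2 x / T1 x ^ 3)"
definition e :: "real \<Rightarrow> real" where "e x = 3 * T2 x ^ 2 / T1 x ^ 4 - T3 x / T1 x ^ 3"

lemma b_bound: "x \<in> X \<Longrightarrow> \<bar>b x\<bar> \<le> K / \<kappa> ^ 2 * \<bar>x - c\<bar> powr (- 1 - \<beta>)"
  using quotient_bound[OF _ b2, of x 2] by (simp add: b_def algebra_simps)

lemma d_bound: "x \<in> X \<Longrightarrow> \<bar>d x\<bar> \<le> 2 * K / \<kappa> ^ 3 * \<bar>x - c\<bar> powr (- 1 - 2 * \<beta>)"
  using quotient_bound[of x "2 * T2 x" "2 * K" "\<beta> - 1" 3] b2[of x] by (simp add: d_def algebra_simps)

lemma e_bound:
  assumes x: "x \<in> X"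
  shows "\<bar>e x\<bar> \<le> (3 * K ^ 2 / \<kappa> ^ 4 + K / \<kappa> ^ 3) * \<bar>x - c\<bar> powr (- 2 - 2 * \<beta>)"
proof -
  have "\<bar>T2 x\<bar> ^ 2 \<le> (K * \<bar>x - c\<bar> powr (\<beta> - 1)) ^ 2" by (intro power_mono b2 x) auto
  also have "\<dots> = K ^ 2 * \<bar>x - c\<bar> powr (2 * (\<beta> - 1))" using x by (simp add: power_mult_distrib powr_power)
  finally have "\<bar>3 * T2 x ^ 2\<bar> \<le> (3 * K ^ 2) * \<bar>x - c\<bar> powr (2 * (\<beta> - 1))" by simp
  from quotient_bound[OF x this, of 4]
  have 1: "\<bar>3 * T2 x ^ 2 / T1 x ^ 4\<bar> \<le> 3 * K ^ 2 / \<kappa> ^ 4 * \<bar>x - c\<bar> powr (- 2 - 2 * \<beta>)"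
    by (simp add: algebra_simps)
  have 2: "\<bar>T3 x / T1 x ^ 3\<bar> \<le> K / \<kappa> ^ 3 * \<bar>x - c\<bar> powr (- 2 - 2 * \<beta>)"
    using quotient_bound[OF x b3[OF x], of 3] by (simp add: algebra_simps)
  show ?thesis using 1 2 unfolding e_def distrib_right by linarith
qed

lemma one_bound: "x \<in> X \<Longrightarrow> \<bar>1 / T1 x ^ n\<bar> \<le> (1 / \<kappa> ^ n) * \<bar>x - c\<bar> powr (- real n * \<beta>)"
  using quotient_bound[of x 1 1 0 n] by simp

lemma b_over_bound: "x \<in> X \<Longrightarrow> \<bar>b x / T1 x\<bar> \<le> K / \<kappa> ^ 3 * \<bar>x - c\<bar> powr (- 1 - 2 * \<beta>)"
  using quotient_bound[OF _ b_bound, of x 1] by (simp add: algebra_simps power3_eq_cube power2_eq_square)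

lemma cont_b: "continuous_on X b"
  unfolding b_def using T1_nz by (intro continuous_intros cont_X) auto
lemma cont_d: "continuous_on X d"
  unfolding d_def using T1_nz by (intro continuous_intros cont_X) auto
lemma cont_e: "continuous_on X e"
  unfolding e_def using T1_nz by (intro continuous_intros cont_X cont3) auto

lemma b_L1: "b \<in> L1"
  by (rule L1_powr_bound[OF cont_b _ b_bound]) (use beta in auto)

text \<open>The choice \<open>\<sigma> = 1 / T1\<close>, for which the factor
  \<open>\<sigma> * T1\<close> is 1.\<close>

lemma L_weak_deriv:
  assumes f: "has_weak_deriv f u"
  shows "has_weak_deriv (L f) (L (\<lambda>x. u x / T1 x + b x * f x))"
    and "(\<lambda>x. u x / T1 x) \<in> L1" and "(\<lambda>x. b x * f x) \<in> L1"
proof -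
  have der: "((\<lambda>x. 1 / T1 x) has_real_derivative b x) (at x within {0..1})" if "x \<in> X" for x
    using T1_nz[OF that] d2[OF that] by (auto intro!: derivative_eq_intros simp: b_def power2_eq_square)
  have bd: "\<bar>1 / T1 x\<bar> \<le> 1 / \<kappa> * \<bar>x - c\<bar> powr (- \<beta>)" if "x \<in> X" for x
    using one_bound[OF that, of 1] by simp
  have bd'': "\<bar>1 / T1 x * T1 x\<bar> \<le> 1 * \<bar>x - c\<bar> powr 0" if "x \<in> X" for x
    using that T1_nz[OF that] by simp
  note R = transfer_weak_deriv[OF f der cont_b _ bd _ b_bound _ bd'']
  have w: "has_weak_deriv (L (\<lambda>x. 1 / T1 x * T1 x * f x)) (L (\<lambda>x. 1 / T1 x * u x + b x * f x))"
    and L: "(\<lambda>x. 1 / T1 x * u x) \<in> L1" "(\<lambda>x. b x * f x) \<in> L1" "(\<lambda>x. 1 / T1 x * T1 x * f x) \<in> L1"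
    using R beta by auto
  show "(\<lambda>x. u x / T1 x) \<in> L1" "(\<lambda>x. b x * f x) \<in> L1" using L by auto
  have "ae_eq (L (\<lambda>x. 1 / T1 x * T1 x * f x)) (L f)"
    by (rule L_cong[OF L(3)], rule ae_eq_X) (use T1_nz in auto)
  from has_weak_deriv_cong[OF w this ae_eq_refl]
  show "has_weak_deriv (L f) (L (\<lambda>x. u x / T1 x + b x * f x))" by simp
qed

text \<open>The choice \<open>\<sigma> = 1 / T1 ^ 2\<close>. Division by \<open>T1\<close> followed
  by \<open>L\<close> is how \<open>L\<close> acts on first derivatives, so this formula governs
  second derivatives.\<close>

lemma M_weak_deriv:
  assumes f: "has_weak_deriv f u"
  shows "has_weak_deriv (L (\<lambda>x. f x / T1 x)) (L (\<lambda>x. u x / T1 x ^ 2 + d x * f x))"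
    and "(\<lambda>x. u x / T1 x ^ 2) \<in> L1" and "(\<lambda>x. d x * f x) \<in> L1"
proof -
  have der: "((\<lambda>x. 1 / T1 x ^ 2) has_real_derivative d x) (at x within {0..1})" if "x \<in> X" for x
    using T1_nz[OF that] d2[OF that]
    by (auto intro!: derivative_eq_intros simp: d_def power2_eq_square power3_eq_cube)
  have bd: "\<bar>1 / T1 x ^ 2\<bar> \<le> 1 / \<kappa> ^ 2 * \<bar>x - c\<bar> powr (- 2 * \<beta>)" if "x \<in> X" for x
    using one_bound[OF that, of 2] by simp
  have bd'': "\<bar>1 / T1 x ^ 2 * T1 x\<bar> \<le> 1 / \<kappa> * \<bar>x - c\<bar> powr (- \<beta>)" if "x \<in> X" for x
    using one_bound[OF that, of 1] T1_nz[OF that] by (simp add: power2_eq_square)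
  note R = transfer_weak_deriv[OF f der cont_d _ bd _ d_bound _ bd'']
  have w: "has_weak_deriv (L (\<lambda>x. 1 / T1 x ^ 2 * T1 x * f x)) (L (\<lambda>x. 1 / T1 x ^ 2 * u x + d x * f x))"
    and L: "(\<lambda>x. 1 / T1 x ^ 2 * u x) \<in> L1" "(\<lambda>x. d x * f x) \<in> L1" "(\<lambda>x. 1 / T1 x ^ 2 * T1 x * f x) \<in> L1"
    using R beta by auto
  show "(\<lambda>x. u x / T1 x ^ 2) \<in> L1" "(\<lambda>x. d x * f x) \<in> L1" using L by auto
  have "ae_eq (L (\<lambda>x. 1 / T1 x ^ 2 * T1 x * f x)) (L (\<lambda>x. f x / T1 x))"
    by (rule L_cong[OF L(3)], rule ae_eq_X) (use T1_nz in \<open>auto simp: power2_eq_square\<close>)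
  from has_weak_deriv_cong[OF w this ae_eq_refl]
  show "has_weak_deriv (L (\<lambda>x. f x / T1 x)) (L (\<lambda>x. u x / T1 x ^ 2 + d x * f x))" by simp
qed

text \<open>The choice \<open>\<sigma> = b / T1\<close>. Although \<open>b\<close> can be unbounded,
  the derivative involves only \<open>b / T1\<close>, which tends to 0 at the cusp, and the
  integrable \<open>e\<close>.\<close>

lemma bL_weak_deriv:
  assumes f: "has_weak_deriv f u"
  shows "has_weak_deriv (L (\<lambda>x. b x * f x)) (L (\<lambda>x. b x / T1 x * u x + e x * f x))"
proof -
  have der: "((\<lambda>x. b x / T1 x) has_real_derivative e x) (at x within {0..1})" if "x \<in> X" for x
    unfolding b_def using T1_nz[OF that] d2[OF that] d3[OF that]
    by (auto intro!: derivative_eq_intros simp: e_def field_simps eval_nat_numeral)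
  have bd'': "\<bar>b x / T1 x * T1 x\<bar> \<le> K / \<kappa> ^ 2 * \<bar>x - c\<bar> powr (- 1 - \<beta>)" if "x \<in> X" for x
    using b_bound[OF that] T1_nz[OF that] by simp
  note R = transfer_weak_deriv[OF f der cont_e _ b_over_bound _ e_bound _ bd'']
  have w: "has_weak_deriv (L (\<lambda>x. b x / T1 x * T1 x * f x)) (L (\<lambda>x. b x / T1 x * u x + e x * f x))"
    and L: "(\<lambda>x. b x / T1 x * T1 x * f x) \<in> L1"
    using R beta by auto
  have "ae_eq (L (\<lambda>x. b x / T1 x * T1 x * f x)) (L (\<lambda>x. b x * f x))"
    by (rule L_cong[OF L], rule ae_eq_X) (use T1_nz in auto)
  from has_weak_deriv_cong[OF w this ae_eq_refl] show ?thesis .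
qed

end

section \<open>Uniqueness of invariant densities\<close>

context nonsingular_map
begin

lemma L_mono:
  assumes "f \<in> L1" "g \<in> L1" "AE x in leb01. f x \<le> g x"
  shows "AE x in leb01. L f x \<le> L g x"
proof -
  have "AE x in leb01. 0 \<le> L (\<lambda>x. g x - f x) x"
    by (rule L_pos[OF L1_diff[OF assms(2,1)]]) (use assms(3) in \<open>auto elim: eventually_mono\<close>)
  then show ?thesis using L_diff[OF assms(2,1)] unfolding ae_eq_def by eventually_elim simp
qed

text \<open>Positivity gives \<open>\<bar>w\<bar> \<le> L \<bar>w\<bar>\<close> almost everywhere,
  and both sides have the same integral.\<close>

lemma L_abs:
  assumes w: "w \<in> L1" "ae_eq (L w) w"
  shows "ae_eq (L (\<lambda>x. \<bar>w x\<bar>)) (\<lambda>x. \<bar>w x\<bar>)"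
proof -
  note A = L1_abs[OF w(1)]
  have n: "ae_eq (L (\<lambda>x. - w x)) (\<lambda>x. - w x)"
    using L_cmult[OF w(1), of "-1"] w(2) unfolding ae_eq_def by (auto elim: eventually_elim2)
  have "AE x in leb01. L w x \<le> L (\<lambda>x. \<bar>w x\<bar>) x" by (rule L_mono[OF w(1) A]) auto
  moreover have "AE x in leb01. L (\<lambda>x. - w x) x \<le> L (\<lambda>x. \<bar>w x\<bar>) x"
    by (rule L_mono[OF L1_uminus[OF w(1)] A]) auto
  ultimately have ge: "AE x in leb01. 0 \<le> L (\<lambda>x. \<bar>w x\<bar>) x - \<bar>w x\<bar>"
    using w(2) n unfolding ae_eq_def by eventually_elim auto
  have i: "integrable leb01 (\<lambda>x. L (\<lambda>x. \<bar>w x\<bar>) x - \<bar>w x\<bar>)"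
    using L1_diff[OF L_L1[OF A] A] by (simp add: L1_def)
  have "(LINT x|leb01. L (\<lambda>x. \<bar>w x\<bar>) x - \<bar>w x\<bar>) = 0"
    using L_integral[OF A] L_L1[OF A] A by (simp add: L1_def)
  then have "AE x in leb01. L (\<lambda>x. \<bar>w x\<bar>) x - \<bar>w x\<bar> = 0"
    using integral_nonneg_eq_0_iff_AE[OF i ge] by simp
  then show ?thesis by (simp add: ae_eq_def)
qed

lemma L_positive_part:
  assumes w: "w \<in> L1" "ae_eq (L w) w"
  shows "ae_eq (L (\<lambda>x. max 0 (w x))) (\<lambda>x. max 0 (w x))"
proof -
  have eq: "(\<lambda>x. max 0 (w x)) = (\<lambda>x. (1/2) * w x + (1/2) * \<bar>w x\<bar>)" by (auto simp: max_def)
  show ?thesis unfolding eq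
    using L_lin[OF w(1) L1_abs[OF w(1)], of "1/2" "1/2"] w(2) L_abs[OF w] unfolding ae_eq_def
    by eventually_elim simp
qed

text \<open>Duality with the indicator of the zero set \<open>Z\<close> of \<open>p\<close>: the
  integral of \<open>p\<close> over the points that enter \<open>Z\<close> equals the integral of
  \<open>L p = p\<close> over \<open>Z\<close>, which is 0.\<close>

lemma support_forward_invariant:
  assumes p: "p \<in> L1" "ae_eq (L p) p" "\<And>x. 0 \<le> p x"
  shows "AE x in leb01. 0 < p x \<longrightarrow> 0 < p (T x)"
proof -
  define Z where "Z = {x \<in> space leb01. p x = 0}"
  have pm: "p \<in> borel_measurable leb01" by (rule L1_measurable[OF p(1)])
  have Z: "Z \<in> sets leb01" unfolding Z_def using pm by measurable
  have ZL: "indicator Z \<in> Linf" by (rule Linf_indicator[OF Z])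
  have ZT: "(\<lambda>x. indicator Z (T x) :: real) \<in> Linf" by (rule Linf_comp[OF nonsing ZL])
  have i: "integrable leb01 (\<lambda>x. p x * indicator Z (T x))" by (rule integrable_mult_Linf[OF p(1) ZT])
  have "(LINT x|leb01. p x * indicator Z (T x)) = (LINT x|leb01. L p x * indicator Z x)"
    by (rule L_dual[OF p(1) ZL, symmetric])
  also have "\<dots> = (LINT x|leb01. p x * indicator Z x)"
    by (rule integral_ae_eq[OF L1_measurable[OF L1_mult_Linf[OF L_L1[OF p(1)] ZL]]])
      (use p(2) in \<open>auto simp: ae_eq_def elim: eventually_mono\<close>)
  also have "\<dots> = (LINT x|leb01. 0)"
    by (rule Bochner_Integration.integral_cong) (auto simp: Z_def split: split_indicator)
  finally have "AE x in leb01. p x * indicator Z (T x) = 0"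
    using integral_nonneg_eq_0_iff_AE[OF i] p(3) by simp
  then show ?thesis using AE_space
  proof eventually_elim
    case (elim x)
    then have "T x \<in> space leb01" using T_in[of x] by simp
    then show ?case using elim p(3)[of "T x"] by (auto simp: Z_def split: split_indicator_asm)
  qed
qed

end

section \<open>Expansion and the supports of invariant functions\<close>

context cusp_map
begin

lemma T_cont_on: "S \<subseteq> X \<Longrightarrow> continuous_on S T"
  using cont_X(1) continuous_on_subset by blast

lemma T_mvt:
  assumes "s < t" "{s..t} \<subseteq> X"
  shows "\<exists>x\<in>{s<..<t}. T t - T s = T1 x * (t - s)"
proof -
  have "\<exists>x\<in>{s<..<t}. T t - T s = (\<lambda>h. T1 x * h) (t - s)"
  proof (rule mvt_simple[OF assms(1)])
    fix x assume "s \<le> x" "x \<le> t"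
    then have "x \<in> X" using assms(2) by auto
    then have "(T has_real_derivative T1 x) (at x within {s..t})"
      using has_field_derivative_subset[OF d1] assms(2) by blast
    then show "(T has_derivative (\<lambda>h. T1 x * h)) (at x within {s..t})"
      by (simp add: has_field_derivative_def)
  qed
  then show ?thesis by simp
qed

lemma T_left:
  assumes "0 \<le> s" "s \<le> t" "t < c" shows "\<theta> * (t - s) \<le> T t - T s"
proof (cases "s = t")
  case False
  then obtain x where "x \<in> {s<..<t}" "T t - T s = T1 x * (t - s)"
    using T_mvt[of s t] assms c_in by force
  moreover from this have "\<theta> \<le> T1 x" using assms by (intro exp_left) auto
  ultimately show ?thesis using False assms by (simp add: mult_right_mono)
qed simp

lemma T_right:
  assumes "c < s" "s \<le> t" "t \<le> 1" shows "\<theta> * (t - s) \<le> T s - T t"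
proof (cases "s = t")
  case False
  then obtain x where x: "x \<in> {s<..<t}" "T t - T s = T1 x * (t - s)"
    using T_mvt[of s t] assms c_in by force
  then have "T1 x \<le> - \<theta>" using assms by (intro exp_right) auto
  then have "T1 x * (t - s) \<le> - \<theta> * (t - s)" using assms by (intro mult_right_mono) auto
  then show ?thesis using x(2) by simp
qed simp

lemma T_left_a: assumes "0 \<le> s" "s < c" shows "T s + \<theta> * (c - s) \<le> a"
proof -
  have "((\<lambda>t. T t - \<theta> * (t - s)) \<longlongrightarrow> a - \<theta> * (c - s)) (at_left c)"
    by (intro tendsto_intros T_lim)
  moreover have "eventually (\<lambda>t. T s \<le> T t - \<theta> * (t - s)) (at_left c)"
    unfolding eventually_at_left[OF assms(2)] using T_left[of s] assms
    by (intro exI[of _ s] conjI allI impI) (auto simp: algebra_simps less_imp_le)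
  ultimately show ?thesis using tendsto_lowerbound[of _ _ "at_left c" "T s"] by fastforce
qed

lemma T_right_a: assumes "c < s" "s \<le> 1" shows "T s + \<theta> * (s - c) \<le> a"
proof -
  have "((\<lambda>t. T t - \<theta> * (s - t)) \<longlongrightarrow> a - \<theta> * (s - c)) (at_right c)"
    by (intro tendsto_intros T_lim)
  moreover have "eventually (\<lambda>t. T s \<le> T t - \<theta> * (s - t)) (at_right c)"
    unfolding eventually_at_right[OF assms(1)] using T_right[of _ s] assms
    by (intro exI[of _ s] conjI allI impI) (auto simp: algebra_simps less_imp_le)
  ultimately show ?thesis using tendsto_lowerbound[of _ _ "at_right c" "T s"] by fastforce
qed

lemma a_pos: "0 < a"
  using T_left_a[of 0] T_ends c_in theta by (smt (verit) mult_pos_pos)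

lemma T_lt_a: "x \<in> X \<Longrightarrow> T x < a"
  using T_left_a[of x] T_right_a[of x] theta by (cases "x < c") (auto, (smt (verit) mult_pos_pos)+)

definition pos_on :: "(real \<Rightarrow> real) \<Rightarrow> real set \<Rightarrow> bool" where
  "pos_on p J \<longleftrightarrow> (AE x in leb01. x \<in> J \<longrightarrow> 0 < p x)"

lemma pos_on_subset: "pos_on p J \<Longrightarrow> I \<subseteq> J \<Longrightarrow> pos_on p I"
  unfolding pos_on_def by (auto elim: eventually_mono)

text \<open>Almost every point of \<open>J\<close> is sent to a point where \<open>p\<close> is
  positive. The exceptional points form a null set, and its image is null because \<open>T\<close>
  is differentiable off the cusp.\<close>

lemma pos_on_image:
  assumes p: "p \<in> L1" "ae_eq (L p) p" "\<And>x. 0 \<le> p x" and J: "J \<subseteq> X" "pos_on p J"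
  shows "pos_on p (T ` J)"
proof -
  have "AE x in leb01. x \<in> J \<longrightarrow> 0 < p (T x)"
    using support_forward_invariant[OF p] J(2) unfolding pos_on_def by eventually_elim auto
  then have "AE x in lebesgue. x \<in> J \<longrightarrow> 0 < p (T x)"
    using J(1) by (auto simp: AE_restrict_space_iff elim!: eventually_mono)
  then obtain N where N: "N \<in> null_sets lebesgue" "{x. \<not> (x \<in> J \<longrightarrow> 0 < p (T x))} \<subseteq> N"
    by (auto simp: eventually_ae_filter)
  define M where "M = {x \<in> J. \<not> 0 < p (T x)}"
  have "negligible M"
    by (rule negligible_subset[of N]) (use N in \<open>auto simp: M_def negligible_iff_null_sets\<close>)
  moreover have "T differentiable_on M"
    unfolding differentiable_on_def
  proof
    fix x assume "x \<in> M"
    then have "x \<in> X" using J(1) by (auto simp: M_def)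
    then have "(T has_real_derivative T1 x) (at x within M)"
      by (rule has_field_derivative_subset[OF d1]) (use J(1) in \<open>auto simp: M_def\<close>)
    then show "T differentiable at x within M"
      by (auto simp: has_field_derivative_def differentiable_def)
  qed
  ultimately have "negligible (T ` M)" by (intro negligible_differentiable_image_negligible) auto
  then have "AE y in lebesgue. y \<notin> T ` M" by (intro AE_I'[of "T ` M"]) (auto simp: negligible_iff_null_sets)
  then have "AE y in lebesgue. y \<in> T ` J \<longrightarrow> 0 < p y" by eventually_elim (auto simp: M_def)
  then show ?thesis unfolding pos_on_def by (auto simp: AE_restrict_space_iff elim: eventually_mono)
qed

lemma T_image_left:
  assumes "0 \<le> s" "s \<le> t" "t < c" shows "{T s..T t} \<subseteq> T ` {s..t}"
  using IVT'[of T s _ t] T_cont_on[of "{s..t}"] assms c_in by fastforce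

lemma T_image_right:
  assumes "c < s" "s \<le> t" "t \<le> 1" shows "{T t..T s} \<subseteq> T ` {s..t}"
  using IVT2'[of T t _ s] T_cont_on[of "{s..t}"] assms c_in by fastforce

lemma T_image_left_a:
  assumes "0 \<le> s" "s < c" shows "{T s..<a} \<subseteq> T ` {s..<c}"
proof
  fix y assume y: "y \<in> {T s..<a}"
  have "eventually (\<lambda>t. y < T t) (at_left c)" using order_tendstoD(1)[OF T_lim(1)] y by auto
  then obtain t0 where t0: "t0 < c" "\<And>t. t0 < t \<Longrightarrow> t < c \<Longrightarrow> y < T t"
    unfolding eventually_at_left[OF assms(2)] by auto
  define t where "t = (max s t0 + c) / 2"
  have t: "s \<le> t" "t0 < t" "t < c" using t0(1) assms by (auto simp: t_def)
  have "y \<in> {T s..T t}" using t0(2)[OF t(2,3)] y by auto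
  then have "y \<in> T ` {s..t}" using T_image_left[OF assms(1) t(1,3)] by blast
  then show "y \<in> T ` {s..<c}" using t by auto
qed

lemma T_image_right_a:
  assumes "c < s" "s \<le> 1" shows "{T s..<a} \<subseteq> T ` {c<..s}"
proof
  fix y assume y: "y \<in> {T s..<a}"
  have "eventually (\<lambda>t. y < T t) (at_right c)" using order_tendstoD(1)[OF T_lim(2)] y by auto
  then obtain t0 where t0: "c < t0" "\<And>t. c < t \<Longrightarrow> t < t0 \<Longrightarrow> y < T t"
    unfolding eventually_at_right[OF assms(1)] by auto
  define t where "t = (min s t0 + c) / 2"
  have t: "t \<le> s" "t < t0" "c < t" using t0(1) assms by (auto simp: t_def)
  have "y \<in> {T s..T t}" using t0(2)[OF t(3,2)] y by auto
  then have "y \<in> T ` {t..s}" using T_image_right[OF t(3,1) assms(2)] by blast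
  then show "y \<in> T ` {c<..s}" using t by auto
qed

text \<open>An interval of positivity that misses \<open>c\<close> covers, under \<open>T\<close>,
  an interval of positivity at least \<open>\<theta>\<close> times as long, and no length exceeds 1.
  One that meets \<open>c\<close> contains a one-sided neighbourhood of \<open>c\<close>, whose
  image contains all values just below \<open>a\<close>.\<close>

lemma pos_near_cusp_value:
  assumes p: "p \<in> L1" "ae_eq (L p) p" "\<And>x. 0 \<le> p x"
    and st: "0 \<le> s" "s < t" "t \<le> 1" "pos_on p {s..t}"
  shows "\<exists>y<a. 0 \<le> y \<and> pos_on p {y..<a}"
proof -
  have "\<exists>s t. 0 \<le> s \<and> s < t \<and> t \<le> 1 \<and> pos_on p {s..t} \<and> s \<le> c \<and> c \<le> t"
  proof (rule ccontr)
    assume no: "\<nexists>s t. 0 \<le> s \<and> s < t \<and> t \<le> 1 \<and> pos_on p {s..t} \<and> s \<le> c \<and> c \<le> t"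
    have grow: "\<exists>s t. 0 \<le> s \<and> s < t \<and> t \<le> 1 \<and> pos_on p {s..t} \<and> \<theta> ^ n * (t0 - s0) \<le> t - s"
      if "0 \<le> s0" "s0 < t0" "t0 \<le> 1" "pos_on p {s0..t0}" for n s0 t0
    proof (induction n)
      case 0 then show ?case using that by (intro exI[of _ s0] exI[of _ t0]) auto
    next
      case (Suc n)
      then obtain s t where st: "0 \<le> s" "s < t" "t \<le> 1" "pos_on p {s..t}" "\<theta> ^ n * (t0 - s0) \<le> t - s"
        by blast
      then have len: "\<theta> ^ Suc n * (t0 - s0) \<le> \<theta> * (t - s)" "0 < \<theta> * (t - s)"
        using theta by (simp_all add: mult.assoc)
      have in01: "T s \<in> {0..1}" "T t \<in> {0..1}" using st T_in[of s] T_in[of t] by auto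
      have "\<not> (s \<le> c \<and> c \<le> t)" using no st(1-4) by blast
      then consider "t < c" | "c < s" by linarith
      then show ?case
      proof cases
        case 1
        have "pos_on p (T ` {s..t})" by (rule pos_on_image[OF p _ st(4)]) (use st 1 c_in in auto)
        then have "pos_on p {T s..T t}" by (rule pos_on_subset) (rule T_image_left, use st 1 in auto)
        then show ?thesis using T_left[of s t] st 1 len in01
          by (intro exI[of _ "T s"] exI[of _ "T t"]) auto
      next
        case 2
        have "pos_on p (T ` {s..t})" by (rule pos_on_image[OF p _ st(4)]) (use st 2 c_in in auto)
        then have "pos_on p {T t..T s}" by (rule pos_on_subset) (rule T_image_right, use st 2 in auto)
        then show ?thesis using T_right[of s t] st 2 len in01
          by (intro exI[of _ "T t"] exI[of _ "T s"]) auto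
      qed
    qed
    obtain n where "1 / (t - s) < \<theta> ^ n" using real_arch_pow[OF theta] by blast
    then have "1 < \<theta> ^ n * (t - s)" using st by (simp add: field_simps)
    then show False using grow[OF st, of n] by auto
  qed
  then obtain s t where st: "0 \<le> s" "s < t" "t \<le> 1" "pos_on p {s..t}" "s \<le> c" "c \<le> t" by blast
  show ?thesis
  proof (cases "s < c")
    case True
    have "pos_on p (T ` {s..<c})"
      by (rule pos_on_image[OF p]) (use st True c_in in \<open>auto intro: pos_on_subset[OF st(4)]\<close>)
    then have "pos_on p {T s..<a}" by (rule pos_on_subset) (rule T_image_left_a[OF st(1) True])
    then show ?thesis using T_lt_a[of s] T_in[of s] st True c_in by (intro exI[of _ "T s"]) auto
  next
    case False
    then have ct: "c < t" using st by auto
    have "pos_on p (T ` {c<..t})"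
      by (rule pos_on_image[OF p]) (use st ct c_in False in \<open>auto intro: pos_on_subset[OF st(4)]\<close>)
    then have "pos_on p {T t..<a}" by (rule pos_on_subset) (rule T_image_right_a[OF ct st(3)])
    then show ?thesis using T_lt_a[of t] T_in[of t] st ct c_in by (intro exI[of _ "T t"]) auto
  qed
qed

lemma continuous_pos_interval:
  assumes c: "continuous_on {0..1} (W::real\<Rightarrow>real)" and x: "x \<in> {0..1}" "0 < W x"
  shows "\<exists>s t. 0 \<le> s \<and> s < t \<and> t \<le> 1 \<and> (\<forall>y\<in>{s..t}. 0 < W y)"
proof -
  have "eventually (\<lambda>y. 0 < W y) (at x within {0..1})"
    using c x by (intro order_tendstoD(1)[of W "W x"]) (auto simp: continuous_on_def)
  then obtain d where d: "d > 0" "\<And>y. y \<in> {0..1} \<Longrightarrow> dist y x < d \<Longrightarrow> 0 < W y"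
    using x(2) unfolding eventually_at by (metis)
  define s where "s = max 0 (x - d/2)"
  define t where "t = min 1 (x + d/2)"
  have "s < t" using x d(1) by (auto simp: s_def t_def)
  moreover have "0 < W y" if "y \<in> {s..t}" for y
    by (rule d(2)) (use that d(1) x in \<open>auto simp: s_def t_def dist_real_def\<close>)
  ultimately show ?thesis by (intro exI[of _ s] exI[of _ t]) (auto simp: s_def t_def)
qed

lemma invariant_W11_pos_near_cusp:
  assumes w: "has_weak_deriv w u" "ae_eq (L w) w" and k: "ae_eq w (\<lambda>x. k + prim u x)"
    and x: "x \<in> {0..1}" "0 < k + prim u x"
  shows "\<exists>y<a. 0 \<le> y \<and> pos_on (\<lambda>x. max 0 (w x)) {y..<a}"
proof -
  note wL = has_weak_deriv_L1(1)[OF w(1)] and uL = has_weak_deriv_L1(2)[OF w(1)]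
  have pL: "(\<lambda>x. max 0 (w x)) \<in> L1" using wL by (auto simp: L1_def)
  have "continuous_on {0..1} (\<lambda>x. k + prim u x)"
    by (intro continuous_intros continuous_on_prim uL)
  from continuous_pos_interval[OF this x]
  obtain s t where st: "0 \<le> s" "s < t" "t \<le> 1" "\<forall>y\<in>{s..t}. 0 < k + prim u y" by blast
  have "pos_on (\<lambda>x. max 0 (w x)) {s..t}"
    unfolding pos_on_def using k unfolding ae_eq_def by eventually_elim (use st(4) in auto)
  then show ?thesis
    by (intro pos_near_cusp_value[OF pL L_positive_part[OF wL w(2)] _ st(1-3)]) auto
qed

lemma invariant_W11_zero:
  assumes w: "has_weak_deriv w u" "ae_eq (L w) w" and z: "(LINT x|leb01. w x) = 0"
  shows "ae_eq w (\<lambda>x. 0)"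
proof (rule ccontr)
  assume nz: "\<not> ae_eq w (\<lambda>x. 0)"
  note wL = has_weak_deriv_L1(1)[OF w(1)] and uL = has_weak_deriv_L1(2)[OF w(1)]
  obtain k where k: "ae_eq w (\<lambda>x. k + prim u x)" using has_weak_deriv_rep[OF w(1)] by blast
  have iw: "integrable leb01 w" using wL by (simp add: L1_def)
  have in': "integrable leb01 (\<lambda>x. - w x)" using iw by simp
  have "\<exists>x\<in>{0..1}. 0 < k + prim u x"
  proof (rule ccontr)
    assume neg: "\<not> ?thesis"
    have "AE x in leb01. 0 \<le> - w x" using k AE_space unfolding ae_eq_def
    proof eventually_elim
      case (elim x)
      then have "\<not> 0 < k + prim u x" using neg by auto
      then show ?case using elim(1) by linarith
    qed
    then show False using integral_nonneg_eq_0_iff_AE[OF in'] z nz by (simp add: ae_eq_def)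
  qed
  then obtain x where x: "x \<in> {0..1}" "0 < k + prim u x" by blast
  have "\<exists>x\<in>{0..1}. k + prim u x < 0"
  proof (rule ccontr)
    assume neg: "\<not> ?thesis"
    have "AE x in leb01. 0 \<le> w x" using k AE_space unfolding ae_eq_def
      by eventually_elim (use neg in \<open>auto simp: not_less\<close>)
    then show False using integral_nonneg_eq_0_iff_AE[OF iw] z nz by (simp add: ae_eq_def)
  qed
  then obtain x' where x': "x' \<in> {0..1}" "0 < - k + prim (\<lambda>x. - u x) x'"
    using prim_cmult[of "-1" u] by force
  have wn: "has_weak_deriv (\<lambda>x. - w x) (\<lambda>x. - u x)" using has_weak_deriv_cmult[OF w(1), of "-1"] by simp
  have Ln: "ae_eq (L (\<lambda>x. - w x)) (\<lambda>x. - w x)"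
    using L_cmult[OF wL, of "-1"] w(2) unfolding ae_eq_def by (auto elim: eventually_elim2)
  have kn: "ae_eq (\<lambda>x. - w x) (\<lambda>x. - k + prim (\<lambda>x. - u x) x)"
    using k prim_cmult[of "-1" u] unfolding ae_eq_def by (auto elim!: eventually_mono)
  obtain y1 where y1: "y1 < a" "0 \<le> y1" "pos_on (\<lambda>x. max 0 (w x)) {y1..<a}"
    using invariant_W11_pos_near_cusp[OF w k x] by blast
  obtain y2 where y2: "y2 < a" "0 \<le> y2" "pos_on (\<lambda>x. max 0 (- w x)) {y2..<a}"
    using invariant_W11_pos_near_cusp[OF wn Ln kn x'] by blast
  \<comment> \<open>Both parts of \<open>w\<close> are positive just below \<open>a\<close>, yet at
    no point can both be positive.\<close>
  have "AE x in leb01. x \<notin> {max y1 y2..<a}"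
    using y1(3) y2(3) unfolding pos_on_def by eventually_elim auto
  then have "AE x in lebesgue. x \<notin> {max y1 y2<..<a}"
    using y1 y2 a_in by (auto simp: AE_restrict_space_iff elim!: eventually_mono)
  then have "negligible {max y1 y2<..<a}"
    unfolding negligible_iff_null_sets by (subst (asm) AE_iff_null_sets[symmetric]) auto
  then show False using negligible_interval(2)[of "max y1 y2" a] y1 y2 by (simp add: box_real)
qed

end

section \<open>Limits, Cauchy sequences and tails in the mean\<close>

lemma L1_norm_le_add:
  assumes "f \<in> L1" "g \<in> L1" "ae_eq F (\<lambda>x. f x + g x)"
  shows "L1_norm F \<le> L1_norm f + L1_norm g"
  using L1_norm_add[OF assms(1,2)] L1_norm_ae_eq[OF L1_add[OF assms(1,2)] ae_eq_sym[OF assms(3)]] by simp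

lemma L1_lim_unique:
  assumes f: "\<And>n. f n \<in> L1" and F: "F \<in> L1" "G \<in> L1"
    and l: "(\<lambda>n. L1_norm (\<lambda>x. f n x - F x)) \<longlonglongrightarrow> 0" "(\<lambda>n. L1_norm (\<lambda>x. f n x - G x)) \<longlonglongrightarrow> 0"
  shows "ae_eq F G"
proof -
  have "(\<lambda>n. L1_norm (\<lambda>x. f n x - F x) + L1_norm (\<lambda>x. f n x - G x)) \<longlonglongrightarrow> 0 + 0"
    by (intro tendsto_add l)
  moreover have "L1_norm (\<lambda>x. F x - G x) \<le> L1_norm (\<lambda>x. f n x - F x) + L1_norm (\<lambda>x. f n x - G x)" for n
    using L1_norm_triangle[OF F(1) f[of n] F(2)] L1_norm_minus_commute[of F "f n"] by simp
  ultimately have "L1_norm (\<lambda>x. F x - G x) \<le> 0"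
    by (intro LIMSEQ_le_const[of _ 0]) auto
  then have "L1_norm (\<lambda>x. F x - G x) = 0" using L1_norm_nonneg[of "\<lambda>x. F x - G x"] by linarith
  then show ?thesis using L1_norm_eq_0[OF L1_diff[OF F]] by (simp add: ae_eq_def)
qed

lemma L1_norm_diff_ge: "f \<in> L1 \<Longrightarrow> g \<in> L1 \<Longrightarrow> \<bar>L1_norm f - L1_norm g\<bar> \<le> L1_norm (\<lambda>x. f x - g x)"
  using L1_norm_le_add[of "\<lambda>x. f x - g x" g f] L1_norm_le_add[of "\<lambda>x. g x - f x" f g]
    L1_norm_minus_commute[of f g] by (fastforce simp: L1_diff)

lemma L1_norm_tendsto:
  assumes "\<And>n. f n \<in> L1" "F \<in> L1" "(\<lambda>n. L1_norm (\<lambda>x. f n x - F x)) \<longlonglongrightarrow> 0"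
  shows "(\<lambda>n. L1_norm (f n)) \<longlonglongrightarrow> L1_norm F"
  by (rule LIM_zero_cancel, rule Lim_null_comparison[OF always_eventually assms(3)])
    (use L1_norm_diff_ge assms in auto)

lemma L1_Cauchy_sum:
  assumes f: "\<And>n. f n \<in> L1" and C: "\<And>m n. L1_norm (\<lambda>x. f m x - f n x) \<le> E m + E n" and E: "E \<longlonglongrightarrow> 0"
  shows "\<exists>F\<in>L1. (\<lambda>n. L1_norm (\<lambda>x. f n x - F x)) \<longlonglongrightarrow> 0"
proof (rule L1_Cauchy[OF f])
  fix e :: real assume "e > 0"
  then have "eventually (\<lambda>n. E n < e / 2) sequentially" by (intro order_tendstoD(2)[OF E]) simp
  then obtain N where N: "\<And>n. n \<ge> N \<Longrightarrow> E n < e / 2" by (auto simp: eventually_sequentially)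
  show "\<exists>N. \<forall>m\<ge>N. \<forall>n\<ge>N. L1_norm (\<lambda>x. f m x - f n x) < e"
  proof (intro exI[of _ N] allI impI)
    fix m n assume "N \<le> m" "N \<le> n"
    then show "L1_norm (\<lambda>x. f m x - f n x) < e" using C[of m n] N[of m] N[of n] by linarith
  qed
qed

text \<open>The excess of \<open>f\<close> over a level \<open>n\<close> tends to 0 pointwise and is
  dominated by \<open>\<bar>f\<bar>\<close>. It is used to split the majorant of \<open>b\<close>
  into a bounded part and a part of small mass.\<close>

lemma L1_tail_small:
  assumes f: "f \<in> L1" and "\<eta> > 0"
  shows "\<exists>N\<ge>0. (\<lambda>x. max 0 (f x - N)) \<in> L1 \<and> L1_norm (\<lambda>x. max 0 (f x - N)) \<le> \<eta>"
proof -
  have m: "(\<lambda>x. max 0 (f x - real n)) \<in> borel_measurable leb01" for n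
    using L1_measurable[OF f] by measurable
  have b: "AE x in leb01. \<bar>max 0 (f x - real n)\<bar> \<le> \<bar>f x\<bar>" for n by (rule AE_I2) auto
  have conv: "AE x in leb01. (\<lambda>n. max 0 (f x - real n)) \<longlonglongrightarrow> 0"
  proof (rule AE_I2)
    fix x
    obtain N where N: "f x \<le> real N" using real_arch_simple by blast
    have "eventually (\<lambda>n. max 0 (f x - real n) = 0) sequentially"
      by (rule eventually_sequentiallyI[of N]) (use N in auto)
    then show "(\<lambda>n. max 0 (f x - real n)) \<longlonglongrightarrow> 0" by (rule tendsto_eventually)
  qed
  have "(\<lambda>n. L1_norm (\<lambda>x. max 0 (f x - real n) - 0)) \<longlonglongrightarrow> 0"
    by (rule L1_dct(2)[OF L1_abs[OF f] m conv]) (use b in auto)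
  then have "eventually (\<lambda>n. L1_norm (\<lambda>x. max 0 (f x - real n)) < \<eta>) sequentially"
    using assms(2) by (auto dest: order_tendstoD(2))
  then obtain n where n: "L1_norm (\<lambda>x. max 0 (f x - real n)) < \<eta>" by (auto simp: eventually_sequentially)
  moreover have "(\<lambda>x. max 0 (f x - real n)) \<in> L1" by (rule L1_dominated[OF f m b])
  ultimately show ?thesis by (intro exI[of _ "real n"]) auto
qed

section \<open>The Lasota--Yorke inequality\<close>

text \<open>The majorant of \<open>\<bar>b\<bar>\<close>, built from the constants alone, so that
  one truncation level serves every map with these constants.\<close>

definition ly_bound :: "real \<Rightarrow> real \<Rightarrow> real \<Rightarrow> real \<Rightarrow> real \<Rightarrow> real" where
  "ly_bound c \<beta> \<kappa> K x = K / \<kappa> ^ 2 * \<bar>x - c\<bar> powr (- 1 - \<beta>)"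

text \<open>Half of the contraction \<open>1 - 1 / \<theta>\<close> is kept, the other half pays for
  the excess of \<open>b\<close>: indeed
  \<open>1 / \<theta> + ly_gap \<theta> = 1 - ly_gap \<theta>\<close>.\<close>

definition ly_gap :: "real \<Rightarrow> real" where "ly_gap \<theta> = (1 - 1 / \<theta>) / 2"

definition ly_cut :: "real \<Rightarrow> real \<Rightarrow> real \<Rightarrow> real \<Rightarrow> real \<Rightarrow> real \<Rightarrow> bool" where
  "ly_cut c \<beta> \<theta> \<kappa> K N \<longleftrightarrow> N \<ge> 0 \<and> (\<lambda>x. max 0 (ly_bound c \<beta> \<kappa> K x - N)) \<in> L1 \<and>
     L1_norm (\<lambda>x. max 0 (ly_bound c \<beta> \<kappa> K x - N)) \<le> ly_gap \<theta>"

lemma ly_cut_exists: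
  assumes "\<beta> < 0" "1 < \<theta>" shows "\<exists>N. ly_cut c \<beta> \<theta> \<kappa> K N"
proof -
  have "ly_bound c \<beta> \<kappa> K \<in> L1" unfolding ly_bound_def[abs_def]
    by (intro L1_cmult powr_abs_L1) (use assms in auto)
  moreover have "ly_gap \<theta> > 0" using assms by (simp add: ly_gap_def)
  ultimately show ?thesis using L1_tail_small unfolding ly_cut_def by blast
qed

context cusp_map
begin

lemma gap_pos: "0 < ly_gap \<theta>" using theta by (simp add: ly_gap_def)

lemma gap_less: "ly_gap \<theta> < 1"
  using theta by (simp add: ly_gap_def field_simps)

lemma ly_cut_obtain: obtains N where "ly_cut c \<beta> \<theta> \<kappa> K N"
  using ly_cut_exists[of \<beta> \<theta> c \<kappa> K] beta theta by auto

lemma inverse_T1_Linf: "(\<lambda>x. 1 / T1 x ^ n) \<in> Linf"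
proof -
  have "continuous_on X (\<lambda>x. 1 / T1 x ^ n)" using T1_nz by (intro continuous_intros cont_X) auto
  moreover have "AE x in leb01. \<bar>1 / T1 x ^ n\<bar> \<le> 1"
    using AE_X
  proof eventually_elim
    case (elim x)
    then have "1 \<le> \<bar>T1 x\<bar> ^ n" using exp_abs[of x] theta by (intro one_le_power) auto
    moreover have "T1 x \<noteq> 0" by (rule T1_nz[OF elim])
    ultimately show ?case by (simp add: power_abs[symmetric] abs_divide divide_le_eq_1)
  qed
  ultimately show ?thesis using borel_measurable_off_point by (auto simp: Linf_def)
qed

lemma div_T1_L1: "f \<in> L1 \<Longrightarrow> (\<lambda>x. f x / T1 x ^ n) \<in> L1"
  using L1_mult_Linf[OF _ inverse_T1_Linf] by simp

lemma div_T1_norm: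
  assumes f: "f \<in> L1" and n: "0 < n" shows "L1_norm (\<lambda>x. f x / T1 x ^ n) \<le> L1_norm f / \<theta>"
proof -
  have "L1_norm (\<lambda>x. f x / T1 x ^ n) \<le> L1_norm (\<lambda>x. 1 / \<theta> * f x)"
  proof (rule L1_norm_mono[OF L1_cmult[OF f] div_T1_L1[OF f]])
    show "AE x in leb01. \<bar>f x / T1 x ^ n\<bar> \<le> \<bar>1 / \<theta> * f x\<bar>"
      using AE_X
    proof eventually_elim
      case (elim x)
      then have "\<theta> \<le> \<bar>T1 x\<bar>" by (rule exp_abs)
      moreover have "\<bar>T1 x\<bar> \<le> \<bar>T1 x\<bar> ^ n"
        using \<open>\<theta> \<le> \<bar>T1 x\<bar>\<close> theta n by (intro self_le_power) auto
      ultimately have "\<theta> \<le> \<bar>T1 x ^ n\<bar>" by (simp add: power_abs)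
      then have "\<bar>f x\<bar> / \<bar>T1 x ^ n\<bar> \<le> \<bar>f x\<bar> / \<theta>" using theta T1_nz[OF elim] by (intro divide_left_mono mult_pos_pos) auto
      then show ?case using theta by (simp add: abs_divide abs_mult)
    qed
  qed
  then show ?thesis using theta unfolding L1_norm_cmult by simp
qed

text \<open>\<open>\<bar>b\<bar>\<close> is at most \<open>N\<close> plus an excess of mass at most
  \<open>ly_gap \<theta>\<close>. The bounded part is charged to the mean norm of \<open>w\<close>,
  the excess to its supremum, which the Sobolev bound controls.\<close>

lemma b_mult_norm:
  assumes N: "ly_cut c \<beta> \<theta> \<kappa> K N" and w: "has_weak_deriv w u"
  shows "L1_norm (\<lambda>x. b x * w x) \<le> N * L1_norm w + ly_gap \<theta> * (L1_norm w + L1_norm u)"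
proof -
  define tl where "tl x = max 0 (ly_bound c \<beta> \<kappa> K x - N)" for x
  have N0: "N \<ge> 0" and tL: "tl \<in> L1" and tn: "L1_norm tl \<le> ly_gap \<theta>"
    using N by (auto simp: ly_cut_def tl_def[abs_def])
  define S where "S = L1_norm w + L1_norm u"
  have S0: "0 \<le> S" using L1_norm_nonneg[of w] L1_norm_nonneg[of u] by (simp add: S_def)
  note wL = has_weak_deriv_L1(1)[OF w]
  have g: "(\<lambda>x. N * \<bar>w x\<bar> + S * tl x) \<in> L1" by (intro L1_add L1_cmult L1_abs wL tL)
  have "L1_norm (\<lambda>x. b x * w x) \<le> L1_norm (\<lambda>x. N * \<bar>w x\<bar> + S * tl x)"
  proof (rule L1_norm_mono[OF g L_weak_deriv(3)[OF w]])
    show "AE x in leb01. \<bar>b x * w x\<bar> \<le> \<bar>N * \<bar>w x\<bar> + S * tl x\<bar>"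
      using AE_X has_weak_deriv_bound[OF w]
    proof eventually_elim
      case (elim x)
      have "\<bar>b x\<bar> \<le> N + tl x" using b_bound[OF elim(1)] unfolding tl_def ly_bound_def by linarith
      then have "\<bar>b x\<bar> * \<bar>w x\<bar> \<le> (N + tl x) * \<bar>w x\<bar>" by (rule mult_right_mono) simp
      moreover have "tl x * \<bar>w x\<bar> \<le> tl x * S" by (rule mult_left_mono) (use elim(2) in \<open>auto simp: S_def tl_def\<close>)
      ultimately show ?case by (simp add: abs_mult algebra_simps)
    qed
  qed
  also have "\<dots> \<le> L1_norm (\<lambda>x. N * \<bar>w x\<bar>) + L1_norm (\<lambda>x. S * tl x)"
    by (intro L1_norm_add L1_cmult L1_abs wL tL)
  also have "\<dots> = N * L1_norm w + S * L1_norm tl"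
    unfolding L1_norm_cmult using N0 S0 by (simp add: L1_norm_def)
  also have "\<dots> \<le> N * L1_norm w + S * ly_gap \<theta>" using S0 tn by (intro add_left_mono mult_left_mono)
  finally show ?thesis by (simp add: S_def mult.commute)
qed

lemma lasota_yorke:
  assumes N: "ly_cut c \<beta> \<theta> \<kappa> K N" and w: "has_weak_deriv w u"
  shows "L1_norm (L (\<lambda>x. u x / T1 x + b x * w x)) \<le> (1 - ly_gap \<theta>) * L1_norm u + (N + ly_gap \<theta>) * L1_norm w"
proof -
  note uL = has_weak_deriv_L1(2)[OF w]
  note L1s = L_weak_deriv(2,3)[OF w]
  have "L1_norm (L (\<lambda>x. u x / T1 x + b x * w x)) \<le> L1_norm (\<lambda>x. u x / T1 x + b x * w x)"
    by (intro L_norm L1_add L1s)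
  also have "\<dots> \<le> L1_norm (\<lambda>x. u x / T1 x) + L1_norm (\<lambda>x. b x * w x)" by (rule L1_norm_add[OF L1s])
  also have "\<dots> \<le> L1_norm u / \<theta> + (N * L1_norm w + ly_gap \<theta> * (L1_norm w + L1_norm u))"
    using div_T1_norm[OF uL, of 1] b_mult_norm[OF N w] by simp
  also have "\<dots> = (1 - ly_gap \<theta>) * L1_norm u + (N + ly_gap \<theta>) * L1_norm w"
  proof -
    have "1 / \<theta> = 1 - 2 * ly_gap \<theta>" using theta by (simp add: ly_gap_def field_simps)
    then have "L1_norm u / \<theta> = (1 - 2 * ly_gap \<theta>) * L1_norm u" by (metis divide_inverse inverse_eq_divide mult.commute)
    then show ?thesis by (simp add: algebra_simps)
  qed
  finally show ?thesis .
qed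

text \<open>The derivative \<open>u\<close> solves the differentiated equation, and the
  Lasota--Yorke inequality leaves a share \<open>ly_gap \<theta>\<close> of its norm on the left.
  The bound does not depend on \<open>l\<close>.\<close>

lemma fixed_point_bound:
  assumes N: "ly_cut c \<beta> \<theta> \<kappa> K N" and w: "has_weak_deriv w u" and r: "has_weak_deriv r s"
    and l: "0 \<le> l" "l \<le> 1" and eq: "ae_eq w (\<lambda>x. l * L w x + r x)"
  shows "L1_norm u \<le> ((N + 1) * L1_norm w + L1_norm s) / ly_gap \<theta>"
proof -
  have "has_weak_deriv w (\<lambda>x. l * L (\<lambda>x. u x / T1 x + b x * w x) x + s x)"
    using has_weak_deriv_cong[OF has_weak_deriv_add[OF has_weak_deriv_cmult[OF L_weak_deriv(1)[OF w], of l] r] ae_eq_sym[OF eq]]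
    by simp
  then have u: "ae_eq u (\<lambda>x. l * L (\<lambda>x. u x / T1 x + b x * w x) x + s x)"
    by (rule has_weak_deriv_ae_unique[OF w])
  have vL: "L (\<lambda>x. u x / T1 x + b x * w x) \<in> L1" by (intro L_L1 L1_add L_weak_deriv(2,3)[OF w])
  have "L1_norm u \<le> L1_norm (\<lambda>x. l * L (\<lambda>x. u x / T1 x + b x * w x) x) + L1_norm s"
    by (rule L1_norm_le_add[OF L1_cmult[OF vL] has_weak_deriv_L1(2)[OF r] u])
  also have "\<dots> \<le> L1_norm (L (\<lambda>x. u x / T1 x + b x * w x)) + L1_norm s"
    unfolding L1_norm_cmult using l L1_norm_nonneg by (simp add: mult_left_le_one_le)
  also have "\<dots> \<le> (1 - ly_gap \<theta>) * L1_norm u + (N + ly_gap \<theta>) * L1_norm w + L1_norm s"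
    using lasota_yorke[OF N w] by simp
  finally have "ly_gap \<theta> * L1_norm u \<le> (N + ly_gap \<theta>) * L1_norm w + L1_norm s" by (simp add: algebra_simps)
  moreover have "(N + ly_gap \<theta>) * L1_norm w \<le> (N + 1) * L1_norm w"
    using gap_less L1_norm_nonneg[of w] by (intro mult_right_mono) auto
  ultimately show ?thesis using gap_pos by (simp add: field_simps)
qed

section \<open>The resolvent\<close>

text \<open>\<open>(N + 1) / ly_gap \<theta> * L1_norm r\<close> is a fixed point of the
  Lasota--Yorke recursion, so the bound reproduces itself at each step.\<close>

lemma iterate_weak_deriv:
  assumes N: "ly_cut c \<beta> \<theta> \<kappa> K N" and r: "has_weak_deriv r s"
  shows "\<exists>D. has_weak_deriv ((L ^^ n) r) D \<and> L1_norm ((L ^^ n) r) \<le> L1_norm r \<and>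
     L1_norm D \<le> L1_norm s + (N + 1) / ly_gap \<theta> * L1_norm r"
proof (induction n)
  case 0
  have "N \<ge> 0" using N by (simp add: ly_cut_def)
  then have "0 \<le> (N + 1) / ly_gap \<theta> * L1_norm r" using gap_pos L1_norm_nonneg[of r] by simp
  then show ?case using r by (intro exI[of _ s]) auto
next
  case (Suc n)
  then obtain D where D: "has_weak_deriv ((L ^^ n) r) D" "L1_norm ((L ^^ n) r) \<le> L1_norm r"
    "L1_norm D \<le> L1_norm s + (N + 1) / ly_gap \<theta> * L1_norm r" by blast
  define D' where "D' = L (\<lambda>x. D x / T1 x + b x * (L ^^ n) r x)"
  have "L1_norm D' \<le> (1 - ly_gap \<theta>) * L1_norm D + (N + ly_gap \<theta>) * L1_norm ((L ^^ n) r)"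
    unfolding D'_def by (rule lasota_yorke[OF N D(1)])
  also have "\<dots> \<le> (1 - ly_gap \<theta>) * (L1_norm s + (N + 1) / ly_gap \<theta> * L1_norm r) + (N + 1) * L1_norm r"
    using N gap_less L1_norm_nonneg[of r] D(2,3) L1_norm_nonneg
    by (intro add_mono mult_mono) (auto simp: ly_cut_def)
  also have "\<dots> = (1 - ly_gap \<theta>) * L1_norm s + (N + 1) / ly_gap \<theta> * L1_norm r"
    using gap_pos by (simp add: field_simps)
  also have "\<dots> \<le> L1_norm s + (N + 1) / ly_gap \<theta> * L1_norm r"
    using gap_pos L1_norm_nonneg[of s] by (simp add: left_diff_distrib)
  finally have "L1_norm D' \<le> \<dots>" .
  moreover have "has_weak_deriv ((L ^^ Suc n) r) D'" unfolding D'_def using L_weak_deriv(1)[OF D(1)] by simp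
  moreover have "L1_norm ((L ^^ Suc n) r) \<le> L1_norm r"
    using L_norm[OF has_weak_deriv_L1(1)[OF D(1)]] D(2) by simp
  ultimately show ?case by blast
qed

text \<open>The Neumann series with terms \<open>l ^ n * (L ^^ n) r\<close>: the iterates and their
  weak derivatives are bounded in the mean, so \<open>l < 1\<close> makes both series
  converge.\<close>

lemma resolvent_exists:
  assumes r: "has_weak_deriv r s" and l: "0 \<le> l" "l < 1"
  shows "\<exists>w u. has_weak_deriv w u \<and> ae_eq w (\<lambda>x. l * L w x + r x)"
proof -
  obtain N where N: "ly_cut c \<beta> \<theta> \<kappa> K N" by (rule ly_cut_obtain)
  define B where "B = L1_norm s + (N + 1) / ly_gap \<theta> * L1_norm r"
  have "\<exists>D. \<forall>n. has_weak_deriv ((L ^^ n) r) (D n) \<and> L1_norm ((L ^^ n) r) \<le> L1_norm r \<and> L1_norm (D n) \<le> B"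
    using iterate_weak_deriv[OF N r] unfolding B_def by (intro choice) blast
  then obtain D where D: "\<And>n. has_weak_deriv ((L ^^ n) r) (D n)"
      "\<And>n. L1_norm ((L ^^ n) r) \<le> L1_norm r" "\<And>n. L1_norm (D n) \<le> B" by blast
  define f where "f n x = l ^ n * (L ^^ n) r x" for n x
  define g where "g n x = l ^ n * D n x" for n x
  have fw: "has_weak_deriv (f n) (g n)" for n
    unfolding f_def[abs_def] g_def[abs_def] by (rule has_weak_deriv_cmult[OF D(1)])
  have geo: "summable (\<lambda>n. l ^ n * M)" for M using l by (intro summable_mult2 summable_geometric) auto
  have sf: "summable (\<lambda>n. L1_norm (f n))"
    by (rule summable_comparison_test'[OF geo[of "L1_norm r"], of 0])
      (use D(2) l L1_norm_nonneg in \<open>auto simp: f_def[abs_def] L1_norm_cmult power_abs abs_mult intro!: mult_left_mono\<close>)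
  have sg: "summable (\<lambda>n. L1_norm (g n))"
    by (rule summable_comparison_test'[OF geo[of B], of 0])
      (use D(3) l L1_norm_nonneg in \<open>auto simp: g_def[abs_def] L1_norm_cmult power_abs abs_mult intro!: mult_left_mono\<close>)
  obtain F U where F: "has_weak_deriv F U" and lim: "(\<lambda>n. L1_norm (\<lambda>x. (\<Sum>k<n. f k x) - F x)) \<longlonglongrightarrow> 0"
    using has_weak_deriv_series[OF fw sf sg] by blast
  note FL = has_weak_deriv_L1(1)[OF F] and rL = has_weak_deriv_L1(1)[OF r] and fL = has_weak_deriv_L1(1)[OF fw]
  define S where "S n x = (\<Sum>k<n. f k x)" for n x
  have SL: "S n \<in> L1" for n unfolding S_def[abs_def] by (intro L1_sum fL)
  \<comment> \<open>Additivity of \<open>L\<close> holds only almost everywhere, so the shift of the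
    index is carried through the partial sums by induction.\<close>
  have rec: "ae_eq (S (Suc n)) (\<lambda>x. l * L (S n) x + r x)" for n
  proof (induction n)
    case 0
    have "ae_eq (L (\<lambda>x. 0)) (\<lambda>x. 0)" using L_cmult[OF L1_const[of 0], of 0] by simp
    then show ?case unfolding ae_eq_def by eventually_elim (simp add: S_def[abs_def] f_def)
  next
    case (Suc n)
    have S1: "S (Suc n) = (\<lambda>x. S n x + f n x)" "S (Suc (Suc n)) = (\<lambda>x. S (Suc n) x + f (Suc n) x)"
      by (auto simp: S_def)
    have "ae_eq (L (f n)) (\<lambda>x. l ^ n * L ((L ^^ n) r) x)"
      unfolding f_def[abs_def] by (rule L_cmult[OF has_weak_deriv_L1(1)[OF D(1)]])
    moreover have "ae_eq (L (S (Suc n))) (\<lambda>x. L (S n) x + L (f n) x)"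
      unfolding S1(1) by (rule L_add[OF SL fL])
    ultimately show ?case using Suc unfolding ae_eq_def S1(2)
      by eventually_elim (simp add: f_def algebra_simps)
  qed
  have SF: "(\<lambda>n. L1_norm (\<lambda>x. S n x - F x)) \<longlonglongrightarrow> 0" using lim by (simp add: S_def)
  have "ae_eq F (\<lambda>x. l * L F x + r x)"
  proof (rule L1_lim_unique[of "\<lambda>n. S (Suc n)"])
    show "S (Suc n) \<in> L1" for n by (rule SL)
    show "F \<in> L1" by (rule FL)
    show GL: "(\<lambda>x. l * L F x + r x) \<in> L1" by (intro L1_add L1_cmult L_L1 FL rL)
    show "(\<lambda>n. L1_norm (\<lambda>x. S (Suc n) x - F x)) \<longlonglongrightarrow> 0" using SF by (rule LIMSEQ_Suc)
    show "(\<lambda>n. L1_norm (\<lambda>x. S (Suc n) x - (l * L F x + r x))) \<longlonglongrightarrow> 0"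
    proof (rule Lim_null_comparison[OF always_eventually SF], intro allI)
      fix n
      have "ae_eq (\<lambda>x. S (Suc n) x - (l * L F x + r x)) (\<lambda>x. l * (L (S n) x - L F x))"
        using rec[of n] unfolding ae_eq_def by eventually_elim (simp add: algebra_simps)
      then have "L1_norm (\<lambda>x. S (Suc n) x - (l * L F x + r x)) = \<bar>l\<bar> * L1_norm (\<lambda>x. L (S n) x - L F x)"
        using L1_norm_ae_eq[OF L1_diff[OF SL GL]] by (simp add: L1_norm_cmult)
      also have "\<dots> \<le> L1_norm (\<lambda>x. L (S n) x - L F x)"
        using l L1_norm_nonneg by (simp add: mult_left_le_one_le)
      also have "\<dots> \<le> L1_norm (\<lambda>x. S n x - F x)" by (rule L_norm_diff[OF SL FL])
      finally show "norm (L1_norm (\<lambda>x. S (Suc n) x - (l * L F x + r x))) \<le> L1_norm (\<lambda>x. S n x - F x)"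
        using L1_norm_nonneg by simp
    qed
  qed
  then show ?thesis using F by blast
qed

end

section \<open>Compactness of approximate fixed points\<close>

lemma L1_norm_bounded_seq:
  assumes "\<And>n. f n \<in> L1" "F \<in> L1" "(\<lambda>n. L1_norm (\<lambda>x. f n x - F x)) \<longlonglongrightarrow> 0"
  obtains B where "\<And>n. L1_norm (f n) \<le> B"
proof -
  have "Bseq (\<lambda>n. L1_norm (f n))" by (rule convergent_imp_Bseq, rule convergentI, rule L1_norm_tendsto[OF assms])
  then obtain B where "\<And>n. norm (L1_norm (f n)) \<le> B" by (auto simp: Bseq_def)
  then have "L1_norm (f n) \<le> B" for n
    using order_trans[OF abs_ge_self, of "L1_norm (f n)" B] by simp
  then show ?thesis by (rule that)
qed

lemma L1_tendsto_scaled: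
  assumes f: "\<And>n. f n \<in> L1" "F \<in> L1" "(\<lambda>n. L1_norm (\<lambda>x. f n x - F x)) \<longlonglongrightarrow> 0"
    and t: "t \<longlonglongrightarrow> (t0::real)"
  shows "(\<lambda>n. L1_norm (\<lambda>x. t n * f n x - t0 * F x)) \<longlonglongrightarrow> 0"
proof (rule Lim_null_comparison[OF always_eventually])
  show "\<forall>n. norm (L1_norm (\<lambda>x. t n * f n x - t0 * F x))
      \<le> \<bar>t n\<bar> * L1_norm (\<lambda>x. f n x - F x) + \<bar>t n - t0\<bar> * L1_norm F"
  proof
    fix n
    have "L1_norm (\<lambda>x. t n * f n x - t0 * F x) \<le> L1_norm (\<lambda>x. t n * (f n x - F x)) + L1_norm (\<lambda>x. (t n - t0) * F x)"
    proof (rule L1_norm_le_add)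
      show "(\<lambda>x. t n * (f n x - F x)) \<in> L1" "(\<lambda>x. (t n - t0) * F x) \<in> L1"
        by (intro L1_cmult L1_diff f)+
    qed (simp add: algebra_simps)
    then show "norm (L1_norm (\<lambda>x. t n * f n x - t0 * F x))
      \<le> \<bar>t n\<bar> * L1_norm (\<lambda>x. f n x - F x) + \<bar>t n - t0\<bar> * L1_norm F"
      using L1_norm_nonneg unfolding L1_norm_cmult by simp
  qed
  have "(\<lambda>n. \<bar>t n\<bar> * L1_norm (\<lambda>x. f n x - F x) + \<bar>t n - t0\<bar> * L1_norm F) \<longlonglongrightarrow> \<bar>t0\<bar> * 0 + \<bar>t0 - t0\<bar> * L1_norm F"
    by (intro tendsto_intros f(3) t)
  then show "(\<lambda>n. \<bar>t n\<bar> * L1_norm (\<lambda>x. f n x - F x) + \<bar>t n - t0\<bar> * L1_norm F) \<longlonglongrightarrow> 0" by simp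
qed

lemma L1_tendsto_add:
  assumes f: "\<And>n. f n \<in> L1" "F \<in> L1" "(\<lambda>n. L1_norm (\<lambda>x. f n x - F x)) \<longlonglongrightarrow> 0"
    and g: "\<And>n. g n \<in> L1" "G \<in> L1" "(\<lambda>n. L1_norm (\<lambda>x. g n x - G x)) \<longlonglongrightarrow> 0"
  shows "(\<lambda>n. L1_norm (\<lambda>x. (f n x + g n x) - (F x + G x))) \<longlonglongrightarrow> 0"
proof (rule Lim_null_comparison[OF always_eventually])
  show "\<forall>n. norm (L1_norm (\<lambda>x. (f n x + g n x) - (F x + G x)))
      \<le> L1_norm (\<lambda>x. f n x - F x) + L1_norm (\<lambda>x. g n x - G x)"
  proof
    fix n
    have "L1_norm (\<lambda>x. (f n x + g n x) - (F x + G x)) \<le> L1_norm (\<lambda>x. f n x - F x) + L1_norm (\<lambda>x. g n x - G x)"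
      by (rule L1_norm_le_add) (auto intro: L1_diff f g simp: algebra_simps)
    then show "norm (L1_norm (\<lambda>x. (f n x + g n x) - (F x + G x)))
      \<le> L1_norm (\<lambda>x. f n x - F x) + L1_norm (\<lambda>x. g n x - G x)"
      using L1_norm_nonneg by simp
  qed
  show "(\<lambda>n. L1_norm (\<lambda>x. f n x - F x) + L1_norm (\<lambda>x. g n x - G x)) \<longlonglongrightarrow> 0"
    using tendsto_add[OF f(3) g(3)] by simp
qed

lemma L1_null_scaled:
  assumes f: "\<And>n. L1_norm (f n) \<le> B" and t: "t \<longlonglongrightarrow> (0::real)"
  shows "(\<lambda>n. L1_norm (\<lambda>x. t n * f n x)) \<longlonglongrightarrow> 0"
proof (rule Lim_null_comparison[OF always_eventually])
  show "\<forall>n. norm (L1_norm (\<lambda>x. t n * f n x)) \<le> \<bar>t n\<bar> * B"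
  proof
    fix n
    have "\<bar>t n\<bar> * L1_norm (f n) \<le> \<bar>t n\<bar> * B" by (rule mult_left_mono[OF f]) simp
    then show "norm (L1_norm (\<lambda>x. t n * f n x)) \<le> \<bar>t n\<bar> * B"
      unfolding L1_norm_cmult using L1_norm_nonneg[of "f n"] by simp
  qed
  show "(\<lambda>n. \<bar>t n\<bar> * B) \<longlonglongrightarrow> 0" by (rule tendsto_mult_left_zero[OF tendsto_rabs_zero[OF t]])
qed

text \<open>The last clause admits unbounded multipliers such as \<open>b\<close>: the Sobolev bound
  makes the sequence uniformly bounded, so \<open>2 * C * \<bar>g\<bar>\<close> dominates the
  products.\<close>

lemma rellich_L1:
  assumes w: "\<And>n. has_weak_deriv (f n) (u n)" and b: "\<And>n. L1_norm (f n) \<le> C" "\<And>n. L1_norm (u n) \<le> C"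
  shows "\<exists>s F. strict_mono (s :: nat \<Rightarrow> nat) \<and> F \<in> L1 \<and> (\<lambda>n. L1_norm (\<lambda>x. f (s n) x - F x)) \<longlonglongrightarrow> 0 \<and>
    (\<forall>g\<in>L1. (\<lambda>x. g x * F x) \<in> L1 \<and> (\<lambda>n. L1_norm (\<lambda>x. g x * f (s n) x - g x * F x)) \<longlonglongrightarrow> 0)"
proof -
  obtain s F where s: "strict_mono (s :: nat \<Rightarrow> nat)" and Fm: "F \<in> borel_measurable leb01"
    and ae: "AE x in leb01. (\<lambda>n. f (s n) x) \<longlonglongrightarrow> F x" using rellich[of f u C, OF w b] by blast
  have bd: "AE x in leb01. \<bar>f n x\<bar> \<le> 2 * C" for n
    using has_weak_deriv_bound[OF w[of n]] by eventually_elim (use b[of n] in linarith)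
  have fm: "f n \<in> borel_measurable leb01" for n using has_weak_deriv_L1(1)[OF w] by (rule L1_measurable)
  have A: "(\<lambda>x. g x * F x) \<in> L1" "(\<lambda>n. L1_norm (\<lambda>x. g x * f (s n) x - g x * F x)) \<longlonglongrightarrow> 0" if g: "g \<in> L1" for g
  proof -
    have gm: "g \<in> borel_measurable leb01" by (rule L1_measurable[OF g])
    have d: "(\<lambda>x. 2 * C * \<bar>g x\<bar>) \<in> L1" by (intro L1_cmult L1_abs g)
    have m: "(\<lambda>x. g x * f (s n) x) \<in> borel_measurable leb01" for n using gm fm by measurable
    have c: "AE x in leb01. (\<lambda>n. g x * f (s n) x) \<longlonglongrightarrow> g x * F x"
      using ae by eventually_elim (intro tendsto_intros)
    have bb: "AE x in leb01. \<bar>g x * f (s n) x\<bar> \<le> 2 * C * \<bar>g x\<bar>" for n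
      using bd[of "s n"] by eventually_elim (auto simp: abs_mult mult.commute[of "2 * C"] intro!: mult_left_mono)
    have mm: "(\<lambda>x. g x * F x) \<in> borel_measurable leb01" using gm Fm by measurable
    show "(\<lambda>x. g x * F x) \<in> L1" "(\<lambda>n. L1_norm (\<lambda>x. g x * f (s n) x - g x * F x)) \<longlonglongrightarrow> 0"
      by (rule L1_dct[OF d m c bb mm])+
  qed
  show ?thesis using s A A[OF L1_const[of 1]] by (intro exI[of _ s] exI[of _ F]) auto
qed

context cusp_map
begin

text \<open>Compactness yields convergence of a subsequence of \<open>w\<close> in the mean. Its
  derivatives then converge too: they solve \<open>u = L (u / T1 + b w) + s\<close>, where the first
  term contracts differences by \<open>1 / \<theta>\<close> and the other two converge. Hence the
  limit lies in \<open>W11\<close> and is not merely of bounded variation.\<close>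

lemma fixed_point_compactness:
  assumes w: "\<And>n. has_weak_deriv (w n) (u n)" and r: "\<And>n. has_weak_deriv (r n) (s n)"
    and eq: "\<And>n. ae_eq (w n) (\<lambda>x. L (w n) x + r n x)" and C: "\<And>n. L1_norm (w n) \<le> C"
    and R: "has_weak_deriv R S" and rR: "(\<lambda>n. L1_norm (\<lambda>x. r n x - R x)) \<longlonglongrightarrow> 0"
    and sS: "(\<lambda>n. L1_norm (\<lambda>x. s n x - S x)) \<longlonglongrightarrow> 0"
  shows "\<exists>\<sigma> W U. strict_mono (\<sigma> :: nat \<Rightarrow> nat) \<and> has_weak_deriv W U \<and> ae_eq W (\<lambda>x. L W x + R x) \<and>
    (\<lambda>n. L1_norm (\<lambda>x. w (\<sigma> n) x - W x)) \<longlonglongrightarrow> 0"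
proof -
  obtain N where N: "ly_cut c \<beta> \<theta> \<kappa> K N" by (rule ly_cut_obtain)
  note wL = has_weak_deriv_L1[OF w] and rL = has_weak_deriv_L1[OF r] and RL = has_weak_deriv_L1[OF R]
  obtain B where B: "\<And>n. L1_norm (s n) \<le> B" by (rule L1_norm_bounded_seq[of s S, OF rL(2) RL(2) sS]) (rule that)
  define C' where "C' = max C (((N + 1) * C + B) / ly_gap \<theta>)"
  have uC: "L1_norm (u n) \<le> C'" for n
  proof -
    have "L1_norm (u n) \<le> ((N + 1) * L1_norm (w n) + L1_norm (s n)) / ly_gap \<theta>"
      by (rule fixed_point_bound[OF N w r, of 1]) (use eq in auto)
    also have "\<dots> \<le> ((N + 1) * C + B) / ly_gap \<theta>"
      using N gap_pos C[of n] B[of n] by (intro divide_right_mono add_mono mult_left_mono) (auto simp: ly_cut_def)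
    finally show ?thesis by (simp add: C'_def)
  qed
  have wC: "L1_norm (w n) \<le> C'" for n using C[of n] by (simp add: C'_def)
  obtain \<sigma> W where \<sigma>: "strict_mono (\<sigma> :: nat \<Rightarrow> nat)" and WL: "W \<in> L1"
    and conv: "(\<lambda>n. L1_norm (\<lambda>x. w (\<sigma> n) x - W x)) \<longlonglongrightarrow> 0"
    and gc: "\<And>g. g \<in> L1 \<Longrightarrow> (\<lambda>x. g x * W x) \<in> L1"
      "\<And>g. g \<in> L1 \<Longrightarrow> (\<lambda>n. L1_norm (\<lambda>x. g x * w (\<sigma> n) x - g x * W x)) \<longlonglongrightarrow> 0"
    using rellich_L1[of w u C', OF w wC uC] by blast
  have sub: "(\<lambda>n. X (\<sigma> n)) \<longlonglongrightarrow> l" if "X \<longlonglongrightarrow> l" for X :: "nat \<Rightarrow> real" and l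
    using LIMSEQ_subseq_LIMSEQ[OF that \<sigma>] by (simp add: comp_def)
  have bwL: "(\<lambda>x. b x * w n x) \<in> L1" for n by (rule L_weak_deriv(3)[OF w])
  have bWL: "(\<lambda>x. b x * W x) \<in> L1" by (rule gc(1)[OF b_L1])
  define z where "z n x = u n x / T1 x + b x * w n x" for n x
  have zL: "z n \<in> L1" for n unfolding z_def[abs_def] by (intro L1_add L_weak_deriv(2)[OF w] bwL)
  have ueq: "ae_eq (u n) (\<lambda>x. L (z n) x + s n x)" for n
    unfolding z_def[abs_def]
    by (rule has_weak_deriv_ae_unique[OF w
          has_weak_deriv_cong[OF has_weak_deriv_add[OF L_weak_deriv(1)[OF w] r] ae_eq_sym[OF eq] ae_eq_refl]])
  \<comment> \<open>The denominator comes from moving \<open>L1_norm D / \<theta>\<close> to the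
    left-hand side.\<close>
  define E where "E n = (L1_norm (\<lambda>x. b x * w (\<sigma> n) x - b x * W x) + L1_norm (\<lambda>x. s (\<sigma> n) x - S x)) / (1 - 1 / \<theta>)" for n
  have t1: "0 < 1 - 1 / \<theta>" using theta by simp
  have E0: "E \<longlonglongrightarrow> 0"
  proof -
    have "(\<lambda>n. L1_norm (\<lambda>x. b x * w (\<sigma> n) x - b x * W x) + L1_norm (\<lambda>x. s (\<sigma> n) x - S x)) \<longlonglongrightarrow> 0"
      using tendsto_add[OF gc(2)[OF b_L1] sub[OF sS]] by simp
    then show ?thesis unfolding E_def by (rule tendsto_divide_zero)
  qed
  have cau: "L1_norm (\<lambda>x. u (\<sigma> m) x - u (\<sigma> n) x) \<le> E m + E n" for m n
  proof -
    let ?m = "\<sigma> m" and ?n = "\<sigma> n"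
    define D where "D x = u ?m x - u ?n x" for x
    have DL: "D \<in> L1" unfolding D_def[abs_def] by (intro L1_diff wL)
    have b3: "L1_norm (\<lambda>x. f ?m x - f ?n x) \<le> L1_norm (\<lambda>x. f ?m x - F x) + L1_norm (\<lambda>x. f ?n x - F x)"
      if "\<And>n. f n \<in> L1" "F \<in> L1" for f and F :: "real \<Rightarrow> real"
      using L1_norm_triangle[of "f ?m" F "f ?n"] L1_norm_minus_commute[of F "f ?n"] that by simp
    have "L1_norm D \<le> L1_norm (\<lambda>x. L (z ?m) x - L (z ?n) x) + L1_norm (\<lambda>x. s ?m x - s ?n x)"
    proof (rule L1_norm_le_add)
      show "(\<lambda>x. L (z ?m) x - L (z ?n) x) \<in> L1" "(\<lambda>x. s ?m x - s ?n x) \<in> L1" by (intro L1_diff L_L1 zL rL)+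
      show "ae_eq D (\<lambda>x. (L (z ?m) x - L (z ?n) x) + (s ?m x - s ?n x))"
        using ueq[of ?m] ueq[of ?n] unfolding ae_eq_def D_def by eventually_elim simp
    qed
    also have "L1_norm (\<lambda>x. L (z ?m) x - L (z ?n) x) \<le> L1_norm (\<lambda>x. z ?m x - z ?n x)" by (rule L_norm_diff[OF zL zL])
    also have "L1_norm (\<lambda>x. z ?m x - z ?n x) \<le> L1_norm (\<lambda>x. D x / T1 x ^ 1) + L1_norm (\<lambda>x. b x * w ?m x - b x * w ?n x)"
      by (rule L1_norm_le_add[OF div_T1_L1[OF DL] L1_diff[OF bwL bwL]]) (simp add: z_def D_def diff_divide_distrib ae_eq_def)
    also have "L1_norm (\<lambda>x. D x / T1 x ^ 1) \<le> L1_norm D / \<theta>" by (rule div_T1_norm[OF DL]) simp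
    also have "L1_norm (\<lambda>x. b x * w ?m x - b x * w ?n x) \<le> L1_norm (\<lambda>x. b x * w ?m x - b x * W x) + L1_norm (\<lambda>x. b x * w ?n x - b x * W x)"
      by (rule b3[of "\<lambda>n x. b x * w n x"]) (intro bwL bWL)+
    also have "L1_norm (\<lambda>x. s ?m x - s ?n x) \<le> L1_norm (\<lambda>x. s ?m x - S x) + L1_norm (\<lambda>x. s ?n x - S x)"
      by (rule b3) (intro rL RL)+
    finally have "L1_norm D * (1 - 1 / \<theta>) \<le> (L1_norm (\<lambda>x. b x * w ?m x - b x * W x) + L1_norm (\<lambda>x. s ?m x - S x))
       + (L1_norm (\<lambda>x. b x * w ?n x - b x * W x) + L1_norm (\<lambda>x. s ?n x - S x))"
      by (simp add: algebra_simps)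
    then have "L1_norm D \<le> E m + E n"
      unfolding E_def add_divide_distrib[symmetric] using t1 by (simp add: pos_le_divide_eq)
    then show ?thesis by (simp add: D_def[abs_def])
  qed
  obtain U where UL: "U \<in> L1" and U: "(\<lambda>n. L1_norm (\<lambda>x. u (\<sigma> n) x - U x)) \<longlonglongrightarrow> 0"
    using L1_Cauchy_sum[of "\<lambda>n. u (\<sigma> n)" E, OF wL(2) cau E0] by blast
  have "has_weak_deriv W U" by (rule has_weak_deriv_limit[OF w WL UL conv U])
  moreover have "ae_eq W (\<lambda>x. L W x + R x)"
  proof (rule L1_lim_unique[OF wL(1) WL _ conv])
    show GL: "(\<lambda>x. L W x + R x) \<in> L1" by (intro L1_add L_L1 WL RL)
    have "(\<lambda>n. L1_norm (\<lambda>x. L (w (\<sigma> n)) x - L W x)) \<longlonglongrightarrow> 0"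
      by (rule Lim_null_comparison[OF always_eventually conv])
        (use L_norm_diff[OF wL(1) WL] L1_norm_nonneg in auto)
    from L1_tendsto_add[OF L_L1[OF wL(1)] L_L1[OF WL] this rL(1) RL(1) sub[OF rR]]
    have "(\<lambda>n. L1_norm (\<lambda>x. (L (w (\<sigma> n)) x + r (\<sigma> n) x) - (L W x + R x))) \<longlonglongrightarrow> 0" .
    moreover have "L1_norm (\<lambda>x. w (\<sigma> n) x - (L W x + R x)) = L1_norm (\<lambda>x. (L (w (\<sigma> n)) x + r (\<sigma> n) x) - (L W x + R x))" for n
      by (rule L1_norm_ae_eq[OF L1_diff[OF wL(1) GL]])
        (use eq[of "\<sigma> n"] in \<open>auto simp: ae_eq_def elim: eventually_mono\<close>)
    ultimately show "(\<lambda>n. L1_norm (\<lambda>x. w (\<sigma> n) x - (L W x + R x))) \<longlonglongrightarrow> 0" by simp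
  qed
  ultimately show ?thesis using \<sigma> conv by blast
qed

text \<open>The solutions \<open>w n\<close> are normalised by \<open>t n = 1 / max 1 \<parallel>w n\<parallel>\<close>. If \<open>t n\<close> accumulated at \<open>0\<close>, the limit
  would be an invariant function of norm \<open>1\<close> and mean \<open>0\<close>.\<close>

lemma solve_limit:
  assumes w: "\<And>n. has_weak_deriv (w n) (u n)" and r: "\<And>n. has_weak_deriv (r n) (s n)"
    and l: "\<And>n. 0 \<le> l n" "\<And>n. l n \<le> 1" "l \<longlonglongrightarrow> (1::real)"
    and eq: "\<And>n. ae_eq (w n) (\<lambda>x. l n * L (w n) x + r n x)" and J: "\<And>n. (LINT x|leb01. w n x) = J"
    and R: "has_weak_deriv R S" and rR: "(\<lambda>n. L1_norm (\<lambda>x. r n x - R x)) \<longlonglongrightarrow> 0"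
    and sS: "(\<lambda>n. L1_norm (\<lambda>x. s n x - S x)) \<longlonglongrightarrow> 0"
  shows "\<exists>W U. has_weak_deriv W U \<and> ae_eq W (\<lambda>x. L W x + R x) \<and> (LINT x|leb01. W x) = J"
proof -
  obtain N where N: "ly_cut c \<beta> \<theta> \<kappa> K N" by (rule ly_cut_obtain)
  then have N0: "N \<ge> 0" by (simp add: ly_cut_def)
  note wL = has_weak_deriv_L1[OF w] and rL = has_weak_deriv_L1[OF r] and RL = has_weak_deriv_L1[OF R]
  obtain B where B: "\<And>n. L1_norm (s n) \<le> B" by (rule L1_norm_bounded_seq[of s S, OF rL(2) RL(2) sS]) (rule that)
  define t where "t n = 1 / max 1 (L1_norm (w n))" for n
  have t01: "t n \<in> {0..1}" for n by (auto simp: t_def divide_le_eq_1)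
  obtain t0 \<rho> where t0: "t0 \<in> {0..1}" and \<rho>: "strict_mono (\<rho> :: nat \<Rightarrow> nat)" and tlim: "(t \<circ> \<rho>) \<longlonglongrightarrow> t0"
    using compact_Icc[of "0::real" 1] t01 unfolding compact_def by metis
  have sub: "(\<lambda>n. X (\<rho> n)) \<longlonglongrightarrow> m" if "X \<longlonglongrightarrow> m" for X :: "nat \<Rightarrow> real" and m
    using LIMSEQ_subseq_LIMSEQ[OF that \<rho>] by (simp add: comp_def)
  have tl: "(\<lambda>n. t (\<rho> n)) \<longlonglongrightarrow> t0" using tlim by (simp add: comp_def)
  define w' where "w' n x = t (\<rho> n) * w (\<rho> n) x" for n x
  define u' where "u' n x = t (\<rho> n) * u (\<rho> n) x" for n x
  define r' where "r' n x = t (\<rho> n) * r (\<rho> n) x" for n x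
  define s' where "s' n x = t (\<rho> n) * s (\<rho> n) x" for n x
  have w'w: "has_weak_deriv (w' n) (u' n)" for n
    unfolding w'_def[abs_def] u'_def[abs_def] by (rule has_weak_deriv_cmult[OF w])
  have r'w: "has_weak_deriv (r' n) (s' n)" for n
    unfolding r'_def[abs_def] s'_def[abs_def] by (rule has_weak_deriv_cmult[OF r])
  have w'n: "L1_norm (w' n) = t (\<rho> n) * L1_norm (w (\<rho> n))" for n
    unfolding w'_def[abs_def] L1_norm_cmult using t01[of "\<rho> n"] by simp
  have w'1: "L1_norm (w' n) \<le> 1" for n
    unfolding w'n t_def using L1_norm_nonneg[of "w (\<rho> n)"] by (auto simp: divide_le_eq_1)
  have s'B: "L1_norm (s' n) \<le> B" for n
  proof -
    have "L1_norm (s' n) \<le> L1_norm (s (\<rho> n))"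
      unfolding s'_def[abs_def] L1_norm_cmult using t01[of "\<rho> n"] L1_norm_nonneg by (auto intro: mult_left_le_one_le)
    then show ?thesis using B[of "\<rho> n"] by simp
  qed
  have eq': "ae_eq (w' n) (\<lambda>x. l (\<rho> n) * L (w' n) x + r' n x)" for n
    using eq[of "\<rho> n"] L_cmult[OF wL(1)[of "\<rho> n"], of "t (\<rho> n)"]
    unfolding ae_eq_def w'_def[abs_def] r'_def by eventually_elim (simp add: algebra_simps)
  define v where "v n = L (\<lambda>x. u' n x / T1 x + b x * w' n x)" for n
  have Lw: "has_weak_deriv (L (w' n)) (v n)" for n unfolding v_def by (rule L_weak_deriv(1)[OF w'w])
  define Cu where "Cu = ((N + 1) * 1 + B) / ly_gap \<theta>"
  have u'C: "L1_norm (u' n) \<le> Cu" for n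
  proof -
    have "L1_norm (u' n) \<le> ((N + 1) * L1_norm (w' n) + L1_norm (s' n)) / ly_gap \<theta>"
      by (rule fixed_point_bound[OF N w'w r'w _ _ eq']) (use l in auto)
    also have "\<dots> \<le> Cu" unfolding Cu_def
      using N0 gap_pos w'1[of n] s'B[of n] by (intro divide_right_mono add_mono mult_left_mono) auto
    finally show ?thesis .
  qed
  have vC: "L1_norm (v n) \<le> Cu + (N + 1)" for n
  proof -
    have "L1_norm (v n) \<le> (1 - ly_gap \<theta>) * L1_norm (u' n) + (N + ly_gap \<theta>) * L1_norm (w' n)"
      unfolding v_def by (rule lasota_yorke[OF N w'w])
    also have "\<dots> \<le> 1 * L1_norm (u' n) + (N + 1) * 1"
      using N0 gap_pos gap_less w'1[of n] L1_norm_nonneg by (intro add_mono mult_mono) auto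
    finally show ?thesis using u'C[of n] by simp
  qed
  have LwC: "L1_norm (L (w' n)) \<le> 1" for n
    using L_norm[OF has_weak_deriv_L1(1)[OF w'w]] w'1[of n] order_trans by blast
  \<comment> \<open>The factor \<open>l\<close> is moved into the source, which gains the term
    \<open>q n * L (w' n)\<close>. This term tends to 0 together with its derivative, because
    \<open>L (w' n)\<close> is bounded in \<open>W11\<close>.\<close>
  define q where "q n = l (\<rho> n) - 1" for n
  have q0: "q \<longlonglongrightarrow> 0" unfolding q_def using sub[OF l(3)] LIM_zero by blast
  define r'' where "r'' n x = r' n x + q n * L (w' n) x" for n x
  define s'' where "s'' n x = s' n x + q n * v n x" for n x
  have r''w: "has_weak_deriv (r'' n) (s'' n)" for n
    unfolding r''_def[abs_def] s''_def[abs_def] by (intro has_weak_deriv_add r'w has_weak_deriv_cmult Lw)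
  have eq'': "ae_eq (w' n) (\<lambda>x. L (w' n) x + r'' n x)" for n
    using eq'[of n] unfolding ae_eq_def r''_def q_def by eventually_elim (simp add: algebra_simps)
  have Rt: "has_weak_deriv (\<lambda>x. t0 * R x) (\<lambda>x. t0 * S x)" by (rule has_weak_deriv_cmult[OF R])
  note lims = L1_tendsto_add[OF _ _ _ _ L1_const[of 0]]
  have r''R: "(\<lambda>n. L1_norm (\<lambda>x. r'' n x - t0 * R x)) \<longlonglongrightarrow> 0"
  proof -
    have 1: "(\<lambda>n. L1_norm (\<lambda>x. r' n x - t0 * R x)) \<longlonglongrightarrow> 0"
      unfolding r'_def by (rule L1_tendsto_scaled[OF rL(1) RL(1) sub[OF rR] tl])
    have 2: "(\<lambda>n. L1_norm (\<lambda>x. q n * L (w' n) x - 0)) \<longlonglongrightarrow> 0"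
      using L1_null_scaled[OF LwC q0] by simp
    show ?thesis unfolding r''_def
      using lims[OF has_weak_deriv_L1(1)[OF r'w] has_weak_deriv_L1(1)[OF Rt] 1 _ 2]
        L1_cmult[OF has_weak_deriv_L1(1)[OF Lw]] by simp
  qed
  have s''S: "(\<lambda>n. L1_norm (\<lambda>x. s'' n x - t0 * S x)) \<longlonglongrightarrow> 0"
  proof -
    have 1: "(\<lambda>n. L1_norm (\<lambda>x. s' n x - t0 * S x)) \<longlonglongrightarrow> 0"
      unfolding s'_def by (rule L1_tendsto_scaled[OF rL(2) RL(2) sub[OF sS] tl])
    have 2: "(\<lambda>n. L1_norm (\<lambda>x. q n * v n x - 0)) \<longlonglongrightarrow> 0"
      using L1_null_scaled[OF vC q0] by simp
    show ?thesis unfolding s''_def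
      using lims[OF has_weak_deriv_L1(2)[OF r'w] has_weak_deriv_L1(2)[OF Rt] 1 _ 2]
        L1_cmult[OF has_weak_deriv_L1(2)[OF Lw]] by simp
  qed
  obtain \<sigma> W U where \<sigma>: "strict_mono (\<sigma> :: nat \<Rightarrow> nat)" and W: "has_weak_deriv W U"
    and Weq: "ae_eq W (\<lambda>x. L W x + t0 * R x)" and lim: "(\<lambda>n. L1_norm (\<lambda>x. w' (\<sigma> n) x - W x)) \<longlonglongrightarrow> 0"
    using fixed_point_compactness[of w' u' r'' s'' 1, OF w'w r''w eq'' w'1 Rt r''R s''S] by blast
  note WL = has_weak_deriv_L1(1)[OF W] and w'L = has_weak_deriv_L1(1)[OF w'w]
  have tls: "(\<lambda>n. t (\<rho> (\<sigma> n))) \<longlonglongrightarrow> t0" using LIMSEQ_subseq_LIMSEQ[OF tl \<sigma>] by (simp add: comp_def)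
  have "(LINT x|leb01. w' n x) = t (\<rho> n) * J" for n unfolding w'_def J[of "\<rho> n", symmetric] by simp
  then have "(\<lambda>n. t (\<rho> (\<sigma> n)) * J) \<longlonglongrightarrow> (LINT x|leb01. W x)"
    using LINT_tendsto1[OF w'L WL lim] by simp
  moreover have "(\<lambda>n. t (\<rho> (\<sigma> n)) * J) \<longlonglongrightarrow> t0 * J" by (intro tendsto_intros tls)
  ultimately have JW: "(LINT x|leb01. W x) = t0 * J" by (rule LIMSEQ_unique)
  have "t0 \<noteq> 0"
  proof
    assume z: "t0 = 0"
    \<comment> \<open>Where \<open>t < 1\<close> the norm of \<open>w\<close> exceeds 1, so the
      normalised norm is exactly 1; this value passes to the limit.\<close>
    have "eventually (\<lambda>n. t (\<rho> (\<sigma> n)) < 1) sequentially" using order_tendstoD(2)[OF tls, of 1] z by simp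
    then have "eventually (\<lambda>n. L1_norm (w' (\<sigma> n)) = 1) sequentially"
    proof eventually_elim
      case (elim n)
      then have "L1_norm (w (\<rho> (\<sigma> n))) > 1" unfolding t_def by (auto simp: divide_less_eq_1 max_def split: if_splits)
      then show ?case unfolding w'n t_def by simp
    qed
    then have "(\<lambda>n. L1_norm (w' (\<sigma> n))) \<longlonglongrightarrow> 1" by (rule tendsto_eventually)
    then have W1: "L1_norm W = 1" using L1_norm_tendsto[OF w'L WL lim] LIMSEQ_unique by blast
    have "ae_eq W (\<lambda>x. 0)"
      by (rule invariant_W11_zero[OF W]) (use Weq z JW in \<open>auto simp: ae_eq_def elim: eventually_mono\<close>)
    then have "L1_norm W = 0" using L1_norm_ae_eq[OF WL] L1_norm_const[of 0] by simp
    then show False using W1 by simp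
  qed
  define V where "V x = 1 / t0 * W x" for x
  have "has_weak_deriv V (\<lambda>x. 1 / t0 * U x)" unfolding V_def[abs_def] by (rule has_weak_deriv_cmult[OF W])
  moreover have "ae_eq V (\<lambda>x. L V x + R x)"
    using Weq L_cmult[OF WL, of "1 / t0"] unfolding ae_eq_def V_def[abs_def]
    by eventually_elim (use \<open>t0 \<noteq> 0\<close> in \<open>simp add: field_simps\<close>)
  moreover have "(LINT x|leb01. V x) = J" unfolding V_def using JW \<open>t0 \<noteq> 0\<close> by simp
  ultimately show ?thesis by blast
qed

text \<open>\<open>L\<close> preserves the integral, so the equation forces \<open>1 - l n\<close>
  times the integral of \<open>w n\<close> to be the integral of \<open>r n\<close>. The factors
  start at \<open>l 0 = 0\<close> and increase to 1.\<close>

lemma resolvent_seq: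
  assumes r: "\<And>n. has_weak_deriv (r n) (s n)"
  defines "l \<equiv> \<lambda>n. 1 - inverse (real (Suc n))"
  obtains w u where "\<And>n. has_weak_deriv (w n) (u n)" "\<And>n. ae_eq (w n) (\<lambda>x. l n * L (w n) x + r n x)"
    "\<And>n. (LINT x|leb01. w n x) * inverse (real (Suc n)) = (LINT x|leb01. r n x)"
    "\<And>n. 0 \<le> l n" "\<And>n. l n \<le> 1" "l \<longlonglongrightarrow> 1"
proof -
  have l: "0 \<le> l n" "l n < 1" for n by (auto simp: l_def divide_simps)
  have "\<forall>n. \<exists>w u. has_weak_deriv w u \<and> ae_eq w (\<lambda>x. l n * L w x + r n x)"
    using resolvent_exists[OF r l] by blast
  then obtain w u where w: "\<And>n. has_weak_deriv (w n) (u n)" "\<And>n. ae_eq (w n) (\<lambda>x. l n * L (w n) x + r n x)"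
    by metis
  have "(LINT x|leb01. w n x) * inverse (real (Suc n)) = (LINT x|leb01. r n x)" for n
  proof -
    note wL = has_weak_deriv_L1(1)[OF w(1)] and rL = has_weak_deriv_L1(1)[OF r]
    have "(LINT x|leb01. w n x) = (LINT x|leb01. l n * L (w n) x + r n x)"
      by (rule integral_ae_eq[OF L1_measurable[OF wL] w(2)])
    also have "\<dots> = l n * (LINT x|leb01. w n x) + (LINT x|leb01. r n x)"
      using L_integral[OF wL[of n]] L_L1[OF wL[of n]] rL[of n] by (simp add: L1_def)
    finally show ?thesis by (simp add: l_def algebra_simps)
  qed
  moreover have "l \<longlonglongrightarrow> 1" unfolding l_def
    using tendsto_diff[OF tendsto_const LIMSEQ_inverse_real_of_nat, of 1] by simp
  ultimately show ?thesis using that[of w u] w l less_imp_le by blast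
qed

section \<open>Solvability for data of mean zero, and invariant densities\<close>

lemma solvable:
  assumes r: "has_weak_deriv r s" "(LINT x|leb01. r x) = 0"
  shows "\<exists>w u. has_weak_deriv w u \<and> ae_eq w (\<lambda>x. L w x + r x) \<and> (LINT x|leb01. w x) = 0"
proof -
  define l where "l n = 1 - inverse (real (Suc n))" for n
  obtain w u where w: "\<And>n. has_weak_deriv (w n) (u n)" "\<And>n. ae_eq (w n) (\<lambda>x. l n * L (w n) x + r x)"
    "\<And>n. (LINT x|leb01. w n x) * inverse (real (Suc n)) = (LINT x|leb01. r x)"
    "\<And>n. 0 \<le> l n" "\<And>n. l n \<le> 1" "l \<longlonglongrightarrow> 1"
    using resolvent_seq[of "\<lambda>_. r" "\<lambda>_. s", OF r(1)] unfolding l_def by blast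
  have "(LINT x|leb01. w n x) = 0" for n using w(3)[of n] r(2) by simp
  then show ?thesis
    using solve_limit[of w u "\<lambda>_. r" "\<lambda>_. s" l 0 r s, OF w(1) r(1) w(4,5,6) w(2) _ r(1)]
    by (simp add: L1_norm_const)
qed

text \<open>The constant source \<open>1 - l n\<close> fixes the integral of the resolvent solutions
  at 1 and disappears in the limit.\<close>

lemma invariant_exists:
  "\<exists>w u. has_weak_deriv w u \<and> ae_eq w (L w) \<and> (LINT x|leb01. w x) = 1"
proof -
  define l where "l n = 1 - inverse (real (Suc n))" for n
  define r :: "nat \<Rightarrow> real \<Rightarrow> real" where "r n = (\<lambda>x. inverse (real (Suc n)))" for n
  have rw: "has_weak_deriv (r n) (\<lambda>x. 0)" for n unfolding r_def by (rule has_weak_deriv_const)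
  obtain w u where w: "\<And>n. has_weak_deriv (w n) (u n)" "\<And>n. ae_eq (w n) (\<lambda>x. l n * L (w n) x + r n x)"
    "\<And>n. (LINT x|leb01. w n x) * inverse (real (Suc n)) = (LINT x|leb01. r n x)"
    "\<And>n. 0 \<le> l n" "\<And>n. l n \<le> 1" "l \<longlonglongrightarrow> 1"
    using resolvent_seq[of r "\<lambda>_ _. 0", OF rw] unfolding l_def by blast
  have J: "(LINT x|leb01. w n x) = 1" for n using w(3)[of n] LINT_const01[of "inverse (real (Suc n))"] by (simp add: r_def)
  have r0: "(\<lambda>n. L1_norm (\<lambda>x. r n x - 0)) \<longlonglongrightarrow> 0"
    using LIMSEQ_inverse_real_of_nat by (simp add: r_def L1_norm_const)
  obtain W U where W: "has_weak_deriv W U" "ae_eq W (\<lambda>x. L W x + 0)" "(LINT x|leb01. W x) = 1"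
    using solve_limit[of w u r "\<lambda>_ _. 0" l 1, OF w(1) rw w(4,5,6) w(2) J has_weak_deriv_const r0]
    by (auto simp: L1_norm_const)
  then show ?thesis by auto
qed

text \<open>A function \<open>g0\<close> of mean 0 in \<open>W11\<close> that is close to
  \<open>w\<close> is a coboundary \<open>\<psi> - L \<psi>\<close>. As \<open>w\<close> is
  invariant, \<open>n w\<close> differs from the telescoped sum \<open>\<psi> - L^n \<psi>\<close>
  by at most \<open>2 n e\<close> in the mean, while that sum stays bounded. Division by a large
  \<open>n\<close> leaves \<open>3 e\<close>.\<close>

lemma invariant_L1_zero:
  assumes w: "w \<in> L1" "ae_eq (L w) w" "(LINT x|leb01. w x) = 0"
  shows "ae_eq w (\<lambda>x. 0)"
proof -
  have small: "L1_norm w \<le> 3 * e" if e: "e > 0" for e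
  proof -
    obtain g p where g: "has_weak_deriv g p" "L1_norm (\<lambda>x. w x - g x) < e"
      using L1_dense_W11[OF w(1) e] by blast
    note gL = has_weak_deriv_L1(1)[OF g(1)]
    define m where "m = (LINT x|leb01. g x)"
    define g0 where "g0 x = g x - m" for x
    have g0w: "has_weak_deriv g0 (\<lambda>x. p x - 0)"
      unfolding g0_def[abs_def] by (rule has_weak_deriv_diff[OF g(1) has_weak_deriv_const])
    note g0L = has_weak_deriv_L1(1)[OF g0w]
    have "(LINT x|leb01. g0 x) = 0"
      unfolding g0_def using gL L1_const[of m] LINT_const01[of m] by (simp add: L1_def m_def)
    then obtain \<psi> v where \<psi>: "has_weak_deriv \<psi> v" "ae_eq \<psi> (\<lambda>x. L \<psi> x + g0 x)"
      using solvable[OF g0w] by blast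
    note \<psi>L = has_weak_deriv_L1(1)[OF \<psi>(1)]
    have "m = (LINT x|leb01. g x - w x)" unfolding m_def using gL w(1,3) by (simp add: L1_def)
    then have "\<bar>m\<bar> \<le> L1_norm (\<lambda>x. w x - g x)"
      using abs_LINT_le[OF L1_diff[OF gL w(1)]] L1_norm_minus_commute[of w g] by simp
    then have "L1_norm (\<lambda>x. w x - g x) + L1_norm (\<lambda>x. m) < 2 * e" using g(2) L1_norm_const[of m] by linarith
    moreover have "L1_norm (\<lambda>x. w x - g0 x) \<le> L1_norm (\<lambda>x. w x - g x) + L1_norm (\<lambda>x. m)"
      by (rule L1_norm_le_add[OF L1_diff[OF w(1) gL] L1_const]) (simp add: g0_def ae_eq_def)
    ultimately have wg: "L1_norm (\<lambda>x. w x - g0 x) \<le> 2 * e" by linarith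
    have iL: "(L ^^ n) \<psi> \<in> L1" for n by (induction n) (auto intro: \<psi>L L_L1)
    have ind: "L1_norm (\<lambda>x. real n * w x - (\<psi> x - (L ^^ n) \<psi> x)) \<le> real n * (2 * e)" for n
    proof (induction n)
      case 0 then show ?case by (simp add: L1_norm_const)
    next
      case (Suc n)
      define A where "A x = real n * w x - (\<psi> x - (L ^^ n) \<psi> x)" for x
      have P: "(\<lambda>x. \<psi> x - (L ^^ n) \<psi> x) \<in> L1" by (intro L1_diff \<psi>L iL)
      have AL: "A \<in> L1" unfolding A_def[abs_def] by (intro L1_diff L1_cmult w \<psi>L iL)
      have 1: "ae_eq (L A) (\<lambda>x. L (\<lambda>x. real n * w x) x - L (\<lambda>x. \<psi> x - (L ^^ n) \<psi> x) x)"
        unfolding A_def[abs_def] by (rule L_diff[OF L1_cmult[OF w(1)] P])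
      have 2: "ae_eq (L (\<lambda>x. real n * w x)) (\<lambda>x. real n * L w x)" by (rule L_cmult[OF w(1)])
      have 3: "ae_eq (L (\<lambda>x. \<psi> x - (L ^^ n) \<psi> x)) (\<lambda>x. L \<psi> x - (L ^^ Suc n) \<psi> x)"
        using L_diff[OF \<psi>L iL[of n]] by simp
      have "L1_norm (\<lambda>x. real (Suc n) * w x - (\<psi> x - (L ^^ Suc n) \<psi> x)) \<le> L1_norm (L A) + L1_norm (\<lambda>x. w x - g0 x)"
      proof (rule L1_norm_le_add[OF L_L1[OF AL] L1_diff[OF w(1) g0L]])
        show "ae_eq (\<lambda>x. real (Suc n) * w x - (\<psi> x - (L ^^ Suc n) \<psi> x)) (\<lambda>x. L A x + (w x - g0 x))"
          using 1 2 3 w(2) \<psi>(2) unfolding ae_eq_def by eventually_elim (simp add: algebra_simps)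
      qed
      also have "\<dots> \<le> real n * (2 * e) + 2 * e"
        using L_norm[OF AL] Suc.IH wg unfolding A_def[abs_def] by linarith
      finally show ?case by (simp add: algebra_simps)
    qed
    have iN: "L1_norm ((L ^^ n) \<psi>) \<le> L1_norm \<psi>" for n
    proof (induction n)
      case (Suc n) then show ?case using L_norm[OF iL[of n]] by simp
    qed simp
    obtain n :: nat where n: "real n * e \<ge> 2 * L1_norm \<psi>" "n > 0"
    proof -
      obtain n where "2 * L1_norm \<psi> < real n * e" using reals_Archimedean3[OF e] by blast
      moreover from this have "n > 0" using L1_norm_nonneg[of \<psi>] by (cases n) auto
      ultimately show ?thesis using that[of n] by simp
    qed
    have P: "(\<lambda>x. \<psi> x - (L ^^ n) \<psi> x) \<in> L1" by (intro L1_diff \<psi>L iL)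
    have "L1_norm (\<lambda>x. real n * w x) \<le> L1_norm (\<lambda>x. real n * w x - (\<psi> x - (L ^^ n) \<psi> x)) + L1_norm (\<lambda>x. \<psi> x - (L ^^ n) \<psi> x)"
      by (rule L1_norm_le_add[OF L1_diff[OF L1_cmult[OF w(1)] P] P]) simp
    also have "\<dots> \<le> real n * (2 * e) + (L1_norm \<psi> + L1_norm \<psi>)"
      using ind[of n] L1_norm_diff[OF \<psi>L iL[of n]] iN[of n] by linarith
    also have "\<dots> \<le> real n * (3 * e)" using n(1) by (simp add: algebra_simps)
    finally have "real n * L1_norm w \<le> real n * (3 * e)" unfolding L1_norm_cmult by simp
    then show ?thesis using n(2) by simp
  qed
  have "L1_norm w \<le> 0"
  proof (rule field_le_epsilon)
    fix e :: real assume "e > 0" then show "L1_norm w \<le> 0 + e" using small[of "e/3"] by simp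
  qed
  then show ?thesis using L1_norm_eq_0[OF w(1)] L1_norm_nonneg[of w] by simp
qed

text \<open>Existence is \<open>solvable\<close>; uniqueness holds even among integrable functions,
  by \<open>invariant_L1_zero\<close>.\<close>

lemma I_minus_L_invertible: "I_minus_L_invertible T"
  unfolding I_minus_L_invertible_def
proof (intro conjI ballI)
  fix w assume w: "w \<in> W11_0"
  then have "has_weak_deriv w (wderiv w)" by (auto simp: W11_0_def intro: wderiv)
  from W11I[OF L_weak_deriv(1)[OF this]] show "L w \<in> W11_0"
    using w L_integral W11_L1 by (auto simp: W11_0_def)
next
  fix r assume r: "r \<in> W11_0"
  obtain w u where w: "has_weak_deriv w u" "ae_eq w (\<lambda>x. L w x + r x)" "(LINT x|leb01. w x) = 0"
    using solvable[OF wderiv, of r] r unfolding W11_0_def by blast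
  note wL = has_weak_deriv_L1(1)[OF w(1)]
  show "\<exists>w\<in>W11_0. ae_eq (\<lambda>x. w x - L w x) r \<and> (\<forall>v\<in>W11_0. ae_eq (\<lambda>x. v x - L v x) r \<longrightarrow> ae_eq v w)"
  proof (intro bexI[of _ w] conjI ballI impI)
    show "w \<in> W11_0" using w W11I by (auto simp: W11_0_def)
    show "ae_eq (\<lambda>x. w x - L w x) r" using w(2) unfolding ae_eq_def by eventually_elim simp
    fix v assume v: "v \<in> W11_0" "ae_eq (\<lambda>x. v x - L v x) r"
    then have vL: "v \<in> L1" and v0: "(LINT x|leb01. v x) = 0" using W11_L1 by (auto simp: W11_0_def)
    have "ae_eq (\<lambda>x. v x - w x) (\<lambda>x. 0)"
    proof (rule invariant_L1_zero)
      show "(\<lambda>x. v x - w x) \<in> L1" by (rule L1_diff[OF vL wL])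
      show "ae_eq (L (\<lambda>x. v x - w x)) (\<lambda>x. v x - w x)"
        using L_diff[OF vL wL] v(2) w(2) unfolding ae_eq_def by eventually_elim simp
      show "(LINT x|leb01. v x - w x) = 0" using vL wL v0 w(3) by (simp add: L1_def)
    qed
    then show "ae_eq v w" by (simp add: ae_eq_def)
  qed
qed

lemma invariant_density_unique:
  assumes "invariant_density T h" "invariant_density T k" shows "ae_eq k h"
proof -
  have L: "h \<in> L1" "k \<in> L1" and eq: "ae_eq (L h) h" "ae_eq (L k) k" and one: "(LINT x|leb01. h x) = 1" "(LINT x|leb01. k x) = 1"
    using assms by (auto simp: invariant_density_def)
  have "ae_eq (\<lambda>x. k x - h x) (\<lambda>x. 0)"
  proof (rule invariant_L1_zero)
    show "(\<lambda>x. k x - h x) \<in> L1" by (rule L1_diff[OF L(2,1)])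
    show "ae_eq (L (\<lambda>x. k x - h x)) (\<lambda>x. k x - h x)"
      using L_diff[OF L(2,1)] eq unfolding ae_eq_def by eventually_elim simp
    show "(LINT x|leb01. k x - h x) = 0" using L one by (simp add: L1_def)
  qed
  then show ?thesis by (simp add: ae_eq_def)
qed

text \<open>With \<open>J\<close> the norm of an invariant \<open>h\<close> of integral 1, the
  function \<open>\<bar>h\<bar> - J h\<close> is invariant of mean 0 and hence vanishes. As
  \<open>J > 0\<close>, this makes \<open>h\<close> nonnegative.\<close>

lemma invariant_density_exists:
  "\<exists>h u. has_weak_deriv h u \<and> invariant_density T h"
proof -
  obtain h u where h: "has_weak_deriv h u" "ae_eq h (L h)" "(LINT x|leb01. h x) = 1"
    using invariant_exists by blast
  note hL = has_weak_deriv_L1(1)[OF h(1)]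
  define J where "J = L1_norm h"
  note A = L1_abs[OF hL]
  have "ae_eq (\<lambda>x. \<bar>h x\<bar> - J * h x) (\<lambda>x. 0)"
  proof (rule invariant_L1_zero)
    show "(\<lambda>x. \<bar>h x\<bar> - J * h x) \<in> L1" by (intro L1_diff A L1_cmult hL)
    show "ae_eq (L (\<lambda>x. \<bar>h x\<bar> - J * h x)) (\<lambda>x. \<bar>h x\<bar> - J * h x)"
      using L_lin[OF A hL, of 1 "- J"] L_abs[OF hL ae_eq_sym[OF h(2)]] h(2)
      unfolding ae_eq_def by eventually_elim simp
    show "(LINT x|leb01. \<bar>h x\<bar> - J * h x) = 0" using hL h(3) by (simp add: L1_def J_def L1_norm_def)
  qed
  then have "AE x in leb01. 0 \<le> h x"
    unfolding ae_eq_def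
  proof eventually_elim
    case (elim x)
    then have "0 \<le> J * h x" using abs_ge_zero[of "h x"] by linarith
    moreover have "J > 0" using abs_LINT_le[OF hL] h(3) unfolding J_def by linarith
    ultimately show ?case by (simp add: zero_le_mult_iff)
  qed
  then show ?thesis using h hL ae_eq_sym unfolding invariant_density_def by blast
qed

section \<open>Second-order regularity of invariant densities\<close>

text \<open>The exponent \<open>- 1 - 2 * \<beta>\<close> is positive and distances to
  \<open>c\<close> are at most 1.\<close>

lemma d_Linf_bound: "\<exists>D\<ge>0. \<forall>x\<in>X. \<bar>d x\<bar> \<le> D"
proof (intro exI[of _ "2 * K / \<kappa> ^ 3"] conjI ballI)
  show nn: "0 \<le> 2 * K / \<kappa> ^ 3" using K_nonneg kappa by simp
  fix x assume x: "x \<in> X"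
  have "\<bar>d x\<bar> \<le> 2 * K / \<kappa> ^ 3 * \<bar>x - c\<bar> powr (- 1 - 2 * \<beta>)" by (rule d_bound[OF x])
  also have "\<bar>x - c\<bar> powr (- 1 - 2 * \<beta>) \<le> 1 powr (- 1 - 2 * \<beta>)"
    using x c_in beta by (intro powr_mono2) auto
  then have "2 * K / \<kappa> ^ 3 * \<bar>x - c\<bar> powr (- 1 - 2 * \<beta>) \<le> 2 * K / \<kappa> ^ 3 * 1"
    using nn by (intro mult_left_mono) auto
  finally show "\<bar>d x\<bar> \<le> 2 * K / \<kappa> ^ 3" by simp
qed

text \<open>The derivative \<open>u\<close> of an invariant \<open>h\<close> solves \<open>u = L (u / T') + L (b h)\<close>. The iteration of the
  right-hand side from \<open>0\<close> converges to \<open>u\<close> in \<open>L\<^sup>1\<close>, and it contracts the norm \<open>\<parallel>z'\<parallel> + A \<parallel>z\<parallel>\<close> for large \<open>A\<close>.\<close>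

lemma invariant_W21:
  assumes h: "has_weak_deriv h u" "ae_eq (L h) h"
  shows "h \<in> W21"
proof -
  note hL = has_weak_deriv_L1(1)[OF h(1)] and uL = has_weak_deriv_L1(2)[OF h(1)]
  note bhL = L_weak_deriv(3)[OF h(1)] and uTL = L_weak_deriv(2)[OF h(1)]
  define v where "v = L (\<lambda>x. b x * h x)"
  define v' where "v' = L (\<lambda>x. b x / T1 x * u x + e x * h x)"
  have v: "has_weak_deriv v v'" unfolding v_def v'_def by (rule bL_weak_deriv[OF h(1)])
  note vL = has_weak_deriv_L1[OF v]
  have "ae_eq u (L (\<lambda>x. u x / T1 x + b x * h x))"
    by (rule has_weak_deriv_ae_unique[OF h(1) has_weak_deriv_cong[OF L_weak_deriv(1)[OF h(1)] h(2) ae_eq_refl]])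
  also have "ae_eq (L (\<lambda>x. u x / T1 x + b x * h x)) (\<lambda>x. L (\<lambda>x. u x / T1 x) x + v x)"
    unfolding v_def by (rule L_add[OF uTL bhL])
  finally have ueq: "ae_eq u (\<lambda>x. L (\<lambda>x. u x / T1 x) x + v x)" .
  \<comment> \<open>The iteration runs on pairs whose second component is the weak derivative of the
    first.\<close>
  define F where "F = (\<lambda>(f, g). (\<lambda>x. L (\<lambda>x. f x / T1 x) x + v x, \<lambda>x. L (\<lambda>x. g x / T1 x ^ 2 + d x * f x) x + v' x))"
  define U where "U n = fst ((F ^^ n) (\<lambda>x. 0, \<lambda>x. 0))" for n
  define Z where "Z n = snd ((F ^^ n) (\<lambda>x. 0, \<lambda>x. 0))" for n
  have U0: "U 0 = (\<lambda>x. 0)" "Z 0 = (\<lambda>x. 0)" by (auto simp: U_def Z_def)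
  have US: "U (Suc n) = (\<lambda>x. L (\<lambda>x. U n x / T1 x) x + v x)"
    "Z (Suc n) = (\<lambda>x. L (\<lambda>x. Z n x / T1 x ^ 2 + d x * U n x) x + v' x)" for n
    by (auto simp: U_def Z_def F_def split: prod.splits)
  have w: "has_weak_deriv (U n) (Z n)" for n
  proof (induction n)
    case 0 then show ?case unfolding U0 by (rule has_weak_deriv_const)
  next
    case (Suc n) show ?case unfolding US by (rule has_weak_deriv_add[OF M_weak_deriv(1)[OF Suc] v])
  qed
  note wL = has_weak_deriv_L1[OF w]
  have divL: "(\<lambda>x. f x / T1 x) \<in> L1" "L1_norm (\<lambda>x. f x / T1 x) \<le> L1_norm f / \<theta>" if "f \<in> L1" for f
    using div_T1_L1[OF that, of 1] div_T1_norm[OF that, of 1] by simp_all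
  have contr: "L1_norm (\<lambda>x. L (\<lambda>x. f x / T1 x) x - L (\<lambda>x. g x / T1 x) x) \<le> L1_norm (\<lambda>x. f x - g x) / \<theta>"
    if "f \<in> L1" "g \<in> L1" for f g
  proof -
    have "L1_norm (\<lambda>x. L (\<lambda>x. f x / T1 x) x - L (\<lambda>x. g x / T1 x) x) \<le> L1_norm (\<lambda>x. f x / T1 x - g x / T1 x)"
      by (rule L_norm_diff) (intro divL that)+
    also have "\<dots> = L1_norm (\<lambda>x. (f x - g x) / T1 x)" by (simp add: diff_divide_distrib)
    also have "\<dots> \<le> L1_norm (\<lambda>x. f x - g x) / \<theta>" by (rule divL) (intro L1_diff that)
    finally show ?thesis .
  qed
  have Uu: "L1_norm (\<lambda>x. U n x - u x) \<le> (1 / \<theta>) ^ n * L1_norm (\<lambda>x. U 0 x - u x)" for n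
  proof (induction n)
    case (Suc n)
    have "ae_eq (\<lambda>x. U (Suc n) x - u x) (\<lambda>x. L (\<lambda>x. U n x / T1 x) x - L (\<lambda>x. u x / T1 x) x)"
      using ueq unfolding ae_eq_def US by eventually_elim simp
    then have "L1_norm (\<lambda>x. U (Suc n) x - u x) = L1_norm (\<lambda>x. L (\<lambda>x. U n x / T1 x) x - L (\<lambda>x. u x / T1 x) x)"
      by (rule L1_norm_ae_eq[OF L1_diff[OF wL(1) uL]])
    also have "\<dots> \<le> L1_norm (\<lambda>x. U n x - u x) / \<theta>" by (rule contr[OF wL(1) uL])
    also have "\<dots> \<le> ((1 / \<theta>) ^ n * L1_norm (\<lambda>x. U 0 x - u x)) / \<theta>"
      using Suc theta by (intro divide_right_mono) auto
    finally show ?case by (simp add: field_simps)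
  qed simp
  have Ulim: "(\<lambda>n. L1_norm (\<lambda>x. U n x - u x)) \<longlonglongrightarrow> 0"
  proof (rule Lim_null_comparison[OF always_eventually])
    show "\<forall>n. norm (L1_norm (\<lambda>x. U n x - u x)) \<le> (1 / \<theta>) ^ n * L1_norm (\<lambda>x. U 0 x - u x)"
    proof
      fix n show "norm (L1_norm (\<lambda>x. U n x - u x)) \<le> (1 / \<theta>) ^ n * L1_norm (\<lambda>x. U 0 x - u x)"
        using Uu[of n] L1_norm_nonneg[of "\<lambda>x. U n x - u x"] by simp
    qed
    have "(\<lambda>n. (1 / \<theta>) ^ n) \<longlonglongrightarrow> 0" using theta by (intro LIMSEQ_power_zero) simp
    then show "(\<lambda>n. (1 / \<theta>) ^ n * L1_norm (\<lambda>x. U 0 x - u x)) \<longlonglongrightarrow> 0" by (rule tendsto_mult_left_zero)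
  qed
  obtain D where D: "D \<ge> 0" "\<And>x. x \<in> X \<Longrightarrow> \<bar>d x\<bar> \<le> D" using d_Linf_bound by auto
  have dL: "(\<lambda>x. d x * f x) \<in> L1" "L1_norm (\<lambda>x. d x * f x) \<le> D * L1_norm f" if f: "f \<in> L1" for f
  proof -
    have dm: "d \<in> borel_measurable leb01" by (rule borel_measurable_off_point[OF cont_d])
    have b: "AE x in leb01. \<bar>d x * f x\<bar> \<le> \<bar>D * f x\<bar>"
      using AE_X by eventually_elim (use D in \<open>auto simp: abs_mult intro!: mult_right_mono\<close>)
    show A: "(\<lambda>x. d x * f x) \<in> L1"
      by (rule L1_dominated[OF L1_cmult[OF f] _ b]) (use dm L1_measurable[OF f] in measurable)
    show "L1_norm (\<lambda>x. d x * f x) \<le> D * L1_norm f"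
      using L1_norm_mono[OF L1_cmult[OF f] A b] D(1) by (simp add: L1_norm_cmult)
  qed
  \<comment> \<open>\<open>A\<close> is chosen so that \<open>D + A / \<theta> = \<rho> * A\<close>
    with \<open>\<rho>\<close> halfway between \<open>1 / \<theta>\<close> and 1. The weighted norm
    then absorbs the term \<open>D * L1_norm (dU n)\<close> that enters the step for
    \<open>dZ\<close>.\<close>
  define A where "A = 2 * D / (1 - 1 / \<theta>)"
  define \<rho> where "\<rho> = (1 + 1 / \<theta>) / 2"
  have \<theta>1: "0 < 1 / \<theta>" "1 / \<theta> < 1" using theta by auto
  have A0: "A \<ge> 0" using D \<theta>1 by (simp add: A_def)
  have \<rho>: "0 \<le> \<rho>" "\<rho> < 1" "1 / \<theta> \<le> \<rho>" using theta by (auto simp: \<rho>_def field_simps)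
  have DA: "D + A * (1 / \<theta>) = \<rho> * A"
  proof -
    define m where "m = 1 / \<theta>"
    have "A * (1 - m) = 2 * D" using \<theta>1 by (simp add: A_def m_def)
    then have "D + A * m = (1 + m) / 2 * A" by (simp add: field_simps)
    then show ?thesis unfolding \<rho>_def m_def .
  qed
  define dU where "dU n x = U (Suc n) x - U n x" for n x
  define dZ where "dZ n x = Z (Suc n) x - Z n x" for n x
  have dUL: "dU n \<in> L1" and dZL: "dZ n \<in> L1" for n
    unfolding dU_def[abs_def] dZ_def[abs_def] by (intro L1_diff wL)+
  have stepU: "L1_norm (dU (Suc n)) \<le> L1_norm (dU n) / \<theta>" for n
    using contr[OF wL(1)[of "Suc n"] wL(1)[of n]] unfolding dU_def[abs_def] US[of "Suc n"] US[of n] by simp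
  have stepZ: "L1_norm (dZ (Suc n)) \<le> L1_norm (dZ n) / \<theta> + D * L1_norm (dU n)" for n
  proof -
    let ?g = "\<lambda>n x. Z n x / T1 x ^ 2 + d x * U n x"
    have gL: "?g n \<in> L1" for n by (intro L1_add div_T1_L1 dL wL)
    have "dZ (Suc n) = (\<lambda>x. L (?g (Suc n)) x - L (?g n) x)"
      unfolding dZ_def[abs_def] US(2)[of "Suc n"] US(2)[of n] by (rule ext) simp
    then have "L1_norm (dZ (Suc n)) \<le> L1_norm (\<lambda>x. ?g (Suc n) x - ?g n x)"
      using L_norm_diff[OF gL[of "Suc n"] gL[of n]] by simp
    also have "\<dots> \<le> L1_norm (\<lambda>x. dZ n x / T1 x ^ 2) + L1_norm (\<lambda>x. d x * dU n x)"
      by (rule L1_norm_le_add[OF div_T1_L1[OF dZL] dL(1)[OF dUL]])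
        (simp add: dZ_def dU_def diff_divide_distrib right_diff_distrib ae_eq_def)
    also have "\<dots> \<le> L1_norm (dZ n) / \<theta> + D * L1_norm (dU n)"
      by (intro add_mono div_T1_norm dL dZL dUL) simp
    finally show ?thesis .
  qed
  define y where "y n = L1_norm (dZ n) + A * L1_norm (dU n)" for n
  have y: "y n \<le> \<rho> ^ n * y 0" for n
  proof (induction n)
    case (Suc n)
    have "y (Suc n) \<le> (L1_norm (dZ n) / \<theta> + D * L1_norm (dU n)) + A * (L1_norm (dU n) / \<theta>)"
      unfolding y_def by (intro add_mono stepZ mult_left_mono stepU A0)
    also have "\<dots> = 1 / \<theta> * L1_norm (dZ n) + (D + A * (1 / \<theta>)) * L1_norm (dU n)" by (simp add: algebra_simps)
    also have "\<dots> \<le> \<rho> * L1_norm (dZ n) + \<rho> * A * L1_norm (dU n)"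
      unfolding DA using \<rho> A0 L1_norm_nonneg[of "dZ n"] L1_norm_nonneg[of "dU n"] by (intro add_mono mult_right_mono) auto
    also have "\<dots> = \<rho> * y n" by (simp add: y_def algebra_simps)
    also have "\<dots> \<le> \<rho> * (\<rho> ^ n * y 0)" by (rule mult_left_mono[OF Suc \<rho>(1)])
    finally show ?case by simp
  qed simp
  have sy: "summable (\<lambda>n. \<rho> ^ n * y 0)" using \<rho> by (intro summable_mult2 summable_geometric) auto
  have "summable (\<lambda>n. L1_norm (dZ n))"
  proof (rule summable_comparison_test'[OF sy, of 0])
    fix n
    have "L1_norm (dZ n) \<le> y n" unfolding y_def using A0 L1_norm_nonneg[of "dU n"] by simp
    then show "norm (L1_norm (dZ n)) \<le> \<rho> ^ n * y 0" using y[of n] L1_norm_nonneg[of "dZ n"] by simp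
  qed
  then obtain V where VL: "V \<in> L1" and V: "(\<lambda>n. L1_norm (\<lambda>x. (\<Sum>k<n. dZ k x) - V x)) \<longlonglongrightarrow> 0"
    using L1_series[of dZ, OF dZL] by blast
  have "(\<Sum>k<n. dZ k x) = Z n x" for n x unfolding dZ_def using U0 by (induction n) auto
  with V have Vl: "(\<lambda>n. L1_norm (\<lambda>x. Z n x - V x)) \<longlonglongrightarrow> 0" by simp
  have "has_weak_deriv u V" by (rule has_weak_deriv_limit[of U Z, OF w uL VL Ulim Vl])
  then show ?thesis by (rule W21I[OF h(1)])
qed

end

text \<open>Integrability comes from \<open>\<bar>f\<bar> \<le> 1 + f^2\<close>; the inequality is
  nonnegativity of the variance of \<open>\<bar>f\<bar>\<close> on a probability space.\<close>

lemma L1_norm_le_L2_norm: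
  assumes f: "f \<in> L2" shows "f \<in> L1" "L1_norm f \<le> L2_norm f"
proof -
  have fm: "f \<in> borel_measurable leb01" and f2: "integrable leb01 (\<lambda>x. (f x)\<^sup>2)" using f by (auto simp: L2_def)
  have "(\<lambda>x. 1 + (f x)\<^sup>2) \<in> L1" by (rule L1_add[OF L1_const]) (use f2 in \<open>simp add: L1_def\<close>)
  then show fL: "f \<in> L1"
  proof (rule L1_dominated'[OF _ fm])
    fix x
    have "0 \<le> (\<bar>f x\<bar> - 1/2)\<^sup>2" by simp
    then show "\<bar>f x\<bar> \<le> \<bar>1 + (f x)\<^sup>2\<bar>" by (simp add: power2_eq_square algebra_simps abs_mult_self_eq)
  qed
  define m where "m = L1_norm f"
  have i1: "integrable leb01 (\<lambda>x. \<bar>f x\<bar>)" using fL by (simp add: L1_def)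
  have ic: "integrable leb01 (\<lambda>x. m\<^sup>2)" using L1_const by (simp add: L1_def)
  have "0 \<le> (LINT x|leb01. (\<bar>f x\<bar> - m)\<^sup>2)" by simp
  also have "\<dots> = (LINT x|leb01. (f x)\<^sup>2 - 2 * m * \<bar>f x\<bar> + m\<^sup>2)"
    by (rule Bochner_Integration.integral_cong) (auto simp: power2_diff)
  also have "\<dots> = (LINT x|leb01. (f x)\<^sup>2) - 2 * m * m + m\<^sup>2"
    using i1 ic f2 LINT_const01[of "m\<^sup>2"] by (simp add: m_def L1_norm_def)
  finally have "m\<^sup>2 \<le> (LINT x|leb01. (f x)\<^sup>2)" by (simp add: power2_eq_square)
  then show "L1_norm f \<le> L2_norm f"
    unfolding L2_norm_def m_def[symmetric] using real_le_rsqrt by blast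
qed

context cusp_map
begin

text \<open>The response formula evaluates the density at preimages of a point, so a representative
  with a continuous classical derivative is selected. It arises from the second weak derivative by
  integrating twice.\<close>

lemma invariant_density_C1:
  "\<exists>h h'. (\<forall>x\<in>{0..1}. (h has_real_derivative h' x) (at x within {0..1})) \<and> continuous_on {0..1} h' \<and>
     invariant_density T h \<and> h \<in> W21"
proof -
  obtain g u where g: "has_weak_deriv g u" "invariant_density T g" using invariant_density_exists by blast
  have gL: "g \<in> L1" and geq: "ae_eq (L g) g" using g(2) by (auto simp: invariant_density_def)
  have "g \<in> W21" by (rule invariant_W21[OF g(1) geq])
  then have "wderiv g \<in> W11" by (simp add: W21_def)
  then have uw: "has_weak_deriv (wderiv g) (wderiv (wderiv g))" by (rule wderiv)
  obtain k where k: "ae_eq (wderiv g) (\<lambda>x. k + prim (wderiv (wderiv g)) x)" using has_weak_deriv_rep[OF uw] by blast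
  define h' where "h' x = k + prim (wderiv (wderiv g)) x" for x
  have h'c: "continuous_on {0..1} h'" unfolding h'_def
    by (intro continuous_intros continuous_on_prim has_weak_deriv_L1[OF uw])
  have h'L: "h' \<in> L1" by (rule continuous_L1[OF h'c])
  have gw: "has_weak_deriv g h'"
    unfolding h'_def[abs_def] by (rule has_weak_deriv_cong[OF wderiv[OF W11I[OF g(1)]] ae_eq_refl k])
  obtain l where l: "ae_eq g (\<lambda>x. l + prim h' x)" using has_weak_deriv_rep[OF gw] by blast
  define h where "h x = l + prim h' x" for x
  have gh: "ae_eq g h" unfolding h_def[abs_def] by (rule l)
  have hw: "has_weak_deriv h h'" by (rule has_weak_deriv_cong[OF gw gh ae_eq_refl])
  have "(h has_real_derivative h' x) (at x within {0..1})" if "x \<in> {0..1}" for x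
    unfolding h_def[abs_def] using prim_has_derivative[OF h'L h'c that] by (auto intro!: derivative_eq_intros)
  moreover have "invariant_density T h"
    unfolding invariant_density_def
  proof (intro conjI)
    show "h \<in> L1" by (rule L1_cong[OF gL gh])
    show "AE x in leb01. 0 \<le> h x" using g(2) gh unfolding invariant_density_def ae_eq_def by (auto elim: eventually_elim2)
    show "(LINT x|leb01. h x) = 1"
      using g(2) integral_ae_eq[OF L1_measurable[OF gL] gh] by (simp add: invariant_density_def)
    show "ae_eq (L h) h"
      by (rule ae_eq_trans[OF ae_eq_sym[OF L_cong[OF gL gh]] ae_eq_trans[OF geq gh]])
  qed
  moreover have "has_weak_deriv h' (wderiv (wderiv g))"
    unfolding h'_def[abs_def] by (rule has_weak_deriv_cong[OF uw k ae_eq_refl])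
  then have "h \<in> W21" by (rule W21I[OF hw])
  ultimately show ?thesis using h'c by blast
qed

end

section \<open>Families of cusp maps\<close>

context admissible_cusp_family
begin

text \<open>One triple of constants serves all parameters. On each branch the derivative never
  vanishes and \<open>A6\<close> gives its sign near \<open>c\<close>, so the intermediate value
  theorem fixes the sign throughout.\<close>

lemma cusp_maps:
  "\<exists>\<theta> \<kappa> K. \<forall>\<epsilon>\<in>{0..<\<delta>}. cusp_map (T \<epsilon>) c (a \<epsilon>) \<beta> \<theta> \<kappa> K (D01 (T \<epsilon>)) ((D01 ^^ 2) (T \<epsilon>)) ((D01 ^^ 3) (T \<epsilon>))"
proof -
  obtain \<theta> where \<theta>: "\<theta> > 1" "\<And>\<epsilon> x. \<epsilon> \<in> {0..<\<delta>} \<Longrightarrow> x \<in> {0..1} - {c} \<Longrightarrow> \<theta> \<le> \<bar>D01 (T \<epsilon>) x\<bar>" using A4 by blast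
  obtain K where K: "\<And>\<epsilon> i x. \<epsilon> \<in> {0..<\<delta>} \<Longrightarrow> i \<in> {0,1,2::nat} \<Longrightarrow> x \<in> {0..1} - {c} \<Longrightarrow>
     \<bar>(D01 ^^ (i + 1)) (T \<epsilon>) x\<bar> / \<bar>x - c\<bar> powr (\<beta> - real i) \<le> K" using A8_upper by blast
  obtain \<kappa> where \<kappa>: "\<kappa> > 0" "\<And>\<epsilon> x. \<epsilon> \<in> {0..<\<delta>} \<Longrightarrow> x \<in> {0..1} - {c} \<Longrightarrow> \<kappa> \<le> \<bar>D01 (T \<epsilon>) x\<bar> / \<bar>x - c\<bar> powr \<beta>"
    using A8_lower by blast
  have "cusp_map (T \<epsilon>) c (a \<epsilon>) \<beta> \<theta> \<kappa> K (D01 (T \<epsilon>)) ((D01 ^^ 2) (T \<epsilon>)) ((D01 ^^ 3) (T \<epsilon>))" if e: "\<epsilon> \<in> {0..<\<delta>}" for \<epsilon>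
  proof -
    have pw: "D01 (D01 (T \<epsilon>)) = (D01 ^^ 2) (T \<epsilon>)" "D01 ((D01 ^^ 2) (T \<epsilon>)) = (D01 ^^ 3) (T \<epsilon>)"
      by (simp_all add: numeral_2_eq_2 numeral_3_eq_3)
    have dif: "((D01 ^^ i) (T \<epsilon>) has_real_derivative D01 ((D01 ^^ i) (T \<epsilon>)) x) (at x within {0..1})"
      if "i < 3" "x \<in> {0..1} - {c}" for i x
    proof -
      have "(D01 ^^ i) (T \<epsilon>) differentiable (at x within {0..1})" using A3[OF e] that unfolding C_on01_def by blast
      then show ?thesis
        unfolding D01_def[of "(D01 ^^ i) (T \<epsilon>)"] has_real_derivative_iff_has_vector_derivative
        by (rule vector_derivative_works[THEN iffD1])
    qed
    have d1: "(T \<epsilon> has_real_derivative D01 (T \<epsilon>) x) (at x within {0..1})" if "x \<in> {0..1} - {c}" for x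
      using dif[of 0 x] that by simp
    have d2: "(D01 (T \<epsilon>) has_real_derivative (D01 ^^ 2) (T \<epsilon>) x) (at x within {0..1})" if "x \<in> {0..1} - {c}" for x
      using dif[of 1 x] that by (simp add: pw)
    have d3: "((D01 ^^ 2) (T \<epsilon>) has_real_derivative (D01 ^^ 3) (T \<epsilon>) x) (at x within {0..1})" if "x \<in> {0..1} - {c}" for x
      using dif[of 2 x] that by (simp add: pw)
    have contD: "continuous_on S (D01 (T \<epsilon>))" if "S \<subseteq> {0..1} - {c}" for S
      unfolding continuous_on_eq_continuous_within
    proof
      fix x assume "x \<in> S"
      then have "continuous (at x within {0..1}) (D01 (T \<epsilon>))" using that by (intro DERIV_continuous[OF d2]) auto
      then show "continuous (at x within S) (D01 (T \<epsilon>))" by (rule continuous_within_subset) (use that in auto)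
    qed
    have left: "\<theta> \<le> D01 (T \<epsilon>) x" if x: "x \<in> {0..<c}" for x
    proof (rule ccontr)
      assume "\<not> \<theta> \<le> D01 (T \<epsilon>) x"
      then have neg: "D01 (T \<epsilon>) x \<le> 0" using \<theta>(2)[OF e, of x] x c_in \<theta>(1) by auto
      have "eventually (\<lambda>y. 0 \<le> D01 (T \<epsilon>) y) (at_left c)"
        using A6[OF e] unfolding filterlim_at_top by blast
      then obtain y0 where y0: "y0 < c" "\<And>y. y0 < y \<Longrightarrow> y < c \<Longrightarrow> 0 \<le> D01 (T \<epsilon>) y"
        using eventually_at_left[of x c] x by auto
      define y where "y = (max x y0 + c) / 2"
      have y: "x \<le> y" "y0 < y" "y < c" using x y0(1) by (auto simp: y_def)
      have "\<exists>z\<ge>x. z \<le> y \<and> D01 (T \<epsilon>) z = 0"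
        by (rule IVT'[OF neg y0(2)[OF y(2,3)] y(1) contD]) (use x y c_in in auto)
      then obtain z where "x \<le> z" "z \<le> y" "D01 (T \<epsilon>) z = 0" by blast
      then show False using \<theta>(2)[OF e, of z] x y c_in \<theta>(1) by auto
    qed
    have right: "D01 (T \<epsilon>) x \<le> - \<theta>" if x: "x \<in> {c<..1}" for x
    proof (rule ccontr)
      assume "\<not> D01 (T \<epsilon>) x \<le> - \<theta>"
      then have neg: "0 \<le> D01 (T \<epsilon>) x" using \<theta>(2)[OF e, of x] x c_in \<theta>(1) by auto
      have "eventually (\<lambda>y. D01 (T \<epsilon>) y \<le> 0) (at_right c)"
        using A6[OF e] unfolding filterlim_at_bot by blast
      then obtain y0 where y0: "c < y0" "\<And>y. c < y \<Longrightarrow> y < y0 \<Longrightarrow> D01 (T \<epsilon>) y \<le> 0"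
        using eventually_at_right[of c x] x by auto
      define y where "y = (min x y0 + c) / 2"
      have y: "y \<le> x" "y < y0" "c < y" using x y0(1) by (auto simp: y_def)
      have "\<exists>z\<ge>y. z \<le> x \<and> D01 (T \<epsilon>) z = 0"
        by (rule IVT'[OF y0(2)[OF y(3,2)] neg y(1) contD]) (use x y c_in in auto)
      then obtain z where "y \<le> z" "z \<le> x" "D01 (T \<epsilon>) z = 0" by blast
      then show False using \<theta>(2)[OF e, of z] x y c_in \<theta>(1) by auto
    qed
    have up: "\<bar>(D01 ^^ (i + 1)) (T \<epsilon>) x\<bar> \<le> K * \<bar>x - c\<bar> powr (\<beta> - real i)"
      if "i \<in> {0,1,2::nat}" "x \<in> {0..1} - {c}" for i x
    proof -
      have "0 < \<bar>x - c\<bar> powr (\<beta> - real i)" using that by simp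
      then show ?thesis using K[OF e that] by (simp add: pos_divide_le_eq)
    qed
    show ?thesis
    proof
      show "nonsingular (T \<epsilon>)" by (rule nonsing[OF e])
      show "continuous_on ({0..1} - {c}) ((D01 ^^ 3) (T \<epsilon>))" using A3[OF e] by (simp add: C_on01_def)
      fix x assume x: "x \<in> {0..1} - {c}"
      show "\<kappa> * \<bar>x - c\<bar> powr \<beta> \<le> \<bar>D01 (T \<epsilon>) x\<bar>"
        using \<kappa>(2)[OF e x] x by (simp add: pos_le_divide_eq)
      show "\<bar>D01 (T \<epsilon>) x\<bar> \<le> K * \<bar>x - c\<bar> powr \<beta>" using up[of 0 x] x by simp
      show "\<bar>(D01 ^^ 2) (T \<epsilon>) x\<bar> \<le> K * \<bar>x - c\<bar> powr (\<beta> - 1)"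
        using up[of 1 x] x by (simp add: numeral_2_eq_2)
      show "\<bar>(D01 ^^ 3) (T \<epsilon>) x\<bar> \<le> K * \<bar>x - c\<bar> powr (\<beta> - 2)"
        using up[of 2 x] x by (simp add: numeral_2_eq_2 numeral_3_eq_3)
    qed (use c_in beta_in \<theta>(1) \<kappa>(1) A2[OF e] d1 d2 d3 left right in auto)
  qed
  then show ?thesis by blast
qed

lemma zero_in: "0 \<in> {0..<\<delta>}" using delta_pos by simp

text \<open>Scaling carries \<open>A9_L2\<close> from the unit ball of \<open>W11\<close> to a ball
  given by \<open>C\<close>, and on the unit interval the mean norm is at most the quadratic
  one.\<close>

lemma transfer_diff_small:
  assumes "e > 0"
  shows "\<forall>\<^sub>F \<epsilon> in at_right 0. \<forall>f u. has_weak_deriv f u \<and> L1_norm f + L1_norm u \<le> C \<longrightarrow>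
     L1_norm (\<lambda>x. transfer_op (T \<epsilon>) f x - transfer_op (T 0) f x) \<le> e"
proof -
  define C' where "C' = max 1 C"
  have C': "C' > 0" "C \<le> C'" by (auto simp: C'_def)
  have "\<forall>\<^sub>F \<epsilon> in at_right 0. \<forall>f\<in>W11. W11_norm f \<le> 1 \<longrightarrow>
               (\<lambda>x. transfer_op (T 0) f x - transfer_op (T \<epsilon>) f x) \<in> L2 \<and>
               L2_norm (\<lambda>x. transfer_op (T 0) f x - transfer_op (T \<epsilon>) f x) \<le> e / C'"
    using A9_L2 assms C' by simp
  moreover have "\<forall>\<^sub>F \<epsilon> in at_right 0. \<epsilon> \<in> {0..<\<delta>}"
    using eventually_at_right_less[of 0] eventually_at_right[of 0 \<delta>, OF delta_pos]
    by (auto simp: eventually_at_right[OF delta_pos] intro: exI[of _ \<delta>] delta_pos)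
  ultimately show ?thesis
  proof eventually_elim
    case (elim \<epsilon>)
    interpret T0: nonsingular_map "T 0" by standard (rule nonsing[OF zero_in])
    interpret Te: nonsingular_map "T \<epsilon>" by standard (rule nonsing[OF elim(2)])
    show ?case
    proof (intro allI impI)
      fix f u assume f: "has_weak_deriv f u \<and> L1_norm f + L1_norm u \<le> C"
      then have fw: "has_weak_deriv f u" and fC: "L1_norm f + L1_norm u \<le> C" by auto
      note fL = has_weak_deriv_L1(1)[OF fw]
      define g where "g x = 1 / C' * f x" for x
      have gw: "has_weak_deriv g (\<lambda>x. 1 / C' * u x)" unfolding g_def[abs_def] by (rule has_weak_deriv_cmult[OF fw])
      note gL = has_weak_deriv_L1(1)[OF gw]
      have "W11_norm g = 1 / C' * (L1_norm f + L1_norm u)"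
        unfolding W11_norm_eq[OF gw] unfolding g_def[abs_def] L1_norm_cmult using C' by (simp add: distrib_left add_divide_distrib)
      also have "\<dots> \<le> 1" using fC C' by (simp add: divide_le_eq_1)
      finally have "(\<lambda>x. T0.L g x - Te.L g x) \<in> L2" "L2_norm (\<lambda>x. T0.L g x - Te.L g x) \<le> e / C'"
        using elim(1) W11I[OF gw] by auto
      then have "L1_norm (\<lambda>x. T0.L g x - Te.L g x) \<le> e / C'" using L1_norm_le_L2_norm(2) order_trans by blast
      then have le: "L1_norm (\<lambda>x. Te.L g x - T0.L g x) \<le> e / C'" using L1_norm_minus_commute[of "Te.L g" "T0.L g"] by simp
      have "ae_eq (\<lambda>x. Te.L g x - T0.L g x) (\<lambda>x. 1 / C' * (Te.L f x - T0.L f x))"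
        using Te.L_cmult[OF fL, of "1 / C'"] T0.L_cmult[OF fL, of "1 / C'"] unfolding ae_eq_def g_def[abs_def]
        by eventually_elim (simp add: algebra_simps diff_divide_distrib)
      then have "L1_norm (\<lambda>x. Te.L g x - T0.L g x) = \<bar>1 / C'\<bar> * L1_norm (\<lambda>x. Te.L f x - T0.L f x)"
        using L1_norm_ae_eq[OF L1_diff[OF Te.L_L1[OF gL] T0.L_L1[OF gL]]] unfolding L1_norm_cmult[symmetric] by blast
      then show "L1_norm (\<lambda>x. transfer_op (T \<epsilon>) f x - transfer_op (T 0) f x) \<le> e"
        using le C' by (simp add: divide_le_eq pos_le_divide_eq field_simps)
    qed
  qed
qed

end

section \<open>Linear response\<close>

lemma tendsto_zeroI:
  fixes f :: "nat \<Rightarrow> real"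
  assumes "\<And>n. 0 \<le> f n" "\<And>e. e > 0 \<Longrightarrow> eventually (\<lambda>n. f n \<le> e) sequentially"
  shows "f \<longlonglongrightarrow> 0"
proof (rule tendstoI)
  fix e :: real assume "e > 0"
  then have "eventually (\<lambda>n. f n \<le> e / 2) sequentially" by (intro assms(2)) simp
  then show "eventually (\<lambda>n. dist (f n) 0 < e) sequentially"
    by eventually_elim (use assms(1) \<open>e > 0\<close> in \<open>auto simp: dist_real_def intro: le_less_trans\<close>)
qed

context admissible_cusp_family
begin

abbreviation LT where "LT \<epsilon> \<equiv> transfer_op (T \<epsilon>)"

text \<open>The truncation level \<open>N\<close> depends only on \<open>c\<close>,
  \<open>\<beta>\<close>, \<open>\<theta>\<close>, \<open>\<kappa>\<close> and \<open>K\<close>,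
  which all maps of the family share.\<close>

lemma uniform_bounds:
  "\<exists>B G. 0 \<le> B \<and> 0 < G \<and> (\<forall>\<epsilon>\<in>{0..<\<delta>}.
    (\<forall>f u. has_weak_deriv f u \<longrightarrow> (\<exists>v. has_weak_deriv (LT \<epsilon> f) v \<and> L1_norm v \<le> L1_norm u + B * L1_norm f)) \<and>
    (\<forall>w u r s. has_weak_deriv w u \<and> has_weak_deriv r s \<and> ae_eq w (\<lambda>x. LT \<epsilon> w x + r x) \<longrightarrow>
       L1_norm u \<le> (B * L1_norm w + L1_norm s) / G))"
proof -
  obtain \<theta> \<kappa> K where CM: "\<And>\<epsilon>. \<epsilon> \<in> {0..<\<delta>} \<Longrightarrow>
      cusp_map (T \<epsilon>) c (a \<epsilon>) \<beta> \<theta> \<kappa> K (D01 (T \<epsilon>)) ((D01 ^^ 2) (T \<epsilon>)) ((D01 ^^ 3) (T \<epsilon>))"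
    using cusp_maps by blast
  interpret C0: cusp_map "T 0" c "a 0" \<beta> \<theta> \<kappa> K "D01 (T 0)" "(D01 ^^ 2) (T 0)" "(D01 ^^ 3) (T 0)"
    by (rule CM[OF zero_in])
  obtain N where N: "ly_cut c \<beta> \<theta> \<kappa> K N" by (rule C0.ly_cut_obtain)
  have N0: "N \<ge> 0" using N by (simp add: ly_cut_def)
  have "(\<forall>f u. has_weak_deriv f u \<longrightarrow> (\<exists>v. has_weak_deriv (LT \<epsilon> f) v \<and> L1_norm v \<le> L1_norm u + (N + 1) * L1_norm f)) \<and>
    (\<forall>w u r s. has_weak_deriv w u \<and> has_weak_deriv r s \<and> ae_eq w (\<lambda>x. LT \<epsilon> w x + r x) \<longrightarrow>
       L1_norm u \<le> ((N + 1) * L1_norm w + L1_norm s) / ly_gap \<theta>)" if e: "\<epsilon> \<in> {0..<\<delta>}" for \<epsilon>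
  proof (intro conjI allI impI)
    interpret C: cusp_map "T \<epsilon>" c "a \<epsilon>" \<beta> \<theta> \<kappa> K "D01 (T \<epsilon>)" "(D01 ^^ 2) (T \<epsilon>)" "(D01 ^^ 3) (T \<epsilon>)"
      by (rule CM[OF e])
    show "\<exists>v. has_weak_deriv (LT \<epsilon> f) v \<and> L1_norm v \<le> L1_norm u + (N + 1) * L1_norm f"
      if f: "has_weak_deriv f u" for f u
    proof -
      have "L1_norm (LT \<epsilon> (\<lambda>x. u x / D01 (T \<epsilon>) x + C.b x * f x))
          \<le> (1 - ly_gap \<theta>) * L1_norm u + (N + ly_gap \<theta>) * L1_norm f" by (rule C.lasota_yorke[OF N f])
      also have "\<dots> \<le> 1 * L1_norm u + (N + 1) * L1_norm f"
        using C0.gap_pos C0.gap_less L1_norm_nonneg[of u] L1_norm_nonneg[of f]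
        by (intro add_mono mult_right_mono) auto
      finally show ?thesis using C.L_weak_deriv(1)[OF f] by (auto simp: algebra_simps)
    qed
    show "L1_norm u \<le> ((N + 1) * L1_norm w + L1_norm s) / ly_gap \<theta>"
      if "has_weak_deriv w u \<and> has_weak_deriv r s \<and> ae_eq w (\<lambda>x. LT \<epsilon> w x + r x)" for w u r s
      by (rule C.fixed_point_bound[OF N, of w u r s 1]) (use that in auto)
  qed
  then show ?thesis using N0 C0.gap_pos by (intro exI[of _ "N + 1"] exI[of _ "ly_gap \<theta>"]) auto
qed

lemma transfer_diff_seq:
  assumes \<epsilon>: "filterlim \<epsilon> (at_right 0) sequentially"
    and f: "\<And>n. has_weak_deriv (f n) (u n)" "\<And>n. L1_norm (f n) + L1_norm (u n) \<le> C"
  shows "(\<lambda>n. L1_norm (\<lambda>x. LT (\<epsilon> n) (f n) x - LT 0 (f n) x)) \<longlonglongrightarrow> 0"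
proof (rule tendsto_zeroI)
  fix e :: real assume "e > 0"
  from eventually_compose_filterlim[OF transfer_diff_small[OF this, of C] \<epsilon>]
  show "eventually (\<lambda>n. L1_norm (\<lambda>x. LT (\<epsilon> n) (f n) x - LT 0 (f n) x) \<le> e) sequentially"
    by eventually_elim (use f in blast)
qed (rule L1_norm_nonneg)

text \<open>Suppose the remainder is not \<open>o(\<epsilon>)\<close> along a sequence. After normalisation, the functions
  \<open>(h \<epsilon> - h 0) / \<epsilon> - w\<close> are bounded in \<open>W\<^sup>1\<^sup>,\<^sup>1\<close> by the Lasota--Yorke inequality, and a limit point is an
  invariant function of \<open>T 0\<close> with norm \<open>1\<close> and mean \<open>0\<close>.\<close>

lemma response_sequence:
  fixes \<epsilon> :: "nat \<Rightarrow> real"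
  assumes \<epsilon>: "\<And>n. 0 < \<epsilon> n" "\<And>n. \<epsilon> n < \<delta>" "\<epsilon> \<longlonglongrightarrow> 0"
    and h: "\<And>\<epsilon>. \<epsilon> \<in> {0..<\<delta>} \<Longrightarrow> invariant_density (T \<epsilon>) (h \<epsilon>)" "\<And>\<epsilon>. \<epsilon> \<in> {0..<\<delta>} \<Longrightarrow> h \<epsilon> \<in> W11"
    and r: "\<And>n. (\<lambda>x. LT (\<epsilon> n) (h 0) x - LT 0 (h 0) x - \<epsilon> n * q x) \<in> W11"
    and ro: "(\<lambda>n. W11_norm (\<lambda>x. LT (\<epsilon> n) (h 0) x - LT 0 (h 0) x - \<epsilon> n * q x) / \<epsilon> n) \<longlonglongrightarrow> 0"
    and w: "has_weak_deriv w uw" "ae_eq w (\<lambda>x. LT 0 w x + q x)" "(LINT x|leb01. w x) = 0"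
    and e: "e > 0" "\<And>n. e * \<epsilon> n < L1_norm (\<lambda>x. h (\<epsilon> n) x - h 0 x - \<epsilon> n * w x)"
  shows False
proof -
  have en: "\<epsilon> n \<in> {0..<\<delta>}" for n using \<epsilon>(1)[of n] \<epsilon>(2)[of n] by simp
  have fl: "filterlim \<epsilon> (at_right 0) sequentially"
    using \<epsilon>(1,3) by (auto simp: filterlim_at less_imp_neq[symmetric])
  interpret T0: nonsingular_map "T 0" by standard (rule nonsing[OF zero_in])
  have Te: "nonsingular_map (T (\<epsilon> n))" for n by standard (rule nonsing[OF en])
  have h1: "h s \<in> L1" "ae_eq (LT s (h s)) (h s)" "(LINT x|leb01. h s x) = 1" if "s \<in> {0..<\<delta>}" for s
    using h(1)[OF that] by (auto simp: invariant_density_def)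
  note h0 = h1[OF zero_in] and hn = h1[OF en]
  note wL = has_weak_deriv_L1[OF w(1)]
  obtain B G where BG: "0 \<le> B" "0 < G"
    and LB: "\<And>s f u. s \<in> {0..<\<delta>} \<Longrightarrow> has_weak_deriv f u \<Longrightarrow>
      \<exists>v. has_weak_deriv (LT s f) v \<and> L1_norm v \<le> L1_norm u + B * L1_norm f"
    and FB: "\<And>s w u r v. s \<in> {0..<\<delta>} \<Longrightarrow> has_weak_deriv w u \<Longrightarrow> has_weak_deriv r v \<Longrightarrow>
      ae_eq w (\<lambda>x. LT s w x + r x) \<Longrightarrow> L1_norm u \<le> (B * L1_norm w + L1_norm v) / G"
    using uniform_bounds by blast
  define R where "R n x = LT (\<epsilon> n) (h 0) x - LT 0 (h 0) x - \<epsilon> n * q x" for n x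
  have Rw: "has_weak_deriv (R n) (wderiv (R n))" for n unfolding R_def[abs_def] by (rule wderiv[OF r])
  have Ro: "(\<lambda>n. W11_norm (R n) / \<epsilon> n) \<longlonglongrightarrow> 0" using ro unfolding R_def[abs_def] .
  have "Bseq (\<lambda>n. W11_norm (R n) / \<epsilon> n)" by (rule convergent_imp_Bseq, rule convergentI, rule Ro)
  then obtain B0 where "\<And>n. norm (W11_norm (R n) / \<epsilon> n) \<le> B0" by (auto simp: Bseq_def)
  then have B0: "W11_norm (R n) / \<epsilon> n \<le> B0" for n
    using order_trans[OF abs_ge_self, of "W11_norm (R n) / \<epsilon> n" B0] by simp
  define M where "M = L1_norm uw + B * L1_norm w"
  obtain v0 where v0: "has_weak_deriv (LT 0 w) v0" "L1_norm v0 \<le> M"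
    using LB[OF zero_in w(1)] by (auto simp: M_def)
  have "\<forall>n. \<exists>v. has_weak_deriv (LT (\<epsilon> n) w) v \<and> L1_norm v \<le> M"
    using LB[OF en w(1)] by (auto simp: M_def)
  then obtain vn where vn: "\<And>n. has_weak_deriv (LT (\<epsilon> n) w) (vn n)" "\<And>n. L1_norm (vn n) \<le> M" by metis
  \<comment> \<open>The source in the equation for the difference quotient of \<open>h\<close> minus
    \<open>w\<close>: the change of the operator on \<open>w\<close> plus the scaled remainder
    \<open>R n\<close>. It tends to 0 in the mean, while its weak derivative is only shown to be
    bounded.\<close>
  define s where "s n x = (LT (\<epsilon> n) w x - LT 0 w x) + 1 / \<epsilon> n * R n x" for n x
  define s' where "s' n x = (vn n x - v0 x) + 1 / \<epsilon> n * wderiv (R n) x" for n x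
  have sw: "has_weak_deriv (s n) (s' n)" for n
    unfolding s_def[abs_def] s'_def[abs_def]
    by (intro has_weak_deriv_add has_weak_deriv_diff vn v0 has_weak_deriv_cmult Rw)
  have RL1: "L1_norm (\<lambda>x. 1 / \<epsilon> n * R n x) \<le> W11_norm (R n) / \<epsilon> n"
    and RL2: "L1_norm (\<lambda>x. 1 / \<epsilon> n * wderiv (R n) x) \<le> W11_norm (R n) / \<epsilon> n" for n
    using \<epsilon>(1)[of n] L1_norm_nonneg[of "R n"] L1_norm_nonneg[of "wderiv (R n)"]
    unfolding L1_norm_cmult W11_norm_def by (auto simp: divide_right_mono)
  have s'B: "L1_norm (s' n) \<le> (M + M) + B0" for n
  proof -
    have "L1_norm (s' n) \<le> L1_norm (\<lambda>x. vn n x - v0 x) + L1_norm (\<lambda>x. 1 / \<epsilon> n * wderiv (R n) x)"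
      unfolding s'_def[abs_def]
      by (intro L1_norm_add L1_diff L1_cmult has_weak_deriv_L1(2)[OF vn(1)] has_weak_deriv_L1(2)[OF v0(1)]
          has_weak_deriv_L1(2)[OF Rw])
    moreover have "L1_norm (\<lambda>x. vn n x - v0 x) \<le> L1_norm (vn n) + L1_norm v0"
      by (intro L1_norm_diff has_weak_deriv_L1(2)[OF vn(1)] has_weak_deriv_L1(2)[OF v0(1)])
    ultimately show ?thesis using vn(2)[of n] v0(2) RL2[of n] B0[of n] by linarith
  qed
  have sL: "s n \<in> L1" for n by (rule has_weak_deriv_L1(1)[OF sw])
  have s0: "(\<lambda>n. L1_norm (s n)) \<longlonglongrightarrow> 0"
  proof (rule Lim_null_comparison[OF always_eventually])
    show "\<forall>n. norm (L1_norm (s n)) \<le> L1_norm (\<lambda>x. LT (\<epsilon> n) w x - LT 0 w x) + W11_norm (R n) / \<epsilon> n"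
    proof
      fix n
      have "L1_norm (s n) \<le> L1_norm (\<lambda>x. LT (\<epsilon> n) w x - LT 0 w x) + L1_norm (\<lambda>x. 1 / \<epsilon> n * R n x)"
        unfolding s_def[abs_def]
        by (intro L1_norm_add L1_diff L1_cmult has_weak_deriv_L1(1)[OF vn(1)] has_weak_deriv_L1(1)[OF v0(1)]
          has_weak_deriv_L1(1)[OF Rw])
      then show "norm (L1_norm (s n)) \<le> L1_norm (\<lambda>x. LT (\<epsilon> n) w x - LT 0 w x) + W11_norm (R n) / \<epsilon> n"
        using RL1[of n] L1_norm_nonneg[of "s n"] by simp
    qed
    have "(\<lambda>n. L1_norm (\<lambda>x. LT (\<epsilon> n) w x - LT 0 w x)) \<longlonglongrightarrow> 0"
      by (rule transfer_diff_seq[OF fl, of "\<lambda>_. w" "\<lambda>_. uw", OF w(1) order_refl])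
    from tendsto_add[OF this Ro]
    show "(\<lambda>n. L1_norm (\<lambda>x. LT (\<epsilon> n) w x - LT 0 w x) + W11_norm (R n) / \<epsilon> n) \<longlonglongrightarrow> 0" by simp
  qed
  define d where "d n x = 1 / \<epsilon> n * (h (\<epsilon> n) x - h 0 x)" for n x
  define v where "v n x = d n x - w x" for n x
  have hw: "has_weak_deriv (h s) (wderiv (h s))" if "s \<in> {0..<\<delta>}" for s by (rule wderiv[OF h(2)[OF that]])
  define u where "u n x = 1 / \<epsilon> n * (wderiv (h (\<epsilon> n)) x - wderiv (h 0) x) - uw x" for n x
  have dL: "d n \<in> L1" for n unfolding d_def[abs_def] by (intro L1_cmult L1_diff hn h0)
  have vw: "has_weak_deriv (v n) (u n)" for n
    unfolding v_def[abs_def] u_def[abs_def] d_def[abs_def]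
    by (intro has_weak_deriv_diff has_weak_deriv_cmult hw en zero_in w)
  note vL = has_weak_deriv_L1[OF vw]
  have veq: "ae_eq (v n) (\<lambda>x. LT (\<epsilon> n) (v n) x + s n x)" for n
  proof -
    interpret Tn: nonsingular_map "T (\<epsilon> n)" by (rule Te)
    have 1: "ae_eq (Tn.L (v n)) (\<lambda>x. Tn.L (d n) x - Tn.L w x)" unfolding v_def[abs_def] by (rule Tn.L_diff[OF dL wL(1)])
    have 2: "ae_eq (Tn.L (d n)) (\<lambda>x. 1 / \<epsilon> n * Tn.L (\<lambda>x. h (\<epsilon> n) x - h 0 x) x)"
      unfolding d_def[abs_def] by (intro Tn.L_cmult L1_diff hn h0)
    have 3: "ae_eq (Tn.L (\<lambda>x. h (\<epsilon> n) x - h 0 x)) (\<lambda>x. Tn.L (h (\<epsilon> n)) x - Tn.L (h 0) x)"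
      by (intro Tn.L_diff hn h0)
    show ?thesis
      using 1 2 3 hn(2)[of n] h0(2) w(2) unfolding ae_eq_def
    proof eventually_elim
      case (elim x)
      have "Tn.L (v n) x + s n x = 1 / \<epsilon> n * (h (\<epsilon> n) x - Tn.L (h 0) x) - LT 0 w x + 1 / \<epsilon> n * R n x"
        using elim by (simp add: s_def)
      also have "\<dots> = 1 / \<epsilon> n * (h (\<epsilon> n) x - LT 0 (h 0) x) - LT 0 w x - q x"
        unfolding R_def using \<epsilon>(1)[of n] by (simp add: field_simps)
      also have "\<dots> = v n x" unfolding v_def d_def using elim by simp
      finally show ?case by simp
    qed
  qed
  define m where "m n = L1_norm (v n)" for n
  have me: "e < m n" for n
  proof -
    have "(\<lambda>x. h (\<epsilon> n) x - h 0 x - \<epsilon> n * w x) = (\<lambda>x. \<epsilon> n * v n x)"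
      unfolding v_def d_def using \<epsilon>(1)[of n] by (auto simp: field_simps)
    then have "e * \<epsilon> n < \<epsilon> n * m n"
      using e(2)[of n] \<epsilon>(1)[of n] unfolding m_def by (simp add: L1_norm_cmult)
    then show ?thesis using \<epsilon>(1)[of n] by (simp add: mult.commute)
  qed
  have mpos: "m n > 0" for n using me[of n] e(1) by linarith
  define v' where "v' n x = 1 / m n * v n x" for n x
  define u' where "u' n x = 1 / m n * u n x" for n x
  define r' where "r' n x = 1 / m n * s n x" for n x
  define t' where "t' n x = 1 / m n * s' n x" for n x
  have v'w: "has_weak_deriv (v' n) (u' n)" for n
    unfolding v'_def[abs_def] u'_def[abs_def] by (rule has_weak_deriv_cmult[OF vw])
  have r'w: "has_weak_deriv (r' n) (t' n)" for n
    unfolding r'_def[abs_def] t'_def[abs_def] by (rule has_weak_deriv_cmult[OF sw])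
  note v'L = has_weak_deriv_L1[OF v'w]
  have v'1: "L1_norm (v' n) = 1" for n
    unfolding v'_def[abs_def] L1_norm_cmult using mpos[of n] by (simp add: m_def)
  \<comment> \<open>As \<open>m n > e\<close>, the normalisation costs at most a factor
    \<open>1 / e\<close>.\<close>
  have le_e: "L1_norm (\<lambda>x. 1 / m n * f x) \<le> L1_norm f / e" for n f
    unfolding L1_norm_cmult using mpos[of n] me[of n] e(1) L1_norm_nonneg[of f] by (simp add: frac_le)
  have v'eq: "ae_eq (v' n) (\<lambda>x. LT (\<epsilon> n) (v' n) x + r' n x)" for n
  proof -
    interpret Tn: nonsingular_map "T (\<epsilon> n)" by (rule Te)
    show ?thesis
      using veq[of n] Tn.L_cmult[OF vL(1)[of n], of "1 / m n"] unfolding ae_eq_def v'_def[abs_def] r'_def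
      by eventually_elim (simp add: distrib_left)
  qed
  define C where "C = max 1 ((B * 1 + ((M + M) + B0) / e) / G)"
  have u'C: "L1_norm (u' n) \<le> C" for n
  proof -
    have "L1_norm (u' n) \<le> (B * L1_norm (v' n) + L1_norm (t' n)) / G"
      by (rule FB[OF en v'w r'w v'eq])
    also have "\<dots> \<le> (B * 1 + ((M + M) + B0) / e) / G"
    proof -
      have "L1_norm (t' n) \<le> L1_norm (s' n) / e" unfolding t'_def[abs_def] by (rule le_e)
      also have "\<dots> \<le> ((M + M) + B0) / e" using s'B[of n] e(1) by (intro divide_right_mono) auto
      finally show ?thesis using BG by (simp add: v'1 divide_right_mono)
    qed
    finally show ?thesis by (simp add: C_def)
  qed
  have v'C: "L1_norm (v' n) \<le> C" for n by (simp add: v'1 C_def)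
  obtain \<sigma> V where \<sigma>: "strict_mono (\<sigma> :: nat \<Rightarrow> nat)" and VL: "V \<in> L1"
    and lim: "(\<lambda>n. L1_norm (\<lambda>x. v' (\<sigma> n) x - V x)) \<longlonglongrightarrow> 0"
    using rellich_L1[of v' u' C, OF v'w v'C u'C] by blast
  have sub: "(\<lambda>n. X (\<sigma> n)) \<longlonglongrightarrow> l" if "X \<longlonglongrightarrow> l" for X :: "nat \<Rightarrow> real" and l
    using LIMSEQ_subseq_LIMSEQ[OF that \<sigma>] by (simp add: comp_def)
  have V1: "L1_norm V = 1"
    using LIMSEQ_unique[OF L1_norm_tendsto[OF v'L(1) VL lim]] v'1 by simp
  have "(LINT x|leb01. v' n x) = 0" for n
  proof -
    have "(LINT x|leb01. d n x) = 0" unfolding d_def using hn(1)[of n] h0(1) hn(3)[of n] h0(3) by (simp add: L1_def)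
    then have "(LINT x|leb01. v n x) = 0" unfolding v_def using dL[of n] wL(1) w(3) by (simp add: L1_def)
    then show ?thesis unfolding v'_def by simp
  qed
  then have V0: "(LINT x|leb01. V x) = 0" using LIMSEQ_unique[OF LINT_tendsto1[OF v'L(1) VL lim]] by simp
  \<comment> \<open>On the functions \<open>v' n\<close>, which are bounded in \<open>W11\<close>,
    the perturbed operators are uniformly close to \<open>LT 0\<close>, so the limit is invariant
    under the unperturbed one.\<close>
  have "ae_eq V (LT 0 V)"
  proof (rule L1_lim_unique[OF v'L(1) VL T0.L_L1[OF VL] lim])
    show "(\<lambda>n. L1_norm (\<lambda>x. v' (\<sigma> n) x - LT 0 V x)) \<longlonglongrightarrow> 0"
    proof (rule Lim_null_comparison[OF always_eventually])
      let ?D = "\<lambda>n. L1_norm (\<lambda>x. LT (\<epsilon> n) (v' n) x - LT 0 (v' n) x)"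
      show "\<forall>n. norm (L1_norm (\<lambda>x. v' (\<sigma> n) x - LT 0 V x))
          \<le> ?D (\<sigma> n) + L1_norm (\<lambda>x. v' (\<sigma> n) x - V x) + L1_norm (s (\<sigma> n)) / e"
      proof
        fix n
        let ?n = "\<sigma> n"
        interpret Tn: nonsingular_map "T (\<epsilon> ?n)" by (rule Te)
        have a1: "(\<lambda>x. Tn.L (v' ?n) x - T0.L (v' ?n) x) \<in> L1" "(\<lambda>x. T0.L (v' ?n) x - T0.L V x) \<in> L1" "r' ?n \<in> L1"
          by (intro L1_diff Tn.L_L1 T0.L_L1 v'L VL has_weak_deriv_L1(1)[OF r'w])+
        have "L1_norm (\<lambda>x. v' ?n x - LT 0 V x)
            \<le> L1_norm (\<lambda>x. (Tn.L (v' ?n) x - T0.L (v' ?n) x) + (T0.L (v' ?n) x - T0.L V x)) + L1_norm (r' ?n)"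
          by (rule L1_norm_le_add[OF L1_add[OF a1(1,2)] a1(3)])
            (use v'eq[of ?n] in \<open>auto simp: ae_eq_def elim: eventually_mono\<close>)
        also have "\<dots> \<le> ?D ?n + L1_norm (\<lambda>x. T0.L (v' ?n) x - T0.L V x) + L1_norm (r' ?n)"
          using L1_norm_add[OF a1(1,2)] by simp
        also have "L1_norm (\<lambda>x. T0.L (v' ?n) x - T0.L V x) \<le> L1_norm (\<lambda>x. v' ?n x - V x)"
          by (rule T0.L_norm_diff[OF v'L(1) VL])
        also have "L1_norm (r' ?n) \<le> L1_norm (s ?n) / e" unfolding r'_def[abs_def] by (rule le_e)
        finally show "norm (L1_norm (\<lambda>x. v' ?n x - LT 0 V x))
          \<le> ?D ?n + L1_norm (\<lambda>x. v' ?n x - V x) + L1_norm (s ?n) / e"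
          using L1_norm_nonneg[of "\<lambda>x. v' ?n x - LT 0 V x"] by simp
      qed
      have D0: "?D \<longlonglongrightarrow> 0"
        by (rule transfer_diff_seq[OF fl v'w, where C = "1 + C"]) (use v'1 u'C in simp)
      have "(\<lambda>n. ?D (\<sigma> n) + L1_norm (\<lambda>x. v' (\<sigma> n) x - V x) + L1_norm (s (\<sigma> n)) / e) \<longlonglongrightarrow> 0 + 0 + 0 / e"
        by (intro tendsto_intros sub[OF D0] lim sub[OF s0]) (use e in simp)
      then show "(\<lambda>n. ?D (\<sigma> n) + L1_norm (\<lambda>x. v' (\<sigma> n) x - V x) + L1_norm (s (\<sigma> n)) / e) \<longlonglongrightarrow> 0" by simp
    qed
  qed
  moreover obtain \<theta> \<kappa> K where "cusp_map (T 0) c (a 0) \<beta> \<theta> \<kappa> K (D01 (T 0)) ((D01 ^^ 2) (T 0)) ((D01 ^^ 3) (T 0))"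
    using cusp_maps zero_in by blast
  ultimately have "ae_eq V (\<lambda>x. 0)"
    using cusp_map.invariant_L1_zero[OF _ VL _ V0] ae_eq_sym by blast
  then show False using V1 L1_norm_ae_eq[OF VL] L1_norm_const[of 0] by simp
qed

lemma eventually_in_domain: "\<forall>\<^sub>F \<epsilon> in at_right 0. \<epsilon> \<in> {0<..<\<delta>}"
  using delta_pos by (auto simp: eventually_at_right[OF delta_pos] intro: exI[of _ \<delta>])

lemma response_expansion:
  assumes h: "\<And>\<epsilon>. \<epsilon> \<in> {0..<\<delta>} \<Longrightarrow> invariant_density (T \<epsilon>) (h \<epsilon>)" "\<And>\<epsilon>. \<epsilon> \<in> {0..<\<delta>} \<Longrightarrow> h \<epsilon> \<in> W11"
    and q: "\<forall>\<^sub>F \<epsilon> in at_right 0. (\<lambda>x. LT \<epsilon> (h 0) x - LT 0 (h 0) x - \<epsilon> * q x) \<in> W11"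
      "(\<lambda>\<epsilon>. W11_norm (\<lambda>x. LT \<epsilon> (h 0) x - LT 0 (h 0) x - \<epsilon> * q x)) \<in> o[at_right 0](\<lambda>\<epsilon>. \<epsilon>)"
    and w: "has_weak_deriv w uw" "ae_eq w (\<lambda>x. LT 0 w x + q x)" "(LINT x|leb01. w x) = 0"
  shows "(\<lambda>\<epsilon>. L1_norm (\<lambda>x. h \<epsilon> x - h 0 x - \<epsilon> * w x)) \<in> o[at_right 0](\<lambda>\<epsilon>. \<epsilon>)"
proof (rule landau_o.smallI)
  fix e :: real assume e: "e > 0"
  let ?R = "\<lambda>\<epsilon> x. LT \<epsilon> (h 0) x - LT 0 (h 0) x - \<epsilon> * q x"
  \<comment> \<open>Membership in \<open>W11\<close> is known only for small parameters. As a
    premise of \<open>?P\<close> it holds at every term of a sequence that violates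
    \<open>?P\<close>.\<close>
  let ?P = "\<lambda>\<epsilon>. ?R \<epsilon> \<in> W11 \<longrightarrow> L1_norm (\<lambda>x. h \<epsilon> x - h 0 x - \<epsilon> * w x) \<le> e * \<epsilon>"
  have Ro: "((\<lambda>\<epsilon>. W11_norm (?R \<epsilon>) / \<epsilon>) \<longlongrightarrow> 0) (at_right 0)" by (rule smalloD_tendsto[OF q(2)])
  have "eventually ?P (at_right 0)"
  proof (rule sequentially_imp_eventually_at_right[OF delta_pos])
    fix f :: "nat \<Rightarrow> real" assume f: "\<And>n. 0 < f n" "\<And>n. f n < \<delta>" "f \<longlonglongrightarrow> 0"
    show "eventually (\<lambda>n. ?P (f n)) sequentially"
    proof (rule ccontr)
      assume "\<not> eventually (\<lambda>n. ?P (f n)) sequentially"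
      then obtain \<rho> where \<rho>: "strict_mono (\<rho> :: nat \<Rightarrow> nat)" "\<And>n. \<not> ?P (f (\<rho> n))"
        using not_eventually_sequentiallyD by blast
      have l: "(\<lambda>n. f (\<rho> n)) \<longlonglongrightarrow> 0" using LIMSEQ_subseq_LIMSEQ[OF f(3) \<rho>(1)] by (simp add: comp_def)
      have fl: "filterlim (\<lambda>n. f (\<rho> n)) (at_right 0) sequentially"
        using l f(1) by (auto simp: filterlim_at less_imp_neq[symmetric])
      have Rn: "?R (f (\<rho> n)) \<in> W11" for n using \<rho>(2)[of n] by blast
      have big: "e * f (\<rho> n) < L1_norm (\<lambda>x. h (f (\<rho> n)) x - h 0 x - f (\<rho> n) * w x)" for n
        using \<rho>(2)[of n] by (simp add: not_le)
      show False
        by (rule response_sequence[where \<epsilon> = "\<lambda>n. f (\<rho> n)" and h = h and q = q and w = w and e = e,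
              OF f(1) f(2) l h Rn filterlim_compose[OF Ro fl] w e big])
    qed
  qed
  then show "\<forall>\<^sub>F \<epsilon> in at_right 0. norm (L1_norm (\<lambda>x. h \<epsilon> x - h 0 x - \<epsilon> * w x)) \<le> e * norm \<epsilon>"
    using q(1) eventually_in_domain
    by eventually_elim (simp add: L1_norm_nonneg)
qed

end

section \<open>Cutoff functions\<close>

lemma tent_weak_deriv:
  assumes st: "0 < s" "s < t" "t < 1"
  defines "\<tau> \<equiv> \<lambda>x::real. max 0 (min (x - s) (t - x))"
  shows "\<exists>\<sigma>. has_weak_deriv \<tau> \<sigma>"
proof -
  define m where "m = (s + t) / 2"
  have m: "s < m" "m < t" using st by (auto simp: m_def)
  define \<sigma> :: "real \<Rightarrow> real" where "\<sigma> x = (if x < s then 0 else if x < m then 1 else if x < t then -1 else 0)" for x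
  have "\<sigma> \<in> borel_measurable borel" unfolding \<sigma>_def by measurable
  then have sm: "\<sigma> \<in> borel_measurable leb01" by (rule borel_measurable_leb01)
  have sL: "\<sigma> \<in> L1" by (rule L1_dominated'[OF L1_const[of 1] sm]) (auto simp: \<sigma>_def)
  have tc: "continuous_on S \<tau>" for S unfolding \<tau>_def by (intro continuous_intros)
  have der: "(\<tau> has_real_derivative \<sigma> x) (at x)" if x: "x \<in> {0<..<1} - {s, m, t}" for x
  proof -
    consider "x < s" | "s < x" "x < m" | "m < x" "x < t" | "t < x" using x by fastforce
    then show ?thesis
    proof cases
      case 1
      have "((\<lambda>x. 0) has_real_derivative \<sigma> x) (at x)" using 1 by (simp add: \<sigma>_def)
      then show ?thesis by (rule has_field_derivative_transform_within_open[of _ _ _ "{..<s}"]) (use 1 in \<open>auto simp: \<tau>_def\<close>)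
    next
      case 2
      have "((\<lambda>x. x - s) has_real_derivative \<sigma> x) (at x)" using 2 m by (auto simp: \<sigma>_def intro!: derivative_eq_intros)
      then show ?thesis
        by (rule has_field_derivative_transform_within_open[of _ _ _ "{s<..<m}"]) (use 2 in \<open>auto simp: \<tau>_def m_def min_def\<close>)
    next
      case 3
      have "((\<lambda>x. t - x) has_real_derivative \<sigma> x) (at x)" using 3 m by (auto simp: \<sigma>_def intro!: derivative_eq_intros)
      then show ?thesis
        by (rule has_field_derivative_transform_within_open[of _ _ _ "{m<..<t}"]) (use 3 in \<open>auto simp: \<tau>_def m_def min_def\<close>)
    next
      case 4
      have "((\<lambda>x. 0) has_real_derivative \<sigma> x) (at x)" using 4 m by (simp add: \<sigma>_def)
      then show ?thesis by (rule has_field_derivative_transform_within_open[of _ _ _ "{t<..}"]) (use 4 in \<open>auto simp: \<tau>_def\<close>)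
    qed
  qed
  have "prim \<sigma> x = \<tau> x - \<tau> 0" if "x \<in> {0..1}" for x
    by (rule prim_FTC[OF sL _ tc _ that, of "{s, m, t}"]) (use der in auto)
  then have "ae_eq \<tau> (\<lambda>x. \<tau> 0 + prim \<sigma> x)" unfolding ae_eq_def by (intro AE_I2) simp
  then have "has_weak_deriv \<tau> \<sigma>" by (rule has_weak_deriv_prim[OF sL continuous_L1[OF tc]])
  then show ?thesis by blast
qed

text \<open>One minus the normalised primitive of a tent between \<open>s\<close> and
  \<open>t\<close>. Its derivative is piecewise linear and continuous, hence weakly differentiable
  in turn.\<close>

lemma plateau_exists:
  assumes st: "0 < s" "s < t" "t < (1::real)"
  shows "\<exists>\<zeta>. \<zeta> \<in> W21 \<and> (\<forall>x\<in>{0..1}. 0 \<le> \<zeta> x \<and> \<zeta> x \<le> 1) \<and> (\<forall>x\<in>{0..s}. \<zeta> x = 1) \<and> (\<forall>x\<in>{t..1}. \<zeta> x = 0)"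
proof -
  define \<tau> where "\<tau> x = max 0 (min (x - s) (t - x))" for x
  obtain \<sigma> where \<sigma>: "has_weak_deriv \<tau> \<sigma>" using tent_weak_deriv[OF st] unfolding \<tau>_def[abs_def] by blast
  have tc: "continuous_on S \<tau>" for S unfolding \<tau>_def by (intro continuous_intros)
  have tL: "\<tau> \<in> L1" by (rule continuous_L1[OF tc])
  have t0: "0 \<le> \<tau> x" for x by (simp add: \<tau>_def)
  define J where "J = prim \<tau> 1"
  have mono: "x \<le> y \<Longrightarrow> prim \<tau> x \<le> prim \<tau> y" for x y using prim_mono[OF tL t0] by (auto simp: mono_def)
  have J: "0 < J"
  proof (rule ccontr)
    assume "\<not> 0 < J"
    then have "prim \<tau> x = 0" if "x \<in> {0..1}" for x
      using mono[of 0 x] mono[of x 1] that prim_0[OF tL, of 0] unfolding J_def by force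
    then have "ae_eq \<tau> (\<lambda>x. 0)" by (rule ae_zero_if_prim_zero[OF tL])
    then have "\<tau> ((s + t) / 2) = 0" by (rule continuous_ae_zero[OF tc]) (use st in auto)
    then show False using st by (simp add: \<tau>_def field_simps)
  qed
  define \<zeta> where "\<zeta> x = 1 - 1 / J * prim \<tau> x" for x
  have lo: "prim \<tau> x = 0" if "x \<le> s" for x
  proof -
    have "prim \<tau> x = (LINT t|leb01. 0)" unfolding prim_def
      by (rule Bochner_Integration.integral_cong) (use that in \<open>auto simp: \<tau>_def split: split_indicator\<close>)
    then show ?thesis by simp
  qed
  have hi: "prim \<tau> x = J" if "t \<le> x" for x
    unfolding prim_def J_def
    by (rule Bochner_Integration.integral_cong) (use that in \<open>auto simp: \<tau>_def split: split_indicator\<close>)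
  have "has_weak_deriv \<zeta> (\<lambda>x. - (1 / J) * \<tau> x)"
  proof (rule has_weak_deriv_C1)
    show "continuous_on {0..1} (\<lambda>x. - (1 / J) * \<tau> x)" by (intro continuous_intros tc)
    fix x :: real assume "x \<in> {0..1}"
    from prim_has_derivative[OF tL tc this]
    show "(\<zeta> has_real_derivative - (1 / J) * \<tau> x) (at x within {0..1})"
      unfolding \<zeta>_def[abs_def] using J by (auto intro!: derivative_eq_intros)
  qed
  then have "\<zeta> \<in> W21" by (rule W21I[OF _ has_weak_deriv_cmult[OF \<sigma>]])
  moreover have "0 \<le> \<zeta> x \<and> \<zeta> x \<le> 1" if "x \<in> {0..1}" for x
    using mono[of 0 x] mono[of x 1] that prim_0[OF tL, of 0] J unfolding \<zeta>_def J_def[symmetric] by (auto simp: divide_le_eq_1)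
  moreover have "\<zeta> x = 1" if "x \<in> {0..s}" for x using lo[of x] that by (simp add: \<zeta>_def)
  moreover have "\<zeta> x = 0" if "x \<in> {t..1}" for x using hi[of x] that J by (simp add: \<zeta>_def)
  ultimately show ?thesis by blast
qed

lemma W21_one_minus:
  assumes "f \<in> W21" shows "(\<lambda>x. 1 - f x) \<in> W21"
proof -
  have f: "f \<in> W11" "wderiv f \<in> W11" using assms by (auto simp: W21_def)
  have "has_weak_deriv (\<lambda>x. 1 - f x) (\<lambda>x. 0 - wderiv f x)"
    by (rule has_weak_deriv_diff[OF has_weak_deriv_const wderiv[OF f(1)]])
  moreover have "has_weak_deriv (\<lambda>x. 0 - wderiv f x) (\<lambda>x. 0 - wderiv (wderiv f) x)"
    by (rule has_weak_deriv_diff[OF has_weak_deriv_const wderiv[OF f(2)]])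
  ultimately show ?thesis by (rule W21I)
qed

lemma prim_mono_AE:
  assumes u: "u \<in> L1" "AE x in leb01. 0 \<le> u x" and xy: "x \<le> y"
  shows "prim u x \<le> prim u y"
proof -
  have c: "ae_eq u (\<lambda>x. max 0 (u x))" unfolding ae_eq_def using u(2) by eventually_elim simp
  have "(\<lambda>x. max 0 (u x)) \<in> L1" by (rule L1_cong[OF u(1) c])
  then have "mono (prim (\<lambda>x. max 0 (u x)))" by (rule prim_mono) simp
  then show ?thesis using xy prim_cong[OF u(1) c] by (auto simp: mono_def)
qed

section \<open>Preimages of intervals\<close>

context cusp_map
begin

text \<open>The branches are strictly monotone in opposite directions, so the points above the level
  are exactly those between its two preimages.\<close>

lemma level_set:
  assumes x: "0 \<le> x1" "x1 < c" "c < x2" "x2 \<le> 1" "T x2 = T x1" and z: "z \<in> X"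
  shows "T z \<le> T x1 \<longleftrightarrow> z \<le> x1 \<or> x2 \<le> z"
proof (cases "z < c")
  case True
  have "z \<le> x1 \<Longrightarrow> T z \<le> T x1" using T_left[of z x1] x z theta by (smt (verit) mult_nonneg_nonneg atLeastAtMost_iff Diff_iff)
  moreover have "x1 < z \<Longrightarrow> T x1 < T z"
  proof -
    assume "x1 < z"
    then have "0 < \<theta> * (z - x1)" using theta by simp
    then show ?thesis using T_left[of x1 z] x True \<open>x1 < z\<close> by simp
  qed
  ultimately show ?thesis using True x by force
next
  case False
  then have cz: "c < z" "z \<le> 1" using z by auto
  have "x2 \<le> z \<Longrightarrow> T z \<le> T x2" using T_right[of x2 z] x cz theta by (smt (verit) mult_nonneg_nonneg)
  moreover have "z < x2 \<Longrightarrow> T x2 < T z"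
  proof -
    assume "z < x2"
    then have "0 < \<theta> * (x2 - z)" using theta by simp
    then show ?thesis using T_right[of z x2] x cz \<open>z < x2\<close> by simp
  qed
  ultimately show ?thesis using cz x by force
qed

lemma preimages_exist:
  assumes "0 \<le> y" "y < a"
  obtains x1 x2 where "0 \<le> x1" "x1 < c" "c < x2" "x2 \<le> 1" "T x1 = y" "T x2 = y"
proof -
  have "y \<in> T ` {0..<c}" using T_image_left_a[of 0] T_ends c_in assms by auto
  then obtain x1 where x1: "x1 \<in> {0..<c}" "T x1 = y" by blast
  have "y \<in> T ` {c<..1}" using T_image_right_a[of 1] T_ends c_in assms by auto
  then obtain x2 where x: "x1 \<in> {0..<c}" "x2 \<in> {c<..1}" "T x1 = y" "T x2 = y" using x1 by blast
  show ?thesis by (rule that[of x1 x2]) (use x in auto)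
qed

lemma prim_L: "u \<in> L1 \<Longrightarrow> prim (L u) y = (LINT z|leb01. u z * indicator {..y} (T z))"
  unfolding prim_def by (rule L_dual[OF _ ind_Linf])

lemma LINT_level:
  assumes x: "0 \<le> x1" "x1 < c" "c < x2" "x2 \<le> 1" "T x2 = T x1" and u: "u \<in> L1"
  shows "(LINT z|leb01. u z * indicator {..T x1} (T z)) = prim u x1 + ((LINT z|leb01. u z) - prim u x2)"
proof -
  have i: "(\<lambda>z. indicator {..T x1} (T z) :: real) \<in> Linf" by (rule Linf_comp[OF nonsing ind_Linf])
  have "(LINT z|leb01. u z * indicator {..T x1} (T z))
      = (LINT z|leb01. u z * indicator {..x1} z + (u z - u z * indicator {..x2} z))"
  proof (rule integral_ae_eq[OF L1_measurable[OF L1_mult_Linf[OF u i]]])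
    show "ae_eq (\<lambda>z. u z * indicator {..T x1} (T z)) (\<lambda>z. u z * indicator {..x1} z + (u z - u z * indicator {..x2} z))"
      unfolding ae_eq_def using AE_X null_point[of x2]
    proof eventually_elim
      case (elim z)
      then show ?case using level_set[OF x elim(1)] x by (auto split: split_indicator)
    qed
  qed
  also have "\<dots> = prim u x1 + ((LINT z|leb01. u z) - prim u x2)"
    unfolding prim_def using prim_integrable[OF u] u by (simp add: L1_def)
  finally show ?thesis .
qed

lemma prim_L_level:
  assumes x: "0 \<le> x1" "x1 < c" "c < x2" "x2 \<le> 1" "T x2 = T x1" and u: "u \<in> L1"
  shows "prim (L u) (T x1) = prim u x1 + ((LINT z|leb01. u z) - prim u x2)"
  unfolding prim_L[OF u] by (rule LINT_level[OF x u])

text \<open>Off the cusp the values of \<open>T\<close> lie below \<open>a\<close>, so the indicator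
  of \<open>{..y}\<close> is 1 at almost every \<open>T z\<close>.\<close>

lemma prim_L_above:
  assumes "u \<in> L1" "a \<le> y" shows "prim (L u) y = (LINT z|leb01. u z)"
  unfolding prim_L[OF assms(1)]
proof (rule integral_ae_eq)
  have i: "(\<lambda>z. indicator {..y} (T z) :: real) \<in> Linf" by (rule Linf_comp[OF nonsing ind_Linf])
  show "(\<lambda>z. u z * indicator {..y} (T z)) \<in> borel_measurable leb01" by (rule L1_measurable[OF L1_mult_Linf[OF assms(1) i]])
  show "ae_eq (\<lambda>z. u z * indicator {..y} (T z)) u"
  proof (rule ae_eq_X)
    fix z assume "z \<in> X"
    then show "u z * indicator {..y} (T z) = u z" using T_lt_a[of z] assms(2) by simp
  qed
qed

end

section \<open>Differentiation of perturbed functions\<close>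

text \<open>The chain rule for a perturbed function at a moving point. The difference quotient
  \<open>Q\<close> is extended by \<open>g\<close> at \<open>y0\<close>, which covers parameters
  with \<open>y \<epsilon> = y0\<close>; uniformity of \<open>\<rho>\<close> allows the expansion to
  be evaluated at \<open>y \<epsilon>\<close>.\<close>

lemma family_compose_deriv:
  fixes G :: "real \<Rightarrow> real \<Rightarrow> real"
  assumes y: "((\<lambda>\<epsilon>. (y \<epsilon> - y0) / \<epsilon>) \<longlongrightarrow> m) (at_right 0)"
    and yin: "\<forall>\<^sub>F \<epsilon> in at_right 0. y \<epsilon> \<in> {0..1}"
    and G: "\<forall>\<^sub>F \<epsilon> in at_right 0. \<forall>x\<in>{0..1}. \<bar>G \<epsilon> x - G 0 x - \<epsilon> * H x\<bar> \<le> \<rho> \<epsilon>"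
    and \<rho>: "((\<lambda>\<epsilon>. \<rho> \<epsilon> / \<epsilon>) \<longlongrightarrow> 0) (at_right 0)"
    and g: "(G 0 has_real_derivative g) (at y0 within {0..1})"
    and H: "continuous_on {0..1} H" and y0: "y0 \<in> {0..1}"
  shows "((\<lambda>\<epsilon>. (G \<epsilon> (y \<epsilon>) - G 0 y0) / \<epsilon>) \<longlongrightarrow> g * m + H y0) (at_right 0)"
proof -
  have pos: "\<forall>\<^sub>F \<epsilon> in at_right (0::real). 0 < \<epsilon>" by (rule eventually_at_right_less)
  have ylim: "(y \<longlongrightarrow> y0) (at_right 0)"
  proof -
    have "((\<lambda>\<epsilon>. (y \<epsilon> - y0) / \<epsilon> * \<epsilon> + y0) \<longlongrightarrow> m * 0 + y0) (at_right 0)" by (intro tendsto_intros y)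
    then have "((\<lambda>\<epsilon>. (y \<epsilon> - y0) / \<epsilon> * \<epsilon> + y0) \<longlongrightarrow> y0) (at_right 0)" by simp
    moreover have "\<forall>\<^sub>F \<epsilon> in at_right 0. (y \<epsilon> - y0) / \<epsilon> * \<epsilon> + y0 = y \<epsilon>" using pos by eventually_elim simp
    ultimately show ?thesis by (rule Lim_transform_eventually)
  qed
  define Q where "Q x = (if x = y0 then g else (G 0 x - G 0 y0) / (x - y0))" for x
  have Qc: "continuous (at y0 within {0..1}) Q"
  proof -
    have "((\<lambda>x. (G 0 x - G 0 y0) / (x - y0)) \<longlongrightarrow> g) (at y0 within {0..1})" using g by (simp add: has_field_derivative_iff)
    then have "(Q \<longlongrightarrow> g) (at y0 within {0..1})"
      by (rule tendsto_cong[THEN iffD1, rotated]) (auto simp: Q_def eventually_at_filter)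
    then show ?thesis by (simp add: continuous_within Q_def)
  qed
  have Qlim: "((\<lambda>\<epsilon>. Q (y \<epsilon>)) \<longlongrightarrow> g) (at_right 0)"
    using continuous_within_tendsto_compose[OF Qc yin ylim] by (simp add: Q_def)
  have Hlim: "((\<lambda>\<epsilon>. H (y \<epsilon>)) \<longlongrightarrow> H y0) (at_right 0)"
    by (rule continuous_within_tendsto_compose[OF _ yin ylim]) (use H y0 in \<open>simp add: continuous_on_eq_continuous_within\<close>)
  have rem: "((\<lambda>\<epsilon>. (G \<epsilon> (y \<epsilon>) - G 0 (y \<epsilon>) - \<epsilon> * H (y \<epsilon>)) / \<epsilon>) \<longlongrightarrow> 0) (at_right 0)"
  proof (rule Lim_null_comparison[OF _ \<rho>])
    show "\<forall>\<^sub>F \<epsilon> in at_right 0. norm ((G \<epsilon> (y \<epsilon>) - G 0 (y \<epsilon>) - \<epsilon> * H (y \<epsilon>)) / \<epsilon>) \<le> \<rho> \<epsilon> / \<epsilon>"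
      using G yin pos by eventually_elim (auto simp: abs_divide intro!: divide_right_mono)
  qed
  have "((\<lambda>\<epsilon>. Q (y \<epsilon>) * ((y \<epsilon> - y0) / \<epsilon>) + H (y \<epsilon>) + (G \<epsilon> (y \<epsilon>) - G 0 (y \<epsilon>) - \<epsilon> * H (y \<epsilon>)) / \<epsilon>) \<longlongrightarrow> g * m + H y0 + 0) (at_right 0)"
    by (intro tendsto_intros Qlim y Hlim rem)
  then have "((\<lambda>\<epsilon>. Q (y \<epsilon>) * ((y \<epsilon> - y0) / \<epsilon>) + H (y \<epsilon>) + (G \<epsilon> (y \<epsilon>) - G 0 (y \<epsilon>) - \<epsilon> * H (y \<epsilon>)) / \<epsilon>) \<longlongrightarrow> g * m + H y0) (at_right 0)"
    by simp
  then show ?thesis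
  proof (rule tendsto_cong[THEN iffD1, rotated])
    show "\<forall>\<^sub>F \<epsilon> in at_right 0. Q (y \<epsilon>) * ((y \<epsilon> - y0) / \<epsilon>) + H (y \<epsilon>) + (G \<epsilon> (y \<epsilon>) - G 0 (y \<epsilon>) - \<epsilon> * H (y \<epsilon>)) / \<epsilon>
        = (G \<epsilon> (y \<epsilon>) - G 0 y0) / \<epsilon>"
      using pos
    proof eventually_elim
      case (elim \<epsilon>)
      have "Q (y \<epsilon>) * (y \<epsilon> - y0) = G 0 (y \<epsilon>) - G 0 y0" by (simp add: Q_def)
      then have "Q (y \<epsilon>) * ((y \<epsilon> - y0) / \<epsilon>) = (G 0 (y \<epsilon>) - G 0 y0) / \<epsilon>" by simp
      moreover have "(G 0 (y \<epsilon>) - G 0 y0) / \<epsilon> + H (y \<epsilon>) + (G \<epsilon> (y \<epsilon>) - G 0 (y \<epsilon>) - \<epsilon> * H (y \<epsilon>)) / \<epsilon>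
          = (G \<epsilon> (y \<epsilon>) - G 0 y0) / \<epsilon>" using elim by (simp add: field_simps)
      ultimately show ?case by (simp only:)
    qed
  qed
qed

text \<open>The expansion of the chain rule, now solved for the increment of \<open>y\<close>. Of
  \<open>y\<close> only convergence is assumed; \<open>Q (y \<epsilon>)\<close> tends to
  \<open>g \<noteq> 0\<close>, so it can be divided by.\<close>

lemma family_implicit_deriv:
  fixes G :: "real \<Rightarrow> real \<Rightarrow> real"
  assumes y: "(y \<longlongrightarrow> y0) (at_right 0)"
    and yin: "\<forall>\<^sub>F \<epsilon> in at_right 0. y \<epsilon> \<in> {0..1}"
    and eq: "\<forall>\<^sub>F \<epsilon> in at_right 0. G \<epsilon> (y \<epsilon>) = G 0 y0"
    and G: "\<forall>\<^sub>F \<epsilon> in at_right 0. \<forall>x\<in>{0..1}. \<bar>G \<epsilon> x - G 0 x - \<epsilon> * H x\<bar> \<le> \<rho> \<epsilon>"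
    and \<rho>: "((\<lambda>\<epsilon>. \<rho> \<epsilon> / \<epsilon>) \<longlongrightarrow> 0) (at_right 0)"
    and g: "(G 0 has_real_derivative g) (at y0 within {0..1})" "g \<noteq> 0"
    and H: "continuous_on {0..1} H" and y0: "y0 \<in> {0..1}"
  shows "((\<lambda>\<epsilon>. (y \<epsilon> - y0) / \<epsilon>) \<longlongrightarrow> - (H y0 / g)) (at_right 0)"
proof -
  have pos: "\<forall>\<^sub>F \<epsilon> in at_right (0::real). 0 < \<epsilon>" by (rule eventually_at_right_less)
  define Q where "Q x = (if x = y0 then g else (G 0 x - G 0 y0) / (x - y0))" for x
  have Qc: "continuous (at y0 within {0..1}) Q"
  proof -
    have "((\<lambda>x. (G 0 x - G 0 y0) / (x - y0)) \<longlongrightarrow> g) (at y0 within {0..1})" using g by (simp add: has_field_derivative_iff)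
    then have "(Q \<longlongrightarrow> g) (at y0 within {0..1})"
      by (rule tendsto_cong[THEN iffD1, rotated]) (auto simp: Q_def eventually_at_filter)
    then show ?thesis by (simp add: continuous_within Q_def)
  qed
  have Qlim: "((\<lambda>\<epsilon>. Q (y \<epsilon>)) \<longlongrightarrow> g) (at_right 0)"
    using continuous_within_tendsto_compose[OF Qc yin y] by (simp add: Q_def)
  have Qnz: "\<forall>\<^sub>F \<epsilon> in at_right 0. Q (y \<epsilon>) \<noteq> 0" by (rule tendsto_imp_eventually_ne[OF Qlim g(2)])
  have Hlim: "((\<lambda>\<epsilon>. H (y \<epsilon>)) \<longlongrightarrow> H y0) (at_right 0)"
    by (rule continuous_within_tendsto_compose[OF _ yin y]) (use H y0 in \<open>simp add: continuous_on_eq_continuous_within\<close>)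
  have rem: "((\<lambda>\<epsilon>. (G \<epsilon> (y \<epsilon>) - G 0 (y \<epsilon>) - \<epsilon> * H (y \<epsilon>)) / \<epsilon>) \<longlongrightarrow> 0) (at_right 0)"
  proof (rule Lim_null_comparison[OF _ \<rho>])
    show "\<forall>\<^sub>F \<epsilon> in at_right 0. norm ((G \<epsilon> (y \<epsilon>) - G 0 (y \<epsilon>) - \<epsilon> * H (y \<epsilon>)) / \<epsilon>) \<le> \<rho> \<epsilon> / \<epsilon>"
      using G yin pos by eventually_elim (auto simp: abs_divide intro!: divide_right_mono)
  qed
  have "((\<lambda>\<epsilon>. - (H (y \<epsilon>) + (G \<epsilon> (y \<epsilon>) - G 0 (y \<epsilon>) - \<epsilon> * H (y \<epsilon>)) / \<epsilon>) / Q (y \<epsilon>)) \<longlongrightarrow> - (H y0 + 0) / g) (at_right 0)"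
    by (intro tendsto_intros Qlim Hlim rem g)
  then have "((\<lambda>\<epsilon>. - (H (y \<epsilon>) + (G \<epsilon> (y \<epsilon>) - G 0 (y \<epsilon>) - \<epsilon> * H (y \<epsilon>)) / \<epsilon>) / Q (y \<epsilon>)) \<longlongrightarrow> - (H y0 / g)) (at_right 0)"
    by simp
  then show ?thesis
  proof (rule tendsto_cong[THEN iffD1, rotated])
    show "\<forall>\<^sub>F \<epsilon> in at_right 0. - (H (y \<epsilon>) + (G \<epsilon> (y \<epsilon>) - G 0 (y \<epsilon>) - \<epsilon> * H (y \<epsilon>)) / \<epsilon>) / Q (y \<epsilon>) = (y \<epsilon> - y0) / \<epsilon>"
      using pos eq Qnz
    proof eventually_elim
      case (elim \<epsilon>)
      have "Q (y \<epsilon>) * (y \<epsilon> - y0) = G 0 (y \<epsilon>) - G 0 y0" by (simp add: Q_def)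
      moreover have "- (H (y \<epsilon>) + (G \<epsilon> (y \<epsilon>) - G 0 (y \<epsilon>) - \<epsilon> * H (y \<epsilon>)) / \<epsilon>) = (G 0 (y \<epsilon>) - G 0 y0) / \<epsilon>"
        using elim by (simp add: field_simps)
      ultimately have "- (H (y \<epsilon>) + (G \<epsilon> (y \<epsilon>) - G 0 (y \<epsilon>) - \<epsilon> * H (y \<epsilon>)) / \<epsilon>) = Q (y \<epsilon>) * (y \<epsilon> - y0) / \<epsilon>"
        by simp
      then show ?case using elim by simp
    qed
  qed
qed

lemma W11_continuous_rep:
  assumes "f \<in> W11"
  shows "\<exists>k. continuous_on {0..1} k \<and> ae_eq f k"
proof -
  obtain l where l: "ae_eq f (\<lambda>x. l + prim (wderiv f) x)" using has_weak_deriv_rep[OF wderiv[OF assms]] by blast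
  have "continuous_on {0..1} (\<lambda>x. l + prim (wderiv f) x)"
    by (intro continuous_intros continuous_on_prim has_weak_deriv_L1[OF wderiv[OF assms]])
  then show ?thesis using l by blast
qed

lemma continuous_rep_bound:
  assumes f: "f \<in> W11" and k: "continuous_on {0..1} k" "ae_eq f k" and y: "y \<in> {0..1}"
  shows "\<bar>k y\<bar> \<le> W11_norm f"
proof -
  note w = wderiv[OF f]
  note wL = has_weak_deriv_L1[OF w]
  obtain l where l: "ae_eq f (\<lambda>x. l + prim (wderiv f) x)" using has_weak_deriv_rep[OF w] by blast
  have "k y = l + prim (wderiv f) y"
    by (rule continuous_ae_eq[OF k(1) _ ae_eq_trans[OF ae_eq_sym[OF k(2)] l] y])
      (intro continuous_intros continuous_on_prim wL)
  then show ?thesis using sup_bound[OF wL(2,1) l, of y] by (simp add: W11_norm_def)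
qed

lemma prim_has_derivative_rep:
  assumes f: "f \<in> L1" and k: "continuous_on {0..1} k" "ae_eq f k" and y: "y \<in> {0..1}"
  shows "(prim f has_real_derivative k y) (at y within {0..1})"
proof -
  have "prim f = prim k" by (rule ext) (rule prim_cong[OF f k(2)])
  then show ?thesis using prim_has_derivative[OF L1_cong[OF f k(2)] k(1) y] by simp
qed

lemma eps_deriv0_eqI:
  assumes "((\<lambda>\<epsilon>. (F \<epsilon> x - F 0 x) / \<epsilon>) \<longlongrightarrow> l) (at_right 0)"
  shows "(\<lambda>\<epsilon>. F \<epsilon> x) differentiable (at_right 0)" "eps_deriv0 F x = l"
proof -
  have "((\<lambda>\<epsilon>. F \<epsilon> x) has_real_derivative l) (at_right 0)"
    using assms by (simp add: has_field_derivative_iff)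
  then have v: "((\<lambda>\<epsilon>. F \<epsilon> x) has_vector_derivative l) (at_right 0)"
    by (simp add: has_real_derivative_iff_has_vector_derivative)
  show "(\<lambda>\<epsilon>. F \<epsilon> x) differentiable (at_right 0)" by (rule differentiableI_vector[OF v])
  show "eps_deriv0 F x = l" unfolding eps_deriv0_def
    by (rule vector_derivative_within[OF _ v]) (simp add: trivial_limit_at_right_real)
qed

section \<open>Dependence of the branches on the parameter\<close>

context admissible_cusp_family
begin

lemma eventually_in_domain': "\<forall>\<^sub>F \<epsilon> in at_right 0. \<epsilon> \<in> {0..<\<delta>}"
  using eventually_in_domain by eventually_elim auto

text \<open>The pointwise form of \<open>A9_deriv\<close>. The \<open>W11\<close> norm of the
  remainder is taken for \<open>\<rho>\<close>: it bounds the primitive and, by the Sobolev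
  embedding, the continuous representative, both uniformly in \<open>y\<close>.\<close>

lemma W21_family:
  assumes f: "f \<in> W21"
  shows "\<exists>Df D k \<rho>. Df \<in> W11 \<and> continuous_on {0..1} D \<and> ae_eq Df D \<and>
    (\<forall>\<epsilon>\<in>{0..<\<delta>}. continuous_on {0..1} (k \<epsilon>) \<and> ae_eq (LT \<epsilon> f) (k \<epsilon>)) \<and>
    ((\<lambda>\<epsilon>. \<rho> \<epsilon> / \<epsilon>) \<longlongrightarrow> 0) (at_right 0) \<and>
    (\<forall>\<^sub>F \<epsilon> in at_right 0. \<forall>y\<in>{0..1}. \<bar>prim (LT \<epsilon> f) y - prim (LT 0 f) y - \<epsilon> * prim Df y\<bar> \<le> \<rho> \<epsilon>) \<and>
    (\<forall>\<^sub>F \<epsilon> in at_right 0. \<forall>y\<in>{0..1}. \<bar>k \<epsilon> y - k 0 y - \<epsilon> * D y\<bar> \<le> \<rho> \<epsilon>) \<and>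
    (\<forall>\<^sub>F \<epsilon> in at_right 0. (\<lambda>x. LT \<epsilon> f x - LT 0 f x - \<epsilon> * Df x) \<in> W11) \<and>
    (\<lambda>\<epsilon>. W11_norm (\<lambda>x. LT \<epsilon> f x - LT 0 f x - \<epsilon> * Df x)) \<in> o[at_right 0](\<lambda>\<epsilon>. \<epsilon>)"
proof -
  obtain Df where Df: "Df \<in> W11" and ev: "\<forall>\<^sub>F \<epsilon> in at_right 0. (\<lambda>x. LT \<epsilon> f x - LT 0 f x - \<epsilon> * Df x) \<in> W11"
    and o: "(\<lambda>\<epsilon>. W11_norm (\<lambda>x. LT \<epsilon> f x - LT 0 f x - \<epsilon> * Df x)) \<in> o[at_right 0](\<lambda>\<epsilon>. \<epsilon>)"
    using A9_deriv f by blast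
  obtain D where D: "continuous_on {0..1} D" "ae_eq Df D" using W11_continuous_rep[OF Df] by blast
  have fw: "has_weak_deriv f (wderiv f)" using f by (intro wderiv) (simp add: W21_def)
  note fL = has_weak_deriv_L1(1)[OF fw] and DfL = W11_L1[OF Df]
  obtain B G where LB: "\<And>s f u. s \<in> {0..<\<delta>} \<Longrightarrow> has_weak_deriv f u \<Longrightarrow>
      \<exists>v. has_weak_deriv (LT s f) v \<and> L1_norm v \<le> L1_norm u + B * L1_norm f"
    using uniform_bounds by blast
  have "\<exists>k. continuous_on {0..1} k \<and> ae_eq (LT \<epsilon> f) k" if "\<epsilon> \<in> {0..<\<delta>}" for \<epsilon>
    using LB[OF that fw] W11I W11_continuous_rep by blast
  then obtain k where k: "\<And>\<epsilon>. \<epsilon> \<in> {0..<\<delta>} \<Longrightarrow> continuous_on {0..1} (k \<epsilon>)" "\<And>\<epsilon>. \<epsilon> \<in> {0..<\<delta>} \<Longrightarrow> ae_eq (LT \<epsilon> f) (k \<epsilon>)"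
    by metis
  define R where "R \<epsilon> x = LT \<epsilon> f x - LT 0 f x - \<epsilon> * Df x" for \<epsilon> x
  have LL: "LT \<epsilon> f \<in> L1" if "\<epsilon> \<in> {0..<\<delta>}" for \<epsilon> using LB[OF that fw] has_weak_deriv_L1(1) by blast
  have e1: "\<forall>\<^sub>F \<epsilon> in at_right 0. \<forall>y\<in>{0..1}. \<bar>prim (LT \<epsilon> f) y - prim (LT 0 f) y - \<epsilon> * prim Df y\<bar> \<le> W11_norm (R \<epsilon>)"
    using ev eventually_in_domain'
  proof eventually_elim
    case (elim \<epsilon>)
    have RL: "R \<epsilon> \<in> L1" unfolding R_def[abs_def] by (intro L1_diff L1_cmult LL elim zero_in DfL)
    have "prim (R \<epsilon>) y = prim (LT \<epsilon> f) y - prim (LT 0 f) y - \<epsilon> * prim Df y" for y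
      unfolding R_def[abs_def] prim_diff[OF L1_diff[OF LL[OF elim(2)] LL[OF zero_in]] L1_cmult[OF DfL]]
        prim_diff[OF LL[OF elim(2)] LL[OF zero_in]] prim_cmult by simp
    moreover have "\<bar>prim (R \<epsilon>) y\<bar> \<le> W11_norm (R \<epsilon>)" for y
      using prim_le[OF RL, of y] L1_norm_nonneg[of "wderiv (R \<epsilon>)"] by (simp add: W11_norm_def)
    ultimately show ?case by metis
  qed
  have e2: "\<forall>\<^sub>F \<epsilon> in at_right 0. \<forall>y\<in>{0..1}. \<bar>k \<epsilon> y - k 0 y - \<epsilon> * D y\<bar> \<le> W11_norm (R \<epsilon>)"
    using ev eventually_in_domain'
  proof eventually_elim
    case (elim \<epsilon>)
    show ?case
    proof
      fix y :: real assume y: "y \<in> {0..1}"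
      have "continuous_on {0..1} (\<lambda>y. k \<epsilon> y - k 0 y - \<epsilon> * D y)"
        by (intro continuous_intros k(1) elim zero_in D)
      moreover have "ae_eq (R \<epsilon>) (\<lambda>y. k \<epsilon> y - k 0 y - \<epsilon> * D y)"
        using k(2)[OF elim(2)] k(2)[OF zero_in] D(2) unfolding ae_eq_def R_def by eventually_elim simp
      moreover have "R \<epsilon> \<in> W11" using elim(1) by (simp add: R_def[abs_def])
      ultimately show "\<bar>k \<epsilon> y - k 0 y - \<epsilon> * D y\<bar> \<le> W11_norm (R \<epsilon>)"
        using continuous_rep_bound[OF _ _ _ y] by blast
    qed
  qed
  have \<rho>: "((\<lambda>\<epsilon>. W11_norm (R \<epsilon>) / \<epsilon>) \<longlongrightarrow> 0) (at_right 0)"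
    unfolding R_def[abs_def] by (rule smalloD_tendsto[OF o])
  show ?thesis
    by (rule exI[of _ Df], rule exI[of _ D], rule exI[of _ k], rule exI[of _ "\<lambda>\<epsilon>. W11_norm (R \<epsilon>)"])
      (use Df D k \<rho> e1 e2 ev o in blast)
qed

text \<open>The pair \<open>(\<sigma>, \<kappa>)\<close> is \<open>(1, 0)\<close> on the left branch
  and \<open>(-1, 1)\<close> on the right, so \<open>\<Phi> \<epsilon>\<close> measures the length
  of the piece of the branch below a level: \<open>x\<close> or \<open>1 - x\<close>. By the last
  two identities \<open>B0\<close> is the derivative of \<open>A0\<close> along the branch.
  \<open>J'\<close> omits the inner end of \<open>J\<close>, so that \<open>T 0 x\<close> lies
  strictly below the top level of the branch.\<close>

definition branch_data ::
  "real set \<Rightarrow> real set \<Rightarrow> real \<Rightarrow> real \<Rightarrow> (real \<Rightarrow> real \<Rightarrow> real) \<Rightarrow> (real \<Rightarrow> real) \<Rightarrow> (real \<Rightarrow> real) \<Rightarrow> bool" where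
  "branch_data J J' \<sigma> \<kappa> \<Phi> \<Psi> D \<longleftrightarrow>
    (\<forall>\<epsilon>\<in>{0..<\<delta>}. \<forall>x\<in>J. \<Phi> \<epsilon> (T \<epsilon> x) = \<sigma> * x + \<kappa>) \<and>
    (\<forall>y\<in>{0..1}. ((\<lambda>\<epsilon>. (\<Phi> \<epsilon> y - \<Phi> 0 y) / \<epsilon>) \<longlongrightarrow> \<Psi> y) (at_right 0)) \<and> \<Psi> 0 = 0 \<and>
    continuous_on {0..1} D \<and> (\<forall>y\<in>{0..1}. (\<Psi> has_real_derivative D y) (at y within {0..1})) \<and>
    (\<forall>x\<in>J'. ((\<lambda>\<epsilon>. T \<epsilon> x) \<longlongrightarrow> T 0 x) (at_right 0) \<and>
       (\<lambda>\<epsilon>. T \<epsilon> x) differentiable (at_right 0) \<and> (\<lambda>\<epsilon>. D01 (T \<epsilon>) x) differentiable (at_right 0) \<and>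
       A0 T x = \<sigma> * \<Psi> (T 0 x) \<and> B0 T x = \<sigma> * D (T 0 x) * D01 (T 0) x)"

text \<open>Duality with a cutoff \<open>f\<close> that is \<open>1\<close> on \<open>J\<close> and \<open>0\<close> on the other branch makes
  \<open>\<Phi> \<epsilon> y = \<integral>\<^sub>0\<^sup>y L\<^sub>\<epsilon> f\<close>, up to an affine map, the inverse of \<open>T\<^sub>\<epsilon>\<close> on \<open>J\<close>. Assumption (A9) differentiates \<open>\<Phi> \<epsilon>\<close> and its
  derivative in \<open>\<epsilon>\<close>, and the implicit function theorem transports this to \<open>T\<^sub>\<epsilon>\<close>.\<close>

lemma branch_data_exists:
  assumes f: "f \<in> W21" "\<And>x. x \<in> {0..1} \<Longrightarrow> 0 \<le> f x"
    and J: "J \<subseteq> {0..1} - {c}" "\<And>z. z \<in> J \<Longrightarrow> at z within J \<noteq> bot"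
    and \<sigma>: "\<sigma> = 1 \<or> \<sigma> = -1"
    and P: "\<And>\<epsilon> x. \<epsilon> \<in> {0..<\<delta>} \<Longrightarrow> x \<in> J \<Longrightarrow> prim (LT \<epsilon> f) (T \<epsilon> x) = \<sigma> * x + \<kappa>"
    and J': "J' \<subseteq> J" and Y: "\<And>x. x \<in> J' \<Longrightarrow> T 0 x < Y" "Y \<le> 1" "{0..Y} \<subseteq> T 0 ` J"
  shows "\<exists>\<Psi> D. branch_data J J' \<sigma> \<kappa> (\<lambda>\<epsilon>. prim (LT \<epsilon> f)) \<Psi> D"
proof -
  obtain \<theta> \<kappa>' K where CM: "\<And>\<epsilon>. \<epsilon> \<in> {0..<\<delta>} \<Longrightarrow>
      cusp_map (T \<epsilon>) c (a \<epsilon>) \<beta> \<theta> \<kappa>' K (D01 (T \<epsilon>)) ((D01 ^^ 2) (T \<epsilon>)) ((D01 ^^ 3) (T \<epsilon>))"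
    using cusp_maps by blast
  interpret C0: cusp_map "T 0" c "a 0" \<beta> \<theta> \<kappa>' K "D01 (T 0)" "(D01 ^^ 2) (T 0)" "(D01 ^^ 3) (T 0)"
    by (rule CM[OF zero_in])
  have Tin: "T \<epsilon> x \<in> {0..1}" if "\<epsilon> \<in> {0..<\<delta>}" "x \<in> {0..1}" for \<epsilon> x
    using nonsingular_map.T_in[of "T \<epsilon>" x] nonsing[OF that(1)] that(2) by (simp add: nonsingular_map_def)
  have fL: "f \<in> L1" using f(1) W11_L1 by (auto simp: W21_def)
  have LL: "LT \<epsilon> f \<in> L1" if "\<epsilon> \<in> {0..<\<delta>}" for \<epsilon>
    using nonsingular_map.L_L1[OF _ fL, of "T \<epsilon>"] nonsing[OF that] by (simp add: nonsingular_map_def)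
  obtain Df D k \<rho> where Df: "Df \<in> W11" and D: "continuous_on {0..1} D" "ae_eq Df D"
    and k: "\<And>\<epsilon>. \<epsilon> \<in> {0..<\<delta>} \<Longrightarrow> continuous_on {0..1} (k \<epsilon>)" "\<And>\<epsilon>. \<epsilon> \<in> {0..<\<delta>} \<Longrightarrow> ae_eq (LT \<epsilon> f) (k \<epsilon>)"
    and \<rho>: "((\<lambda>\<epsilon>. \<rho> \<epsilon> / \<epsilon>) \<longlongrightarrow> 0) (at_right 0)"
    and e1: "\<forall>\<^sub>F \<epsilon> in at_right 0. \<forall>y\<in>{0..1}. \<bar>prim (LT \<epsilon> f) y - prim (LT 0 f) y - \<epsilon> * prim Df y\<bar> \<le> \<rho> \<epsilon>"
    and e2: "\<forall>\<^sub>F \<epsilon> in at_right 0. \<forall>y\<in>{0..1}. \<bar>k \<epsilon> y - k 0 y - \<epsilon> * D y\<bar> \<le> \<rho> \<epsilon>"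
    using W21_family[OF f(1)] by blast
  note DfL = W11_L1[OF Df]
  define \<Phi> where "\<Phi> \<epsilon> = prim (LT \<epsilon> f)" for \<epsilon>
  define \<Psi> where "\<Psi> = prim Df"
  have \<Phi>d: "(\<Phi> \<epsilon> has_real_derivative k \<epsilon> y) (at y within {0..1})" if "\<epsilon> \<in> {0..<\<delta>}" "y \<in> {0..1}" for \<epsilon> y
    unfolding \<Phi>_def using that by (intro prim_has_derivative_rep LL k)
  have \<Psi>d: "(\<Psi> has_real_derivative D y) (at y within {0..1})" if "y \<in> {0..1}" for y
    unfolding \<Psi>_def using that by (intro prim_has_derivative_rep DfL D)
  have \<Psi>c: "continuous_on {0..1} \<Psi>" unfolding \<Psi>_def by (rule continuous_on_prim[OF DfL])
  have \<sigma>2: "\<sigma> * \<sigma> = 1" "\<sigma> \<noteq> 0" using \<sigma> by auto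
  have JX: "z \<in> {0..1}" "z \<noteq> c" if "z \<in> J" for z using J(1) that by auto
  \<comment> \<open>Differentiating
    \<open>\<Phi> \<epsilon> (T \<epsilon> z) = \<sigma> * z + \<kappa>\<close> shows that
    \<open>k \<epsilon>\<close> is, up to the sign \<open>\<sigma>\<close>, the reciprocal of the
    derivative of the branch.\<close>
  have kT: "k \<epsilon> (T \<epsilon> z) * D01 (T \<epsilon>) z = \<sigma>" if e: "\<epsilon> \<in> {0..<\<delta>}" and z: "z \<in> J" for \<epsilon> z
  proof -
    have "(T \<epsilon> has_real_derivative D01 (T \<epsilon>) z) (at z within {0..1})"
      using cusp_map.d1[OF CM[OF e], of z] JX[OF z] by simp
    then have Td: "(T \<epsilon> has_real_derivative D01 (T \<epsilon>) z) (at z within J)"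
      by (rule has_field_derivative_subset) (use J(1) in auto)
    have "(\<Phi> \<epsilon> has_real_derivative k \<epsilon> (T \<epsilon> z)) (at (T \<epsilon> z) within T \<epsilon> ` J)"
      by (rule has_field_derivative_subset[OF \<Phi>d[OF e Tin[OF e JX(1)[OF z]]]]) (use Tin[OF e] JX in auto)
    from DERIV_image_chain[OF this Td]
    have 1: "((\<Phi> \<epsilon> \<circ> T \<epsilon>) has_real_derivative k \<epsilon> (T \<epsilon> z) * D01 (T \<epsilon>) z) (at z within J)" .
    have "((\<lambda>x. \<sigma> * x + \<kappa>) has_real_derivative \<sigma>) (at z within J)" by (auto intro!: derivative_eq_intros)
    then have 2: "((\<Phi> \<epsilon> \<circ> T \<epsilon>) has_real_derivative \<sigma>) (at z within J)"
      by (rule has_field_derivative_transform_within[OF _ zero_less_one z]) (use P[OF e] in \<open>simp add: \<Phi>_def\<close>)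
    show ?thesis
      using vector_derivative_unique_within[OF J(2)[OF z], of "\<Phi> \<epsilon> \<circ> T \<epsilon>"] 1 2
      unfolding has_real_derivative_iff_has_vector_derivative by blast
  qed
  have \<Phi>mono: "\<Phi> 0 x \<le> \<Phi> 0 y" if "x \<le> y" for x y
    unfolding \<Phi>_def
  proof (rule prim_mono_AE[OF LL[OF zero_in] _ that])
    show "AE x in leb01. 0 \<le> LT 0 f x" by (rule C0.L_pos[OF fL]) (use f(2) in \<open>auto intro!: AE_I2\<close>)
  qed
  \<comment> \<open>The inverse of \<open>T 0\<close> on \<open>J\<close>, recovered from
    \<open>\<Phi> 0\<close> by means of \<open>\<sigma> * \<sigma> = 1\<close>.\<close>
  define Z where "Z y = \<sigma> * (\<Phi> 0 y - \<kappa>)" for y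
  have ZT: "Z (T 0 z) = z" if "z \<in> J" for z
  proof -
    have "Z (T 0 z) = \<sigma> * \<sigma> * z" unfolding Z_def \<Phi>_def using P[OF zero_in that] by simp
    then show ?thesis using \<sigma>2 by simp
  qed
  have main: "((\<lambda>\<epsilon>. T \<epsilon> x) \<longlongrightarrow> T 0 x) (at_right 0) \<and>
       (\<lambda>\<epsilon>. T \<epsilon> x) differentiable (at_right 0) \<and> (\<lambda>\<epsilon>. D01 (T \<epsilon>) x) differentiable (at_right 0) \<and>
       A0 T x = \<sigma> * \<Psi> (T 0 x) \<and> B0 T x = \<sigma> * D (T 0 x) * D01 (T 0) x" if x: "x \<in> J'" for x
  proof -
    have xJ: "x \<in> J" using x J' by blast
    define y0 where "y0 = T 0 x"
    define t1 where "t1 = D01 (T 0) x"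
    define t2 where "t2 = (D01 ^^ 2) (T 0) x"
    have y0: "y0 \<in> {0..1}" "y0 < Y" unfolding y0_def using Tin[OF zero_in JX(1)[OF xJ]] Y(1)[OF x] by auto
    have t1nz: "t1 \<noteq> 0" unfolding t1_def using C0.T1_nz[of x] JX[OF xJ] by simp
    have k0: "k 0 y0 = \<sigma> / t1" using kT[OF zero_in xJ] t1nz unfolding y0_def t1_def by (simp add: field_simps)
    have k0nz: "k 0 y0 \<noteq> 0" unfolding k0 using t1nz \<sigma>2 by simp
    have yin: "\<forall>\<^sub>F \<epsilon> in at_right 0. T \<epsilon> x \<in> {0..1}"
      using eventually_in_domain' by eventually_elim (rule Tin[OF _ JX(1)[OF xJ]])
    have eq: "\<forall>\<^sub>F \<epsilon> in at_right 0. \<Phi> \<epsilon> (T \<epsilon> x) = \<Phi> 0 y0"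
      using eventually_in_domain' by eventually_elim (use P[OF _ xJ] zero_in in \<open>simp add: \<Phi>_def y0_def\<close>)
    \<comment> \<open>Together with monotonicity this makes \<open>\<Phi> 0\<close> separate
      \<open>y0\<close> strictly from the levels on either side, so that convergence of
      \<open>\<Phi> 0 (T \<epsilon> x)\<close> forces convergence of
      \<open>T \<epsilon> x\<close>.\<close>
    have inj: "y = y0" if y: "y \<in> {0..Y}" "\<Phi> 0 y = \<Phi> 0 y0" for y
    proof -
      obtain z where z: "z \<in> J" "y = T 0 z" using Y(3) y(1) by blast
      have "z = Z y" using ZT[OF z(1)] z(2) by simp
      also have "\<dots> = Z y0" unfolding Z_def using y(2) by simp
      also have "\<dots> = x" unfolding y0_def by (rule ZT[OF xJ])
      finally show ?thesis using z(2) by (simp add: y0_def)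
    qed
    have up: "\<Phi> 0 y0 < \<Phi> 0 y" if "y0 < y" for y
    proof -
      define y' where "y' = min y Y"
      have "\<Phi> 0 y' \<noteq> \<Phi> 0 y0" using inj[of y'] that y0 by (auto simp: y'_def)
      moreover have "\<Phi> 0 y0 \<le> \<Phi> 0 y'" by (rule \<Phi>mono) (use that y0 in \<open>auto simp: y'_def\<close>)
      moreover have "\<Phi> 0 y' \<le> \<Phi> 0 y" by (rule \<Phi>mono) (simp add: y'_def)
      ultimately show ?thesis by simp
    qed
    have down: "\<Phi> 0 y < \<Phi> 0 y0" if "y < y0" "0 \<le> y" for y
      using inj[of y] that y0 \<Phi>mono[of y y0] by fastforce
    have lim0: "((\<lambda>\<epsilon>. \<Phi> 0 (T \<epsilon> x)) \<longlongrightarrow> \<Phi> 0 y0) (at_right 0)"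
    proof -
      obtain M where M: "\<And>y. \<bar>\<Psi> y\<bar> \<le> M" using prim_le[OF DfL] unfolding \<Psi>_def by blast
      have idl: "((\<lambda>\<epsilon>::real. \<epsilon>) \<longlongrightarrow> 0) (at_right 0)" by (rule tendsto_ident_at)
      have "((\<lambda>\<epsilon>. \<rho> \<epsilon> / \<epsilon> * \<epsilon> + \<epsilon> * M) \<longlongrightarrow> 0 * 0 + 0 * M) (at_right 0)" by (intro tendsto_intros \<rho> idl)
      then have z: "((\<lambda>\<epsilon>. \<rho> \<epsilon> / \<epsilon> * \<epsilon> + \<epsilon> * M) \<longlongrightarrow> 0) (at_right 0)" by simp
      have "((\<lambda>\<epsilon>. \<Phi> 0 (T \<epsilon> x) - \<Phi> 0 y0) \<longlongrightarrow> 0) (at_right 0)"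
      proof (rule Lim_null_comparison[OF _ z])
        show "\<forall>\<^sub>F \<epsilon> in at_right 0. norm (\<Phi> 0 (T \<epsilon> x) - \<Phi> 0 y0) \<le> \<rho> \<epsilon> / \<epsilon> * \<epsilon> + \<epsilon> * M"
          using e1 eq yin eventually_at_right_less[of 0]
        proof eventually_elim
          case (elim \<epsilon>)
          have "\<bar>\<Phi> \<epsilon> (T \<epsilon> x) - \<Phi> 0 (T \<epsilon> x) - \<epsilon> * \<Psi> (T \<epsilon> x)\<bar> \<le> \<rho> \<epsilon>"
            using elim unfolding \<Phi>_def \<Psi>_def by blast
          moreover have "\<bar>\<epsilon> * \<Psi> (T \<epsilon> x)\<bar> \<le> \<epsilon> * M" using M[of "T \<epsilon> x"] elim by (simp add: abs_mult)
          ultimately have "\<bar>\<Phi> 0 (T \<epsilon> x) - \<Phi> 0 y0\<bar> \<le> \<rho> \<epsilon> + \<epsilon> * M" using elim(2) by linarith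
          then show ?case using elim(4) by simp
        qed
      qed
      then show ?thesis by (rule LIM_zero_cancel)
    qed
    have ylim: "((\<lambda>\<epsilon>. T \<epsilon> x) \<longlongrightarrow> y0) (at_right 0)"
    proof (rule order_tendstoI)
      fix l assume l: "l < y0"
      show "\<forall>\<^sub>F \<epsilon> in at_right 0. l < T \<epsilon> x"
      proof (cases "l < 0")
        case True
        show ?thesis using yin by eventually_elim (use True in auto)
      next
        case False
        then have "\<Phi> 0 l < \<Phi> 0 y0" using down[of l] l by simp
        from order_tendstoD(1)[OF lim0 this] show ?thesis
        proof eventually_elim
          case (elim \<epsilon>)
          then have "\<not> T \<epsilon> x \<le> l" using \<Phi>mono[of "T \<epsilon> x" l] by linarith
          then show ?case by simp
        qed
      qed
    next
      fix u assume "y0 < u"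
      from order_tendstoD(2)[OF lim0 up[OF this]] show "\<forall>\<^sub>F \<epsilon> in at_right 0. T \<epsilon> x < u"
      proof eventually_elim
        case (elim \<epsilon>)
        then have "\<not> u \<le> T \<epsilon> x" using \<Phi>mono[of u "T \<epsilon> x"] by linarith
        then show ?case by simp
      qed
    qed
    define m where "m = - (\<Psi> y0 / k 0 y0)"
    have ydl: "((\<lambda>\<epsilon>. (T \<epsilon> x - T 0 x) / \<epsilon>) \<longlongrightarrow> m) (at_right 0)"
      unfolding m_def y0_def[symmetric]
      by (rule family_implicit_deriv[where G = \<Phi> and H = \<Psi> and \<rho> = \<rho>, OF ylim yin eq _ \<rho> \<Phi>d[OF zero_in y0(1)] k0nz \<Psi>c y0(1)])
        (use e1 in \<open>simp add: \<Phi>_def \<Psi>_def\<close>)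
    have dT: "(\<lambda>\<epsilon>. T \<epsilon> x) differentiable (at_right 0)" "eps_deriv0 T x = m"
      using eps_deriv0_eqI[where F = T, OF ydl] by auto
    have m_eq: "m = - \<sigma> * \<Psi> y0 * t1" unfolding m_def k0 using \<sigma> t1nz by auto
    have ZY: "Z ` {0..Y} \<subseteq> {0..1}"
    proof
      fix v assume "v \<in> Z ` {0..Y}"
      then obtain y where y: "y \<in> {0..Y}" "v = Z y" by blast
      then obtain z where z: "z \<in> J" "y = T 0 z" using Y(3) by blast
      show "v \<in> {0..1}" unfolding y(2) z(2) ZT[OF z(1)] by (rule JX(1)[OF z(1)])
    qed
    \<comment> \<open>On \<open>{0..Y}\<close> the function \<open>k 0\<close> is
      \<open>\<sigma> / D01 (T 0)\<close> composed with the inverse branch \<open>Z\<close>. Since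
      \<open>y0 < Y\<close>, a derivative within \<open>{0..Y}\<close> is one within
      \<open>{0..1}\<close>.\<close>
    have kd: "(k 0 has_real_derivative - \<sigma> * t2 / t1 ^ 3) (at y0 within {0..1})"
    proof -
      have "((\<lambda>z. \<sigma> / D01 (T 0) z) has_real_derivative - \<sigma> * t2 / t1 ^ 2) (at x within {0..1})"
        using C0.d2[of x] JX[OF xJ] t1nz unfolding t1_def t2_def
        by (auto intro!: derivative_eq_intros simp: power2_eq_square)
      then have i: "((\<lambda>z. \<sigma> / D01 (T 0) z) has_real_derivative - \<sigma> * t2 / t1 ^ 2) (at (Z y0) within Z ` {0..Y})"
        unfolding y0_def ZT[OF xJ] by (rule has_field_derivative_subset[OF _ ZY])
      have "(Z has_real_derivative \<sigma> * k 0 y0) (at y0 within {0..1})"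
        unfolding Z_def[abs_def] using \<Phi>d[OF zero_in y0(1)] by (auto intro!: derivative_eq_intros)
      then have "(Z has_real_derivative 1 / t1) (at y0 within {0..1})" unfolding k0 using \<sigma>2 by simp
      then have ii: "(Z has_real_derivative 1 / t1) (at y0 within {0..Y})"
        by (rule has_field_derivative_subset) (use Y(2) in auto)
      have iii: "(((\<lambda>z. \<sigma> / D01 (T 0) z) \<circ> Z) has_real_derivative - \<sigma> * t2 / t1 ^ 2 * (1 / t1)) (at y0 within {0..Y})"
        by (rule DERIV_image_chain[OF i ii])
      have "(k 0 has_real_derivative - \<sigma> * t2 / t1 ^ 2 * (1 / t1)) (at y0 within {0..Y})"
      proof (rule has_field_derivative_transform_within[OF iii zero_less_one])
        show "y0 \<in> {0..Y}" using y0 by auto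
        fix y assume "y \<in> {0..Y}"
        then obtain z where z: "z \<in> J" "y = T 0 z" using Y(3) by blast
        have "D01 (T 0) z \<noteq> 0" using C0.T1_nz[of z] JX[OF z(1)] by simp
        then show "((\<lambda>z. \<sigma> / D01 (T 0) z) \<circ> Z) y = k 0 y"
          using kT[OF zero_in z(1)] ZT[OF z(1)] z(2) by (simp add: field_simps)
      qed
      moreover have "at y0 within {0..Y} = at y0 within {0..1}"
        by (rule at_within_nhd[of _ "{..<Y}"]) (use y0 Y(2) in auto)
      ultimately show ?thesis by (simp add: power2_eq_square power3_eq_cube)
    qed
    define l where "l = - \<sigma> * t2 / t1 ^ 3 * m + D y0"
    have kl: "((\<lambda>\<epsilon>. (k \<epsilon> (T \<epsilon> x) - k 0 y0) / \<epsilon>) \<longlongrightarrow> l) (at_right 0)"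
      unfolding l_def
      by (rule family_compose_deriv[where \<rho> = \<rho>, OF _ yin e2 \<rho> kd D(1) y0(1)]) (use ydl in \<open>simp add: y0_def\<close>)
    \<comment> \<open>What the expansion of \<open>k\<close> differentiates in the parameter is the
      reciprocal of the derivative of \<open>T \<epsilon>\<close>; the derivative itself is
      recovered by inverting.\<close>
    define r where "r \<epsilon> = 1 / D01 (T \<epsilon>) x" for \<epsilon>
    have req: "r \<epsilon> = \<sigma> * k \<epsilon> (T \<epsilon> x)" if "\<epsilon> \<in> {0..<\<delta>}" for \<epsilon>
    proof -
      have "D01 (T \<epsilon>) x \<noteq> 0" using cusp_map.T1_nz[OF CM[OF that], of x] JX[OF xJ] by simp
      then show ?thesis using kT[OF that xJ] \<sigma> unfolding r_def by (auto simp: field_simps)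
    qed
    have rl: "((\<lambda>\<epsilon>. (r \<epsilon> - r 0) / \<epsilon>) \<longlongrightarrow> \<sigma> * l) (at_right 0)"
    proof (rule Lim_transform_eventually)
      show "((\<lambda>\<epsilon>. \<sigma> * ((k \<epsilon> (T \<epsilon> x) - k 0 y0) / \<epsilon>)) \<longlongrightarrow> \<sigma> * l) (at_right 0)" by (intro tendsto_intros kl)
      show "\<forall>\<^sub>F \<epsilon> in at_right 0. \<sigma> * ((k \<epsilon> (T \<epsilon> x) - k 0 y0) / \<epsilon>) = (r \<epsilon> - r 0) / \<epsilon>"
        using eventually_in_domain'
        by eventually_elim (simp add: req zero_in y0_def right_diff_distrib diff_divide_distrib)
    qed
    have r0: "(r \<longlongrightarrow> r 0) (at_right 0)"
    proof (rule Lim_transform_eventually)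
      have "((\<lambda>\<epsilon>. (r \<epsilon> - r 0) / \<epsilon> * \<epsilon> + r 0) \<longlongrightarrow> \<sigma> * l * 0 + r 0) (at_right 0)" by (intro tendsto_intros rl)
      then show "((\<lambda>\<epsilon>. (r \<epsilon> - r 0) / \<epsilon> * \<epsilon> + r 0) \<longlongrightarrow> r 0) (at_right 0)" by simp
      show "\<forall>\<^sub>F \<epsilon> in at_right 0. (r \<epsilon> - r 0) / \<epsilon> * \<epsilon> + r 0 = r \<epsilon>"
        using eventually_at_right_less[of 0] by eventually_elim simp
    qed
    have r0nz: "r 0 \<noteq> 0" and r0t: "r 0 = 1 / t1" unfolding r_def t1_def[symmetric] using t1nz by auto
    have tl: "((\<lambda>\<epsilon>. (D01 (T \<epsilon>) x - D01 (T 0) x) / \<epsilon>) \<longlongrightarrow> - (\<sigma> * l) / (r 0 * r 0)) (at_right 0)"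
    proof (rule Lim_transform_eventually)
      show "((\<lambda>\<epsilon>. - ((r \<epsilon> - r 0) / \<epsilon>) / (r \<epsilon> * r 0)) \<longlongrightarrow> - (\<sigma> * l) / (r 0 * r 0)) (at_right 0)"
        by (intro tendsto_intros rl r0) (use r0nz in simp)
      show "\<forall>\<^sub>F \<epsilon> in at_right 0. - ((r \<epsilon> - r 0) / \<epsilon>) / (r \<epsilon> * r 0) = (D01 (T \<epsilon>) x - D01 (T 0) x) / \<epsilon>"
        using eventually_in_domain
      proof eventually_elim
        case (elim \<epsilon>)
        then have "D01 (T \<epsilon>) x \<noteq> 0" using cusp_map.T1_nz[OF CM[of \<epsilon>], of x] JX[OF xJ] by simp
        then show ?case using t1nz elim unfolding r_def t1_def by (simp add: field_simps)
      qed
    qed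
    define \<tau> where "\<tau> = - (\<sigma> * l) / (r 0 * r 0)"
    have dD: "(\<lambda>\<epsilon>. D01 (T \<epsilon>) x) differentiable (at_right 0)" "eps_deriv0 (\<lambda>\<epsilon>. D01 (T \<epsilon>)) x = \<tau>"
      using eps_deriv0_eqI[where F = "\<lambda>\<epsilon>. D01 (T \<epsilon>)", OF tl] unfolding \<tau>_def by auto
    have "A0 T x = \<sigma> * \<Psi> (T 0 x)"
      unfolding A0_def dT(2) m_eq t1_def[symmetric] y0_def[symmetric] using t1nz by simp
    moreover have "B0 T x = \<sigma> * D (T 0 x) * D01 (T 0) x"
    proof -
      have "\<tau> / t1 = - (\<sigma> * l) * t1" unfolding \<tau>_def r0t using t1nz by (simp add: field_simps)
      then have "B0 T x = m * t2 / t1 ^ 2 + \<sigma> * l * t1"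
        unfolding B0_def dT(2) dD(2) t1_def[symmetric] t2_def[symmetric] by simp
      \<comment> \<open>The term with the second derivative cancels the first summand of
        \<open>B0\<close>, because \<open>\<sigma> * \<sigma> = 1\<close>.\<close>
      also have "\<sigma> * l * t1 = - (\<sigma> * \<sigma>) * m * t2 / t1 ^ 2 + \<sigma> * D y0 * t1"
        unfolding l_def using t1nz by (simp add: field_simps power2_eq_square power3_eq_cube)
      finally show ?thesis unfolding \<sigma>2 y0_def t1_def by simp
    qed
    ultimately show ?thesis using ylim dT(1) dD(1) unfolding y0_def by blast
  qed
  have "((\<lambda>\<epsilon>. (\<Phi> \<epsilon> y - \<Phi> 0 y) / \<epsilon>) \<longlongrightarrow> \<Psi> y) (at_right 0)" if y: "y \<in> {0..1}" for y
  proof -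
    have "((\<lambda>\<epsilon>. (\<Phi> \<epsilon> y - \<Phi> 0 y) / \<epsilon>) \<longlongrightarrow> k 0 y * 0 + \<Psi> y) (at_right 0)"
      by (rule family_compose_deriv[where y = "\<lambda>_. y" and ?y0.0 = y and m = 0 and G = \<Phi> and H = \<Psi> and \<rho> = \<rho>, OF _ _ _ \<rho> \<Phi>d[OF zero_in y] \<Psi>c y])
        (use e1 y in \<open>simp_all add: \<Phi>_def \<Psi>_def\<close>)
    then show ?thesis by simp
  qed
  moreover have "\<Psi> 0 = 0" unfolding \<Psi>_def by (rule prim_0[OF DfL]) simp
  ultimately show ?thesis
    unfolding branch_data_def using P D(1) \<Psi>d main unfolding \<Phi>_def
    by (intro exI[of _ \<Psi>] exI[of _ D]) blast
qed

end

section \<open>The response formula\<close>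

lemma prim_diff_const:
  assumes u: "u \<in> L1" and ab: "0 \<le> a" "a \<le> b" "b \<le> 1" and k: "\<And>x. x \<in> {a..b} \<Longrightarrow> u x = k"
  shows "prim u b - prim u a = k * (b - a)"
proof -
  have "prim u b - prim u a = integral {a..b} (\<lambda>t. if t \<in> {0..1} then u t else 0)"
    by (rule prim_diff_integral(1)[OF u ab(2)])
  also have "\<dots> = integral {a..b} (\<lambda>t. k)" by (rule Henstock_Kurzweil_Integration.integral_cong) (use ab k in auto)
  finally show ?thesis using ab by simp
qed

lemma powr_tendsto_0_left:
  assumes "0 < (c::real)" "0 < r" shows "((\<lambda>t. (c - t) powr r) \<longlongrightarrow> 0) (at_left c)"
proof -
  have "((\<lambda>t. (c - t) powr r) \<longlongrightarrow> (c - c) powr r) (at_left c)"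
  proof (rule tendsto_powr2)
    show "((\<lambda>t. c - t) \<longlongrightarrow> c - c) (at_left c)" by (intro tendsto_intros)
    show "\<forall>\<^sub>F t in at_left c. 0 \<le> c - t"
      using eventually_at_left_real[OF assms(1)] by eventually_elim simp
  qed (use assms in auto)
  then show ?thesis by simp
qed

lemma at_within_Icc_nontrivial: "(a::real) < b \<Longrightarrow> z \<in> {a..b} \<Longrightarrow> at z within {a..b} \<noteq> bot"
  using connected_imp_perfect[of "{a..b}" z] by (auto simp: trivial_limit_within)

text \<open>Clamping the argument to \<open>{a..b}\<close> turns \<open>g\<close>, which is
  controlled only there, into a continuous function on the whole unit interval.\<close>

lemma prim_FTC_segment:
  assumes ab: "0 \<le> a" "a \<le> b" "b \<le> 1" and g: "continuous_on {a..b} g"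
    and F: "\<And>z. z \<in> {a..b} \<Longrightarrow> (F has_real_derivative g z) (at z within {a..b})"
  defines "e \<equiv> \<lambda>z. g (max a (min b z))"
  shows "e \<in> L1" "prim e b - prim e a = F b - F a"
proof -
  have "continuous_on {0..1} e" unfolding e_def
    by (rule continuous_on_compose2[OF g]) (use ab in \<open>auto intro!: continuous_intros\<close>)
  then show L: "e \<in> L1" by (rule continuous_L1)
  have "prim e b - prim e a = integral {a..b} (\<lambda>t. if t \<in> {0..1} then e t else 0)"
    by (rule prim_diff_integral(1)[OF L ab(2)])
  also have "\<dots> = integral {a..b} g"
    by (rule Henstock_Kurzweil_Integration.integral_cong) (use ab in \<open>auto simp: e_def\<close>)
  also have "\<dots> = F b - F a"
    using fundamental_theorem_of_calculus[OF ab(2), of F g] F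
    by (auto simp: has_real_derivative_iff_has_vector_derivative intro: integral_unique)
  finally show "prim e b - prim e a = F b - F a" .
qed

context cusp_map
begin

text \<open>The bound on \<open>T1\<close> makes
  \<open>T t + K / (\<beta> + 1) * (c - t) powr (\<beta> + 1)\<close> nonincreasing to the left of
  \<open>c\<close>, with limit \<open>a\<close>. A single value of \<open>T\<close> thus controls
  the height \<open>a\<close>, uniformly in the family.\<close>

lemma a_le:
  assumes x: "0 \<le> x" "x < c"
  shows "a \<le> T x + K / (\<beta> + 1) * (c - x) powr (\<beta> + 1)"
proof -
  define F where "F t = T t + K / (\<beta> + 1) * (c - t) powr (\<beta> + 1)" for t
  have Fd: "(F has_real_derivative T1 t - K * (c - t) powr \<beta>) (at t within {0..1})" if t: "0 \<le> t" "t < c" for t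
  proof -
    have "(T has_real_derivative T1 t) (at t within {0..1})" by (rule d1) (use t c_in in auto)
    then show ?thesis unfolding F_def[abs_def] using t beta
      by (auto intro!: derivative_eq_intros)
  qed
  have Fle: "F t \<le> F x" if t: "x \<le> t" "t < c" for t
  proof (cases "x = t")
    case False
    have "\<exists>z\<in>{x<..<t}. F t - F x = (\<lambda>h. (T1 z - K * (c - z) powr \<beta>) * h) (t - x)"
    proof (rule mvt_simple)
      show "x < t" using t False by simp
      fix z assume z: "x \<le> z" "z \<le> t"
      have "(F has_real_derivative T1 z - K * (c - z) powr \<beta>) (at z within {x..t})"
        by (rule has_field_derivative_subset[OF Fd]) (use z t x c_in in auto)
      then show "(F has_derivative (\<lambda>h. (T1 z - K * (c - z) powr \<beta>) * h)) (at z within {x..t})"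
        by (simp add: has_field_derivative_def)
    qed
    then obtain z where z: "z \<in> {x<..<t}" "F t - F x = (T1 z - K * (c - z) powr \<beta>) * (t - x)" by blast
    have "T1 z \<le> K * (c - z) powr \<beta>" using b1_upper[of z] z x t c_in by (auto simp: abs_if split: if_splits)
    then have "(T1 z - K * (c - z) powr \<beta>) * (t - x) \<le> 0" using t by (intro mult_nonpos_nonneg) auto
    then show ?thesis using z(2) by simp
  qed simp
  have "(F \<longlongrightarrow> a + K / (\<beta> + 1) * 0) (at_left c)"
    unfolding F_def[abs_def] by (intro tendsto_add tendsto_mult tendsto_const T_lim powr_tendsto_0_left) (use c_in beta in auto)
  then have "(F \<longlongrightarrow> a) (at_left c)" by simp
  moreover have "eventually (\<lambda>t. F t \<le> F x) (at_left c)"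
    unfolding eventually_at_left[OF x(2)] using Fle by (intro exI[of _ x]) (use x in auto)
  ultimately have "a \<le> F x" using tendsto_upperbound[of F a "at_left c" "F x"] by simp
  then show ?thesis by (simp add: F_def)
qed

end

section \<open>The two branches and the height of the cusp\<close>

context admissible_cusp_family
begin

text \<open>The cutoff is 1 on \<open>{0..s}\<close> and 0 from \<open>t < c\<close> on. The right
  preimage of \<open>T \<epsilon> x\<close> therefore contributes nothing, and the primitive of the
  image at that level is the length \<open>x\<close>.\<close>

lemma left_branch:
  assumes s: "0 < s" "s < c"
  shows "\<exists>\<Phi> \<Psi> D. branch_data {0..s} {0..<s} 1 0 \<Phi> \<Psi> D"
proof -
  obtain \<theta> \<kappa> K where CM: "\<And>\<epsilon>. \<epsilon> \<in> {0..<\<delta>} \<Longrightarrow>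
      cusp_map (T \<epsilon>) c (a \<epsilon>) \<beta> \<theta> \<kappa> K (D01 (T \<epsilon>)) ((D01 ^^ 2) (T \<epsilon>)) ((D01 ^^ 3) (T \<epsilon>))"
    using cusp_maps by blast
  interpret C0: cusp_map "T 0" c "a 0" \<beta> \<theta> \<kappa> K "D01 (T 0)" "(D01 ^^ 2) (T 0)" "(D01 ^^ 3) (T 0)"
    by (rule CM[OF zero_in])
  define t where "t = (s + c) / 2"
  have t: "s < t" "t < c" "t < 1" using s c_in by (auto simp: t_def)
  obtain f where f: "f \<in> W21" "\<And>x. x \<in> {0..1} \<Longrightarrow> 0 \<le> f x" "\<And>x. x \<in> {0..s} \<Longrightarrow> f x = 1" "\<And>x. x \<in> {t..1} \<Longrightarrow> f x = 0"
    using plateau_exists[OF s(1) t(1,3)] by metis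
  have fL: "f \<in> L1" using f(1) W11_L1 by (auto simp: W21_def)
  have P: "prim (LT \<epsilon> f) (T \<epsilon> x) = 1 * x + 0" if e: "\<epsilon> \<in> {0..<\<delta>}" and x: "x \<in> {0..s}" for \<epsilon> x
  proof -
    interpret C: cusp_map "T \<epsilon>" c "a \<epsilon>" \<beta> \<theta> \<kappa> K "D01 (T \<epsilon>)" "(D01 ^^ 2) (T \<epsilon>)" "(D01 ^^ 3) (T \<epsilon>)"
      by (rule CM[OF e])
    have xX: "x \<in> {0..1} - {c}" using x s c_in by auto
    obtain x1 x2 where x2: "c < x2" "x2 \<le> 1" "T \<epsilon> x2 = T \<epsilon> x"
      using C.preimages_exist[of "T \<epsilon> x"] C.T_in[of x] C.T_lt_a[OF xX] xX by auto
    have "prim (LT \<epsilon> f) (T \<epsilon> x) = prim f x + ((LINT z|leb01. f z) - prim f x2)"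
      by (rule C.prim_L_level) (use x s x2 fL in auto)
    also have "prim f x = x" using prim_diff_const[OF fL, of 0 x 1] prim_0[OF fL, of 0] x s c_in f(3) by auto
    also have "(LINT z|leb01. f z) - prim f x2 = 0"
      using prim_diff_const[OF fL, of x2 1 0] prim_1[of 1 f] x2 c_in t f(4) by auto
    finally show ?thesis by simp
  qed
  have "\<exists>\<Psi> D. branch_data {0..s} {0..<s} 1 0 (\<lambda>\<epsilon>. prim (LT \<epsilon> f)) \<Psi> D"
  proof (rule branch_data_exists[OF f(1,2)])
    show "{0..s} \<subseteq> {0..1} - {c}" using s c_in by auto
    show "at z within {0..s} \<noteq> bot" if "z \<in> {0..s}" for z by (rule at_within_Icc_nontrivial[OF s(1) that])
    show "T 0 x < T 0 s" if "x \<in> {0..<s}" for x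
    proof -
      have "0 < \<theta> * (s - x)" using C0.theta that by simp
      then show ?thesis using C0.T_left[of x s] that s by simp
    qed
    show "T 0 s \<le> 1" using C0.T_in[of s] s c_in by simp
    show "{0..T 0 s} \<subseteq> T 0 ` {0..s}" using C0.T_image_left[of 0 s] C0.T_ends s by simp
  qed (use P in auto)
  then show ?thesis by blast
qed

text \<open>The mirror image, with one minus a plateau as cutoff: the part of the branch below the
  level \<open>T \<epsilon> x\<close> is \<open>{x..1}\<close>, of length
  \<open>1 - x\<close>.\<close>

lemma right_branch:
  assumes t: "c < t" "t < 1"
  shows "\<exists>\<Phi> \<Psi> D. branch_data {t..1} {t<..1} (-1) 1 \<Phi> \<Psi> D"
proof -
  obtain \<theta> \<kappa> K where CM: "\<And>\<epsilon>. \<epsilon> \<in> {0..<\<delta>} \<Longrightarrow>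
      cusp_map (T \<epsilon>) c (a \<epsilon>) \<beta> \<theta> \<kappa> K (D01 (T \<epsilon>)) ((D01 ^^ 2) (T \<epsilon>)) ((D01 ^^ 3) (T \<epsilon>))"
    using cusp_maps by blast
  interpret C0: cusp_map "T 0" c "a 0" \<beta> \<theta> \<kappa> K "D01 (T 0)" "(D01 ^^ 2) (T 0)" "(D01 ^^ 3) (T 0)"
    by (rule CM[OF zero_in])
  define s where "s = (t + c) / 2"
  have s: "s < t" "c < s" "0 < s" using t c_in by (auto simp: s_def)
  obtain g where g: "g \<in> W21" "\<And>x. x \<in> {0..1} \<Longrightarrow> 0 \<le> g x \<and> g x \<le> 1" "\<And>x. x \<in> {0..s} \<Longrightarrow> g x = 1" "\<And>x. x \<in> {t..1} \<Longrightarrow> g x = 0"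
    using plateau_exists[OF s(3,1) t(2)] by metis
  define f where "f x = 1 - g x" for x
  have f: "f \<in> W21" "\<And>x. x \<in> {0..1} \<Longrightarrow> 0 \<le> f x" "\<And>x. x \<in> {0..s} \<Longrightarrow> f x = 0" "\<And>x. x \<in> {t..1} \<Longrightarrow> f x = 1"
    using W21_one_minus[OF g(1)] g by (auto simp: f_def[abs_def])
  have fL: "f \<in> L1" using f(1) W11_L1 by (auto simp: W21_def)
  have P: "prim (LT \<epsilon> f) (T \<epsilon> x) = -1 * x + 1" if e: "\<epsilon> \<in> {0..<\<delta>}" and x: "x \<in> {t..1}" for \<epsilon> x
  proof -
    interpret C: cusp_map "T \<epsilon>" c "a \<epsilon>" \<beta> \<theta> \<kappa> K "D01 (T \<epsilon>)" "(D01 ^^ 2) (T \<epsilon>)" "(D01 ^^ 3) (T \<epsilon>)"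
      by (rule CM[OF e])
    have xX: "x \<in> {0..1} - {c}" using x t c_in by auto
    obtain x1 x2 where x1: "0 \<le> x1" "x1 < c" "T \<epsilon> x1 = T \<epsilon> x"
      using C.preimages_exist[of "T \<epsilon> x"] C.T_in[of x] C.T_lt_a[OF xX] xX by auto
    have "prim (LT \<epsilon> f) (T \<epsilon> x1) = prim f x1 + ((LINT z|leb01. f z) - prim f x)"
      by (rule C.prim_L_level) (use x t x1 fL in auto)
    also have "prim f x1 = 0" using prim_diff_const[OF fL, of 0 x1 0] prim_0[OF fL, of 0] x1 s c_in f(3) by auto
    also have "(LINT z|leb01. f z) - prim f x = 1 - x"
      using prim_diff_const[OF fL, of x 1 1] prim_1[of 1 f] x t c_in f(4) by auto
    finally show ?thesis using x1(3) by simp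
  qed
  have "\<exists>\<Psi> D. branch_data {t..1} {t<..1} (-1) 1 (\<lambda>\<epsilon>. prim (LT \<epsilon> f)) \<Psi> D"
  proof (rule branch_data_exists[OF f(1,2)])
    show "{t..1} \<subseteq> {0..1} - {c}" using t c_in by auto
    show "at z within {t..1} \<noteq> bot" if "z \<in> {t..1}" for z by (rule at_within_Icc_nontrivial[OF t(2) that])
    show "T 0 x < T 0 t" if "x \<in> {t<..1}" for x
    proof -
      have "0 < \<theta> * (x - t)" using C0.theta that by simp
      then show ?thesis using C0.T_right[of t x] that t by simp
    qed
    show "T 0 t \<le> 1" using C0.T_in[of t] t c_in by simp
    show "{0..T 0 t} \<subseteq> T 0 ` {t..1}" using C0.T_image_right[of t 1] C0.T_ends t by simp
  qed (use P in auto)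
  then show ?thesis by blast
qed

text \<open>Every \<open>x\<close> off the cusp lies in a branch piece whose inner end is halfway
  between \<open>x\<close> and \<open>c\<close>.\<close>

lemma eps_differentiable:
  assumes x: "x \<in> {0..1} - {c}"
  shows "((\<lambda>\<epsilon>. T \<epsilon> x) \<longlongrightarrow> T 0 x) (at_right 0)" "(\<lambda>\<epsilon>. T \<epsilon> x) differentiable (at_right 0)"
    "(\<lambda>\<epsilon>. D01 (T \<epsilon>) x) differentiable (at_right 0)"
proof -
  have "((\<lambda>\<epsilon>. T \<epsilon> x) \<longlongrightarrow> T 0 x) (at_right 0) \<and> (\<lambda>\<epsilon>. T \<epsilon> x) differentiable (at_right 0) \<and>
    (\<lambda>\<epsilon>. D01 (T \<epsilon>) x) differentiable (at_right 0)"
  proof (cases "x < c")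
    case True
    have "0 < (x + c) / 2" "(x + c) / 2 < c" "x \<in> {0..<(x + c) / 2}" using True x c_in by auto
    then show ?thesis using left_branch[of "(x + c) / 2"] unfolding branch_data_def by blast
  next
    case False
    have "c < (x + c) / 2" "(x + c) / 2 < 1" "x \<in> {(x + c) / 2<..1}" using False x c_in by auto
    then show ?thesis using right_branch[of "(x + c) / 2"] unfolding branch_data_def by blast
  qed
  then show "((\<lambda>\<epsilon>. T \<epsilon> x) \<longlongrightarrow> T 0 x) (at_right 0)" "(\<lambda>\<epsilon>. T \<epsilon> x) differentiable (at_right 0)"
    "(\<lambda>\<epsilon>. D01 (T \<epsilon>) x) differentiable (at_right 0)" by blast+
qed

text \<open>This half of continuity keeps levels above \<open>a 0\<close> out of reach of the nearby
  maps. Near the cusp \<open>a \<epsilon>\<close> exceeds \<open>T \<epsilon> x\<close> by an amount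
  that is small uniformly in the parameter, and for fixed \<open>x\<close> the value
  \<open>T \<epsilon> x\<close> tends to \<open>T 0 x < a 0\<close>.\<close>

lemma a_upper:
  assumes "a 0 < y" shows "\<forall>\<^sub>F \<epsilon> in at_right 0. a \<epsilon> \<le> y"
proof -
  obtain \<theta> \<kappa> K where CM: "\<And>\<epsilon>. \<epsilon> \<in> {0..<\<delta>} \<Longrightarrow>
      cusp_map (T \<epsilon>) c (a \<epsilon>) \<beta> \<theta> \<kappa> K (D01 (T \<epsilon>)) ((D01 ^^ 2) (T \<epsilon>)) ((D01 ^^ 3) (T \<epsilon>))"
    using cusp_maps by blast
  have "((\<lambda>x. K / (\<beta> + 1) * (c - x) powr (\<beta> + 1)) \<longlongrightarrow> K / (\<beta> + 1) * 0) (at_left c)"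
    by (intro tendsto_mult tendsto_const powr_tendsto_0_left) (use c_in beta_in in auto)
  then have "((\<lambda>x. K / (\<beta> + 1) * (c - x) powr (\<beta> + 1)) \<longlongrightarrow> 0) (at_left c)" by simp
  then have "\<forall>\<^sub>F x in at_left c. K / (\<beta> + 1) * (c - x) powr (\<beta> + 1) < (y - a 0) / 2"
    using assms by (intro order_tendstoD(2)) auto
  moreover have "\<forall>\<^sub>F x in at_left c. x \<in> {0<..<c}"
    using eventually_at_left_real[OF c_in(1)] .
  ultimately have "\<forall>\<^sub>F x in at_left c. K / (\<beta> + 1) * (c - x) powr (\<beta> + 1) < (y - a 0) / 2 \<and> x \<in> {0<..<c}"
    by eventually_elim simp
  then have "\<exists>x. K / (\<beta> + 1) * (c - x) powr (\<beta> + 1) < (y - a 0) / 2 \<and> x \<in> {0<..<c}"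
    by (rule eventually_happens'[OF trivial_limit_at_left_real])
  then obtain x where x: "K / (\<beta> + 1) * (c - x) powr (\<beta> + 1) < (y - a 0) / 2" "0 < x" "x < c"
    by auto
  have xX: "x \<in> {0..1} - {c}" using x c_in by auto
  have "T 0 x < a 0" by (rule cusp_map.T_lt_a[OF CM[OF zero_in] xX])
  then have "T 0 x < (y + a 0) / 2" using assms by simp
  from order_tendstoD(2)[OF eps_differentiable(1)[OF xX] this]
  show ?thesis using eventually_in_domain'
  proof eventually_elim
    case (elim \<epsilon>)
    have "a \<epsilon> \<le> T \<epsilon> x + K / (\<beta> + 1) * (c - x) powr (\<beta> + 1)"
      by (rule cusp_map.a_le[OF CM[OF elim(2)]]) (use x in auto)
    moreover define P where "P = K / (\<beta> + 1) * (c - x) powr (\<beta> + 1)"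
    ultimately have "a \<epsilon> \<le> T \<epsilon> x + P" "P < (y - a 0) / 2" using x(1) by simp_all
    then show ?case using elim(1) by simp
  qed
qed

definition response_source :: "(real \<Rightarrow> real) \<Rightarrow> real \<Rightarrow> real" where
  "response_source h z = A0 T z * wderiv h z + B0 T z * h z"

text \<open>Both sides equal \<open>\<Psi>\<^sub>1 y * h x\<^sub>1 + \<Psi>\<^sub>2 y * h x\<^sub>2\<close>, where \<open>x\<^sub>1\<close> and \<open>x\<^sub>2\<close> are the preimages of \<open>y\<close>: on the left
  this is the derivative in \<open>\<epsilon>\<close> of the mass that \<open>h\<close> gives to \<open>{T\<^sub>\<epsilon> \<le> y}\<close>, and on the right \<open>A\<^sub>0 h' + B\<^sub>0 h\<close> is
  \<open>(A\<^sub>0 h)'\<close> because \<open>B\<^sub>0\<close> is the derivative of \<open>A\<^sub>0\<close> on each branch.\<close>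

lemma response_primitive:
  assumes h: "\<And>x. x \<in> {0..1} \<Longrightarrow> (h has_real_derivative h' x) (at x within {0..1})" "continuous_on {0..1} h'"
    and q: "\<And>y. y \<in> {0..1} \<Longrightarrow> ((\<lambda>\<epsilon>. (prim (LT \<epsilon> h) y - prim (LT 0 h) y) / \<epsilon>) \<longlongrightarrow> Q y) (at_right 0)"
    and y: "0 \<le> y" "y < a 0"
  shows "(\<lambda>z. response_source h z * indicator {..y} (T 0 z)) \<in> L1"
    and "Q y = (LINT z|leb01. response_source h z * indicator {..y} (T 0 z))"
proof -
  obtain \<theta> \<kappa> K where CM: "\<And>\<epsilon>. \<epsilon> \<in> {0..<\<delta>} \<Longrightarrow>
      cusp_map (T \<epsilon>) c (a \<epsilon>) \<beta> \<theta> \<kappa> K (D01 (T \<epsilon>)) ((D01 ^^ 2) (T \<epsilon>)) ((D01 ^^ 3) (T \<epsilon>))"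
    using cusp_maps by blast
  interpret C0: cusp_map "T 0" c "a 0" \<beta> \<theta> \<kappa> K "D01 (T 0)" "(D01 ^^ 2) (T 0)" "(D01 ^^ 3) (T 0)"
    by (rule CM[OF zero_in])
  have hc: "continuous_on {0..1} h" by (rule DERIV_continuous_on[OF h(1)])
  have hL: "h \<in> L1" by (rule continuous_L1[OF hc])
  have hw: "has_weak_deriv h h'" by (rule has_weak_deriv_C1[OF h(2,1)])
  have y1: "y \<in> {0..1}" using y C0.a_in by auto
  obtain x1 x2 where x: "0 \<le> x1" "x1 < c" "c < x2" "x2 \<le> 1" "T 0 x1 = y" "T 0 x2 = y"
    using C0.preimages_exist[OF y] by metis
  define s where "s = (x1 + c) / 2"
  define t where "t = (x2 + c) / 2"
  have s: "0 < s" "x1 < s" "s < c" using x c_in by (auto simp: s_def)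
  have t: "c < t" "t < x2" "t < 1" using x c_in by (auto simp: t_def)
  obtain \<Phi>1 \<Psi>1 D1 where B1: "branch_data {0..s} {0..<s} 1 0 \<Phi>1 \<Psi>1 D1" using left_branch[OF s(1,3)] by blast
  obtain \<Phi>2 \<Psi>2 D2 where B2: "branch_data {t..1} {t<..1} (-1) 1 \<Phi>2 \<Psi>2 D2" using right_branch[OF t(1,3)] by blast
  have b1: "\<And>\<epsilon> x. \<epsilon> \<in> {0..<\<delta>} \<Longrightarrow> x \<in> {0..s} \<Longrightarrow> \<Phi>1 \<epsilon> (T \<epsilon> x) = x"
     "((\<lambda>\<epsilon>. (\<Phi>1 \<epsilon> y - \<Phi>1 0 y) / \<epsilon>) \<longlongrightarrow> \<Psi>1 y) (at_right 0)" "\<Psi>1 0 = 0" "continuous_on {0..1} D1"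
     "\<And>y. y \<in> {0..1} \<Longrightarrow> (\<Psi>1 has_real_derivative D1 y) (at y within {0..1})"
     "\<And>x. x \<in> {0..<s} \<Longrightarrow> A0 T x = \<Psi>1 (T 0 x)" "\<And>x. x \<in> {0..<s} \<Longrightarrow> B0 T x = D1 (T 0 x) * D01 (T 0) x"
    using B1 y1 unfolding branch_data_def by auto
  have b2: "\<And>\<epsilon> x. \<epsilon> \<in> {0..<\<delta>} \<Longrightarrow> x \<in> {t..1} \<Longrightarrow> \<Phi>2 \<epsilon> (T \<epsilon> x) = 1 - x"
     "((\<lambda>\<epsilon>. (\<Phi>2 \<epsilon> y - \<Phi>2 0 y) / \<epsilon>) \<longlongrightarrow> \<Psi>2 y) (at_right 0)" "\<Psi>2 0 = 0" "continuous_on {0..1} D2"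
     "\<And>y. y \<in> {0..1} \<Longrightarrow> (\<Psi>2 has_real_derivative D2 y) (at y within {0..1})"
     "\<And>x. x \<in> {t<..1} \<Longrightarrow> A0 T x = - \<Psi>2 (T 0 x)" "\<And>x. x \<in> {t<..1} \<Longrightarrow> B0 T x = - D2 (T 0 x) * D01 (T 0) x"
    using B2 y1 unfolding branch_data_def by auto
  have ended: "(F has_real_derivative D (T 0 z) * D01 (T 0) z * h z + \<Psi> (T 0 z) * h' z) (at z within S)"
    if F: "F = (\<lambda>z. \<Psi> (T 0 z) * h z)" and \<Psi>: "\<And>y. y \<in> {0..1} \<Longrightarrow> (\<Psi> has_real_derivative D y) (at y within {0..1})"
      and S: "S \<subseteq> {0..1}" "z \<in> S" "z \<noteq> c" for F \<Psi> D :: "real \<Rightarrow> real" and S z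
  proof -
    have z: "z \<in> {0..1}" using S by auto
    have Td: "(T 0 has_real_derivative D01 (T 0) z) (at z within S)"
      by (rule has_field_derivative_subset[OF C0.d1 S(1)]) (use z S in auto)
    have "(\<Psi> has_real_derivative D (T 0 z)) (at (T 0 z) within T 0 ` S)"
      by (rule has_field_derivative_subset[OF \<Psi>]) (use C0.T_in z S in auto)
    from DERIV_image_chain[OF this Td]
    have "((\<lambda>z. \<Psi> (T 0 z)) has_real_derivative D (T 0 z) * D01 (T 0) z) (at z within S)" by (simp add: comp_def)
    from DERIV_mult[OF this has_field_derivative_subset[OF h(1)[OF z] S(1)]]
    show ?thesis unfolding F by (simp add: algebra_simps)
  qed
  have contg: "continuous_on S (\<lambda>z. D (T 0 z) * D01 (T 0) z * h z + \<Psi> (T 0 z) * h' z)"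
    if D: "continuous_on {0..1} D" and \<Psi>: "\<And>y. y \<in> {0..1} \<Longrightarrow> (\<Psi> has_real_derivative D y) (at y within {0..1})"
      and S: "S \<subseteq> {0..1} - {c}" for \<Psi> D :: "real \<Rightarrow> real" and S
  proof -
    have c1: "continuous_on S (T 0)" "continuous_on S (D01 (T 0))"
      using C0.cont_X S continuous_on_subset by blast+
    have c2: "continuous_on {0..1} \<Psi>" by (rule DERIV_continuous_on[OF \<Psi>])
    have im: "T 0 ` S \<subseteq> {0..1}" using C0.T_in S by auto
    show ?thesis
      by (intro continuous_on_add continuous_on_mult c1 continuous_on_compose2[OF D c1(1) im]
          continuous_on_compose2[OF c2 c1(1) im] continuous_on_subset[OF hc] continuous_on_subset[OF h(2)])
        (use S in auto)
  qed
  \<comment> \<open>\<open>g1\<close> and \<open>g2\<close> are the source on the two branches,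
    written as the derivatives of \<open>\<Psi>1 (T 0 z) * h z\<close> and
    \<open>- (\<Psi>2 (T 0 z) * h z)\<close>.\<close>
  define g1 where "g1 z = D1 (T 0 z) * D01 (T 0) z * h z + \<Psi>1 (T 0 z) * h' z" for z
  define g2 where "g2 z = - (D2 (T 0 z) * D01 (T 0) z * h z + \<Psi>2 (T 0 z) * h' z)" for z
  define e1 where "e1 z = g1 (max 0 (min x1 z))" for z
  define e2 where "e2 z = g2 (max x2 (min 1 z))" for z
  have e1: "e1 \<in> L1" "prim e1 x1 - prim e1 0 = \<Psi>1 (T 0 x1) * h x1 - \<Psi>1 (T 0 0) * h 0"
    unfolding e1_def[abs_def]
    by (rule prim_FTC_segment[where F = "\<lambda>z. \<Psi>1 (T 0 z) * h z"];
        use x c_in in \<open>auto simp: g1_def[abs_def] intro!: contg ended b1(4,5)\<close>)+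
  have e2: "e2 \<in> L1" "prim e2 1 - prim e2 x2 = - (\<Psi>2 (T 0 1) * h 1) - - (\<Psi>2 (T 0 x2) * h x2)"
    unfolding e2_def[abs_def]
    by (rule prim_FTC_segment[where F = "\<lambda>z. - (\<Psi>2 (T 0 z) * h z)"];
        use x c_in in \<open>auto simp: g2_def[abs_def] simp del: minus_add_distrib
          intro!: continuous_on_minus DERIV_minus contg ended b2(4,5)\<close>)+
  have wd: "ae_eq (wderiv h) h'" by (rule wderiv_eq[OF hw])
  \<comment> \<open>The set where \<open>T 0 z \<le> y\<close> consists of the pieces outside
    \<open>x1\<close> and \<open>x2\<close>; the neighbourhood of the cusp between them is left
    out.\<close>
  define E where "E z = e1 z * indicator {..x1} z + (e2 z - e2 z * indicator {..x2} z)" for z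
  have i1: "(\<lambda>z. e1 z * indicator {..x1} z) \<in> L1" "(\<lambda>z. e2 z * indicator {..x2} z) \<in> L1"
    using prim_integrable[OF e1(1)] prim_integrable[OF e2(1)] by (auto simp: L1_def)
  have EL: "E \<in> L1" unfolding E_def[abs_def] by (intro L1_add L1_diff i1 e2(1))
  have eq: "ae_eq E (\<lambda>z. response_source h z * indicator {..y} (T 0 z))"
    using wd C0.AE_X null_point[of x2] unfolding ae_eq_def
  proof eventually_elim
    case (elim z)
    have lev: "T 0 z \<le> y \<longleftrightarrow> z \<le> x1 \<or> x2 \<le> z" using C0.level_set[OF x(1-4) _ elim(2)] x(5,6) by simp
    consider "z \<le> x1" | "x1 < z" "z < x2" | "x2 < z" using elim(3) by linarith
    then show ?case
    proof cases
      case 1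
      then have "response_source h z = g1 z"
        unfolding response_source_def g1_def using b1(6)[of z] b1(7)[of z] elim s by (simp add: algebra_simps)
      moreover have "e1 z = g1 z" using 1 elim(2) by (simp add: e1_def)
      ultimately show ?thesis using 1 lev x unfolding E_def by simp
    next
      case 2
      then show ?thesis using lev unfolding E_def by simp
    next
      case 3
      then have "response_source h z = g2 z"
        unfolding response_source_def g2_def using b2(6)[of z] b2(7)[of z] elim t by (simp add: algebra_simps)
      moreover have "e2 z = g2 z" using 3 elim(2) by (simp add: e2_def)
      ultimately show ?thesis using 3 lev x unfolding E_def by simp
    qed
  qed
  show "(\<lambda>z. response_source h z * indicator {..y} (T 0 z)) \<in> L1" by (rule L1_cong[OF EL eq])
  have "(LINT z|leb01. response_source h z * indicator {..y} (T 0 z)) = (LINT z|leb01. E z)"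
    by (rule integral_ae_eq[symmetric, OF L1_measurable[OF EL] eq])
  also have "\<dots> = prim e1 x1 + (prim e2 1 - prim e2 x2)"
    unfolding E_def prim_1[OF order_refl] unfolding prim_def using i1 e2(1) by (simp add: L1_def)
  also have "prim e1 x1 = \<Psi>1 y * h x1" using e1(2) prim_0[OF e1(1), of 0] C0.T_ends b1(3) x by simp
  also have "prim e2 1 - prim e2 x2 = \<Psi>2 y * h x2" using e2(2) C0.T_ends b2(3) x by simp
  finally have right: "(LINT z|leb01. response_source h z * indicator {..y} (T 0 z)) = \<Psi>1 y * h x1 + \<Psi>2 y * h x2" .
  \<comment> \<open>A margin on each side: \<open>y\<close> is below \<open>T 0\<close> at
    \<open>s'\<close> and \<open>t'\<close>, so for small parameters the preimages of
    \<open>y\<close> under \<open>T \<epsilon>\<close> stay in \<open>{0..s'}\<close> and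
    \<open>{t'..1}\<close>, where the branch data apply.\<close>
  define s' where "s' = (x1 + s) / 2"
  define t' where "t' = (x2 + t) / 2"
  have s': "x1 < s'" "s' < s" "0 \<le> s'" and t': "t' < x2" "t < t'" using s t x by (auto simp: s'_def t'_def)
  have X': "s' \<in> {0..1} - {c}" "t' \<in> {0..1} - {c}" using s' t' s t x c_in by auto
  have gt: "y < T 0 s'" "y < T 0 t'"
    using C0.level_set[OF x(1-4) _ X'(1)] C0.level_set[OF x(1-4) _ X'(2)] x s' t' s t by auto
  have ev: "\<forall>\<^sub>F \<epsilon> in at_right 0. \<Phi>1 \<epsilon> y \<in> {0..1} \<and> 1 - \<Phi>2 \<epsilon> y \<in> {0..1} \<and>
      prim (LT \<epsilon> h) y = prim h (\<Phi>1 \<epsilon> y) + ((LINT z|leb01. h z) - prim h (1 - \<Phi>2 \<epsilon> y))"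
    using order_tendstoD(1)[OF eps_differentiable(1)[OF X'(1)] gt(1)]
      order_tendstoD(1)[OF eps_differentiable(1)[OF X'(2)] gt(2)] eventually_in_domain'
  proof eventually_elim
    case (elim \<epsilon>)
    interpret C: cusp_map "T \<epsilon>" c "a \<epsilon>" \<beta> \<theta> \<kappa> K "D01 (T \<epsilon>)" "(D01 ^^ 2) (T \<epsilon>)" "(D01 ^^ 3) (T \<epsilon>)"
      by (rule CM[OF elim(3)])
    have "y \<in> T \<epsilon> ` {0..s'}" using C.T_image_left[of 0 s'] C.T_ends s' s elim y by force
    then obtain z1 where z1: "z1 \<in> {0..s'}" "T \<epsilon> z1 = y" by blast
    have "y \<in> T \<epsilon> ` {t'..1}" using C.T_image_right[of t' 1] C.T_ends t' t x elim y by force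
    then obtain z2 where z2: "z2 \<in> {t'..1}" "T \<epsilon> z2 = y" by blast
    have p1: "\<Phi>1 \<epsilon> y = z1" using b1(1)[OF elim(3), of z1] z1 s' by auto
    have p2: "\<Phi>2 \<epsilon> y = 1 - z2" using b2(1)[OF elim(3), of z2] z2 t' by auto
    have "prim (LT \<epsilon> h) (T \<epsilon> z1) = prim h z1 + ((LINT z|leb01. h z) - prim h z2)"
      by (rule C.prim_L_level) (use z1 z2 s' s t' t hL in auto)
    then show ?case unfolding p1 p2 using z1 z2 s' s t' t c_in by auto
  qed
  have p0: "\<Phi>1 0 y = x1" "\<Phi>2 0 y = 1 - x2" using b1(1)[OF zero_in, of x1] b2(1)[OF zero_in, of x2] x s t by auto
  have P0: "prim (LT 0 h) y = prim h x1 + ((LINT z|leb01. h z) - prim h x2)"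
    using C0.prim_L_level[OF x(1-4) _ hL] x by simp
  have prd: "(prim h has_real_derivative h z) (at z within {0..1})" if "z \<in> {0..1}" for z
    by (rule prim_has_derivative[OF hL hc that])
  have l1: "((\<lambda>\<epsilon>. (prim h (\<Phi>1 \<epsilon> y) - prim h x1) / \<epsilon>) \<longlongrightarrow> h x1 * \<Psi>1 y + 0) (at_right 0)"
  proof (rule family_compose_deriv[where G = "\<lambda>_. prim h" and H = "\<lambda>_. 0" and \<rho> = "\<lambda>_. 0"])
    show "((\<lambda>\<epsilon>. (\<Phi>1 \<epsilon> y - x1) / \<epsilon>) \<longlongrightarrow> \<Psi>1 y) (at_right 0)" using b1(2) p0 by simp
    show "\<forall>\<^sub>F \<epsilon> in at_right 0. \<Phi>1 \<epsilon> y \<in> {0..1}" using ev by eventually_elim blast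
  qed (use prd x c_in in auto)
  have l2: "((\<lambda>\<epsilon>. (prim h (1 - \<Phi>2 \<epsilon> y) - prim h x2) / \<epsilon>) \<longlongrightarrow> h x2 * (- \<Psi>2 y) + 0) (at_right 0)"
  proof (rule family_compose_deriv[where G = "\<lambda>_. prim h" and H = "\<lambda>_. 0" and \<rho> = "\<lambda>_. 0"])
    have "((\<lambda>\<epsilon>. - ((\<Phi>2 \<epsilon> y - \<Phi>2 0 y) / \<epsilon>)) \<longlongrightarrow> - \<Psi>2 y) (at_right 0)" by (intro tendsto_intros b2(2))
    then show "((\<lambda>\<epsilon>. (1 - \<Phi>2 \<epsilon> y - x2) / \<epsilon>) \<longlongrightarrow> - \<Psi>2 y) (at_right 0)"
      by (subst (asm) minus_divide_left) (simp add: p0 algebra_simps)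
    show "\<forall>\<^sub>F \<epsilon> in at_right 0. 1 - \<Phi>2 \<epsilon> y \<in> {0..1}" using ev by eventually_elim blast
  qed (use prd x c_in in auto)
  have "((\<lambda>\<epsilon>. (prim h (\<Phi>1 \<epsilon> y) - prim h x1) / \<epsilon> - (prim h (1 - \<Phi>2 \<epsilon> y) - prim h x2) / \<epsilon>)
      \<longlongrightarrow> (h x1 * \<Psi>1 y + 0) - (h x2 * (- \<Psi>2 y) + 0)) (at_right 0)" by (intro tendsto_diff l1 l2)
  then have "((\<lambda>\<epsilon>. (prim (LT \<epsilon> h) y - prim (LT 0 h) y) / \<epsilon>) \<longlongrightarrow> (h x1 * \<Psi>1 y + 0) - (h x2 * (- \<Psi>2 y) + 0)) (at_right 0)"
  proof (rule Lim_transform_eventually)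
    show "\<forall>\<^sub>F \<epsilon> in at_right 0. (prim h (\<Phi>1 \<epsilon> y) - prim h x1) / \<epsilon> - (prim h (1 - \<Phi>2 \<epsilon> y) - prim h x2) / \<epsilon>
        = (prim (LT \<epsilon> h) y - prim (LT 0 h) y) / \<epsilon>"
      using ev by eventually_elim (simp add: P0 diff_divide_distrib add_divide_distrib)
  qed
  then have "Q y = (h x1 * \<Psi>1 y + 0) - (h x2 * (- \<Psi>2 y) + 0)"
    by (rule tendsto_unique[OF trivial_limit_at_right_real q[OF y1]])
  then show "Q y = (LINT z|leb01. response_source h z * indicator {..y} (T 0 z))"
    unfolding right by (simp add: mult.commute)
qed

text \<open>By \<open>a_upper\<close> the level \<open>y\<close> is eventually at least
  \<open>a \<epsilon>\<close>, so all primitives at \<open>y\<close> equal the full integral of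
  \<open>h\<close> and the quotients vanish.\<close>

lemma response_primitive_above:
  assumes h: "h \<in> L1"
    and q: "((\<lambda>\<epsilon>. (prim (LT \<epsilon> h) y - prim (LT 0 h) y) / \<epsilon>) \<longlongrightarrow> Q) (at_right 0)" and y: "a 0 < y"
  shows "Q = 0"
proof -
  obtain \<theta> \<kappa> K where CM: "\<And>\<epsilon>. \<epsilon> \<in> {0..<\<delta>} \<Longrightarrow>
      cusp_map (T \<epsilon>) c (a \<epsilon>) \<beta> \<theta> \<kappa> K (D01 (T \<epsilon>)) ((D01 ^^ 2) (T \<epsilon>)) ((D01 ^^ 3) (T \<epsilon>))"
    using cusp_maps by blast
  have "\<forall>\<^sub>F \<epsilon> in at_right 0. 0 = (prim (LT \<epsilon> h) y - prim (LT 0 h) y) / \<epsilon>"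
    using a_upper[OF y] eventually_in_domain'
  proof eventually_elim
    case (elim \<epsilon>)
    show ?case using cusp_map.prim_L_above[OF CM[OF elim(2)] h elim(1)]
        cusp_map.prim_L_above[OF CM[OF zero_in] h, of y] y by simp
  qed
  then have "((\<lambda>\<epsilon>. (prim (LT \<epsilon> h) y - prim (LT 0 h) y) / \<epsilon>) \<longlongrightarrow> 0) (at_right 0)"
    by (rule Lim_transform_eventually[OF tendsto_const])
  then show ?thesis by (rule tendsto_unique[OF trivial_limit_at_right_real q])
qed

text \<open>On the preimage of \<open>{..b}\<close> with \<open>b < a 0\<close> the source is
  integrable, and equality of primitives identifies its transfer with \<open>q\<close>. Levels
  increasing to \<open>a 0\<close> and dominated convergence give duality for all admissible test
  functions; the representative chosen by \<open>transfer_op\<close> agrees with \<open>q\<close>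
  below \<open>a 0\<close> because both are determined on each \<open>{..b}\<close>.\<close>

lemma response_identification:
  assumes h: "\<And>x. x \<in> {0..1} \<Longrightarrow> (h has_real_derivative h' x) (at x within {0..1})" "continuous_on {0..1} h'"
    and q: "\<And>y. y \<in> {0..1} \<Longrightarrow> ((\<lambda>\<epsilon>. (prim (LT \<epsilon> h) y - prim (LT 0 h) y) / \<epsilon>) \<longlongrightarrow> prim q y) (at_right 0)"
    and qL: "q \<in> L1"
  shows "is_transfer (T 0) (response_source h) q" "ae_eq (response_q T (a 0) h) q"
proof -
  obtain \<theta> \<kappa> K where CM: "\<And>\<epsilon>. \<epsilon> \<in> {0..<\<delta>} \<Longrightarrow>
      cusp_map (T \<epsilon>) c (a \<epsilon>) \<beta> \<theta> \<kappa> K (D01 (T \<epsilon>)) ((D01 ^^ 2) (T \<epsilon>)) ((D01 ^^ 3) (T \<epsilon>))"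
    using cusp_maps by blast
  interpret C0: cusp_map "T 0" c "a 0" \<beta> \<theta> \<kappa> K "D01 (T 0)" "(D01 ^^ 2) (T 0)" "(D01 ^^ 3) (T 0)"
    by (rule CM[OF zero_in])
  have hL: "h \<in> L1" by (rule continuous_L1[OF DERIV_continuous_on[OF h(1)]])
  let ?f = "response_source h"
  have fb: "(\<lambda>z. ?f z * indicator {..b} (T 0 z)) \<in> L1"
    and fi: "prim q b = (LINT z|leb01. ?f z * indicator {..b} (T 0 z))" if "0 \<le> b" "b < a 0" for b
    using response_primitive[OF h q that] by auto
  have qm: "q \<in> borel_measurable leb01" by (rule L1_measurable[OF qL])
  \<comment> \<open>Both functions are cut at \<open>b\<close>; taking a primitive up to
    \<open>y\<close> lowers the cut to \<open>min b y\<close>, where the two primitives are known to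
    agree.\<close>
  have cut: "(LINT x|leb01. q x * indicator {..b} x * g x) = (LINT z|leb01. ?f z * indicator {..b} (T 0 z) * g (T 0 z))"
    if b: "0 \<le> b" "b < a 0" and g: "g \<in> Linf" for b g
  proof -
    let ?u = "\<lambda>z. ?f z * indicator {..b} (T 0 z)"
    have qb: "(\<lambda>x. q x * indicator {..b} x) \<in> L1" by (rule L1_mult_Linf[OF qL ind_Linf])
    have minind: "indicator {..b} x * indicator {..y} x = (indicator {..min b y} x :: real)" for x y :: real
      by (auto split: split_indicator)
    have "ae_eq (\<lambda>x. LT 0 ?u x - q x * indicator {..b} x) (\<lambda>x. 0)"
    proof (rule ae_zero_if_prim_zero[OF L1_diff[OF C0.L_L1[OF fb[OF b]] qb]])
      fix y :: real assume y: "y \<in> {0..1}"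
      have "prim (LT 0 ?u) y = (LINT z|leb01. ?f z * indicator {..min b y} (T 0 z))"
        unfolding C0.prim_L[OF fb[OF b]] by (simp add: mult.assoc minind)
      also have "\<dots> = prim q (min b y)" using fi[of "min b y"] b y by simp
      also have "\<dots> = prim (\<lambda>x. q x * indicator {..b} x) y" unfolding prim_def by (simp add: mult.assoc minind)
      finally show "prim (\<lambda>x. LT 0 ?u x - q x * indicator {..b} x) y = 0"
        unfolding prim_diff[OF C0.L_L1[OF fb[OF b]] qb] by simp
    qed
    then have "ae_eq (LT 0 ?u) (\<lambda>x. q x * indicator {..b} x)" by (simp add: ae_eq_def)
    then have "ae_eq (\<lambda>x. LT 0 ?u x * g x) (\<lambda>x. q x * indicator {..b} x * g x)"
      unfolding ae_eq_def by eventually_elim simp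
    then have "(LINT x|leb01. q x * indicator {..b} x * g x) = (LINT x|leb01. LT 0 ?u x * g x)"
      by (rule integral_ae_eq[symmetric, OF L1_measurable[OF L1_mult_Linf[OF C0.L_L1[OF fb[OF b]] g]]])
    also have "\<dots> = (LINT z|leb01. ?u z * g (T 0 z))" by (rule C0.L_dual[OF fb[OF b] g])
    finally show ?thesis .
  qed
  have "0 < a 0" by (rule C0.a_pos)
  define b where "b n = a 0 * (1 - inverse (real (Suc n)))" for n
  have b: "0 \<le> b n" "b n < a 0" for n using \<open>0 < a 0\<close> by (auto simp: b_def divide_simps mult_less_cancel_left1)
  have bl: "b \<longlonglongrightarrow> a 0"
  proof -
    have "b \<longlonglongrightarrow> a 0 * (1 - 0)" unfolding b_def by (intro tendsto_intros LIMSEQ_inverse_real_of_nat)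
    then show ?thesis by simp
  qed
  have indl: "(\<lambda>n. indicator {..b n} x) \<longlonglongrightarrow> (1::real)" if "x < a 0" for x
  proof (rule tendsto_eventually)
    show "eventually (\<lambda>n. indicator {..b n} x = (1::real)) sequentially"
      using order_tendstoD(1)[OF bl that] by eventually_elim simp
  qed
  \<comment> \<open>The source is measurable as a pointwise limit of its integrable cuts, with the
    value at \<open>c\<close> reset on a null set.\<close>
  have fm: "?f \<in> borel_measurable leb01"
  proof -
    define g where "g n z = (if z = c then 0 else ?f z * indicator {..b n} (T 0 z))" for n z
    have gm: "g n \<in> borel_measurable leb01" for n
      by (rule borel_measurable_ae_eq[OF L1_measurable[OF fb[OF b(1)[of n] b(2)[of n]]]], rule C0.ae_eq_X) (simp add: g_def)
    have "(\<lambda>z. if z = c then 0 else ?f z) \<in> borel_measurable leb01"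
    proof (rule borel_measurable_LIMSEQ_real[OF _ gm])
      fix z assume "z \<in> space leb01"
      then have z: "z \<in> {0..1}" by simp
      show "(\<lambda>n. g n z) \<longlonglongrightarrow> (if z = c then 0 else ?f z)"
      proof (cases "z = c")
        case False
        then have "T 0 z < a 0" using C0.T_lt_a[of z] z by simp
        from tendsto_mult[OF tendsto_const[of "?f z"] indl[OF this]] show ?thesis using False by (simp add: g_def)
      qed (simp add: g_def)
    qed
    then show ?thesis by (rule borel_measurable_ae_eq) (rule C0.ae_eq_X, simp)
  qed
  \<comment> \<open>At \<open>y = a 0\<close> the value follows by right continuity from the levels
    above or, when \<open>a 0 = 1\<close>, from conservation of the integral.\<close>
  have above: "prim q y = 0" if "a 0 \<le> y" "y \<in> {0..1}" for y
  proof (cases "a 0 < y")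
    case True
    then show ?thesis by (rule response_primitive_above[OF hL q[OF that(2)]])
  next
    case False
    then have ya: "y = a 0" using that by simp
    show ?thesis
    proof (cases "a 0 < 1")
      case True
      have "\<forall>\<^sub>F z in at_right (a 0). z \<in> {a 0<..<1}" by (rule eventually_at_right_real[OF True])
      then have "\<forall>\<^sub>F z in at_right (a 0). 0 = prim q z"
        by eventually_elim (use response_primitive_above[OF hL q] C0.a_pos in fastforce)
      then have "(prim q \<longlongrightarrow> 0) (at_right (a 0))" by (rule Lim_transform_eventually[OF tendsto_const])
      moreover have "(prim q \<longlongrightarrow> prim q (a 0)) (at_right (a 0))"
        using isCont_prim[OF qL, of "a 0"] unfolding isCont_def by (rule filterlim_mono) (auto intro: at_le)
      ultimately show ?thesis unfolding ya using tendsto_unique[OF trivial_limit_at_right_real] by blast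
    next
      case False
      then have "y = 1" using ya that(2) by simp
      have "\<forall>\<^sub>F \<epsilon> in at_right 0. 0 = (prim (LT \<epsilon> h) 1 - prim (LT 0 h) 1) / \<epsilon>"
        using eventually_in_domain'
      proof eventually_elim
        case (elim \<epsilon>)
        have "a \<epsilon> \<le> 1" using A2[OF elim] by simp
        then show ?case using cusp_map.prim_L_above[OF CM[OF elim] hL, of 1] C0.prim_L_above[OF hL, of 1] C0.a_in by simp
      qed
      then have "((\<lambda>\<epsilon>. (prim (LT \<epsilon> h) 1 - prim (LT 0 h) 1) / \<epsilon>) \<longlongrightarrow> 0) (at_right 0)"
        by (rule Lim_transform_eventually[OF tendsto_const])
      then show ?thesis unfolding \<open>y = 1\<close> using tendsto_unique[OF trivial_limit_at_right_real q[of 1]] by simp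
    qed
  qed
  have qa: "(\<lambda>x. q x * indicator {..a 0} x) \<in> L1" by (rule L1_mult_Linf[OF qL ind_Linf])
  have "ae_eq (\<lambda>x. q x - q x * indicator {..a 0} x) (\<lambda>x. 0)"
  proof (rule ae_zero_if_prim_zero[OF L1_diff[OF qL qa]])
    fix y :: real assume y: "y \<in> {0..1}"
    have "prim (\<lambda>x. q x * indicator {..a 0} x) y = prim q (min (a 0) y)"
      unfolding prim_def by (rule Bochner_Integration.integral_cong) (auto split: split_indicator)
    also have "\<dots> = prim q y" using above[of "a 0"] above[of y] C0.a_in y by (cases "a 0 \<le> y") (auto simp: min_def)
    finally show "prim (\<lambda>x. q x - q x * indicator {..a 0} x) y = 0" unfolding prim_diff[OF qL qa] by simp
  qed
  then have "AE x in leb01. x \<noteq> a 0 \<and> q x = q x * indicator {..a 0} x"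
    unfolding ae_eq_def using null_point[of "a 0"] by eventually_elim simp
  then have qzero: "AE x in leb01. x \<noteq> a 0 \<and> (a 0 \<le> x \<longrightarrow> q x = 0)"
    by eventually_elim (auto split: split_indicator_asm)
  show tr: "is_transfer (T 0) ?f q"
    unfolding is_transfer_def
  proof (intro conjI ballI impI fm qm)
    fix g assume g: "g \<in> Linf" and i: "integrable leb01 (\<lambda>x. ?f x * g (T 0 x))"
    show iq: "integrable leb01 (\<lambda>x. q x * g x)" by (rule integrable_mult_Linf[OF qL g])
    have gm: "g \<in> borel_measurable leb01" using g by (simp add: Linf_def)
    have gT: "(\<lambda>x. g (T 0 x)) \<in> Linf" by (rule Linf_comp[OF C0.nonsing g])
    have 1: "(\<lambda>n. LINT x|leb01. q x * indicator {..b n} x * g x) \<longlonglongrightarrow> (LINT x|leb01. q x * g x)"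
    proof (rule integral_dominated_convergence)
      show "integrable leb01 (\<lambda>x. \<bar>q x * g x\<bar>)" using iq by simp
      show "(\<lambda>x. q x * g x) \<in> borel_measurable leb01" using iq by auto
      show "(\<lambda>x. q x * indicator {..b n} x * g x) \<in> borel_measurable leb01" for n
        by (rule L1_measurable[OF L1_mult_Linf[OF L1_mult_Linf[OF qL ind_Linf] g]])
      show "AE x in leb01. (\<lambda>n. q x * indicator {..b n} x * g x) \<longlonglongrightarrow> q x * g x"
        using qzero
      proof eventually_elim
        case (elim x)
        show ?case
        proof (cases "x < a 0")
          case True
          have "(\<lambda>n. q x * indicator {..b n} x * g x) \<longlonglongrightarrow> q x * 1 * g x" by (intro tendsto_intros indl True)
          then show ?thesis by simp
        qed (use elim in auto)
      qed
      show "AE x in leb01. norm (q x * indicator {..b n} x * g x) \<le> \<bar>q x * g x\<bar>" for n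
        by (rule AE_I2) (auto split: split_indicator)
    qed
    have 2: "(\<lambda>n. LINT x|leb01. ?f x * indicator {..b n} (T 0 x) * g (T 0 x)) \<longlonglongrightarrow> (LINT x|leb01. ?f x * g (T 0 x))"
    proof (rule integral_dominated_convergence)
      show "integrable leb01 (\<lambda>x. \<bar>?f x * g (T 0 x)\<bar>)" using i by simp
      show "(\<lambda>x. ?f x * g (T 0 x)) \<in> borel_measurable leb01" using i by auto
      show "(\<lambda>x. ?f x * indicator {..b n} (T 0 x) * g (T 0 x)) \<in> borel_measurable leb01" for n
        by (rule L1_measurable[OF L1_mult_Linf[OF fb[OF b(1)[of n] b(2)[of n]] gT]])
      show "AE x in leb01. (\<lambda>n. ?f x * indicator {..b n} (T 0 x) * g (T 0 x)) \<longlonglongrightarrow> ?f x * g (T 0 x)"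
        using C0.AE_X
      proof eventually_elim
        case (elim x)
        have "(\<lambda>n. ?f x * indicator {..b n} (T 0 x) * g (T 0 x)) \<longlonglongrightarrow> ?f x * 1 * g (T 0 x)"
          by (intro tendsto_intros indl C0.T_lt_a elim)
        then show ?case by simp
      qed
      show "AE x in leb01. norm (?f x * indicator {..b n} (T 0 x) * g (T 0 x)) \<le> \<bar>?f x * g (T 0 x)\<bar>" for n
        by (rule AE_I2) (auto split: split_indicator)
    qed
    show "(LINT x|leb01. q x * g x) = (LINT x|leb01. ?f x * g (T 0 x))"
      by (rule LIMSEQ_unique[OF 1]) (use 2 cut[OF b g] in simp)
  qed
  \<comment> \<open>Duality for \<open>u\<close> can be used only against test functions whose
    product with the source is integrable, so \<open>u\<close> and \<open>q\<close> are compared on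
    each \<open>{..b n}\<close>. From \<open>a 0\<close> on \<open>response_q\<close> is 0 by
    definition, and so is \<open>q\<close> almost everywhere.\<close>
  define u where "u = transfer_op (T 0) ?f"
  have u: "is_transfer (T 0) ?f u" unfolding u_def transfer_op_def by (rule someI[of "is_transfer (T 0) ?f", OF tr])
  have same: "AE x in leb01. x \<le> b n \<longrightarrow> u x = q x" for n
  proof -
    have D: "integrable leb01 (\<lambda>x. u x * g x) \<and> (LINT x|leb01. u x * g x) = (LINT x|leb01. q x * g x)"
      if g: "g = (\<lambda>x. indicator E x * indicator {..b n} x)" and E: "indicator E \<in> Linf" for g :: "real \<Rightarrow> real" and E
    proof -
      have gL: "g \<in> Linf"
      proof (rule LinfI[of _ 1])
        show "g \<in> borel_measurable leb01" unfolding g using E ind_Linf[of "b n"]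
          by (intro borel_measurable_times) (auto simp: Linf_def)
      qed (auto simp: g split: split_indicator)
      have "integrable leb01 (\<lambda>z. ?f z * indicator {..b n} (T 0 z) * indicator E (T 0 z))"
        by (rule integrable_mult_Linf[OF fb[OF b(1)[of n] b(2)[of n]] Linf_comp[OF C0.nonsing E]])
      then have i: "integrable leb01 (\<lambda>z. ?f z * g (T 0 z))" unfolding g by (simp add: mult_ac)
      have "integrable leb01 (\<lambda>x. v x * g x) \<and> (LINT x|leb01. v x * g x) = (LINT x|leb01. ?f x * g (T 0 x))"
        if "is_transfer (T 0) ?f v" for v
        using that gL i unfolding is_transfer_def by blast
      from this[OF u] this[OF tr] show ?thesis by simp
    qed
    have unb: "(\<lambda>x. u x * indicator {..b n} x) \<in> L1"
      using D[of "\<lambda>x. indicator UNIV x * indicator {..b n} x" UNIV] Linf_const[of 1] by (simp add: L1_def indicator_def[of UNIV])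
    have qnb: "(\<lambda>x. q x * indicator {..b n} x) \<in> L1" by (rule L1_mult_Linf[OF qL ind_Linf])
    have "ae_eq (\<lambda>x. u x * indicator {..b n} x - q x * indicator {..b n} x) (\<lambda>x. 0)"
    proof (rule L1_ae_zero[OF L1_diff[OF unb qnb]])
      fix E assume "E \<in> sets leb01"
      then have E: "indicator E \<in> Linf" by (rule Linf_indicator)
      have "(LINT x|leb01. (u x * indicator {..b n} x - q x * indicator {..b n} x) * indicator E x)
         = (LINT x|leb01. u x * (indicator E x * indicator {..b n} x) - q x * (indicator E x * indicator {..b n} x))"
        by (rule Bochner_Integration.integral_cong) (auto simp: algebra_simps)
      also have "\<dots> = (LINT x|leb01. u x * (indicator E x * indicator {..b n} x)) - (LINT x|leb01. q x * (indicator E x * indicator {..b n} x))"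
      proof (rule Bochner_Integration.integral_diff)
        show "integrable leb01 (\<lambda>x. u x * (indicator E x * indicator {..b n} x))" using D[OF refl E] by blast
        show "integrable leb01 (\<lambda>x. q x * (indicator E x * indicator {..b n} x))"
          using integrable_mult_Linf[OF qnb E] by (simp add: mult_ac)
      qed
      finally have "(LINT x|leb01. (u x * indicator {..b n} x - q x * indicator {..b n} x) * indicator E x)
         = (LINT x|leb01. u x * (indicator E x * indicator {..b n} x)) - (LINT x|leb01. q x * (indicator E x * indicator {..b n} x))" .
      then show "(LINT x|leb01. (u x * indicator {..b n} x - q x * indicator {..b n} x) * indicator E x) = 0"
        using D[OF refl E] by simp
    qed
    then show ?thesis unfolding ae_eq_def by eventually_elim auto
  qed
  have "AE x in leb01. \<forall>n. x \<le> b n \<longrightarrow> u x = q x"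
    using same unfolding AE_all_countable by blast
  then have below: "AE x in leb01. x < a 0 \<longrightarrow> u x = q x"
  proof eventually_elim
    case (elim x)
    show ?case
    proof
      assume "x < a 0"
      then have "eventually (\<lambda>n. x < b n) sequentially" by (rule order_tendstoD(1)[OF bl])
      then obtain n where "x < b n" by (auto simp: eventually_sequentially)
      then show "u x = q x" using elim by (meson less_imp_le)
    qed
  qed
  have rq: "response_q T (a 0) h = (\<lambda>x. if x < a 0 then u x else 0)"
    unfolding response_q_def[abs_def] u_def response_source_def[abs_def] ..
  show "ae_eq (response_q T (a 0) h) q"
    unfolding ae_eq_def rq using below qzero by eventually_elim auto
qed

end

theorem theorem1:
  fixes \<delta> c \<beta> :: real and T :: "real \<Rightarrow> real \<Rightarrow> real" and a :: "real \<Rightarrow> real"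
  assumes "admissible_cusp_family \<delta> c \<beta> T a"
  shows "\<exists>\<delta>\<^sub>2 h. 0 < \<delta>\<^sub>2 \<and> \<delta>\<^sub>2 \<le> \<delta> \<and>
    \<comment> \<open>unique invariant densities, lying in the Sobolev space of order two\<close>
    (\<forall>\<epsilon>\<in>{0..<\<delta>\<^sub>2}. invariant_density (T \<epsilon>) (h \<epsilon>) \<and> h \<epsilon> \<in> W21 \<and>
       (\<forall>k. invariant_density (T \<epsilon>) k \<longrightarrow> ae_eq k (h \<epsilon>))) \<and>
    \<comment> \<open>differentiability in the mean at 0\<close>
    (\<exists>h'\<in>L1. (\<lambda>\<epsilon>. L1_norm (\<lambda>x. h \<epsilon> x - h 0 x - \<epsilon> * h' x)) \<in> o[at_right 0](\<lambda>\<epsilon>. \<epsilon>)) \<and>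
    \<comment> \<open>the objects in the response formula are well defined\<close>
    (\<forall>x\<in>{0..1} - {c}. (\<lambda>\<epsilon>. T \<epsilon> x) differentiable (at_right 0) \<and>
                     (\<lambda>\<epsilon>. D01 (T \<epsilon>) x) differentiable (at_right 0)) \<and>
    (\<exists>u. is_transfer (T 0) (\<lambda>y. A0 T y * wderiv (h 0) y + B0 T y * h 0 y) u) \<and>
    response_q T (a 0) (h 0) \<in> W11_0 \<and>
    I_minus_L_invertible (T 0) \<and>
    \<comment> \<open>the response formula\<close>
    (\<lambda>\<epsilon>. L1_norm (\<lambda>x. h \<epsilon> x - h 0 x -
        \<epsilon> * I_minus_L_inv (T 0) (response_q T (a 0) (h 0)) x)) \<in> o[at_right 0](\<lambda>\<epsilon>. \<epsilon>)"
proof -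
  interpret admissible_cusp_family \<delta> c \<beta> T a by (rule assms)
  obtain \<theta> \<kappa> K where CM: "\<And>\<epsilon>. \<epsilon> \<in> {0..<\<delta>} \<Longrightarrow>
      cusp_map (T \<epsilon>) c (a \<epsilon>) \<beta> \<theta> \<kappa> K (D01 (T \<epsilon>)) ((D01 ^^ 2) (T \<epsilon>)) ((D01 ^^ 3) (T \<epsilon>))"
    using cusp_maps by blast
  interpret C0: cusp_map "T 0" c "a 0" \<beta> \<theta> \<kappa> K "D01 (T 0)" "(D01 ^^ 2) (T 0)" "(D01 ^^ 3) (T 0)"
    by (rule CM[OF zero_in])
  have "\<exists>h h'. (\<forall>x\<in>{0..1}. (h has_real_derivative h' x) (at x within {0..1})) \<and> continuous_on {0..1} h' \<and>
     invariant_density (T \<epsilon>) h \<and> h \<in> W21" if "\<epsilon> \<in> {0..<\<delta>}" for \<epsilon>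
    by (rule cusp_map.invariant_density_C1[OF CM[OF that]])
  then obtain h h' where hd: "\<And>\<epsilon> x. \<epsilon> \<in> {0..<\<delta>} \<Longrightarrow> x \<in> {0..1} \<Longrightarrow> (h \<epsilon> has_real_derivative h' \<epsilon> x) (at x within {0..1})"
    and hc: "\<And>\<epsilon>. \<epsilon> \<in> {0..<\<delta>} \<Longrightarrow> continuous_on {0..1} (h' \<epsilon>)"
    and hi: "\<And>\<epsilon>. \<epsilon> \<in> {0..<\<delta>} \<Longrightarrow> invariant_density (T \<epsilon>) (h \<epsilon>)"
    and h2: "\<And>\<epsilon>. \<epsilon> \<in> {0..<\<delta>} \<Longrightarrow> h \<epsilon> \<in> W21"
    by metis
  have h1: "h \<epsilon> \<in> W11" if "\<epsilon> \<in> {0..<\<delta>}" for \<epsilon> using h2[OF that] by (simp add: W21_def)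
  have h0L: "h 0 \<in> L1" by (rule W11_L1[OF h1[OF zero_in]])
  \<comment> \<open>Here \<open>q\<close> is the derivative that \<open>A9_deriv\<close> attaches to
    \<open>h 0\<close>; it is identified with \<open>response_q\<close> only afterwards.\<close>
  obtain q \<rho> where q: "q \<in> W11" and \<rho>: "((\<lambda>\<epsilon>. \<rho> \<epsilon> / \<epsilon>) \<longlongrightarrow> 0) (at_right 0)"
    and e1: "\<forall>\<^sub>F \<epsilon> in at_right 0. \<forall>y\<in>{0..1}. \<bar>prim (LT \<epsilon> (h 0)) y - prim (LT 0 (h 0)) y - \<epsilon> * prim q y\<bar> \<le> \<rho> \<epsilon>"
    and ev: "\<forall>\<^sub>F \<epsilon> in at_right 0. (\<lambda>x. LT \<epsilon> (h 0) x - LT 0 (h 0) x - \<epsilon> * q x) \<in> W11"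
    and o: "(\<lambda>\<epsilon>. W11_norm (\<lambda>x. LT \<epsilon> (h 0) x - LT 0 (h 0) x - \<epsilon> * q x)) \<in> o[at_right 0](\<lambda>\<epsilon>. \<epsilon>)"
    using W21_family[OF h2[OF zero_in]] by blast
  have qL: "q \<in> L1" by (rule W11_L1[OF q])
  have ql: "((\<lambda>\<epsilon>. (prim (LT \<epsilon> (h 0)) y - prim (LT 0 (h 0)) y) / \<epsilon>) \<longlongrightarrow> prim q y) (at_right 0)"
    if y: "y \<in> {0..1}" for y
  proof -
    have "((\<lambda>\<epsilon>. (prim (LT \<epsilon> (h 0)) y - prim (LT 0 (h 0)) y) / \<epsilon> - prim q y) \<longlongrightarrow> 0) (at_right 0)"
    proof (rule Lim_null_comparison[OF _ \<rho>])
      show "\<forall>\<^sub>F \<epsilon> in at_right 0. norm ((prim (LT \<epsilon> (h 0)) y - prim (LT 0 (h 0)) y) / \<epsilon> - prim q y) \<le> \<rho> \<epsilon> / \<epsilon>"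
        using e1 eventually_at_right_less[of 0]
      proof eventually_elim
        case (elim \<epsilon>)
        have "(prim (LT \<epsilon> (h 0)) y - prim (LT 0 (h 0)) y) / \<epsilon> - prim q y
            = (prim (LT \<epsilon> (h 0)) y - prim (LT 0 (h 0)) y - \<epsilon> * prim q y) / \<epsilon>" using elim(2) by (simp add: field_simps)
        also have "norm \<dots> \<le> \<rho> \<epsilon> / \<epsilon>" using elim y by (auto simp: abs_divide intro!: divide_right_mono)
        finally show ?case .
      qed
    qed
    then show ?thesis by (rule LIM_zero_cancel)
  qed
  note id = response_identification[OF hd[OF zero_in] hc[OF zero_in] ql qL]
  define rq where "rq = response_q T (a 0) (h 0)"
  have rq: "ae_eq rq q" unfolding rq_def by (rule id(2))
  \<comment> \<open>The operators preserve the integral, so the difference quotients of the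
    primitives at level 1 vanish.\<close>
  have q0: "(LINT x|leb01. q x) = 0"
  proof -
    have "\<forall>\<^sub>F \<epsilon> in at_right 0. 0 = (prim (LT \<epsilon> (h 0)) 1 - prim (LT 0 (h 0)) 1) / \<epsilon>"
      using eventually_in_domain'
    proof eventually_elim
      case (elim \<epsilon>)
      have "a \<epsilon> \<le> 1" using A2[OF elim] by simp
      then show ?case using cusp_map.prim_L_above[OF CM[OF elim] h0L, of 1] C0.prim_L_above[OF h0L, of 1] C0.a_in by simp
    qed
    then have "((\<lambda>\<epsilon>. (prim (LT \<epsilon> (h 0)) 1 - prim (LT 0 (h 0)) 1) / \<epsilon>) \<longlongrightarrow> 0) (at_right 0)"
      by (rule Lim_transform_eventually[OF tendsto_const])
    then show ?thesis using tendsto_unique[OF trivial_limit_at_right_real ql[of 1]] prim_1[of 1 q] by simp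
  qed
  have rqW: "rq \<in> W11_0"
    using W11_cong[OF q ae_eq_sym[OF rq]] integral_ae_eq[OF L1_measurable[OF qL] ae_eq_sym[OF rq]] q0
    by (simp add: W11_0_def)
  define w where "w = I_minus_L_inv (T 0) rq"
  have ex: "\<exists>w. w \<in> W11_0 \<and> ae_eq (\<lambda>x. w x - LT 0 w x) rq"
    using C0.I_minus_L_invertible rqW unfolding I_minus_L_invertible_def by blast
  have w: "w \<in> W11_0" "ae_eq (\<lambda>x. w x - LT 0 w x) rq"
    using someI_ex[OF ex] unfolding w_def I_minus_L_inv_def by blast+
  have ww: "has_weak_deriv w (wderiv w)" using w(1) by (intro wderiv) (simp add: W11_0_def)
  have "ae_eq w (\<lambda>x. LT 0 w x + q x)" using w(2) rq unfolding ae_eq_def by eventually_elim simp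
  from response_expansion[OF hi h1 ev o ww this] w(1)
  have main: "(\<lambda>\<epsilon>. L1_norm (\<lambda>x. h \<epsilon> x - h 0 x - \<epsilon> * w x)) \<in> o[at_right 0](\<lambda>\<epsilon>. \<epsilon>)"
    by (simp add: W11_0_def)
  show ?thesis
  \<comment> \<open>The full range of parameters serves, because existence and uniqueness were
    proved for each map of the family separately.\<close>
  proof (intro exI[of _ \<delta>] exI[of _ h] conjI ballI allI impI)
    show "invariant_density (T \<epsilon>) (h \<epsilon>)" "h \<epsilon> \<in> W21" if "\<epsilon> \<in> {0..<\<delta>}" for \<epsilon> using hi h2 that by auto
    show "ae_eq k (h \<epsilon>)" if "\<epsilon> \<in> {0..<\<delta>}" "invariant_density (T \<epsilon>) k" for \<epsilon> k
      by (rule cusp_map.invariant_density_unique[OF CM[OF that(1)] hi[OF that(1)] that(2)])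
    show "\<exists>h'\<in>L1. (\<lambda>\<epsilon>. L1_norm (\<lambda>x. h \<epsilon> x - h 0 x - \<epsilon> * h' x)) \<in> o[at_right 0](\<lambda>\<epsilon>. \<epsilon>)"
      using main has_weak_deriv_L1(1)[OF ww] by blast
    show "\<exists>u. is_transfer (T 0) (\<lambda>y. A0 T y * wderiv (h 0) y + B0 T y * h 0 y) u"
      using id(1) unfolding response_source_def[abs_def] by blast
    show "response_q T (a 0) (h 0) \<in> W11_0" using rqW by (simp add: rq_def)
    show "(\<lambda>\<epsilon>. L1_norm (\<lambda>x. h \<epsilon> x - h 0 x - \<epsilon> * I_minus_L_inv (T 0) (response_q T (a 0) (h 0)) x)) \<in> o[at_right 0](\<lambda>\<epsilon>. \<epsilon>)"
      using main by (simp add: w_def rq_def)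
  qed (use delta_pos eps_differentiable C0.I_minus_L_invertible in auto)
qed

end
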